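(* Let $m\ge0$ be an integer, $R\in\{0,1,2,\dots\}$ and $u>0$ large. With $\mathcal A_{2m+2},\mathcal B_{2m+2}$, $\epsilon^{(U)}_{2m+2}(u)$ and $w_R^{(j,k)}$ as in the context, put $$\gamma_{m,R}(u)=2^{-\frac12u+R-\frac12}u^{\frac14u-\frac12R-\frac{13}{12}}\sqrt{\pi}\exp\left\{-\frac14u+\sum_{s=0}^{m}\frac{\mathrm{E}_{2s+1}(1)}{u^{2s+1}}+\epsilon_{2m+2}^{(U)}(u)\right\}\mathbf{F}\left(\tfrac12-\tfrac12R,-\tfrac12R;\tfrac14u-\tfrac12R+\tfrac34;\tfrac12\right).$$ Then there is a function $\mathcal G_{m,R}(u,z)$, analytic in $Z$ and the same for all three pairs, such that for $j,k\in\{0,\pm1\}$, $j<k$, $z\in Z$, $$w_R^{(j,k)}(u,z)=\gamma_{m,R}(u)\left\{\mathrm{Wi}^{(j,k)}(u^{2/3}\zeta)\mathcal A_{2m+2}(u,z)+{\mathrm{Wi}^{(j,k)}}'(u^{2/3}\zeta)\mathcal B_{2m+2}(u,z)\right\}+\mathcal G_{m,R}(u,z),$$ and, for $z$ inside a positively oriented simple closed contour $\Gamma\subset Z\setminus\{1\}$ that encloses $z=1$, $$\mathcal G_{m,R}(u,z)=\frac1{u^2}\sum_{s=0}^m\frac{G^{\ast}_{s,R}(z)}{u^{2s}}-\frac{\gamma_{m,R}(u)}{2\pi iu^{2/3}}\oint_{\Gamma}\left\{\frac{\zeta(t)}{t^2-1}\right\}^{1/4}\frac{J_m(u,t)\,dt}{\zeta(t)(t-z)}+\mathcal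 O\left(\frac1{u^{2m+4}}\right)$$ as $u\to\infty$, where $$J_m(u,z)=-\exp\left\{\sum_{s=1}^m\frac{\tilde{\mathcal E}_{2s}(z)}{u^{2s}}\right\}\cosh\left\{\sum_{s=0}^m\frac{\tilde{\mathcal E}_{2s+1}(z)}{u^{2s+1}}\right\}\sum_{k=0}^m\frac{(3k)!}{k!(3u^2\zeta^3)^k}$$ $$\qquad+\frac1{u\zeta^{3/2}}\exp\left\{\sum_{s=1}^m\frac{\mathcal E_{2s}(z)}{u^{2s}}\right\}\sinh\left\{\sum_{s=0}^m\frac{\mathcal E_{2s+1}(z)}{u^{2s+1}}\right\}\sum_{k=0}^m\frac{(3k+1)!}{k!(3u^2\zeta^3)^k},$$ and $G^{\ast}_{s,R}(z)$ is the analytic part at $z=1$ (Laurent expansion minus principal part) of $G_{s,R}(z)$, with $G_{0,R}(z)=-z^R/(z^2-1)$, $G_{s+1,R}(z)=G_{s,R}''(z)/(z^2-1)$.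
   Context: $U(a,z)$ is the parabolic cylinder function: the solution of $y''-(\tfrac14z^2+a)y=0$ with $U(a,z)\sim z^{-a-1/2}e^{-z^2/4}$ as $z\to\infty$, $|\arg z|\le\frac34\pi-\delta$. $\mathbf{F}(a,b;c;z)=\sum_{s\ge0}\frac{(a)_s(b)_sz^s}{\Gamma(c+s)s!}$. Scorer functions: $\mathrm{Hi}(z)=\frac1\pi\int_0^\infty\exp(-\frac13t^3+zt)dt$; $\mathrm{Wi}^{(-1,1)}(z)=\pi\mathrm{Hi}(z)$, $\mathrm{Wi}^{(0,1)}(z)=\pi e^{-2\pi i/3}\mathrm{Hi}(ze^{-2\pi i/3})$, $\mathrm{Wi}^{(-1,0)}(z)=\pi e^{2\pi i/3}\mathrm{Hi}(ze^{2\pi i/3})$. Variables: $\xi=\tfrac23\zeta^{3/2}=\int_1^z(t^2-1)^{1/2}dt$, with $\xi,\zeta\ge0$ for $z\ge1$; $\xi$ is continuous in the plane cut along $(-\infty,1]$ and $\zeta$ is analytic in the plane cut along $(-\infty,-1]$. $\beta=z/\sqrt{z^2-1}$, positive for $z>1$, cut along $[-1,1]$. Roots $\zeta^{1/4}$, $(z^2-1)^{1/4}$ are positive for $z>1$ and continued continuously; $(\zeta/(z^2-1))^{1/4}$ is positive on $(-1,\infty)$. Coefficients: $\mathrm{E}_1(\beta)=\frac1{24}\beta(5\beta^2-6)$, $\mathrm{E}_2(\beta)=\frac1{16}(\beta^2-1)^2(5\beta^2-2)$, and for $s\ge2$ $$\mathrm{E}_{s+1}(\beta)=\tfrac12(\beta^2-1)^2\mathrm{E}_s'(\beta)+\tfrac12\int_{\sigma(s)}^{\beta}(p^2-1)^2\sum_{j=1}^{s-1}\mathrm{E}_j'(p)\mathrm{E}_{s-j}'(p)\,dp,$$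 $\sigma(s)=1$ for $s$ odd, $\sigma(s)=0$ for $s$ even. Let $a_1=a_2=\frac5{72}$, $\tilde a_1=\tilde a_2=-\frac7{72}$, each sequence continued for $s\ge2$ by $b_{s+1}=\frac12(s+1)b_s+\frac12\sum_{j=1}^{s-1}b_jb_{s-j}$. Set $\mathcal{E}_s(z)=\mathrm{E}_s(\beta)+(-1)^sa_ss^{-1}\xi^{-s}$, $\tilde{\mathcal E}_s(z)=\mathrm{E}_s(\beta)+(-1)^s\tilde a_ss^{-1}\xi^{-s}$. Empty sums are zero. $Z$ is the open unbounded domain containing $z=1$ and the points at infinity $+\infty,\pm i\infty$, bounded by the two level curves $\Re(\xi)=\text{const}$ that run from $z=-1$ to infinity in the left half plane. $\mathcal A_{2m+2},\mathcal B_{2m+2}$ are functions analytic in $Z$, real on $(-1,\infty)$, such that $w_{m,l}=\mathrm{Ai}_l(u^{2/3}\zeta)\mathcal A_{2m+2}+\mathrm{Ai}_l'(u^{2/3}\zeta)\mathcal B_{2m+2}$ ($l=0,\pm1$; $\mathrm{Ai}_l(x)=\mathrm{Ai}(xe^{-2\pi il/3})$) are solutions of $w''-u^2(z^2-1)w=0$ recessive at $+\infty$, $i\infty$, $-i\infty$ for $l=0,1,-1$ respectively, and $$\mathcal A_{2m+2}=\left(\tfrac{\zeta}{z^2-1}\right)^{1/4}\left[\exp\left\{\sum_{s=1}^m\tfrac{\tilde{\mathcal E}_{2s}(z)}{u^{2s}}\right\}\cosh\left\{\sum_{s=0}^m\tfrac{\tilde{\mathcal E}_{2s+1}(z)}{u^{2s+1}}\right\}+\mathcal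 O(u^{-2m-2})\right],$$ $$\mathcal B_{2m+2}=\frac{1}{u^{1/3}\zeta^{1/4}(z^2-1)^{1/4}}\left[\exp\left\{\sum_{s=1}^m\tfrac{\mathcal E_{2s}(z)}{u^{2s}}\right\}\sinh\left\{\sum_{s=0}^m\tfrac{\mathcal E_{2s+1}(z)}{u^{2s+1}}\right\}+\mathcal O(u^{-2m-2})\right]$$ uniformly on unbounded closed subsets of $Z\setminus\{1\}$. The constant $\epsilon^{(U)}_{2m+2}(u)=\mathcal O(u^{-2m-2})$ is defined by $U(-\tfrac12u,\sqrt{2u}z)=\sqrt\pi\,2^{\frac34-\frac14u}u^{\frac14u-\frac1{12}}\exp\{-\frac14u+\sum_{s=0}^m\mathrm{E}_{2s+1}(1)u^{-2s-1}+\epsilon^{(U)}_{2m+2}(u)\}w_{m,0}(u,z)$. $w_R^{(j,k)}(u,z)$ ($j<k$ in $\{-1,0,1\}$) is the unique solution of $w''-u^2(z^2-1)w=z^R$ that is not exponentially large at both points at infinity labelled $j$ and $k$, where $0\leftrightarrow+\infty$, $1\leftrightarrow i\infty$, $-1\leftrightarrow-i\infty$.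
   Formalization: The formulas for Wi^{(0,1)} and Wi^{(-1,0)} are interchanged: Wi^{(0,1)}(z)=πe^{2πi/3}Hi(ze^{2πi/3}), Wi^{(-1,0)}(z)=πe^{-2πi/3}Hi(ze^{-2πi/3}); as printed, Wi^{(0,1)}(u^{2/3}ζ) is exponentially large at i∞, contradicting the definition of w_R^{(0,1)}. *)

theory Defs
  imports "HOL-Complex_Analysis.Complex_Analysis"
begin

section \<open>Special functions\<close>

text \<open>Maclaurin series (DLMF 9.4.1) with
  \<open>Ai(0) = 1 / (3 powr (2/3) * \<Gamma>(2/3))\<close> and \<open>Ai'(0) = - 1 / (3 powr (1/3) * \<Gamma>(1/3))\<close>.\<close>

definition Ai :: "complex \<Rightarrow> complex" where
  "Ai z = (\<Sum>n. z ^ (3*n) * of_real (3 powr (- 2 * real n - 2/3)) / (fact n * Gamma (of_nat n + 2/3)))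
        - (\<Sum>n. z ^ (3*n+1) * of_real (3 powr (- 2 * real n - 4/3)) / (fact n * Gamma (of_nat n + 4/3)))"

definition Ai_rot :: "int \<Rightarrow> complex \<Rightarrow> complex" where
  "Ai_rot l x = Ai (x * exp (- 2 * pi * \<i> * of_int l / 3))"

definition Hi :: "complex \<Rightarrow> complex" where
  "Hi z = 1 / of_real pi * integral {0..} (\<lambda>t::real. exp (- (of_real t ^ 3) / 3 + z * of_real t))"

text \<open>\<open>Wi j k\<close> solves \<open>w'' - x w = 1\<close> and is not exponentially large in the directions
  \<open>arg x = 2\<pi>j/3\<close> and \<open>arg x = 2\<pi>k/3\<close>, the directions of recessiveness of \<open>Ai_rot j\<close> and \<open>Ai_rot k\<close>.
  Since \<open>Hi\<close> is exponentially large only for \<open>\<bar>arg x\<bar> < \<pi>/3\<close>, the factor for \<open>(0,1)\<close>, which may grow only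
  around \<open>arg x = -2\<pi>/3\<close>, has to be \<open>exp (2\<pi>\<i>/3)\<close>, and the factor for \<open>(-1,0)\<close> its conjugate. With the two
  factors interchanged, the difference of the \<open>(0,1)\<close> and \<open>(-1,1)\<close> functions would be a nonzero multiple of
  \<open>Ai_rot (-1)\<close> instead of \<open>Ai_rot 1\<close>
  (DLMF 9.12.14: \<open>Hi(x) = exp(2\<pi>\<i>/3) Hi(x exp(2\<pi>\<i>/3)) + 2 exp(-\<pi>\<i>/6) Ai(x exp(-2\<pi>\<i>/3))\<close>),
  incompatible with \<open>wR_solution\<close> below.\<close>

definition Wi :: "int \<Rightarrow> int \<Rightarrow> complex \<Rightarrow> complex" where
  "Wi j k x =
     (if (j, k) = (-1, 1) then of_real pi * Hi x
      else if (j, k) = (0, 1) then of_real pi * exp (2 * pi * \<i> / 3) * Hi (x * exp (2 * pi * \<i> / 3))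
      else of_real pi * exp (- 2 * pi * \<i> / 3) * Hi (x * exp (- 2 * pi * \<i> / 3)))"

definition hyperF_reg :: "complex \<Rightarrow> complex \<Rightarrow> complex \<Rightarrow> complex \<Rightarrow> complex" where
  "hyperF_reg a b c z =
     (\<Sum>s. pochhammer a s * pochhammer b s * z ^ s * rGamma (c + of_nat s) / fact s)"

definition parabolic_cylinder_U :: "(real \<Rightarrow> complex \<Rightarrow> complex) \<Rightarrow> bool" where
  "parabolic_cylinder_U U \<longleftrightarrow>
     (\<forall>a. U a holomorphic_on UNIV \<and>
          (\<forall>z. (deriv ^^ 2) (U a) z - (z\<^sup>2 / 4 + of_real a) * U a z = 0) \<and>
          (\<forall>\<delta>>0. U a \<sim>[inf at_infinity (principal {z. \<bar>Arg z\<bar> \<le> 3/4 * pi - \<delta>})]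
                    (\<lambda>z. z powr (- of_real a - 1/2) * exp (- z\<^sup>2 / 4))))"


section \<open>Variables\<close>

text \<open>\<open>csqrt (t - 1) * csqrt (t + 1)\<close> is \<open>(t\<^sup>2 - 1)^(1/2)\<close> with cut \<open>[-1,1]\<close>, positive for \<open>t > 1\<close>. On the
  cuts every multivalued function below takes its limit from the upper half plane.\<close>

definition sqrt_z2m1 :: "complex \<Rightarrow> complex" where
  "sqrt_z2m1 t = csqrt (t - 1) * csqrt (t + 1)"

definition \<xi> :: "complex \<Rightarrow> complex" where
  "\<xi> z = contour_integral (linepath 1 z) sqrt_z2m1"

text \<open>The quotient \<open>\<xi> / (z - 1)^(3/2)\<close> is analytic off \<open>(-\<infinity>,-1]\<close>, positive on \<open>(-1,\<infinity>)\<close>, and has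
  positive real part, so that with principal powers \<open>\<zeta>\<close> is the branch of \<open>(3\<xi>/2)^(2/3)\<close> that is analytic
  off \<open>(-\<infinity>,-1]\<close> and nonnegative on \<open>[1,\<infinity>)\<close>. The principal value of \<open>(3\<xi>/2)^(2/3)\<close> is not, since
  \<open>arg \<xi>\<close> takes all values in \<open>(0,2\<pi>)\<close> on the upper half plane.\<close>

definition \<zeta> :: "complex \<Rightarrow> complex" where
  "\<zeta> z = (z - 1) * (3/2 * \<xi> z / csqrt (z - 1) ^ 3) powr (2/3)"

definition \<beta> :: "complex \<Rightarrow> complex" where
  "\<beta> z = z / sqrt_z2m1 z"

text \<open>The arguments of \<open>\<zeta> / (z - 1)\<close> and of \<open>\<zeta> / (z\<^sup>2 - 1)\<close> lie in \<open>(-\<pi>,\<pi>)\<close> off \<open>(-\<infinity>,-1]\<close>,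
  so the principal powers below are the continuous branches that are positive for \<open>z > 1\<close>.\<close>

definition \<zeta>_root4 :: "complex \<Rightarrow> complex" where
  "\<zeta>_root4 z = (z - 1) powr (1/4) * (\<zeta> z / (z - 1)) powr (1/4)"

definition z2m1_root4 :: "complex \<Rightarrow> complex" where
  "z2m1_root4 z = (z - 1) powr (1/4) * (z + 1) powr (1/4)"

definition quot_root4 :: "complex \<Rightarrow> complex" where
  "quot_root4 z = (\<zeta> z / (z\<^sup>2 - 1)) powr (1/4)"

text \<open>The curves \<open>\<Re> \<xi> = const\<close> that run from \<open>-1\<close> to infinity in the left half plane. The real points
  have to be left out because \<open>\<Re> \<xi> = 0\<close> also holds on the segment \<open>[-1,1]\<close>.\<close>

definition level_curves :: "complex set" where
  "level_curves = insert (-1) {z. Re z < 0 \<and> Im z \<noteq> 0 \<and> Re (\<xi> z) = Re (\<xi> (-1))}"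

definition Zdom :: "complex set" where
  "Zdom = connected_component_set (- level_curves) 1"


section \<open>Coefficients\<close>

fun E :: "nat \<Rightarrow> complex \<Rightarrow> complex" where
  "E 0 = (\<lambda>b. 0)"
| "E (Suc 0) = (\<lambda>b. 1/24 * b * (5 * b\<^sup>2 - 6))"
| "E (Suc (Suc 0)) = (\<lambda>b. 1/16 * (b\<^sup>2 - 1)\<^sup>2 * (5 * b\<^sup>2 - 2))"
| "E (Suc (Suc (Suc n))) = (\<lambda>b.
     1/2 * (b\<^sup>2 - 1)\<^sup>2 * deriv (E (Suc (Suc n))) b
     + 1/2 * contour_integral (linepath (if odd (Suc (Suc n)) then 1 else 0) b)
         (\<lambda>p. (p\<^sup>2 - 1)\<^sup>2 * (\<Sum>j=1..Suc n. deriv (E j) p * deriv (E (Suc (Suc n) - j)) p)))"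

fun airy_coeff :: "complex \<Rightarrow> nat \<Rightarrow> complex" where
  "airy_coeff c 0 = 0"
| "airy_coeff c (Suc 0) = c"
| "airy_coeff c (Suc (Suc 0)) = c"
| "airy_coeff c (Suc (Suc (Suc n))) =
     1/2 * of_nat (Suc (Suc (Suc n))) * airy_coeff c (Suc (Suc n))
     + 1/2 * (\<Sum>j=1..Suc n. airy_coeff c j * airy_coeff c (Suc (Suc n) - j))"

definition a_coeff :: "nat \<Rightarrow> complex" where
  "a_coeff = airy_coeff (5/72)"

definition a_tilde :: "nat \<Rightarrow> complex" where
  "a_tilde = airy_coeff (- 7/72)"

definition calE :: "nat \<Rightarrow> complex \<Rightarrow> complex" where
  "calE s z = E s (\<beta> z) + (-1) ^ s * a_coeff s / of_nat s / \<xi> z ^ s"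

definition calE_tilde :: "nat \<Rightarrow> complex \<Rightarrow> complex" where
  "calE_tilde s z = E s (\<beta> z) + (-1) ^ s * a_tilde s / of_nat s / \<xi> z ^ s"

definition exp_cosh :: "nat \<Rightarrow> real \<Rightarrow> complex \<Rightarrow> complex" where
  "exp_cosh m u z = exp (\<Sum>s=1..m. calE_tilde (2 * s) z / of_real u ^ (2 * s))
                  * cosh (\<Sum>s=0..m. calE_tilde (2 * s+1) z / of_real u ^ (2 * s+1))"

definition exp_sinh :: "nat \<Rightarrow> real \<Rightarrow> complex \<Rightarrow> complex" where
  "exp_sinh m u z = exp (\<Sum>s=1..m. calE (2 * s) z / of_real u ^ (2 * s))
                  * sinh (\<Sum>s=0..m. calE (2 * s+1) z / of_real u ^ (2 * s+1))"


section \<open>Solutions\<close>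

definition uniform_bigo ::
  "complex set \<Rightarrow> (real \<Rightarrow> complex \<Rightarrow> complex) \<Rightarrow> (real \<Rightarrow> real) \<Rightarrow> bool" where
  "uniform_bigo S f g \<longleftrightarrow> (\<exists>C. \<forall>\<^sub>F u in at_top. \<forall>z\<in>S. norm (f u z) \<le> C * g u)"

definition inf_dir :: "int \<Rightarrow> complex" where
  "inf_dir l = (if l = 0 then 1 else if l = 1 then \<i> else - \<i>)"

text \<open>Solutions of the differential equations behave at infinity throughout the open sector of angle
  \<open>\<pi>/2\<close> around \<open>d \<in> {1, \<i>, -\<i>}\<close> as they do on its central ray.\<close>

definition recessive_at :: "complex \<Rightarrow> (complex \<Rightarrow> complex) \<Rightarrow> bool" where
  "recessive_at d f \<longleftrightarrow> (\<exists>c>0. \<forall>\<^sub>F r in at_top. norm (f (of_real r * d)) \<le> exp (- c * r))"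

definition exp_large_at :: "complex \<Rightarrow> (complex \<Rightarrow> complex) \<Rightarrow> bool" where
  "exp_large_at d f \<longleftrightarrow> (\<exists>c>0. \<forall>\<^sub>F r in at_top. norm (f (of_real r * d)) \<ge> exp (c * r))"

definition wR_solution :: "nat \<Rightarrow> int \<Rightarrow> int \<Rightarrow> real \<Rightarrow> (complex \<Rightarrow> complex) \<Rightarrow> bool" where
  "wR_solution R j k u w \<longleftrightarrow>
     w holomorphic_on UNIV \<and>
     (\<forall>z. (deriv ^^ 2) w z - of_real (u\<^sup>2) * (z\<^sup>2 - 1) * w z = z ^ R) \<and>
     \<not> exp_large_at (inf_dir j) w \<and> \<not> exp_large_at (inf_dir k) w"

definition airy_arg :: "real \<Rightarrow> complex \<Rightarrow> complex" where
  "airy_arg u z = of_real (u powr (2/3)) * \<zeta> z"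

definition w_airy ::
  "(real \<Rightarrow> complex \<Rightarrow> complex) \<Rightarrow> (real \<Rightarrow> complex \<Rightarrow> complex) \<Rightarrow> int \<Rightarrow> real \<Rightarrow> complex \<Rightarrow> complex" where
  "w_airy A B l u z = Ai_rot l (airy_arg u z) * A u z + deriv (Ai_rot l) (airy_arg u z) * B u z"

text \<open>The sets \<open>{z. ball z \<delta> \<subseteq> Zdom - {1}}\<close> are the closed subsets on which the asymptotic expansions
  are uniform: they keep a positive distance from \<open>1\<close> and from the boundary of \<open>Zdom\<close>. For a set that
  approaches the boundary curves at infinity the expansions cannot be uniform, because on these
  curves the contribution of the second turning point \<open>-1\<close> is not small.\<close>

definition airy_type_coefficients ::
  "nat \<Rightarrow> (real \<Rightarrow> complex \<Rightarrow> complex) \<Rightarrow> (real \<Rightarrow> complex \<Rightarrow> complex) \<Rightarrow> bool" where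
  "airy_type_coefficients m A B \<longleftrightarrow>
     (\<forall>\<^sub>F u in at_top.
        A u holomorphic_on Zdom \<and> B u holomorphic_on Zdom \<and>
        (\<forall>x::real. x > -1 \<longrightarrow> A u (of_real x) \<in> \<real> \<and> B u (of_real x) \<in> \<real>) \<and>
        (\<forall>l\<in>{-1, 0, 1}.
           (\<forall>z\<in>Zdom. (deriv ^^ 2) (w_airy A B l u) z
                       - of_real (u\<^sup>2) * (z\<^sup>2 - 1) * w_airy A B l u z = 0) \<and>
           recessive_at (inf_dir l) (w_airy A B l u))) \<and>
     (\<forall>\<delta>>0.
        uniform_bigo {z. ball z \<delta> \<subseteq> Zdom - {1}}
          (\<lambda>u z. A u z / quot_root4 z - exp_cosh m u z) (\<lambda>u. 1 / u ^ (2*m+2)) \<and>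
        uniform_bigo {z. ball z \<delta> \<subseteq> Zdom - {1}}
          (\<lambda>u z. B u z * (of_real (u powr (1/3)) * \<zeta>_root4 z * z2m1_root4 z) - exp_sinh m u z)
          (\<lambda>u. 1 / u ^ (2*m+2)))"


section \<open>Quantities in the expansion\<close>

definition gamma_mR :: "nat \<Rightarrow> nat \<Rightarrow> (real \<Rightarrow> complex) \<Rightarrow> real \<Rightarrow> complex" where
  "gamma_mR m R \<epsilon> u =
     of_real (2 powr (- u/2 + real R - 1/2) * u powr (u/4 - real R/2 - 13/12) * sqrt pi)
     * exp (- of_real u / 4 + (\<Sum>s=0..m. E (2 * s+1) 1 / of_real u ^ (2 * s+1)) + \<epsilon> u)
     * hyperF_reg (1/2 - of_nat R/2) (- of_nat R/2) (of_real u/4 - of_nat R/2 + 3/4) (1/2)"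

text \<open>\<open>3/2 * \<xi> z\<close> is \<open>\<zeta>^(3/2)\<close>.\<close>

definition J :: "nat \<Rightarrow> real \<Rightarrow> complex \<Rightarrow> complex" where
  "J m u z =
     - exp_cosh m u z
         * (\<Sum>k=0..m. fact (3*k) / (fact k * (3 * of_real u ^ 2 * \<zeta> z ^ 3) ^ k))
     + 1 / (of_real u * (3/2 * \<xi> z)) * exp_sinh m u z
         * (\<Sum>k=0..m. fact (3*k+1) / (fact k * (3 * of_real u ^ 2 * \<zeta> z ^ 3) ^ k))"

fun G_coeff :: "nat \<Rightarrow> nat \<Rightarrow> complex \<Rightarrow> complex" where
  "G_coeff R 0 = (\<lambda>z. - (z ^ R) / (z\<^sup>2 - 1))"
| "G_coeff R (Suc s) = (\<lambda>z. (deriv ^^ 2) (G_coeff R s) z / (z\<^sup>2 - 1))"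

text \<open>\<open>remove_sings\<close> supplies the value at the removable singularity \<open>a\<close>.\<close>

definition analytic_part :: "(complex \<Rightarrow> complex) \<Rightarrow> complex \<Rightarrow> complex \<Rightarrow> complex" where
  "analytic_part f a =
     remove_sings (\<lambda>z. f z - poly (fls_prpart (laurent_expansion f a)) (1 / (z - a)))"

definition G_star :: "nat \<Rightarrow> nat \<Rightarrow> complex \<Rightarrow> complex" where
  "G_star R s = analytic_part (G_coeff R s) 1"

definition encircles_1 :: "(real \<Rightarrow> complex) \<Rightarrow> bool" where
  "encircles_1 \<Gamma> \<longleftrightarrow>
     valid_path \<Gamma> \<and> simple_path \<Gamma> \<and> pathfinish \<Gamma> = pathstart \<Gamma> \<and>
     path_image \<Gamma> \<subseteq> Zdom - {1} \<and> 1 \<in> inside (path_image \<Gamma>) \<and> winding_number \<Gamma> 1 = 1"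

end

(*
  Write L w = w'' - u^2 (z^2 - 1) w. Explicit integrals of Laplace type solve L w = z^R for R = 0, 1, and
  the recursion S_{R+2} = S_R + (R (R-1) S_{R-2} - z^R) / u^2 yields solutions for every R. They are bounded
  in the relevant sectors, and a homogeneous solution that is not exponentially large at two of the three
  infinities vanishes, so they are the functions w_R^(j,k). The difference of two of them is recessive at
  one infinity, hence a multiple of a parabolic cylinder function; Watson's lemma gives the multiple, and
  with the connection formulas of Hi and Ai this is the same multiple gamma of the corresponding
  difference of the functions Wi. Therefore G does not depend on the pair.

  A solution that is merely bounded near a point where z^2 - 1 does not vanish has the formal expansion
  in powers of u^{-2} there, by Cauchy's estimate applied repeatedly to w = (w'' - z^R) / (u^2 (z^2 - 1)).
  Since each point of Zdom - {1} has a pair (j,k) for which both w_R^(j,k) and Wi^(j,k) (u^{2/3} zeta) are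
  algebraic (in a sliver of the left half plane after a reflection), this gives
  G = sum G_s / u^{2s+2} - gamma u^{-2/3} (zeta / (z^2-1))^{1/4} J / zeta + O(u^{-2m-4}) locally
  uniformly in Zdom - {1}. Cauchy's integral formula for G on Gamma extends the estimate to z = 1: the
  integral of G_s(t) / (t - z) is its analytic part, and that of the error term is bounded by moving
  Gamma to small circles about 1.
*)

theory Submission
  imports Defs "HOL-Probability.Distributions" "HOL-Real_Asymp.Real_Asymp"
begin

section \<open>Linear second-order equations\<close>

text \<open>The powers of u leave no slack. \<open>A\<close>, \<open>B\<close> and the Scorer
  functions are known to relative order u^(-2m-2), the bracket multiplied by \<open>gamma_mR\<close>
  is of size u^(-2/3) where it is algebraic, and the claimed error is u^(-2m-4). So
  \<open>gamma_mR\<close> = O(u^(-4/3)) has to be proved, which takes a Stirling-type lower bound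
  for Gamma, and every bound on the inhomogeneous solutions has to be uniform in u although the
  exponents in their Laplace kernels grow with u. No asymptotic theory of the equation at infinity
  enters. On the rays from 0 in the directions 1, i, -i the equation reads f'' = q f with q real and
  eventually positive, so |f|^2 is convex; uniqueness and proportionality of solutions rest on this.
  The hypergeometric factor of \<open>gamma_mR\<close> appears because its contiguous relation in R
  is the homogeneous part of the recursion of the S_R. \<xi> and \<beta> jump across (-1,1) and only
  even combinations of them are analytic there, so these are treated through local branches with a
  common sign.\<close>

lemma exp_bound_integral:
 fixes f :: "real => complex"
 assumes cont: "continuous_on {0..} f" and bnd: "\<And>t. t \<ge> 0 ==> norm (f t) \<le> C * exp (- (c * t))"
  and c: "c > 0"
 shows "f integrable_on {0..}"
  and "norm (integral {0..} f) \<le> C / c"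
  and "N \<ge> 0 ==> norm (integral {0..} f - integral {0..N} f) \<le> C / c * exp (- (c * N))"
proof -
 let ?a = "%t. C * exp (- (c * t))"
 have hi: "(?a has_integral C * (exp (- (c * a)) / c)) {a..}" for a
  using has_integral_mult_right[OF has_integral_exp_minus_to_infinity[OF c, of a], of C] by simp
 have gi: "?a integrable_on {a..}" for a using hi by auto
 have ai: "f absolutely_integrable_on {0..}" by (rule measurable_bounded_by_integrable_imp_absolutely_integrable[OF _ _ gi])
    (auto intro!: continuous_imp_measurable_on_sets_lebesgue cont bnd)
 then show fi: "f integrable_on {0..}" using set_lebesgue_integral_eq_integral(1) by auto
 have fia: "f integrable_on {a..}" if "a \<ge> 0" for a
 by (rule set_lebesgue_integral_eq_integral(1)) ((rule set_integrable_subset[OF ai], use that in auto))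
 have tail: "norm (integral {a..} f) \<le> C / c * exp (- (c * a))" if "a \<ge> 0" for a
 proof -
  have "norm (integral {a..} f) \<le> integral {a..} ?a" by (rule integral_norm_bound_integral[OF fia[OF that] gi]) (use that bnd in auto)
  also have "\<dots> = C / c * exp (- (c * a))" using integral_unique[OF hi[of a]] by simp
  finally show ?thesis .
 qed
 show "norm (integral {0..} f) \<le> C / c" using tail[of 0] by simp
 assume N: "N \<ge> 0"
 have "integral {0..} f = integral {0..N} f + integral {N..} f"
 proof -
  have "{0..} = {0..N} \<union> {N..}" using N by auto
  moreover have "f integrable_on {0..N}" by (rule integrable_continuous_real) (rule continuous_on_subset[OF cont], simp)
  moreover have "negligible ({0..N} \<inter> {N..})"
  using N by simp
  ultimately show ?thesis using fia[OF N] by simp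
 qed
 then show "norm (integral {0..} f - integral {0..N} f) \<le> C / c * exp (- (c * N))" using tail[OF N] by simp
qed

section \<open>Growth along a ray by convexity of the squared modulus\<close>

text \<open>A ray in direction d with d^2 = 1 or -1 turns Weber's equation into f'' = q f with q
  real. Then |f|^2 has second derivative 2 |f'|^2 + 2 q |f|^2, hence is convex where q is
  nonnegative.\<close>

lemma ray_phi_deriv:
 fixes f f' :: "real => complex"
 assumes "(f has_vector_derivative f' r) (at r)" "(f' has_vector_derivative of_real (q r) * f r) (at r)"
 shows "((%r. (cmod (f r))^2) has_real_derivative 2 * Re (cnj (f r) * f' r)) (at r)"
  and "((%r. 2 * Re (cnj (f r) * f' r)) has_real_derivative
     2 * (cmod (f' r))^2 + 2 * q r * (cmod (f r))^2) (at r)"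
proof -
 have [derivative_intros]: "((%r. Re (f r)) has_real_derivative Re (f' r)) (at r)"
  "((%r. Im (f r)) has_real_derivative Im (f' r)) (at r)"
  "((%r. Re (f' r)) has_real_derivative Re (of_real (q r) * f r)) (at r)"
  "((%r. Im (f' r)) has_real_derivative Im (of_real (q r) * f r)) (at r)"
  using assms by (auto simp:
 intro!: derivative_eq_intros
)
 show "((%r. (cmod (f r))^2) has_real_derivative 2 * Re (cnj (f r) * f' r)) (at r)" unfolding cmod_power2
   by (auto intro!: derivative_eq_intros)
 show "((%r. 2 * Re (cnj (f r) * f' r)) has_real_derivative
     2 * (cmod (f' r))^2 + 2 * q r * (cmod (f r))^2) (at r)"
  unfolding cmod_power2
  by (auto intro!: derivative_eq_intros simp: algebra_simps power2_eq_square)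
qed

context
 fixes f f' :: "real => complex" and q :: "real => real" and a :: real
 assumes D1: "\<And>r. r \<ge> a ==> (f has_vector_derivative f' r) (at r)"
  and D2: "\<And>r. r \<ge> a ==> (f' has_vector_derivative of_real (q r) * f r) (at r)"
  and q: "\<And>r. r \<ge> a ==> q r \<ge> 0"
begin

lemma ray_phi_deriv':
 assumes "r \<ge> a"
 shows "((%r. (cmod (f r))^2) has_real_derivative 2 * Re (cnj (f r) * f' r)) (at r)"
  and "((%r. 2 * Re (cnj (f r) * f' r)) has_real_derivative
     2 * (cmod (f' r))^2 + 2 * q r * (cmod (f r))^2) (at r)" using ray_phi_deriv[of f f' r q] D1[OF assms] D2[OF assms] by auto

lemma ray_psi_mono:
 assumes "a \<le> r" "r \<le> s"
 shows "Re (cnj (f r) * f' r) \<le> Re (cnj (f s) * f' s)"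
proof -
 have "2 * Re (cnj (f r) * f' r) \<le> 2 * Re (cnj (f s) * f' s)" by (rule DERIV_nonneg_imp_nondecreasing[OF assms(2)])
   (intro exI conjI, rule ray_phi_deriv'(2), use q assms in "auto intro!: ")
 then show ?thesis by simp
qed

lemma ray_phi_lower:
 assumes "a \<le> c" "c \<le> r"
 shows "(cmod (f r))^2 \<ge> (cmod (f c))^2 + 2 * Re (cnj (f c) * f' c) * (r - c)"
proof -
 have "(cmod (f c))^2 - 2 * Re (cnj (f c) * f' c) * (c - c) \<le>
    (cmod (f r))\<^sup>2 - 2 * Re (cnj (f c) * f' c) * (r - c)"
 proof (rule DERIV_nonneg_imp_nondecreasing[OF assms(2)])
  fix x assume x: "c \<le> x" "x \<le> r"
  show "\<exists>y. ((%x. (cmod (f x))^2 - 2 * Re (cnj (f c) * f' c) * (x - c)) has_real_derivative y) (at x) \<and> 0 \<le> y"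
  proof (intro exI conjI)
   show "((%x. (cmod (f x))^2 - 2 * Re (cnj (f c) * f' c) * (x - c)) has_real_derivative
     2 * Re (cnj (f x) * f' x) - 2 * Re (cnj (f c) * f' c)) (at x)"
    using DERIV_diff[OF ray_phi_deriv'(1)[of x]
      DERIV_cmult[OF DERIV_diff[OF DERIV_ident DERIV_const], of "2 * Re (cnj (f c) * f' c)"]] x assms by simp
  qed (use x assms ray_psi_mono[of c x] in simp)
 qed
 then show ?thesis by simp
qed

text \<open>A convex function that is bounded on a half-line has no positive slope. As the slope
  starts nonnegative and does not decrease, it vanishes identically, and the second derivative 2
  |f'|^2 + 2 q |f|^2 = 0 forces f = 0.\<close>

lemma ray_zero:
 assumes "Re (cnj (f a) * f' a) \<ge> 0" and B: "\<And>r. r \<ge> a ==> cmod (f r) \<le> B"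
  and qpos: "\<And>r. r > a ==> q r > 0" and r: "r > a"
 shows "f r = 0"
proof -
 have psi0: "Re (cnj (f c) * f' c) = 0" if c: "c \<ge> a" for c
 proof (rule ccontr)
  assume ne: "Re (cnj (f c) * f' c) \<noteq> 0"
  have pos: "Re (cnj (f c) * f' c) > 0" using ray_psi_mono[of a c] assms(1) c ne by simp
  \<comment> \<open>At this point the tangent at c has risen by B^2 + 1, which exceeds the
    bound.\<close>
  define s where "s = c + (B^2 + 1) / (2 * Re (cnj (f c) * f' c))"
  have "s \<ge> c" unfolding s_def using pos by simp
  then have "(cmod (f s))^2 \<ge> (cmod (f c))^2 + (B^2 + 1)" using ray_phi_lower[OF c, of s] pos by (simp add: s_def)
  moreover have "(cmod (f s))^2 \<le> B^2" by (rule power_mono) (use B \<open>s \<ge> c\<close> c in auto)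
  ultimately show False by (smt (verit) zero_le_power2)
 qed
 have D: "((%r. 2 * Re (cnj (f r) * f' r)) has_real_derivative
     2 * (cmod (f' r))^2 + 2 * q r * (cmod (f r))^2) (at r)"
  by (rule ray_phi_deriv'(2)) (use r in auto)
 have "((%r. 0) has_real_derivative
     2 * (cmod (f' r))^2 + 2 * q r * (cmod (f r))^2) (at r)"
  by (rule has_field_derivative_transform_within_open[OF D, of "{a<..}"]) (use r psi0 in auto)
 then have "2 * (cmod (f' r))^2 + 2 * q r * (cmod (f r))^2 = 0" using DERIV_unique DERIV_const by blast
 moreover have "(cmod (f' r))^2 \<ge> 0" "q r * (cmod (f r))^2 \<ge> 0" using qpos[OF r] by auto
 ultimately have "q r * (cmod (f r))^2 = 0" by linarith
 then show ?thesis using qpos[OF r] by simp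
qed

text \<open>Unboundedness makes the slope of p = |f|^2 positive at some point c. Since p'' >= k^2 p,
  the function (p' + k p) exp (- k r) does not decrease, so (p exp (k r))' >= A exp (2 k r).
  Integration gives p >= const exp (k r), and the square root halves the exponent.\<close>

lemma ray_grow:
 assumes k: "k > 0" and qk: "\<And>r. r \<ge> a ==> q r \<ge> k^2"
  and unb: "\<And>B. \<exists>r\<ge>a. cmod (f r) > B"
 shows "\<exists>C>0. \<exists>r0\<ge>a. \<forall>r\<ge>r0. cmod (f r) \<ge> C * exp (k * r / 2)"
proof -
 let ?p = "%r. (cmod (f r))^2" and ?s = "%r. 2 * Re (cnj (f r) * f' r)"
 have "\<exists>c\<ge>a. ?s c > 0"
 proof (rule ccontr)
  assume "\<not> ?thesis"
  then have neg: "?s c \<le> 0" if "c \<ge> a" for c using that by auto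
  obtain r where r: "r \<ge> a" "cmod (f r) > cmod (f a)" using unb[of "cmod (f a)"] by auto
  have "?p r \<le> ?p a" by (rule DERIV_nonpos_imp_nonincreasing[OF r(1)])
     (intro exI conjI, rule ray_phi_deriv'(1), use neg in auto)
  then show False using r(2) by simp
 qed
 then obtain c where c: "c \<ge> a" "?s c > 0" by auto
 define A where "A = (?s c + k * ?p c) * exp (- (k * c))"
 have A: "A > 0" unfolding A_def using c k by (simp add: add_pos_nonneg)
 have chi: "(?s r + k * ?p r) * exp (- (k * r)) \<ge> A" if r: "r \<ge> c" for r unfolding A_def
 proof (rule DERIV_nonneg_imp_nondecreasing[OF r])
  fix x assume x: "c \<le> x" "x \<le> r"
  then have xa: "x \<ge> a" using c by simp
  show "\<exists>y. ((%r. (?s r + k * ?p r) * exp (- (k * r))) has_real_derivative y) (at x) \<and> 0 \<le> y"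
  proof (intro exI conjI)
   show "((%r. (?s r + k * ?p r) * exp (- (k * r))) has_real_derivative
    ((2 * (cmod (f' x))^2 + 2 * q x * ?p x + k * ?s x) * exp (- (k * x)) + (?s x + k * ?p x) * (exp (- (k * x)) * - k))) (at x)"
    by (rule derivative_eq_intros ray_phi_deriv' | use xa in simp)+
   have "2 * (cmod (f' x))^2 + 2 * q x * ?p x - k^2 * ?p x \<ge> 0"
   proof -
    have "q x * ?p x \<ge> k^2 * ?p x" using qk[OF xa] by (intro mult_right_mono) auto
    moreover have "k^2 * ?p x \<ge> 0" by simp
    moreover have "(cmod (f' x))^2 \<ge> 0" by simp
    ultimately show ?thesis by linarith
   qed
   then have "0 \<le> (2 * (cmod (f' x))^2 + 2 * q x * ?p x - k^2 * ?p x) * exp (- (k * x))" by simp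
   then show "0 \<le> ((2 * (cmod (f' x))^2 + 2 * q x * ?p x + k * ?s x) * exp (- (k * x)) + (?s x + k * ?p x) * (exp (- (k * x)) * - k))"
    by (simp add: algebra_simps power2_eq_square)
  qed
 qed
 have low: "?p r * exp (k * r) - A / (2 * k) * exp (2 * k * r) \<ge> ?p c * exp (k * c) - A / (2 * k) * exp (2 * k * c)" if r: "r \<ge> c" for r
 proof (rule DERIV_nonneg_imp_nondecreasing[OF r])
  fix x assume x: "c \<le> x" "x \<le> r"
  then have xa: "x \<ge> a" using c by simp
  show "\<exists>y. ((%r. ?p r * exp (k * r) - A / (2 * k) * exp (2 * k * r)) has_real_derivative y) (at x) \<and> 0 \<le> y"
  proof (intro exI conjI)
   show "((%r. ?p r * exp (k * r) - A / (2 * k) * exp (2 * k * r)) has_real_derivative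
    ((?s x + k * ?p x) * exp (k * x) - A * exp (2 * k * x))) (at x)"
    by (rule derivative_eq_intros ray_phi_deriv' | use xa k in "simp add: algebra_simps")+
   have "A * exp (2 * k * x) \<le> ((?s x + k * ?p x) * exp (- (k * x))) * exp (2 * k * x)" using chi[OF x(1)] by simp
   also have "\<dots> = (?s x + k * ?p x) * (exp (- (k * x)) * exp (2 * k * x))" by simp
   also have "exp (- (k * x)) * exp (2 * k * x) = exp (k * x)" by (simp add: mult_exp_exp)
   finally show "0 \<le> (?s x + k * ?p x) * exp (k * x) - A * exp (2 * k * x)" by simp
  qed
 qed
 \<comment> \<open>From distance 1/k on, exp (2 k c) is at most half of exp (2 k r), so at least
   half of the integrated term survives.\<close>
 have fin: "cmod (f r) \<ge> sqrt (A / (4 * k)) * exp (k * r / 2)" if r: "r \<ge> c + 1 / k" for r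
 proof -
  have "1 / k > 0" using k by simp
  then have rc: "r \<ge> c" using r by linarith
  have e2: "exp (2 * k * c) \<le> exp (2 * k * r) / 2"
  proof -
   have kr: "2 * k * c + 1 \<le> 2 * k * r" using mult_left_mono[OF r, of k] k by (simp add: algebra_simps)
   have "exp (2 * k * c) * 2 \<le> exp (2 * k * c) * exp 1" by (intro mult_left_mono) (use exp_ge_add_one_self[of "1::real"] in auto)
   also have "\<dots> = exp (2 * k * c + 1)" by (simp add: exp_add)
   also have "\<dots> \<le> exp (2 * k * r)" using kr by simp
   finally show ?thesis by simp
  qed
  have "?p r * exp (k * r) \<ge> A / (2 * k) * (exp (2 * k * r) - exp (2 * k * c))"
  proof -
   have "?p c * exp (k * c) \<ge> 0" by simp
   with low[OF rc] show ?thesis unfolding right_diff_distrib by linarith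
  qed
  also have "A / (2 * k) * (exp (2 * k * r) - exp (2 * k * c)) \<ge> A / (2 * k) * (exp (2 * k * r) / 2)"
   using e2 A k by (intro mult_left_mono) auto
  finally have "?p r * exp (k * r) \<ge> (A / (4 * k) * exp (k * r)) * exp (k * r)" by (simp add: mult_exp_exp mult.assoc)
  then have "?p r \<ge> A / (4 * k) * exp (k * r)" using mult_le_cancel_right_pos[OF exp_gt_zero] by blast
  then have "sqrt (?p r) \<ge> sqrt (A / (4 * k) * exp (k * r))" by (rule real_sqrt_le_mono)
  moreover have "sqrt (exp (k * r)) = exp (k * r / 2)" by (rule real_sqrt_unique) (simp_all add: power2_eq_square mult_exp_exp)
  ultimately show ?thesis by (simp only: real_sqrt_mult real_sqrt_abs abs_norm_cancel)
 qed
 have "1 / k > 0" using k by simp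
 then have "c + 1 / k \<ge> a" using c by linarith
 moreover have "sqrt (A / (4 * k)) > 0" using A k by simp
 ultimately show ?thesis by (intro exI[of _ "sqrt (A / (4 * k))"] exI[of _ "c + 1 / k"] conjI allI impI fin)
qed

end

section \<open>Calculus of holomorphic solutions of y'' - g y = p\<close>

definition ode2 :: "(complex => complex) => complex set => (complex => complex) => (complex => complex) => bool" where
 "ode2 g S p y \<longleftrightarrow> y holomorphic_on S \<and> (\<forall>z\<in>S. (deriv ^^ 2) y z - g z * y z = p z)"

abbreviation "weber u \<equiv> ode2 (%z. of_real (u^2) * (z^2 - 1))"

lemma deriv2_alt: "(deriv ^^ 2) f = deriv (deriv f)" by (simp add: numeral_2_eq_2)

lemma ode2_holo: "ode2 g S p y ==> y holomorphic_on S" by (simp add: ode2_def)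

lemma ode2_subset: "ode2 g S p y ==> T \<subseteq> S ==> ode2 g T p y" by (auto simp: ode2_def intro:)

lemma ode2_add:
 assumes "ode2 g S p y" "ode2 g S q v" "open S"
 shows "ode2 g S (%z. p z + q z) (%z. y z + v z)"
proof -
 have "(deriv ^^ 2) (%z. y z + v z) z = (deriv ^^ 2) y z + (deriv ^^ 2) v z" if "z \<in> S" for z
  using assms that by (intro higher_deriv_add[of y S v]) (auto simp: ode2_def)
 then show ?thesis using assms by (auto simp: ode2_def algebra_simps intro!: holomorphic_intros)
qed

lemma ode2_cmult:
 assumes "ode2 g S p y" "open S"
 shows "ode2 g S (%z. c * p z) (%z. c * y z)"
proof -
 have "(deriv ^^ 2) (%z. c * y z) z = c * (deriv ^^ 2) y z" if "z \<in> S" for z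
  using assms that by (intro higher_deriv_cmult[of y S]) (auto simp: ode2_def)
 then show ?thesis using assms by (auto simp: ode2_def algebra_simps intro!: holomorphic_intros)
qed

lemma ode2_diff:
 assumes "ode2 g S p y" "ode2 g S q v" "open S"
 shows "ode2 g S (%z. p z - q z) (%z. y z - v z)"
 using ode2_add[OF assms(1) ode2_cmult[OF assms(2,3), of "-1"] assms(3)] by simp

lemma ode2_cong:
 assumes "ode2 g S p y" "open S" "\<And>z. z \<in> S ==> y z = v z" "\<And>z. z \<in> S ==> p z = q z"
 shows "ode2 g S q v"
proof -
 have "(deriv ^^ 2) v z = (deriv ^^ 2) y z" if "z \<in> S" for z by (rule higher_deriv_transform_within_open[of _ S, symmetric])
    (use assms that in "auto simp: ode2_def intro: holomorphic_transform")
 then show ?thesis using assms by (auto simp: ode2_def cong: holomorphic_cong)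
qed

lemma ode2I:
 assumes "open S" "\<And>z. z \<in> S ==> (y has_field_derivative y' z) (at z)"
  "\<And>z. z \<in> S ==> (y' has_field_derivative y'' z) (at z)"
  "\<And>z. z \<in> S ==> y'' z - g z * y z = p z"
 shows "ode2 g S p y"
proof -
 have "deriv (deriv y) z = y'' z" if z: "z \<in> S" for z
 proof -
  have "deriv (deriv y) z = deriv y' z" by (rule deriv_cong_ev[OF eventually_mono[OF eventually_nhds_in_open[OF assms(1) z]] refl])
     (rule DERIV_imp_deriv, rule assms(2))
  then show ?thesis using assms(3)[OF z] by (simp add: DERIV_imp_deriv)
 qed
 then show ?thesis using assms by (auto simp: ode2_def deriv2_alt holomorphic_on_open)
qed

lemma ode2_derivs:
 assumes "ode2 g S p y" "open S" "z \<in> S"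
 shows "(y has_field_derivative deriv y z) (at z)"
  "(deriv y has_field_derivative g z * y z + p z) (at z)"
proof -
 have h: "y holomorphic_on S" using assms by (simp add: ode2_def)
 show "(y has_field_derivative deriv y z) (at z)" using holomorphic_derivI[OF h assms(2,3)] .
 have "(deriv y has_field_derivative deriv (deriv y) z) (at z)" using holomorphic_derivI[OF holomorphic_deriv[OF h assms(2)] assms(2,3)] .
 moreover have "deriv (deriv y) z = g z * y z + p z" using assms by (auto simp: ode2_def deriv2_alt algebra_simps)
 ultimately show "(deriv y has_field_derivative g z * y z + p z) (at z)" by simp
qed

lemma ode2_chain_linear:
 assumes "ode2 g S p y" "open S" "open T" "\<And>z. z \<in> T ==> c * z \<in> S"
 shows "ode2 (%z. c^2 * g (c * z)) T (%z. c^2 * p (c * z)) (%z. y (c * z))"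
proof (rule ode2I[OF assms(3), where y' = "%z. c * deriv y (c * z)" and y'' = "%z. c^2 * (g (c * z) * y (c * z) + p (c * z))"])
 fix z assume z: "z \<in> T"
 note D = ode2_derivs[OF assms(1,2) assms(4)[OF z]]
 have L: "((%z. c * z) has_field_derivative c) (at z)" by simp
 show "((%z. y (c * z)) has_field_derivative c * deriv y (c * z)) (at z)"
  by (rule DERIV_cong[OF DERIV_chain2[where g = "%z. c * z", OF D(1) L]]) simp
 have "((%z. deriv y (c * z)) has_field_derivative (g (c * z) * y (c * z) + p (c * z)) * c) (at z)"
  by (rule DERIV_chain2[where g = "%z. c * z", OF D(2) L])
 from DERIV_cmult[OF this, of c]
 show "((%z. c * deriv y (c * z)) has_field_derivative c^2 * (g (c * z) * y (c * z) + p (c * z))) (at z)"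
  by (rule DERIV_cong) (simp add: power2_eq_square)
qed (simp add: algebra_simps)

lemma ode2_cnj:
 assumes "ode2 g S p y" "open S" "open T" "\<And>z. z \<in> T ==> cnj z \<in> S"
 shows "ode2 (%z. cnj (g (cnj z))) T (%z. cnj (p (cnj z))) (%z. cnj (y (cnj z)))"
proof (rule ode2I[OF assms(3), where y' = "%z. cnj (deriv y (cnj z))" and y'' = "%z. cnj (g (cnj z) * y (cnj z) + p (cnj z))"])
 fix z assume z: "z \<in> T"
 note D = ode2_derivs[OF assms(1,2) assms(4)[OF z]]
 show "((%z. cnj (y (cnj z))) has_field_derivative cnj (deriv y (cnj z))) (at z)"
  using has_field_derivative_cnj_cnj[OF D(1)] by (simp add: o_def)
 show "((%z. cnj (deriv y (cnj z))) has_field_derivative cnj (g (cnj z) * y (cnj z) + p (cnj z))) (at z)"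
  using has_field_derivative_cnj_cnj[OF D(2)] by (simp add: o_def)
qed (simp add: algebra_simps)

text \<open>Leibniz' rule applied to y'' = g y shows by induction that all derivatives at a vanish,
  and the identity theorem applies.\<close>

lemma ode2_unique:
 assumes y: "ode2 g S (%_. 0) y" and S: "open S" "connected S" and g: "g holomorphic_on S"
  and a: "a \<in> S" "y a = 0" "deriv y a = 0" and z: "z \<in> S"
 shows "y z = 0"
proof (rule holomorphic_fun_eq_0_on_connected[OF ode2_holo[OF y] S _ a(1) z])
 fix n
 show "(deriv ^^ n) y a = 0"
 proof (induction n rule: less_induct)
  case (less n)
  consider "n = 0" | "n = 1" | k where "n = k + 2" using that(3)[of "n - 2"] by (cases "n \<ge> 2") (auto simp: less_2_cases_iff not_le)
  then show ?case
  proof cases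
   case 3
   have "(deriv ^^ n) y a = (deriv ^^ k) ((deriv ^^ 2) y) a" unfolding 3 by (simp only: funpow_add o_apply)
   also have "\<dots> = (deriv ^^ k) (%w. g w * y w) a"
   by (rule higher_deriv_transform_within_open[OF _ _ S(1) a(1)]) ((rule holomorphic_higher_deriv[OF ode2_holo[OF y] S(1)]), (use y g in "auto simp: ode2_def intro!: holomorphic_intros"))
   also have "\<dots> = (\<Sum>i = 0..k. of_nat (k choose i) * (deriv ^^ i) g a * (deriv ^^ (k - i)) y a)"
    by (rule higher_deriv_mult[OF g ode2_holo[OF y] S(1) a(1)])
   also have "\<dots> = 0" by rule (use less 3 in auto)
   finally show ?thesis .
  qed (use a in auto)
 qed
qed

section \<open>Boundedness at infinity on the three rays\<close>

text \<open>For homogeneous solutions on these rays this is the negation of exponential largeness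
  (see \<open>dichotomy\<close>), but in contrast to that negation it is visibly stable under linear
  combinations.\<close>

definition bddr :: "complex => (complex => complex) => bool" where
 "bddr d f \<longleftrightarrow> (\<exists>B. \<forall>\<^sub>F r in at_top. norm (f (of_real r * d)) \<le> B)"

lemma bddrI: "\<forall>\<^sub>F r in at_top. norm (f (of_real r * d)) \<le> B ==> bddr d f" by (auto simp: bddr_def)

lemma bddr_diff: "bddr d f ==> bddr d g ==> bddr d (%z. f z - g z)" unfolding bddr_def
proof clarify
 fix A B let ?a = "%r. of_real r * d"
 assume "\<forall>\<^sub>F r in at_top. norm (f (?a r)) \<le> A" "\<forall>\<^sub>F r in at_top. norm (g (?a r)) \<le> B"
 then have "\<forall>\<^sub>F r in at_top. norm (f (?a r) - g (?a r)) \<le> A + B" by eventually_elim (rule norm_triangle_le_diff, simp)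
 then show "\<exists>B. \<forall>\<^sub>F r in at_top. norm (f (?a r) - g (?a r)) \<le> B" by auto
qed

lemma bddr_cmult: "bddr d f ==> bddr d (%z. c * f z)" unfolding bddr_def
proof clarify
 fix A assume "\<forall>\<^sub>F r in at_top. norm (f (of_real r * d)) \<le> A"
 then have "\<forall>\<^sub>F r in at_top. norm (c * f (of_real r * d)) \<le> norm c * A" by eventually_elim (simp add: norm_mult mult_left_mono)
 then show "\<exists>B. \<forall>\<^sub>F r in at_top. norm (c * f (of_real r * d)) \<le> B" by auto
qed

lemma bddr_add: "bddr d f ==> bddr d g ==> bddr d (%z. f z + g z)"
 using bddr_diff[of d f "%z. (-1) * g z"] bddr_cmult[of d g "-1"] by simp

lemma bddr_cong: "bddr d f ==> \<forall>\<^sub>F r in at_top. f (of_real r * d) = g (of_real r * d) ==> bddr d g"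
 unfolding bddr_def
proof clarify
 fix B let ?a = "%r. of_real r * d"
 assume "\<forall>\<^sub>F r in at_top. f (?a r) = g (?a r)" "\<forall>\<^sub>F r in at_top. norm (f (?a r)) \<le> B"
 then have "\<forall>\<^sub>F r in at_top. norm (g (?a r)) \<le> B" by eventually_elim simp
 then show "\<exists>B. \<forall>\<^sub>F r in at_top. norm (g (?a r)) \<le> B" by auto
qed

lemma recessive_imp_bddr: "recessive_at d f ==> bddr d f" unfolding recessive_at_def
proof clarify
 fix c :: real assume "c > 0" and ev: "\<forall>\<^sub>F r in at_top. norm (f (of_real r * d)) \<le> exp (- c * r)"
 have "\<forall>\<^sub>F r in at_top. norm (f (of_real r * d)) \<le> 1" using ev eventually_ge_at_top[of 0]
  by eventually_elim (use \<open>c > 0\<close> in "force intro: order_trans")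
 then show ?thesis by (rule bddrI)
qed

lemma bddr_bound:
 assumes "bddr d f" and cont: "continuous_on ((%r. of_real r * d) ` {a..}) f"
 obtains B where "\<And>r. r \<ge> a ==> norm (f (of_real r * d)) \<le> B"
proof -
 let ?b = "%r. norm (f (of_real r * d))"
 obtain A r0 where A: "\<And>r. r \<ge> r0 ==> ?b r \<le> A" using assms(1) by (auto simp: bddr_def eventually_at_top_linorder)
 let ?a = "%r. f (of_real r * d)"
 let ?c = "{a..max a r0}"
 have c: "continuous_on ?c ?a" by (rule continuous_on_compose2[OF cont]) (auto intro!: continuous_intros)
 have "compact (?a ` ?c)" by (rule compact_continuous_image[OF c]) simp
 then have "bounded (?a ` ?c)" by (rule compact_imp_bounded)
 then obtain B where "\<forall>x\<in>?a ` ?c. norm x \<le> B" unfolding bounded_iff by blast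
 then have B: "?b r \<le> B" if "r \<in> ?c" for r using that by simp
 show ?thesis
 proof (rule that[of "max A B"])
  fix r assume "r \<ge> a"
  then show "?b r \<le> max A B" using A[of r] B[of r] by (cases "r \<le> r0") auto
 qed
qed

text \<open>With z = r d and d^2 = \<sigma> the equation becomes f'' = u^2 (r^2 - \<sigma>) f. The
  condition a^2 >= \<sigma> lets the ray start at distance 1, the turning point, when \<sigma> = 1,
  and already at 0 when \<sigma> = -1.\<close>

locale weber_ray =
 fixes u :: real and d :: complex and \<sigma> :: real and S :: "complex set" and y :: "complex => complex" and a :: real
 assumes u: "u > 0" and d2: "d^2 = of_real \<sigma>" and sig: "\<sigma> = 1 \<or> \<sigma> = -1"
  and S: "open S" and ray: "\<And>r. r \<ge> a ==> of_real r * d \<in> S"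
  and y: "weber u S (%_. 0) y" and a: "a \<ge> 0" "a^2 \<ge> \<sigma>"
begin

lemma D1: "r \<ge> a ==> ((%r. y (of_real r * d)) has_vector_derivative d * deriv y (of_real r * d)) (at r)"
proof -
 assume r: "r \<ge> a"
 have "((%r. of_real r * d) has_vector_derivative d) (at r)" by (auto intro!: derivative_eq_intros)
 from field_vector_diff_chain_at[OF this ode2_derivs(1)[OF y S ray[OF r]]]
 show ?thesis by (simp add: o_def)
qed

lemma D2: "r \<ge> a ==> ((%r. d * deriv y (of_real r * d)) has_vector_derivative
  of_real (u^2 * (r^2 - \<sigma>)) * y (of_real r * d)) (at r)"
proof -
 assume r: "r \<ge> a"
 let ?c = "%r. of_real r * d"
 have 1: "(?c has_vector_derivative d) (at r)" by (auto intro!: derivative_eq_intros)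
 let ?b = "of_real (u^2) * (?c r^2 - 1)"
 let ?a = "?b * y (?c r)"
 have "((%r. deriv y (?c r)) has_vector_derivative
   d * ?a) (at r)"
  using field_vector_diff_chain_at[OF 1 ode2_derivs(2)[OF y S ray[OF r]]] by (simp add: o_def)
 from has_vector_derivative_mult_right[OF this, of d]
 have "((%r. d * deriv y (?c r)) has_vector_derivative
   d^2 * ?a) (at r)"
  by (simp only: power2_eq_square mult.assoc)
 moreover have "d^2 * ?b = of_real (u^2 * (r^2 - \<sigma>))" using sig by (auto simp: power_mult_distrib d2)
 ultimately show ?thesis by (simp only: mult.assoc[symmetric])
qed

lemma qnn: "r \<ge> a ==> u^2 * (r^2 - \<sigma>) \<ge> 0"
proof -
 assume "r \<ge> a"
 then have "a^2 \<le> r^2" using a by simp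
 then show ?thesis using a by simp
qed

lemma qpos: "r > a ==> u^2 * (r^2 - \<sigma>) > 0"
proof -
 assume "r > a"
 then have "a^2 < r^2" using a by (intro power_strict_mono) auto
 then show ?thesis using a u by simp
qed

lemma cont: "continuous_on ((%r. of_real r * d) ` {a..}) y"
 by (rule continuous_on_subset[OF holomorphic_on_imp_continuous_on[OF ode2_holo[OF y]]]) (use ray in auto)

lemma bounded_zero:
 assumes "bddr d y" "Re (cnj (y (of_real a * d)) * (d * deriv y (of_real a * d))) \<ge> 0" "r > a"
 shows "y (of_real r * d) = 0"
proof -
 obtain B where B: "\<And>r. r \<ge> a ==> norm (y (of_real r * d)) \<le> B" using bddr_bound[OF assms(1) cont] by auto
 show ?thesis
  by (rule ray_zero[of a "%r. y (of_real r * d)" "%r. d * deriv y (of_real r * d)" "%r. u^2 * (r^2 - \<sigma>)" B])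
    (use D1 D2 qnn qpos assms B in auto)
qed

text \<open>A positive initial slope would make y vanish beyond a by \<open>bounded_zero\<close>,
  hence also at a by continuity, and then the slope would be 0.\<close>

lemma bounded_psi_neg:
 assumes "bddr d y"
 shows "Re (cnj (y (of_real a * d)) * (d * deriv y (of_real a * d))) \<le> 0"
proof (rule ccontr)
 assume *: "\<not> ?thesis"
 have z: "y (of_real r * d) = 0" if "r > a" for r using bounded_zero[OF assms _ that] * by simp
 let ?a = "%r. y (of_real r * d)"
 have "(?a \<longlongrightarrow> y (of_real a * d)) (at_right a)" using has_vector_derivative_continuous[OF D1[of a]] unfolding continuous_at
  by (rule tendsto_mono[OF at_le, rotated]) auto
 moreover have "(?a \<longlongrightarrow> 0) (at_right a)"
  by (rule tendsto_eventually) (rule eventually_mono[OF eventually_at_right_less[of a]], rule z)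
 ultimately have "y (of_real a * d) = 0" using tendsto_unique trivial_limit_at_right_real by blast
 then show False using * by simp
qed

lemma dichotomy:
 assumes "\<not> bddr d y"
 shows "\<exists>C>0. \<exists>k>0. \<forall>\<^sub>F r in at_top. norm (y (of_real r * d)) \<ge> C * exp (k * r)"
proof -
 \<comment> \<open>For r >= 2 the factor r^2 - \<sigma> is at least 1, so the coefficient is at
   least u^2, as \<open>ray_grow\<close> requires.\<close>
 define b where "b = max a 2"
 have ba: "b \<ge> a" by (simp add: b_def)
 let ?a = "%r. norm (y (of_real r * d))"
 let ?b = "%r. u^2 * (r^2 - \<sigma>)"
 have "\<exists>C>0. \<exists>r0\<ge>b. \<forall>r\<ge>r0. ?a r \<ge> C * exp (u * r / 2)"
 proof (rule ray_grow[of b "%r. y (of_real r * d)" "%r. d * deriv y (of_real r * d)" "%r. ?b r" u])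
  fix r assume r: "r \<ge> b"
  have "r^2 \<ge> 2^2" by (rule power_mono) (use r b_def in auto)
  then have "1 \<le> r^2 - \<sigma>" using sig by auto
  from mult_left_mono[OF this, of "u^2"] show "u^2 \<le> ?b r" by simp
  show "0 \<le> ?b r" using qnn[of r] r ba by simp
 next
  fix B show "\<exists>r\<ge>b. B < ?a r" using assms by (auto simp: bddr_def eventually_at_top_linorder not_le dest!:)
 qed (use D1 D2 ba u in auto)
 then obtain C r0 where "C > 0" "\<forall>r\<ge>r0. ?a r \<ge> C * exp (u / 2 * r)" by auto
 then show ?thesis using u by (intro exI[of _ C] conjI exI[of _ "u/2"]) (auto simp: eventually_at_top_linorder)
qed

text \<open>Carries the dichotomy over to inhomogeneous solutions: w differs from a polynomially
  bounded particular solution v by y, and an exponentially growing y would dominate v.\<close>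

lemma not_exp_large:
 assumes "\<not> exp_large_at d w" and poly: "\<forall>\<^sub>F r in at_top. norm (v (of_real r * d)) \<le> K * r ^ N"
  and w: "\<forall>\<^sub>F r in at_top. w (of_real r * d) = v (of_real r * d) + y (of_real r * d)"
 shows "bddr d y"
proof (rule ccontr)
 assume "\<not> ?thesis"
 then obtain C k where C: "C > 0" "k > 0" "\<forall>\<^sub>F r in at_top. norm (y (of_real r * d)) \<ge> C * exp (k * r)" using dichotomy by auto
 have ev: "\<forall>\<^sub>F r in at_top. K * r ^ N + exp (k / 2 * r) \<le> C * exp (k * r)"
 proof -
  have l1: "((%r::real. r ^ N / exp r) \<longlongrightarrow> 0) at_top" by (rule tendsto_power_div_exp_0)
  have lin: "filterlim (%r. k * r) at_top at_top" using C
   by (intro filterlim_tendsto_pos_mult_at_top[OF tendsto_const _ filterlim_ident]) auto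
  let ?b = "%r. (k * r) ^ N / exp (k * r)"
  have l2: "(?b \<longlongrightarrow> 0) at_top" using filterlim_compose[OF l1 lin] by simp
  let ?a = "?b"
  have l3: "((%r. K / k ^ N * ?a r) \<longlongrightarrow> K / k ^ N * 0) at_top" by (intro tendsto_intros l2)
  have "filterlim (%r. k / 2 * r) at_top at_top"
   by (rule filterlim_tendsto_pos_mult_at_top[OF tendsto_const _ filterlim_ident]) (use C in simp)
  then have "filterlim (%r. - (k / 2 * r)) at_bot at_top" by (simp add: filterlim_uminus_at_bot)
  then have l4: "((%r. exp (- (k / 2 * r))) \<longlongrightarrow> 0) at_top" by (rule filterlim_compose[OF exp_at_bot])
  have "\<forall>\<^sub>F r in at_top. K / k ^ N * ?a r + exp (- (k / 2 * r)) < C" using tendsto_add[OF l3 l4] C order_tendstoD(2) by simp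
  then show ?thesis
  proof eventually_elim
   case (elim r)
   have "K * r ^ N + exp (k / 2 * r) = (K / k ^ N * ?a r + exp (- (k / 2 * r))) * exp (k * r)"
    using C by (simp add: power_mult_distrib distrib_right mult_exp_exp)
   also have "\<dots> \<le> C * exp (k * r)" using elim by simp
   finally show ?case .
  qed
 qed
 have "\<forall>\<^sub>F r in at_top. norm (w (of_real r * d)) \<ge> exp (k / 2 * r)" using C(3) ev poly w
 proof eventually_elim
  case (elim r)
  have "norm (y (of_real r * d)) \<le> norm (w (of_real r * d)) + norm (v (of_real r * d))"
   using elim(4) by (metis add_diff_cancel_left' norm_triangle_ineq4)
  then show ?case using elim by simp
 qed
 then have "exp_large_at d w" unfolding exp_large_at_def using C by (intro exI[of _ "k/2"]) auto
 then show False using assms by simp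
qed

end

lemma islimpt_ray:
 assumes "d \<noteq> 0"
 shows "(of_real (a + 1) * d) islimpt ((%r. of_real r * d :: complex) ` {a<..})"
 unfolding islimpt_sequential
proof (intro exI conjI allI)
 fix n :: nat
 show "of_real (a + 1 + 1 / real (Suc n)) * d \<in> (%r. of_real r * d) ` {a<..} - {of_real (a + 1) * d}"
 proof
  have "1 / real (Suc n) > 0" by simp
  then show "of_real (a + 1 + 1 / real (Suc n)) * d \<in> (%r. of_real r * d) ` {a<..}" by (intro imageI) (simp only: greaterThan_iff)
  show "of_real (a + 1 + 1 / real (Suc n)) * d \<notin> {of_real (a + 1) * d}"
   unfolding singleton_iff mult_cancel_right of_real_eq_iff using assms by simp
 qed
next
 let ?a = "%n. of_real (a + 1 + 1 / real (Suc n)) * d"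
 have "?a \<longlonglongrightarrow> of_real (a + 1 + 0) * d" by (intro tendsto_intros LIMSEQ_Suc[OF lim_1_over_n])
 then show "?a \<longlonglongrightarrow> of_real (a + 1) * d" by simp
qed

lemma holo_zero_on_ray:
 fixes d :: complex
 assumes y: "y holomorphic_on S" and S: "open S" "connected S" and "d \<noteq> 0"
  and ray: "\<And>r. r \<ge> a ==> of_real r * d \<in> S" and y0: "\<And>r. r > a ==> y (of_real r * d) = 0" and z: "z \<in> S"
 shows "y z = 0"
proof (rule analytic_continuation[OF y S _ _ islimpt_ray[OF \<open>d \<noteq> 0\<close>] _ z])
 show "(%r. of_real r * d) ` {a<..} \<subseteq> S" using ray by auto
 show "of_real (a + 1) * d \<in> S" by (rule ray) simp
 show "\<And>z. z \<in> (%r. of_real r * d) ` {a<..} ==> y z = 0" using y0 by auto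
qed

text \<open>The combination y1 (a d) y2 - y2 (a d) y1 is bounded and vanishes at the start of the
  ray, so its slope there is 0 and \<open>bounded_zero\<close> applies. Thus the solutions bounded
  at one infinity span at most a line.\<close>

lemma weber_ray_proportional:
 assumes "u > 0" "d^2 = of_real \<sigma>" "\<sigma> = 1 \<or> \<sigma> = -1" "a \<ge> 0" "a^2 \<ge> \<sigma>"
  and S: "open S" "connected S" and ray: "\<And>r. r \<ge> a ==> of_real r * d \<in> S"
  and y1: "weber u S (%_. 0) y1" and y2: "weber u S (%_. 0) y2" and b1: "bddr d y1" and b2: "bddr d y2"
  and z: "z \<in> S"
 shows "y1 (of_real a * d) * y2 z = y2 (of_real a * d) * y1 z"
proof -
 let ?a = "of_real a * d"
 define y where "y = (%z. y1 ?a * y2 z - y2 ?a * y1 z)"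
 have y: "weber u S (%_. 0) y" using ode2_diff[OF ode2_cmult[OF y2 S(1)] ode2_cmult[OF y1 S(1)] S(1)] unfolding y_def by simp
 have b: "bddr d y" unfolding y_def by (intro bddr_diff bddr_cmult b1 b2)
 have wr: "weber_ray u d \<sigma> S y a" by (rule weber_ray.intro[OF assms(1-3) S(1) ray y assms(4,5)])
 have nn: "Re (cnj (y ?a) * (d * deriv y ?a)) \<ge> 0" unfolding y_def by simp
 have z0: "y (of_real r * d) = 0" if "r > a" for r by (rule weber_ray.bounded_zero[OF wr b nn that])
 have "d \<noteq> 0"
 using assms(2) assms(3) by auto
 then have "y z = 0" by (rule holo_zero_on_ray[where y = y and z = z and S = S and d = d and a = a, OF ode2_holo[OF y] S])
   (rule ray z0 z, assumption?)+
 then show ?thesis unfolding y_def by (rule eq_iff_diff_eq_0[THEN iffD2])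
qed

section \<open>Integrals with a parameter\<close>

lemma param_integral_deriv:
 fixes c :: "real => complex" and h h' :: "complex => real => complex"
 assumes c: "continuous_on {a..b} c"
  and D: "\<And>z t. ((%z. h z t) has_field_derivative h' z t) (at z)"
  and h: "continuous_on UNIV (%(z, t). h z t)" and h': "continuous_on UNIV (%(z, t). h' z t)"
 shows "((%z. integral {a..b} (%t. c t * h z t)) has_field_derivative integral {a..b} (%t. c t * h' z t)) (at z)"
proof -
 let ?a = "continuous_on"
 have slice: "?a {a..b} (%t. h z t)" for z
 proof -
  have "?a {a..b} (%t. (%(z, t). h z t) (z, t))" by (rule continuous_on_compose2[OF h]) (auto intro!: continuous_intros)
  then show ?thesis by simp
 qed
 have c2: "?a (UNIV \<times> {a..b}) (%p. c (snd p))" by (rule continuous_on_compose2[OF c]) (auto intro!: continuous_intros)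
 have h2: "?a (UNIV \<times> {a..b}) (%p. h' (fst p) (snd p))" using continuous_on_subset[OF h'] by (simp add: case_prod_unfold)
 have "?a (UNIV \<times> cbox a b) (%(x, t). c t * h' x t)" using continuous_on_mult[OF c2 h2] by (simp add: case_prod_unfold)
 then have "((%x. integral (cbox a b) (%t. c t * h x t)) has_field_derivative integral (cbox a b) (%t. c t * h' z t)) (at z within UNIV)"
  by (intro leibniz_rule_field_derivative)
   (auto intro!: DERIV_cmult D integrable_continuous_real continuous_intros c slice)
 then show ?thesis by simp
qed

text \<open>The operator applied to the kernel is an exact t-derivative of \<Phi>, so only boundary
  values of \<Phi> remain as inhomogeneity. Differentiability of \<Phi> is asked for in the open
  interval because the kernels have branch points at end points.\<close>

lemma ode2_integral:
 fixes c :: "real => complex" and h h' h'' \<Phi> :: "complex => real => complex"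
 assumes c: "continuous_on {a..b} c" and ab: "a \<le> b"
  and D: "\<And>z t. ((%z. h z t) has_field_derivative h' z t) (at z)"
   "\<And>z t. ((%z. h' z t) has_field_derivative h'' z t) (at z)"
  and h: "continuous_on UNIV (%(z, t). h z t)" and h': "continuous_on UNIV (%(z, t). h' z t)"
   and h'': "continuous_on UNIV (%(z, t). h'' z t)"
  and F: "\<And>z. continuous_on {a..b} (\<Phi> z)"
   "\<And>z t. t \<in> {a<..<b} ==> (\<Phi> z has_vector_derivative c t * (h'' z t - g z * h z t)) (at t)"
 shows "ode2 g UNIV (%z. \<Phi> z b - \<Phi> z a) (%z. integral {a..b} (%t. c t * h z t))"
proof (rule ode2I[OF open_UNIV, where y' = "%z. integral {a..b} (%t. c t * h' z t)"
   and y'' = "%z. integral {a..b} (%t. c t * h'' z t)"])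
 fix z :: complex
 show "((%z. integral {a..b} (%t. c t * h z t)) has_field_derivative integral {a..b} (%t. c t * h' z t)) (at z)"
  by (rule param_integral_deriv[OF c D(1) h h'])
 show "((%z. integral {a..b} (%t. c t * h' z t)) has_field_derivative integral {a..b} (%t. c t * h'' z t)) (at z)"
  by (rule param_integral_deriv[OF c D(2) h' h''])
 have slice: "continuous_on {a..b} (%t. k z t)" if "continuous_on UNIV (%(z, t). k z t)" for k :: "complex => real => complex"
 proof -
  have "continuous_on {a..b} (%t. (%(z, t). k z t) (z, t))"
   by (rule continuous_on_compose2[OF that]) (auto intro!: continuous_intros)
  then show ?thesis by simp
 qed
 have i1: "(%t. c t * h'' z t) integrable_on {a..b}" and i2: "(%t. c t * h z t) integrable_on {a..b}"
  by (intro integrable_continuous_real continuous_intros c slice h h'')+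
 have "((%t. c t * (h'' z t - g z * h z t)) has_integral (\<Phi> z b - \<Phi> z a)) {a..b}"
  by (rule fundamental_theorem_of_calculus_interior[OF ab F])
 moreover have "((%t. c t * h'' z t - g z * (c t * h z t)) has_integral
   (integral {a..b} (%t. c t * h'' z t) - g z * integral {a..b} (%t. c t * h z t))) {a..b}"
  by (intro has_integral_diff has_integral_mult_right integrable_integral i1 i2)
 ultimately show "integral {a..b} (%t. c t * h'' z t) - g z * integral {a..b} (%t. c t * h z t) = \<Phi> z b - \<Phi> z a"
  by (intro has_integral_unique) (auto simp: algebra_simps)
qed

lemma ode2_limit:
 assumes S: "open S" and y: "\<And>N::nat. ode2 g S (p N) (y N)"
  and ul: "\<And>z. z \<in> S ==> \<exists>d>0. cball z d \<subseteq> S \<and> uniform_limit (cball z d) y H sequentially"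
  and p: "\<And>z. z \<in> S ==> (%N. p N z) \<longlonglongrightarrow> P z"
 shows "ode2 g S P H"
 unfolding ode2_def
proof (intro conjI ballI)
 show "H holomorphic_on S" by (rule holomorphic_uniform_sequence[OF S]) (use y ul in "auto simp: ode2_def")
 fix z assume z: "z \<in> S"
 obtain d where d: "d > 0" "cball z d \<subseteq> S" "uniform_limit (cball z d) y H sequentially" using ul[OF z] by auto
 have "uniform_limit (ball z d) y H sequentially" by (rule uniform_limit_on_subset[OF d(3)]) auto
 then have "(%N. (deriv ^^ 2) (y N) z) \<longlonglongrightarrow> (deriv ^^ 2) H z"
 by (rule higher_deriv_complex_uniform_limit) ((intro always_eventually allI holomorphic_on_subset[OF ode2_holo[OF y]], use in auto), (use d in auto))
 moreover have "(%N. y N z) \<longlonglongrightarrow> H z" by (rule tendsto_uniform_limitI[OF d(3)]) (use d in auto)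
 ultimately have "(%N. (deriv ^^ 2) (y N) z - g z * y N z) \<longlonglongrightarrow> (deriv ^^ 2) H z - g z * H z"
  by (intro tendsto_intros)
 moreover have "(%N. (deriv ^^ 2) (y N) z - g z * y N z) = (%N. p N z)" using y z by (auto simp: ode2_def)
 ultimately show "(deriv ^^ 2) H z - g z * H z = P z" using LIMSEQ_unique[OF _ p[OF z]] by simp
qed

lemma improper_uniform_limit:
 fixes c :: "real => complex" and h :: "complex => real => complex"
 assumes c: "continuous_on {0..} c" and h: "continuous_on UNIV (%(z, t). h z t)" and kappa: "\<kappa> > 0"
  and b: "\<And>z t. z \<in> K ==> t \<ge> 0 ==> norm (c t * h z t) \<le> C * exp (- (\<kappa> * t))"
 shows "uniform_limit K (%N z. integral {0..real N} (%t. c t * h z t)) (%z. integral {0..} (%t. c t * h z t)) sequentially"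
  (is "uniform_limit K ?I ?J sequentially")
proof -
 have slice: "continuous_on {0..} (%t. h z t)" for z
 proof -
  have "continuous_on {0..} (%t. (%(z, t). h z t) (z, t))"
   by (rule continuous_on_compose2[OF h]) (auto intro!: continuous_intros)
  then show ?thesis by simp
 qed
 let ?a = "%N. \<kappa> * real N"
 have tl: "(%N. C / \<kappa> * exp (- (?a N))) \<longlonglongrightarrow> 0"
 proof -
  have "filterlim ?a at_top sequentially"
   by (rule filterlim_tendsto_pos_mult_at_top[OF tendsto_const \<open>\<kappa> > 0\<close> filterlim_real_sequentially])
  then have "filterlim (%N. - (?a N)) at_bot sequentially" by (simp add: filterlim_uminus_at_bot)
  from tendsto_mult[OF tendsto_const[of "C / \<kappa>"] filterlim_compose[OF exp_at_bot this]] show ?thesis by simp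
 qed
 show ?thesis unfolding uniform_limit_iff
 proof (intro allI impI)
  fix e :: real assume "e > 0"
  from order_tendstoD(2)[OF tl this] show "\<forall>\<^sub>F N in sequentially. \<forall>z\<in>K. dist (?I N z) (?J z) < e"
  proof eventually_elim
   case (elim N)
   show ?case
   proof
    fix z assume z: "z \<in> K"
    have "norm (?J z - ?I N z) \<le> C / \<kappa> * exp (- (?a N))"
     by (rule exp_bound_integral(3)) (use b z kappa in "auto intro!: continuous_intros c slice")
    then show "dist (?I N z) (?J z) < e" using elim by (simp add: dist_norm norm_minus_commute)
   qed
  qed
 qed
qed

lemma improper_deriv:
 fixes c :: "real => complex" and h h' :: "complex => real => complex"
 assumes c: "continuous_on {0..} c" and h: "continuous_on UNIV (%(z, t). h z t)" and kappa: "\<kappa> > 0"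
  and D: "\<And>z t. ((%z. h z t) has_field_derivative h' z t) (at z)" and h': "continuous_on UNIV (%(z, t). h' z t)"
  and b: "\<And>z t. z \<in> ball z0 d ==> t \<ge> 0 ==> norm (c t * h z t) \<le> C * exp (- (\<kappa> * t))" and d: "d > 0"
 shows "(%N. integral {0..real N} (%t. c t * h' z0 t)) \<longlonglongrightarrow> deriv (%z. integral {0..} (%t. c t * h z t)) z0"
proof -
 let ?a = "%N. %z. integral {0..real N} (%t. c t * h z t)"
 have D': "((?a N) has_field_derivative integral {0..real N} (%t. c t * h' z t)) (at z)" for N z
  by (rule param_integral_deriv[OF continuous_on_subset[OF c] D h h']) auto
 have "(%N. (deriv ^^ 1) (?a N) z0) \<longlonglongrightarrow> (deriv ^^ 1) (%z. integral {0..} (%t. c t * h z t)) z0"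
 proof (rule higher_deriv_complex_uniform_limit[OF improper_uniform_limit[OF c h kappa b]])
  show "\<forall>\<^sub>F N in sequentially. (?a N) holomorphic_on ball z0 d"
   using D' by (intro always_eventually) (auto simp: holomorphic_on_open)
 qed (use d in auto)
 then show ?thesis using DERIV_imp_deriv[OF D'] by simp
qed

text \<open>The exponential bound makes the integrals over [0,N] converge locally uniformly, so the
  equation passes to the limit, with L as boundary value at infinity.\<close>

lemma ode2_improper:
 fixes c :: "real => complex" and h h' h'' \<Phi> :: "complex => real => complex"
 assumes c: "continuous_on {0..} c" and S: "open S"
  and D: "\<And>z t. ((%z. h z t) has_field_derivative h' z t) (at z)"
   "\<And>z t. ((%z. h' z t) has_field_derivative h'' z t) (at z)"
  and h: "continuous_on UNIV (%(z, t). h z t)" and h': "continuous_on UNIV (%(z, t). h' z t)"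
   and h'': "continuous_on UNIV (%(z, t). h'' z t)"
  and F: "\<And>z. continuous_on {0..} (\<Phi> z)"
   "\<And>z t. t > 0 ==> (\<Phi> z has_vector_derivative c t * (h'' z t - g z * h z t)) (at t)"
  and lim: "\<And>z. z \<in> S ==> (\<Phi> z \<longlongrightarrow> L z) at_top"
  and bnd: "\<And>z0. z0 \<in> S ==> \<exists>d>0. cball z0 d \<subseteq> S \<and> (\<exists>C. \<exists>\<kappa>>0. \<forall>z\<in>cball z0 d. \<forall>t\<ge>0. norm (c t * h z t) \<le> C * exp (- (\<kappa> * t)))"
 shows "ode2 g S (%z. L z - \<Phi> z 0) (%z. integral {0..} (%t. c t * h z t))"
proof (rule ode2_limit[OF S, where y = "%N z. integral {0..real N} (%t. c t * h z t)" and p = "%N z. \<Phi> z (real N) - \<Phi> z 0"])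
 fix N :: nat
 let ?b = "%z. integral {0..real N} (%t. c t * h z t)"
 let ?d = "%z. \<Phi> z (real N) - \<Phi> z 0"
 have "ode2 g UNIV ?d ?b" by (rule ode2_integral[OF continuous_on_subset[OF c] _ D h h' h'' continuous_on_subset[OF F(1)] F(2)]) auto
 then show "ode2 g S ?d ?b" by (rule ode2_subset) simp
next
 fix z0 assume "z0 \<in> S"
 then obtain d C \<kappa> where d: "d > 0" "cball z0 d \<subseteq> S" "\<kappa> > 0"
  and b: "\<And>z t. z \<in> cball z0 d ==> t \<ge> 0 ==> norm (c t * h z t) \<le> C * exp (- (\<kappa> * t))"
  using bnd by meson
 let ?a = "%N z. integral {0..real N} (%t. c t * h z t)"
 let ?c = "%z. integral {0..} (%t. c t * h z t)"
 let ?e = "%d. uniform_limit (cball z0 d) ?a ?c sequentially"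
 have "?e d" by (rule improper_uniform_limit[OF c h d(3) b])
 then show "\<exists>d>0. cball z0 d \<subseteq> S \<and> ?e d" using d by auto
next
 fix z assume "z \<in> S"
 then show "(%N. \<Phi> z (real N) - \<Phi> z 0) \<longlonglongrightarrow> L z - \<Phi> z 0"
  by (intro tendsto_intros filterlim_compose[OF lim filterlim_real_sequentially])
qed

lemma contour_integral_ray:
 assumes "N > 0"
 shows "contour_integral (linepath 0 (of_real N * d)) f = integral {0..N} (%t. d * f (of_real t * d))"
proof -
 let ?a = "%x. d * f (of_real (N * x) * d)"
 have "contour_integral (linepath 0 (of_real N * d)) f = N *\<^sub>R integral {0..1} ?a" unfolding contour_integral_integral by (simp add: scaleR_conv_of_real mult_ac)
 also have "integral {0..1} ?a = (1 / N) *\<^sub>R integral {0..N} (%t. d * f (of_real t * d))"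
  using integral_stretch_real[of N 0 N "%t. d * f (of_real t * d)"] assms by simp
 also have "N *\<^sub>R ((1 / N) *\<^sub>R integral {0..N} (%t. d * f (of_real t * d))) = integral {0..N} (%t. d * f (of_real t * d))"
  by simp
 finally show ?thesis .
qed

text \<open>Cauchy's theorem on the triangle 0, N d1, N d2, whose far side contributes O(N exp (-
  \<kappa> N)). Differentiability is assumed in the interior of the wedge and continuity up to its
  boundary, as the branch point T = -1 of a later kernel lies on a bounding ray.\<close>

lemma ray_rotation:
 fixes f :: "complex => complex" and d1 d2 :: complex
 defines "W \<equiv> {of_real a * d1 + of_real b * d2 | a b. a \<ge> 0 \<and> b \<ge> 0}"
 assumes cont: "continuous_on W f" and diff: "\<And>w. w \<in> interior W ==> f field_differentiable (at w)"
  and bnd: "\<And>a b. a \<ge> 0 ==> b \<ge> 0 ==> norm (f (of_real a * d1 + of_real b * d2)) \<le> C * exp (- (\<kappa> * (a + b)))"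
  and kappa: "\<kappa> > 0"
 shows "integral {0..} (%t. d1 * f (of_real t * d1)) = integral {0..} (%t. d2 * f (of_real t * d2))"
proof -
 have C: "C \<ge> 0" using order_trans[OF norm_ge_zero bnd[of 0 0]] by simp
 have mem1: "of_real t * d1 \<in> W" if "t \<ge> 0" for t unfolding W_def by (rule , rule exI[of _ t], rule exI[of _ 0]) (use that in simp)
 have mem2: "of_real t * d2 \<in> W" if "t \<ge> 0" for t unfolding W_def by (rule , rule exI[of _ 0], rule exI[of _ t]) (use that in simp)
 have b1: "norm (d1 * f (of_real t * d1)) \<le> (norm d1 * C) * exp (- (\<kappa> * t))" if "t \<ge> 0" for t
  using mult_left_mono[OF bnd[of t 0], of "norm d1"] that by (simp add: norm_mult)
 have b2: "norm (d2 * f (of_real t * d2)) \<le> (norm d2 * C) * exp (- (\<kappa> * t))" if "t \<ge> 0" for t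
  using mult_left_mono[OF bnd[of 0 t], of "norm d2"] that by (simp add: norm_mult)
 let ?b = "%t. d1 * f (of_real t * d1)"
 let ?c = "%t. d2 * f (of_real t * d2)"
 have c1: "continuous_on {0..} ?b" and c2: "continuous_on {0..} ?c"
  by (intro continuous_intros continuous_on_compose2[OF cont]; use mem1 mem2 in auto)+
 let ?I1 = "integral {0..} ?b" and ?I2 = "integral {0..} ?c"
 let ?g = "norm d1 * C / \<kappa>"
 let ?h = "norm d2 * C / \<kappa>"
 let ?K = "?g + ?h"
 let ?a = "%N. exp (- (\<kappa> * N))"
 let ?d = "%C N. C * norm (d2 - d1) * (N * ?a N)"
 have main: "norm (?I1 - ?I2) \<le> ?K * ?a N + ?d C N" if N: "N > 0" for N
 proof -
  let ?n1 = "of_real N * d1" and ?n2 = "of_real N * d2"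
  let ?e = "convex hull {0, ?n1, ?n2}"
  have hull: "?e \<subseteq> W"
  proof
   fix x assume "x \<in> ?e"
   then obtain p q where pq: "p \<ge> 0" "q \<ge> 0" "x = p *\<^sub>R ?n1 + q *\<^sub>R ?n2" unfolding convex_hull_3 by auto
   have "x = of_real (p * N) * d1 + of_real (q * N) * d2" unfolding pq(3) by (simp add: scaleR_conv_of_real)
   moreover have "p * N \<ge> 0" "q * N \<ge> 0" using pq N by auto
   ultimately show "x \<in> W" unfolding W_def by blast
  qed
  let ?f = "linepath ?n1 ?n2"
  have "(f has_contour_integral 0) (linepath 0 ?n1 +++ ?f +++ linepath ?n2 0)" by (rule Cauchy_theorem_triangle_cofinite[where S = "{}"])
    (use hull interior_mono[OF hull] diff in "auto intro: continuous_on_subset[OF cont]")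
  then have "contour_integral (linepath 0 ?n1) f + contour_integral ?f f + contour_integral (linepath ?n2 0) f = 0"
   by (rule has_chain_integral_chain_integral3)
  moreover have "contour_integral (linepath ?n2 0) f = - contour_integral (linepath 0 ?n2) f"
  proof (rule contour_integral_reverse_linepath)
   have "closed_segment ?n2 0 \<subseteq> ?e" unfolding segment_convex_hull by (rule hull_mono) auto
   then show "continuous_on (closed_segment ?n2 0) f" using continuous_on_subset[OF cont] hull by simp
  qed
  ultimately have eq: "integral {0..N} ?b - integral {0..N} ?c = - contour_integral ?f f"
  proof -
   have alg: "a + b + c = 0 ==> c = - d ==> a - d = - b" for a b c d :: complex by auto
   show ?thesis unfolding contour_integral_ray[OF N, symmetric] by (rule alg) fact+
  qed
  let ?k = "closed_segment ?n1 ?n2"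
  have seg: "norm (f x) \<le> C * ?a N" if x: "x \<in> ?k" for x
  proof -
   obtain s where s: "0 \<le> s" "s \<le> 1" "x = (1 - s) *\<^sub>R ?n1 + s *\<^sub>R ?n2" using x unfolding closed_segment_def by blast
   have "norm (f x) \<le> C * exp (- (\<kappa> * ((1 - s) * N + s * N)))" using bnd[of "(1-s)*N" "s*N"] s N by (simp add: scaleR_conv_of_real mult_ac)
   then show ?thesis by (simp add: algebra_simps)
  qed
  have ci: "f contour_integrable_on ?f"
  proof (rule contour_integrable_continuous_linepath)
   have "?k \<subseteq> ?e" unfolding segment_convex_hull by (rule hull_mono) auto
   then show "continuous_on ?k f" using continuous_on_subset[OF cont] hull by simp
  qed
  have "norm (contour_integral ?f f) \<le> C * ?a N * norm (?n2 - ?n1)" by (rule contour_integral_bound_linepath[OF ci _ seg]) (use C in auto)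
  also have "norm (?n2 - ?n1) = N * norm (d2 - d1)" using N by (simp add: norm_mult flip: right_diff_distrib)
  finally have n1: "norm (integral {0..N} ?b - integral {0..N} ?c) \<le> ?d C N" unfolding eq by (simp add: mult_ac)
  have n2: "norm (?I1 - integral {0..N} ?b) \<le> ?g * ?a N" by (rule exp_bound_integral(3)[OF c1 b1 kappa]) (use N in auto)
  have n3: "norm (?I2 - integral {0..N} ?c) \<le> ?h * ?a N" by (rule exp_bound_integral(3)[OF c2 b2 kappa]) (use N in auto)
  have "?I1 - ?I2 = (?I1 - integral {0..N} ?b) - (?I2 - integral {0..N} ?c) + (integral {0..N} ?b - integral {0..N} ?c)" by simp
  also have "norm \<dots> \<le> ?g * ?a N + ?h * ?a N + ?d C N" by (intro norm_triangle_mono norm_triangle_le_diff add_mono n1 n2 n3)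
  finally show ?thesis by (simp add: distrib_right)
 qed
 have lin: "filterlim (%N. \<kappa> * N) at_top at_top"
  by (rule filterlim_tendsto_pos_mult_at_top[OF tendsto_const kappa filterlim_ident])
 have t0: "((%x::real. x ^ 1 / exp x) \<longlongrightarrow> 0) at_top" "((%x::real. x ^ 0 / exp x) \<longlongrightarrow> 0) at_top" by (rule tendsto_power_div_exp_0)+
 have "((%N. (\<kappa> * N) ^ 1 / exp (\<kappa> * N) / \<kappa>) \<longlongrightarrow> 0 / \<kappa>) at_top"
  by (intro tendsto_divide filterlim_compose[OF t0(1) lin]) (use kappa in auto)
 then have e1: "((%N. N * ?a N) \<longlongrightarrow> 0) at_top" using kappa by (simp add: exp_minus field_simps)
 have e0: "(?a \<longlongrightarrow> 0) at_top" using filterlim_compose[OF t0(2) lin] by (simp add: exp_minus field_simps)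
 have "((%N. ?K * ?a N + ?d C N) \<longlongrightarrow> ?K * 0 + C * norm (d2 - d1) * 0) at_top" by (intro tendsto_intros e0 e1)
 then have "norm (?I1 - ?I2) \<le> ?K * 0 + C * norm (d2 - d1) * 0"
  by (rule tendsto_lowerbound) (use main in "auto intro: eventually_mono[OF eventually_gt_at_top[of 0]]")
 then show ?thesis by simp
qed

lemma improper_tendsto:
 fixes f :: "real => complex"
 assumes "continuous_on {0..} f" "\<And>t. t \<ge> 0 ==> norm (f t) \<le> C * exp (- (c * t))" "c > 0"
 shows "((%N. integral {0..N} f) \<longlongrightarrow> integral {0..} f) at_top"
proof -
 have lin: "filterlim (%N. c * N) at_top at_top" by (rule filterlim_tendsto_pos_mult_at_top[OF tendsto_const assms(3) filterlim_ident])
 then have "filterlim (%N. - (c * N)) at_bot at_top" by (simp add: filterlim_uminus_at_bot)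
 from tendsto_mult[OF tendsto_const[of "C / c"] filterlim_compose[OF exp_at_bot this]]
 have tl: "((%N. C / c * exp (- (c * N))) \<longlongrightarrow> 0) at_top" by simp
 have "((%N. integral {0..} f - integral {0..N} f) \<longlongrightarrow> 0) at_top" by (rule Lim_null_comparison[OF _ tl])
   (use exp_bound_integral(3)[OF assms] in "auto intro: eventually_mono[OF eventually_ge_at_top[of 0]]")
 from tendsto_diff[OF tendsto_const[of "integral {0..} f"] this] show ?thesis by simp
qed

lemma improper_scale:
 fixes f :: "real => complex"
 assumes f: "continuous_on {0..} f" and b: "\<And>t. t \<ge> 0 ==> norm (f t) \<le> C * exp (- (c * t))" and c: "c > 0" and m: "m > 0"
 shows "integral {0..} (%t. f (m * t)) = integral {0..} f / of_real m"
proof -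
 have cm: "continuous_on {0..} (%t. f (m * t))" by (intro continuous_on_compose2[OF f]) (use m in auto)
 have bm: "norm (f (m * t)) \<le> C * exp (- ((c * m) * t))" if "t \<ge> 0" for t using b[of "m * t"] that m by (simp add: mult.assoc)
 have lin: "filterlim (%N. m * N) at_top at_top" by (rule filterlim_tendsto_pos_mult_at_top[OF tendsto_const m filterlim_ident])
 let ?a = "%N. integral {0..N} (%t. f (m * t))"
 have "(?a \<longlongrightarrow> integral {0..} (%t. f (m * t))) at_top" by (rule improper_tendsto[OF cm bm]) (use c m in auto)
 moreover have "(?a \<longlongrightarrow> (1 / m) *\<^sub>R integral {0..} f) at_top"
 proof (rule Lim_transform_eventually[OF tendsto_scaleR[OF tendsto_const filterlim_compose[OF improper_tendsto[OF f b c] lin]]])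
  show "\<forall>\<^sub>F N in at_top. (1 / m) *\<^sub>R integral {0..m * N} f = integral {0..N} (%t. f (m * t))"
   using eventually_gt_at_top[of 0]
  proof eventually_elim
   case (elim N)
   show ?case using integral_stretch_real[of m 0 "m * N" f] m by simp
  qed
 qed auto
 ultimately show ?thesis using tendsto_unique[OF trivial_limit_at_top_linorder] by (simp add: scaleR_conv_of_real)
qed

text \<open>The constant is the maximum of t^a exp (- c t), attained at t = a / c.\<close>

lemma powr_exp_bound:
 fixes a c t :: real
 assumes "a > 0" "c > 0" "t \<ge> 0"
 shows "t powr a \<le> exp (a * ln (a / c) - a) * exp (c * t)"
proof (cases "t = 0")
 case False
 then have t: "t > 0" using assms by simp
 have "ln (c * t / a) \<le> c * t / a - 1" by (rule ln_le_minus_one) (use t assms in auto)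
 then have "a * ln (c * t / a) \<le> a * (c * t / a - 1)" using assms by simp
 also have "a * (c * t / a - 1) = c * t - a" using assms by (simp add: algebra_simps)
 also have "ln (c * t / a) = ln t - ln (a / c)" using t assms by (simp add: ln_div ln_mult)
 finally have "exp (a * ln t) \<le> exp (a * ln (a / c) - a + c * t)" by (simp add: algebra_simps)
 then show ?thesis by (simp add: powr_def exp_add)
qed simp

lemma continuous_on_powr_const:
 assumes "a > 0" shows "continuous_on {0..} (%t::real. t powr a)"
 by (rule continuous_on_powr') (use assms in "auto intro!: ")

lemma has_integral_complex_of_real:
 "(f has_integral I) S ==> ((%t. complex_of_real (f t)) has_integral of_real I) S"
 using has_integral_linear[of f I S of_real] bounded_linear_of_real by (simp add: o_def)

lemma Gamma_integral_scaled:
 fixes a l :: real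
 assumes a: "a > 0" and l: "l > 0"
 shows "((%t. t powr a * exp (- (l * t))) has_integral Gamma (a + 1) / l powr (a + 1)) {0..}"
proof -
 define f where "f = (%t. complex_of_real (t powr a * exp (- t)))"
 have cont: "continuous_on {0..} f" unfolding f_def by (intro continuous_intros continuous_on_powr_const a)
 let ?a = "exp (a * ln (a / (1/2)) - a)"
 have b: "norm (f t) \<le> ?a * exp (- (1/2 * t))" if "t \<ge> 0" for t
 proof -
  have "t powr a * exp (- t) \<le> (?a * exp (1/2 * t)) * exp (- t)" using powr_exp_bound[OF a _ that, of "1/2"] by simp
  also have "\<dots> = ?a * exp (- (1/2 * t))" by (simp add: mult_exp_exp)
  finally show ?thesis unfolding f_def norm_of_real by simp
 qed
 let ?b = "of_real (Gamma (a + 1))"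
 have "((%t. complex_of_real (t powr (a + 1 - 1) / exp t)) has_integral ?b) {0..}"
  by (intro has_integral_of_real Gamma_integral_real) (use a in simp)
 then have I: "integral {0..} f = ?b" unfolding f_def by (auto simp: exp_minus divide_inverse)
 have cm: "continuous_on {0..} (%t. f (l * t))" by (intro continuous_on_compose2[OF cont]) (use l in auto)
 have bm: "norm (f (l * t)) \<le> ?a * exp (- ((1/2 * l) * t))" if "t \<ge> 0" for t using b[of "l * t"] that l by simp
 have "(%t. f (l * t)) integrable_on {0..}" by (rule exp_bound_integral(1)[OF cm bm]) (use l in auto)
 then have "((%t. f (l * t)) has_integral ?b / of_real l) {0..}" using integrable_integral improper_scale[OF cont b _ l] I by fastforce
 from has_integral_mult_right[OF this, of "of_real (1 / l powr a)"]
 have "((%t. of_real (1 / l powr a) * f (l * t)) has_integral of_real (Gamma (a + 1) / l powr (a + 1))) {0..}"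
  using l by (simp add: powr_add field_simps)
 moreover have "of_real (1 / l powr a) * f (l * t) = of_real (t powr a * exp (- (l * t)))" if "t \<in> {0..}" for t
  using l by (simp add: f_def powr_mult)
 ultimately have "((%t. complex_of_real (t powr a * exp (- (l * t)))) has_integral of_real (Gamma (a + 1) / l powr (a + 1))) {0..}"
  by (subst has_integral_cong[where g = "%t. of_real (1 / l powr a) * f (l * t)"]) auto
 from has_integral_linear[OF this bounded_linear_Re] show ?thesis by (simp add: o_def)
qed

text \<open>Leading term of Watson's lemma. For bounded continuous h the estimate |h t - h 0| <= e'
  + (2 B / d) t holds for all t >= 0 and replaces a splitting of the integral; its linear part costs
  one factor 1/l.\<close>

lemma watson:
 fixes h :: "real => complex"
 assumes a: "a > 0" and h: "continuous_on {0..} h" and B: "\<And>t. t \<ge> 0 ==> norm (h t) \<le> B"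
 shows "((%l. of_real (l powr (a + 1)) * integral {0..} (%t. of_real (t powr a * exp (- (l * t))) * h t))
  \<longlongrightarrow> of_real (Gamma (a + 1)) * h 0) at_top"
proof -
 have B0: "B \<ge> 0" using B[of 0] norm_ge_zero order_trans by blast
 let ?y = "Gamma (a + 1)"
 have G: "?y > 0" using a by simp
 let ?A = "%l. l powr (a + 1)"
 let ?p = "%l. of_real (?A l)"
 let ?x = "%l t. exp (- (l * t))"
 let ?B = "integral {0..}"
 let ?b = "%l. norm (?p l * ?B (%t. of_real (t powr a * ?x l t) * h t) - of_real ?y * h 0)"
 have key: "\<forall>\<^sub>F l in at_top. ?b l < e" if e: "e > 0" for e
 proof -
  define e' where "e' = e / (2 * ?y)"
  have e': "e' > 0" using e G by (simp add: e'_def)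
  let ?D = "%t. norm (h t - h 0)"
  obtain d where d: "d > 0" "\<And>t. t \<ge> 0 ==> t < d ==> ?D t < e'"
  proof -
   obtain d where "d > 0" "\<forall>t\<in>{0..}. dist t 0 < d \<longrightarrow> dist (h t) (h 0) < e'"
    using h e' unfolding continuous_on_iff by (meson atLeast_iff order_refl)
   then show ?thesis by (intro that[of d]) (auto simp: dist_norm)
  qed
  let ?C = "2 * B / d"
  have hb: "?D t \<le> e' + ?C * t" if t: "t \<ge> 0" for t
  proof (cases "t < d")
   case True
   have "?C * t \<ge> 0" using B0 d t by simp
   then show ?thesis using d(2)[OF t True] by simp
  next
   case False
   have "?D t \<le> 2 * B" using B[OF t] B[of 0] norm_triangle_ineq4[of "h t" "h 0"] by simp
   also have "2 * B \<le> ?C * t" using False d B0 by (simp add: field_simps mult_left_mono)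
   finally show ?thesis using e' by simp
  qed
  let ?f = "2 * B / d * Gamma (a + 2)"
  have est: "?b l \<le> e / 2 + ?f / l" if l: "l > 0" for l
  proof -
   let ?w = "%t. t powr a * ?x l t"
   let ?q = "?y / ?A l"
   have w1: "(?w has_integral ?q) {0..}" by (rule Gamma_integral_scaled[OF a l])
   let ?v = "%t. t powr (a + 1) * ?x l t"
   have "(?v has_integral Gamma (a + 1 + 1) / l powr (a + 1 + 1)) {0..}" by (rule Gamma_integral_scaled) (use a l in auto)
   then have w2: "((%t. ?w t * t) has_integral Gamma (a + 2) / l powr (a + 2)) {0..}" by (subst has_integral_cong[where g = "?v"])
     (auto simp: powr_add add.assoc)
   have wc: "((%t. of_real (?w t)) has_integral complex_of_real ?q) {0..}" by (rule has_integral_of_real[OF w1])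
   let ?s = "%t. of_real (?w t) * h t"
   let ?d = "%t. ?s t"
   have hi: "?d integrable_on {0..}"
   proof (rule exp_bound_integral(1))
    show "continuous_on {0..} ?d" by (intro continuous_intros continuous_on_powr_const a h)
    let ?h = "exp (a * ln (a / (l/2)) - a)"
    show "norm (?s t) \<le> (?h * B) * exp (- (l / 2 * t))" if t: "t \<ge> 0" for t
    proof -
     have "?w t * norm (h t) \<le> (?h * exp (l/2 * t)) * ?x l t * B" by (intro mult_mono powr_exp_bound a t B) (use l in auto)
     also have "\<dots> = (?h * B) * (exp (l/2 * t) * ?x l t)" by simp
     also have "exp (l/2 * t) * ?x l t = exp (- (l / 2 * t))" by (simp add: mult_exp_exp)
     finally show ?thesis by (simp add: norm_mult)
    qed
   qed (use l in auto)
   let ?a = "?B ?d - of_real ?q * h 0"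
   let ?g = "%t. ?s t - of_real (?w t) * h 0"
   have df: "(?g has_integral
     ?a) {0..}"
    by (intro has_integral_diff integrable_integral hi has_integral_mult_left wc)
   let ?r = "?q * e' + ?C * (Gamma (a + 2) / l powr (a + 2))"
   let ?e = "?r"
   let ?k = "%t. ?w t * e' + ?C * (?w t * t)"
   have dom: "(?k has_integral
     ?e) {0..}"
    by (intro has_integral_add has_integral_mult_left has_integral_mult_right w1 w2)
   have "norm (?B ?g) \<le>
     ?B ?k"
   proof (rule integral_norm_bound_integral)
    fix t :: real assume "t \<in> {0..}"
    then have t: "t \<ge> 0" by simp
    let ?l = "norm (?s t - of_real (?w t) * h 0)"
    have "?l = ?w t * ?D t" unfolding right_diff_distrib[symmetric] norm_mult norm_of_real by simp
    also have "\<dots> \<le> ?w t * (e' + ?C * t)" by (intro mult_left_mono hb t) auto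
    finally show "?l \<le> ?w t * e' + ?C * (?w t * t)" by (simp add: algebra_simps)
   qed (use df dom in blast)+
   then have n: "norm ?a \<le> ?r" using integral_unique[OF df] integral_unique[OF dom] by simp
   have "?p l * ?B ?d - of_real ?y * h 0 = ?p l * ?a" using l by (simp add: right_diff_distrib)
   also have "norm \<dots> \<le> ?A l * ?e" unfolding norm_mult using n by (intro mult_mono) auto
   also have "\<dots> = ?y * e' + ?f * (?A l / l powr (a + 2))" using l by (simp add: distrib_left)
   also have "?A l / l powr (a + 2) = 1 / l" using l by (simp add: powr_diff[symmetric])
   also have "?y * e' = e / 2" using G by (simp add: e'_def)
   finally show ?thesis by simp
  qed
  have "((%l. ?f / l) \<longlongrightarrow> 0) at_top"
   by (intro tendsto_divide_0[OF tendsto_const] filterlim_at_top_imp_at_infinity filterlim_ident)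
  then have "\<forall>\<^sub>F l in at_top. ?f / l < e / 2" using e order_tendstoD(2) half_gt_zero by blast
  then show ?thesis using eventually_gt_at_top[of 0]
  proof eventually_elim
   case (elim l)
   show ?case using est[OF elim(2)] elim(1) by simp
  qed
 qed
 then show ?thesis unfolding tendsto_iff dist_norm by blast
qed

section \<open>Formal expansions of bounded solutions\<close>

text \<open>Coefficients of the formal solution, the sum of b_s / u^(2 s + 2), of y'' - u^2 f y = p,
  found by comparing powers of u. The choice f = z^2 - 1, p = z^R gives \<open>G_coeff\<close>; f =
  z, p = 1 gives the divergent series of the Scorer function.\<close>

fun bc :: "(complex => complex) => (complex => complex) => nat => complex => complex" where
 "bc f p 0 = (%z. - (p z) / f z)"
| "bc f p (Suc s) = (%z. (deriv ^^ 2) (bc f p s) z / f z)"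

lemma bc_holomorphic:
 assumes "f holomorphic_on S" "p holomorphic_on S" "open S" "\<And>z. z \<in> S ==> f z \<noteq> 0"
 shows "bc f p s holomorphic_on S"
proof (induction s)
 case 0
 show ?case unfolding bc.simps by (intro holomorphic_intros assms)
next
 case (Suc s)
 show ?case unfolding bc.simps by (intro holomorphic_intros assms Suc)
qed

lemma deriv2_sum:
 assumes "finite A" "\<And>s. s \<in> A ==> g s holomorphic_on S" "open S" "z \<in> S"
 shows "(deriv ^^ 2) (%z. \<Sum>s\<in>A. g s z * c s) z = (\<Sum>s\<in>A. (deriv ^^ 2) (g s) z * c s)"
 using assms
proof (induction A rule: finite_induct)
 case (insert x A)
 have hx: "g x holomorphic_on S" and hA: "\<And>s. s \<in> A ==> g s holomorphic_on S" using insert by auto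
 let ?a = "deriv ^^ 2"
 have "?a (%z. \<Sum>s\<in>insert x A. g s z * c s) z = ?a (%z. c x * g x z + (\<Sum>s\<in>A. g s z * c s)) z"
  using insert by (simp add: mult.commute)
 also have "\<dots> = ?a (%z. c x * g x z) z + ?a (%z. \<Sum>s\<in>A. g s z * c s) z"
  by (rule higher_deriv_add[of _ S]) (use insert in "auto intro!: holomorphic_intros")
 also have "?a (%z. c x * g x z) z = c x * ?a (g x) z" by (rule higher_deriv_cmult[OF hx]) (use insert in auto)
 finally show ?case using insert by simp
qed (simp add: deriv2_alt)

text \<open>A solution that is merely bounded has the formal expansion: \<open>w'' = O(1)\<close> by Cauchy's estimate, so
 \<open>w = (w'' - p) / (u^2 f)\<close> determines \<open>w\<close> up to \<open>O(1/u^2)\<close>, and this can be iterated.\<close>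

lemma bootstrap_aux:
 assumes f: "f holomorphic_on ball z0 r" and p: "p holomorphic_on ball z0 r" and r: "r > 0"
  and f0: "\<And>z. z \<in> ball z0 r ==> f z \<noteq> 0"
  and y: "\<forall>\<^sub>F u in at_top. ode2 (%z. of_real (u^2) * f z) (ball z0 r) p (y u)"
  and bnd: "\<forall>\<^sub>F u in at_top. \<forall>z\<in>ball z0 r. norm (y u z) \<le> C"
 shows "\<exists>K. \<forall>\<^sub>F u in at_top. \<forall>z\<in>ball z0 (r / 2 ^ N).
  norm (y u z - (\<Sum>s<N. bc f p s z / of_real u ^ (2 * s + 2))) \<le> K / u ^ (2 * N)"
proof (induction N)
 case 0
 then show ?case using bnd by auto
next
 case (Suc N)
 then obtain K where K: "\<forall>\<^sub>F u in at_top. \<forall>z\<in>ball z0 (r / 2 ^ N).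
  norm (y u z - (\<Sum>s<N. bc f p s z / of_real u ^ (2 * s + 2))) \<le> K / u ^ (2 * N)" by auto
 define \<rho> where "\<rho> = r / 2 ^ N"
 have rho: "\<rho> > 0" "\<rho> \<le> r" using r by (auto simp: \<rho>_def field_simps)
 let ?f = "cball z0 (r / 2)"
 have "continuous_on ?f f" by (rule continuous_on_subset[OF holomorphic_on_imp_continuous_on[OF f]]) (use r in auto)
 then have "continuous_on ?f (%z. inverse (f z))" by (intro continuous_intros) (use f0 r in auto)
 then have "bounded ((%z. inverse (f z)) ` ?f)" by (intro compact_imp_bounded compact_continuous_image) auto
 then obtain M where "\<forall>x\<in>(%z. inverse (f z)) ` ?f. norm x \<le> M" unfolding bounded_iff by blast
 then have M: "norm (inverse (f z)) \<le> M" if "z \<in> ?f" for z using that by simp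
 have bch: "bc f p s holomorphic_on ball z0 r" for s by (rule bc_holomorphic[OF f p open_ball f0])
 let ?p = "\<rho> / 4"
 define K' where "K' = (2 * K / ?p^2) * M"
 let ?b = "%s z u. \<Sum>s<Suc N. bc f p s z / of_real u ^ (2 * s + 2)"
 let ?k = "%u z. norm (y u z - (?b s z u)) \<le> K' / u ^ (2 * Suc N)"
 have "\<forall>\<^sub>F u in at_top. \<forall>z\<in>ball z0 (r / 2 ^ Suc N).
  ?k u z"
  using K y eventually_gt_at_top[of 0]
 proof eventually_elim
  case (elim u)
  let ?e = "%s. 1 / of_real u ^ (2 * s + 2)"
  define v where "v = (%z. y u z - (\<Sum>s<N. bc f p s z * ?e s))"
  have yh: "y u holomorphic_on ball z0 r" using elim(2) by (rule ode2_holo)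
  have vh: "v holomorphic_on ball z0 r" unfolding v_def by (intro holomorphic_intros yh bch)
  show ?case
  proof
   fix z assume z: "z \<in> ball z0 (r / 2 ^ Suc N)"
   then have z2: "dist z0 z < \<rho> / 2" by (simp add: \<rho>_def)
   have zr: "z \<in> ball z0 r" using z2 rho by simp
   let ?q = "ball z0 \<rho>"
   have sub: "cball z ?p \<subseteq> ?q"
   proof
    fix x assume "x \<in> cball z ?p"
    then show "x \<in> ?q" using z2 dist_triangle[of z0 x z] rho by simp
   qed
   have subr: "?q \<subseteq> ball z0 r" using rho by auto
   let ?h = "fact 2 * (K / u ^ (2 * N)) / ?p ^ 2"
   let ?l = "deriv ^^ 2"
   \<comment> \<open>Circles of radius \<rho>/4 around points of the half-size ball stay where the
     previous estimate holds; this is why the radius is halved in each round.\<close>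
   have d2: "norm (?l v z) \<le> ?h"
   proof (rule Cauchy_inequality)
    show "v holomorphic_on ball z ?p" by (rule holomorphic_on_subset[OF vh]) (use sub subr ball_subset_cball in blast)
    show "continuous_on (cball z ?p) v" by (rule continuous_on_subset[OF holomorphic_on_imp_continuous_on[OF vh]]) (use sub subr in blast)
    fix x assume "norm (z - x) = \<rho> / 4"
    then have "x \<in> ?q" using sub by (auto simp: dist_norm)
    then show "norm (v x) \<le> K / u ^ (2 * N)" using elim(1) by (auto simp: v_def \<rho>_def)
   qed (use rho in auto)
   let ?a = "\<Sum>s<N. ?l (bc f p s) z * ?e s"
   have dv: "?l v z = ?l (y u) z - ?a"
   proof -
    let ?g = "%z. \<Sum>s<N. bc f p s z * ?e s"
    have "?l v z = ?l (y u) z - ?l ?g z"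
     unfolding v_def by (rule higher_deriv_diff[of _ "ball z0 r"]) (intro yh holomorphic_intros bch open_ball zr)+
    also have "?l ?g z = ?a" by (rule deriv2_sum[OF _ bch open_ball zr]) simp
    finally show ?thesis .
   qed
   have u0: "of_real u \<noteq> 0" using elim by simp
   let ?d = "of_real (u^2)"
   \<comment> \<open>Solving the equation for y, the terms b_s'' / f of the known part become the
     coefficients with index s + 1, and v'' / (u^2 f) is left as error.\<close>
   have eq: "y u z - (?b s z u) = ?l v z * inverse (f z) / ?d"
   proof -
    have "?d * f z * y u z = ?l (y u) z - p z" using elim(2) zr by (simp add: ode2_def algebra_simps)
    moreover have nz: "?d * f z \<noteq> 0" using u0 f0[OF zr] by simp
    ultimately have "y u z = (?l (y u) z - p z) / (?d * f z)" by (simp add: eq_divide_eq mult.commute)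
    also have "?l (y u) z = ?l v z + ?a" using dv by simp
    also have "(\<dots> - p z) / (?d * f z) = ?l v z * inverse (f z) / ?d + (?a / (?d * f z) + - (p z) / f z / ?d)"
     using nz by (simp add: field_simps)
    also have "?a / (?d * f z) = (\<Sum>s<N. bc f p (Suc s) z / of_real u ^ (2 * Suc s + 2))" unfolding sum_divide_distrib
      by (rule sum.cong[OF refl]) (use in "simp add: field_simps power2_eq_square")
    also have "\<dots> + - (p z) / f z / ?d = (?b s z u)" unfolding sum.lessThan_Suc_shift by (simp add: power2_eq_square)
    finally show ?thesis by simp
   qed
   have "norm (y u z - (?b s z u)) = norm (?l v z) * norm (inverse (f z)) / u^2" unfolding eq by (simp add: norm_mult norm_divide norm_power)
   also have "\<dots> \<le> ?h * M / u^2"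
   proof (intro divide_right_mono mult_mono d2 M)
    have "r / 2 ^ Suc N \<le> r / 2" using r by (simp add: field_simps)
    then show "z \<in> ?f" using z by simp
    show "0 \<le> ?h" using order_trans[OF norm_ge_zero d2] .
   qed auto
   also have "\<dots> = K' / u ^ (2 * Suc N)" by (simp add: K'_def field_simps power2_eq_square)
   finally show "?k u z" .
  qed
 qed
 then show ?case by auto
qed

lemma norm_divide_of_real_power:
 "u > 0 ==> norm (x / complex_of_real u ^ k) = norm x / u ^ k"
 by (simp add: norm_divide norm_power)

text \<open>One iteration beyond the terms kept: the last term is bounded on a smaller closed ball
  and is absorbed, so the error has the order of the first omitted term.\<close>

lemma bootstrap:
 assumes f: "f holomorphic_on ball z0 r" and p: "p holomorphic_on ball z0 r" and r: "r > 0"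
  and f0: "\<And>z. z \<in> ball z0 r ==> f z \<noteq> 0"
  and y: "\<forall>\<^sub>F u in at_top. ode2 (%z. of_real (u^2) * f z) (ball z0 r) p (y u)"
  and bnd: "\<forall>\<^sub>F u in at_top. \<forall>z\<in>ball z0 r. norm (y u z) \<le> C"
 shows "\<exists>\<rho>>0. \<rho> \<le> r \<and> (\<exists>K. \<forall>\<^sub>F u in at_top. \<forall>z\<in>ball z0 \<rho>.
  norm (y u z - (\<Sum>s<N. bc f p s z / of_real u ^ (2 * s + 2))) \<le> K / u ^ (2 * N + 2))"
proof -
 let ?b = "%u z. y u z - (\<Sum>s<Suc N. bc f p s z / of_real u ^ (2 * s + 2))"
 let ?e = "ball z0 (r / 2 ^ Suc N)"
 obtain K where K: "\<forall>\<^sub>F u in at_top. \<forall>z\<in>?e.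
  norm (?b u z) \<le> K / u ^ (2 * Suc N)"
  using bootstrap_aux[OF assms, of "Suc N"] by auto
 have h: "bc f p N holomorphic_on ball z0 r" by (rule bc_holomorphic[OF f p open_ball f0])
 have rr: "r / 2 ^ Suc N \<le> r / 2" "r / 2 ^ Suc N > 0" "r / 2 < r" using r by (auto simp: field_simps)
 have "bounded (bc f p N ` cball z0 (r / 2))"
  by (intro compact_imp_bounded compact_continuous_image holomorphic_on_imp_continuous_on holomorphic_on_subset[OF h]) (use r in auto)
 then obtain M where M: "\<forall>x\<in>bc f p N ` cball z0 (r / 2). norm x \<le> M" unfolding bounded_iff by blast
 let ?a = "%u z. norm (y u z - (\<Sum>s<N. bc f p s z / of_real u ^ (2 * s + 2)))"
 let ?f = "2 * N + 2"
 have "\<forall>\<^sub>F u in at_top. \<forall>z\<in>?e.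
  ?a u z \<le> (K + M) / u ^ ?f"
  using K eventually_gt_at_top[of 0]
 proof eventually_elim
  case (elim u)
  show ?case
  proof
   fix z assume z: "z \<in> ?e"
   then have M': "norm (bc f p N z) \<le> M" using rr M by auto
   have "?a u z =
    norm ((?b u z) + bc f p N z / of_real u ^ ?f)"
    by simp
   also have "\<dots> \<le> K / u ^ ?f + M / u ^ ?f"
   proof (rule norm_triangle_mono)
    show "norm (?b u z) \<le> K / u ^ ?f" using elim(1) z by simp
    let ?d = "norm (bc f p N z / of_real u ^ ?f)"
    have "?d = norm (bc f p N z) / u ^ ?f" by (rule norm_divide_of_real_power[OF elim(2)])
    then show "?d \<le> M / u ^ ?f" using M' elim(2) by (simp only: divide_right_mono zero_le_power)
   qed
   finally show "?a u z \<le> (K + M) / u ^ ?f" by (simp add: add_divide_distrib)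
  qed
 qed
 moreover have "r / 2 ^ Suc N \<le> r" using rr by simp
 ultimately show ?thesis using rr(2) by auto
qed

text \<open>Cauchy's estimate on circles of radius \<rho>/4 carries the error over to the
  derivative; the expansion of the derivative of the Scorer function is obtained in this
  way.\<close>

lemma bootstrap_deriv:
 assumes f: "f holomorphic_on ball z0 r" and p: "p holomorphic_on ball z0 r" and r: "r > 0"
  and f0: "\<And>z. z \<in> ball z0 r ==> f z \<noteq> 0"
  and y: "\<forall>\<^sub>F u in at_top. ode2 (%z. of_real (u^2) * f z) (ball z0 r) p (y u)"
  and bnd: "\<forall>\<^sub>F u in at_top. \<forall>z\<in>ball z0 r. norm (y u z) \<le> C"
 shows "\<exists>\<rho>>0. \<rho> \<le> r \<and> (\<exists>K. \<forall>\<^sub>F u in at_top. \<forall>z\<in>ball z0 \<rho>.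
  norm (y u z - (\<Sum>s<N. bc f p s z / of_real u ^ (2 * s + 2))) \<le> K / u ^ (2 * N + 2) \<and>
  norm (deriv (y u) z - (\<Sum>s<N. deriv (bc f p s) z / of_real u ^ (2 * s + 2))) \<le> K / u ^ (2 * N + 2))"
proof -
 let ?g = "%u z. y u z - (\<Sum>s<N. bc f p s z / of_real u ^ (2 * s + 2))"
 let ?d = "%u z. norm (?g u z)"
 let ?h = "%u. u ^ (2 * N + 2)"
 obtain \<rho> K where rho: "\<rho> > 0" "\<rho> \<le> r" and K: "\<forall>\<^sub>F u in at_top. \<forall>z\<in>ball z0 \<rho>.
  ?d u z \<le> K / ?h u"
  using bootstrap[OF assms, of N] by auto
 have bch: "bc f p s holomorphic_on ball z0 r" for s by (rule bc_holomorphic[OF f p open_ball f0])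
 let ?a = "%s z u. \<Sum>s<N. deriv (bc f p s) z / of_real u ^ (2 * s + 2)"
 let ?k = "\<rho> / 4"
 let ?b = "max K (K / ?k)"
 let ?e = "%u. ?b / ?h u"
 let ?f = "%u z. deriv (y u) z - (?a s z u)"
 have "\<forall>\<^sub>F u in at_top. \<forall>z\<in>ball z0 (\<rho> / 2).
  ?d u z \<le> ?e u \<and>
  norm (?f u z) \<le> ?e u"
  using K y eventually_gt_at_top[of 0]
 proof eventually_elim
  case (elim u)
  define v where "v = (%z. ?g u z)"
  have yh: "y u holomorphic_on ball z0 r" using elim(2) by (rule ode2_holo)
  have vh: "v holomorphic_on ball z0 r" unfolding v_def by (intro holomorphic_intros yh bch) (use elim in simp)
  show ?case
  proof
   fix z assume z: "z \<in> ball z0 (\<rho> / 2)"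
   then have z2: "dist z0 z < \<rho> / 2" by simp
   have zr: "z \<in> ball z0 r" using z2 rho by simp
   have sub: "cball z ?k \<subseteq> ball z0 \<rho>"
   proof
    fix x assume "x \<in> cball z ?k"
    then show "x \<in> ball z0 \<rho>" using z2 dist_triangle[of z0 x z] rho by simp
   qed
   have subr: "ball z0 \<rho> \<subseteq> ball z0 r" using rho by auto
   have d1: "norm ((deriv ^^ 1) v z) \<le> fact 1 * (K / ?h u) / ?k ^ 1"
   proof (rule Cauchy_inequality)
    show "v holomorphic_on ball z ?k" by (rule holomorphic_on_subset[OF vh]) (use sub subr ball_subset_cball in blast)
    show "continuous_on (cball z ?k) v" by (rule continuous_on_subset[OF holomorphic_on_imp_continuous_on[OF vh]]) (use sub subr in blast)
    fix x assume "norm (z - x) = \<rho> / 4"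
    then show "norm (v x) \<le> K / ?h u" using sub elim(1) by (auto simp: dist_norm v_def)
   qed (use rho in auto)
   have D: "(g has_field_derivative deriv g z) (at z)" if "g holomorphic_on ball z0 r" for g using holomorphic_derivI[OF that open_ball zr] .
   have "(v has_field_derivative (?f u z)) (at z)" unfolding v_def by (intro DERIV_diff DERIV_sum DERIV_cdivide D yh bch)
   then have dv: "deriv v z = ?f u z" by (rule DERIV_imp_deriv)
   have "norm (deriv v z) \<le> (K / ?k) / ?h u" using d1 by (simp add: mult_ac)
   also have "\<dots> \<le> ?e u" using elim(3) by (intro divide_right_mono) auto
   finally have 1: "norm (deriv v z) \<le> ?e u" .
   have "norm (v z) \<le> K / ?h u" using elim(1) z2 rho by (auto simp: v_def)
   also have "\<dots> \<le> ?e u" using elim(3) by (intro divide_right_mono) auto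
   finally show "?d u z \<le> ?e u \<and>
    norm (?f u z) \<le> ?e u"
    using 1 unfolding dv by (simp add: v_def)
  qed
 qed
 moreover have "\<rho> / 2 > 0" "\<rho> / 2 \<le> r" using rho by auto
 ultimately show ?thesis by (intro exI[of _ "\<rho> / 2"] conjI exI[of _ "?b"])
qed

text \<open>Beyond t = 1 + 3 K / c the cubic term outweighs the linear one; before it the linear
  term alone is at most the bound.\<close>

lemma cubic_bound:
 fixes K c t :: real
 assumes "K \<ge> 0" "c > 0" "t \<ge> 0"
 shows "K * t - c * t ^ 3 / 3 \<le> K * (1 + 3 * K / c)"
proof (cases "t \<le> 1 + 3 * K / c")
 case True
 then have "K * t \<le> K * (1 + 3 * K / c)" using assms by (intro mult_left_mono)
 moreover have "c * t ^ 3 / 3 \<ge> 0" using assms by simp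
 ultimately show ?thesis by simp
next
 case False
 have kc: "3 * K / c \<ge> 0" using assms by simp
 then have t: "t \<ge> 1" "t \<ge> 3 * K / c" using False by auto
 then have "t * t \<ge> 3 * K / c * 1" by (intro mult_mono) auto
 then have "c * (t * t) \<ge> 3 * K" using assms by (simp add: field_simps)
 then have "c * (t * t) * t \<ge> 3 * K * t" using assms by (intro mult_right_mono)
 then have "K * t - c * t ^ 3 / 3 \<le> 0" by (simp add: power3_eq_cube)
 also have "0 \<le> K * (1 + 3 * K / c)" using assms by simp
 finally show ?thesis .
qed

section \<open>The functions of Airy and Scorer\<close>

text \<open>\<open>Hi\<close> without the factor 1 / pi, so that the inhomogeneity in its equation
  is exactly 1.\<close>

definition HI :: "complex => complex" where
 "HI z = integral {0..} (%t::real. exp (- (of_real t ^ 3) / 3 + z * of_real t))"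

lemma Hi_HI: "Hi z = 1 / of_real pi * HI z" by (simp add: Hi_def HI_def)

text \<open>\<open>cubic_bound\<close> with K = M + 1 and c = 1; the extra 1 in K pays for the
  decaying factor exp (- t).\<close>

lemma HI_bound:
 fixes z :: complex
 assumes "norm z \<le> M" "t \<ge> 0"
 shows "norm (exp (- (of_real t ^ 3) / 3 + z * of_real t)) \<le> exp ((M + 1) * (1 + 3 * (M + 1))) * exp (- (1 * t))"
proof -
 have M: "M \<ge> 0" using assms norm_ge_zero order_trans by blast
 have "Re z * t \<le> M * t" using assms complex_Re_le_cmod[of z] by (intro mult_right_mono) auto
 then have "- (t ^ 3) / 3 + Re z * t \<le> (M + 1) * t - 1 * t ^ 3 / 3 - t" by (simp add: algebra_simps)
 also have "\<dots> \<le> (M + 1) * (1 + 3 * (M + 1) / 1) - t" using cubic_bound[of "M + 1" 1 t] M assms by simp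
 finally have "exp (- (t ^ 3) / 3 + Re z * t) \<le> exp ((M + 1) * (1 + 3 * (M + 1)) - t)" by simp
 moreover have "Re (- (of_real t ^ 3) / 3 + z * of_real t) = - (t ^ 3) / 3 + Re z * t" by simp
 moreover have "exp ((M + 1) * (1 + 3 * (M + 1)) - t) = exp ((M + 1) * (1 + 3 * (M + 1))) * exp (- (1 * t))" by (simp add: mult_exp_exp)
 ultimately show ?thesis unfolding norm_exp_eq_Re by (simp only:)
qed

lemma DERIV_exp_linear:
 "((%z::complex. exp (a + z * b)) has_field_derivative b * exp (a + z * b)) (at z)"
 by (rule derivative_eq_intros | simp)+

lemma HI_ode: "ode2 (%z. z) UNIV (%_. 1) HI"
proof -
 let ?a = "%t z. exp (- (of_real t ^ 3) / 3 + z * of_real t)"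
 let ?d = "%t z. of_real t ^ 2 * ?a t z"
 have "ode2 (%z. z) UNIV (%z. 0 - (- exp (- (of_real 0 ^ 3) / 3 + z * of_real 0)))
   (%z. integral {0..} (%t. 1 * ?a t z))"
 \<comment> \<open>The kernel times t^2 - z is the t-derivative of - exp (- t^3 / 3 + z t), whose
   value at t = 0 supplies the inhomogeneity 1.\<close>
 proof (rule ode2_improper[where h' = "%z t. of_real t * ?a t z"
    and h'' = "%z t. ?d t z"
    and \<Phi> = "%z t. - ?a t z"])
  show "((%z. ?a t z) has_field_derivative of_real t * ?a t z) (at z)" for z :: complex and t :: real by (rule DERIV_exp_linear)
  show "((%z. of_real t * ?a t z) has_field_derivative ?d t z) (at z)" for z :: complex and t :: real
   using DERIV_cmult[OF DERIV_exp_linear[of "- (of_real t ^ 3) / 3" "of_real t" z], of "of_real t"]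
   by (simp add: power2_eq_square mult.assoc)
  show "((%t. - ?a t z) has_vector_derivative
    1 * (?d t z - z * ?a t z)) (at t)" for z :: complex and t :: real
  proof -
   have "((%w. - exp (- (w ^ 3) / 3 + z * w)) has_field_derivative
     (?d t z - z * ?a t z)) (at (of_real t))"
   proof -
    let ?e = "%w. - (w ^ 3) / 3 + z * w"
    have "(?e has_field_derivative (- (3 * of_real t ^ 2) / 3 + z)) (at (of_real t))" by (auto intro!: derivative_eq_intros)
    from DERIV_minus[OF DERIV_chain2[where f = exp and g = "?e", OF DERIV_exp this]]
    show ?thesis by (rule DERIV_cong) (simp add: algebra_simps)
   qed
   from has_vector_derivative_real_field[OF this] show ?thesis by simp
  qed
  show "((%t. - ?a t z) \<longlongrightarrow> 0) at_top" for z :: complex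
  proof (rule Lim_null_comparison)
   let ?b = "exp ((norm z + 1) * (1 + 3 * (norm z + 1)))"
   show "\<forall>\<^sub>F t in at_top. norm (- ?a t z) \<le> ?b * exp (- (1 * t))"
    using eventually_ge_at_top[of 0] by eventually_elim (simp only: norm_minus_cancel, rule HI_bound, simp_all)
   have "((%t::real. exp (- t)) \<longlongrightarrow> 0) at_top"
    by (rule filterlim_compose[OF exp_at_bot filterlim_uminus_at_bot_at_top])
   from tendsto_mult[OF tendsto_const[of "?b"] this]
   show "((%t. ?b * exp (- (1 * t))) \<longlongrightarrow> 0) at_top" by simp
  qed
  fix z0 :: complex
  let ?c = "exp ((norm z0 + 1 + 1) * (1 + 3 * (norm z0 + 1 + 1)))"
  show "\<exists>d>0. cball z0 d \<subseteq> UNIV \<and> (\<exists>C. \<exists>\<kappa>>0. \<forall>z\<in>cball z0 d. \<forall>t\<ge>0. norm (1 * ?a t z) \<le> C * exp (- (\<kappa> * t)))"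
  proof (rule exI[of _ 1], intro conjI, simp, simp, rule exI[of _ "?c"],
    rule exI[of _ 1], intro conjI ballI allI impI, simp)
   fix z :: complex and t :: real assume z: "z \<in> cball z0 1" "t \<ge> 0"
   have "norm z \<le> norm z0 + 1" using z norm_triangle_ineq2[of z z0] by (auto simp: dist_norm norm_minus_commute)
   from HI_bound[OF this z(2)] show "norm (1 * ?a t z) \<le> ?c * exp (- (1 * t))" by simp
  qed
 qed (auto intro!: continuous_intros simp: case_prod_unfold)
 then show ?thesis by (simp add: HI_def[abs_def])
qed

text \<open>In the cube of a + b cis \<alpha> the phases 0, \<alpha>, 2 \<alpha>, 3 \<alpha> all
  have cosine at least cos (3 \<alpha>) > 0. So the real part of w^3 is at least cos (3 \<alpha>) (a
  + b)^3 in the whole wedge, and the path may be turned.\<close>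

lemma HI_rotate:
 assumes al: "\<bar>\<alpha>\<bar> < pi / 6"
 shows "HI x = integral {0..} (%t::real. cis \<alpha> * exp (- ((of_real t * cis \<alpha>) ^ 3) / 3 + x * (of_real t * cis \<alpha>)))"
proof -
 define f where "f = (%w::complex. exp (- (w ^ 3) / 3 + x * w))"
 let ?c = "3 * \<alpha>"
 define c where "c = cos ?c"
 have c: "c > 0" "c \<le> 1" unfolding c_def using al by (auto intro!: cos_gt_zero_pi)
 let ?b = "cos (2 * \<alpha>)"
 have cc: "cos \<alpha> \<ge> c" "?b \<ge> c"
 proof -
  have "cos \<bar>?c\<bar> \<le> cos \<bar>\<alpha>\<bar>" "cos \<bar>?c\<bar> \<le> cos \<bar>2 * \<alpha>\<bar>"
   by (rule cos_monotone_0_pi_le; use al in "simp add: ")+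
  then show "cos \<alpha> \<ge> c" "?b \<ge> c" unfolding c_def by (simp_all only: cos_abs_real)
 qed
 let ?d = "norm x + 1"
 let ?a = "exp (?d * (1 + 3 * ?d / c))"
 have "integral {0..} (%t. 1 * f (of_real t * 1)) = integral {0..} (%t. cis \<alpha> * f (of_real t * cis \<alpha>))"
 proof (rule ray_rotation[where \<kappa> = 1 and C = "?a"])
  fix a b :: real assume ab: "a \<ge> 0" "b \<ge> 0"
  let ?w = "of_real a * 1 + of_real b * cis \<alpha>"
  have "?w ^ 3 = of_real (a ^ 3) + of_real (3 * a^2 * b) * cis \<alpha> + of_real (3 * a * b^2) * cis (2 * \<alpha>) + of_real (b ^ 3) * cis ?c"
  proof -
   have "cis (2 * \<alpha>) = cis \<alpha> ^ 2" "cis ?c = cis \<alpha> ^ 3" using Complex.DeMoivre[of \<alpha> 2] Complex.DeMoivre[of \<alpha> 3] by auto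
   then show ?thesis by (simp add: power3_eq_cube power2_eq_square algebra_simps)
  qed
  then have re: "Re (?w ^ 3) = a ^ 3 + 3 * a^2 * b * cos \<alpha> + 3 * a * b^2 * ?b + b ^ 3 * cos ?c" by simp
  have "c * (a + b) ^ 3 = a ^ 3 * c + 3 * a^2 * b * c + 3 * a * b^2 * c + b ^ 3 * c" by (simp add: power3_eq_cube power2_eq_square algebra_simps)
  also have "\<dots> \<le> a ^ 3 * 1 + 3 * a^2 * b * cos \<alpha> + 3 * a * b^2 * ?b + b ^ 3 * c"
   by (intro add_mono mult_left_mono cc c) (use ab in auto)
  finally have re3: "c * (a + b) ^ 3 \<le> Re (?w ^ 3)" unfolding re c_def by simp
  have nw: "norm ?w \<le> a + b" by (rule norm_triangle_le) (use ab in "simp add: norm_mult")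
  have "Re (x * ?w) \<le> norm x * (a + b)" by (rule order_trans[OF complex_Re_le_cmod]) (simp only: norm_mult, intro mult_left_mono nw, simp)
  then have "- Re (?w ^ 3) / 3 + Re (x * ?w) \<le> ?d * (a + b) - c * (a + b) ^ 3 / 3 - (a + b)" using re3 by (simp add: algebra_simps)
  also have "\<dots> \<le> ?d * (1 + 3 * ?d / c) - (a + b)" using cubic_bound[of "norm x + 1" c "a + b"] c ab by simp
  finally have "exp (- Re (?w ^ 3) / 3 + Re (x * ?w)) \<le> ?a * exp (- (1 * (a + b)))" by (simp add: mult_exp_exp)
  moreover have "norm (f ?w) = exp (- Re (?w ^ 3) / 3 + Re (x * ?w))" unfolding f_def by simp
  ultimately show "norm (f ?w) \<le> ?a * exp (- (1 * (a + b)))" by simp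
 next
  show "f field_differentiable at w" for w
  proof (rule holomorphic_on_imp_differentiable_at[OF _ open_UNIV UNIV_I])
   show "f holomorphic_on UNIV" unfolding f_def by (intro holomorphic_intros) simp
  qed
 qed (auto simp: f_def intro!: continuous_intros)
 then show ?thesis by (simp add: HI_def f_def)
qed

text \<open>On the turned path the integrand at argument l x is at most exp (l t Re (cis \<alpha>
  x)) in modulus, so one bound serves all dilations l >= 1. As \<alpha> varies this covers the
  sector |arg (- x)| < 2 pi / 3.\<close>

lemma HI_sector_bound:
 assumes al: "\<bar>\<alpha>\<bar> < pi / 6" and x0: "Re (cis \<alpha> * x0) < 0"
 shows "\<exists>r>0. \<exists>C. \<forall>x\<in>ball x0 r. \<forall>l\<ge>1. norm (HI (of_real l * x)) \<le> C"
proof -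
 let ?c = "cis \<alpha>"
 define \<delta> where "\<delta> = - Re (?c * x0) / 2"
 have d: "\<delta> > 0" using x0 by (simp add: \<delta>_def)
 let ?d = "cos (3 * \<alpha>)"
 have c: "?d > 0" using al by (auto intro!: cos_gt_zero_pi)
 have "norm (HI (of_real l * x)) \<le> 1 / \<delta>" if x: "x \<in> ball x0 \<delta>" and l: "l \<ge> 1" for x l
 proof -
  have "Re (?c * (x - x0)) \<le> norm (?c * (x - x0))" by (rule complex_Re_le_cmod)
  also have "\<dots> < \<delta>" using x by (simp add: norm_mult dist_norm norm_minus_commute)
  finally have rx: "Re (?c * x) \<le> - \<delta>" unfolding right_diff_distrib minus_complex.sel \<delta>_def by linarith
  let ?b = "l * Re (?c * x)"
  have "?b \<le> 1 * Re (?c * x)" using rx d l by simp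
  then have rl: "?b \<le> - \<delta>" using rx by simp
  let ?a = "%t. of_real t * ?c"
  have b: "norm (?c * exp (- (?a t ^ 3) / 3 + of_real l * x * ?a t)) \<le> 1 * exp (- (\<delta> * t))" if t: "t \<ge> 0" for t
  proof -
   have "Re (?a t ^ 3) = t ^ 3 * ?d"
   using Complex.DeMoivre[of \<alpha> 3] by (simp add: power_mult_distrib)
   moreover have "Re (of_real l * x * ?a t) = t * ?b" by (simp add: algebra_simps)
   ultimately have "Re (- (?a t ^ 3) / 3 + of_real l * x * ?a t) = - (t ^ 3 * ?d) / 3 + t * ?b" by simp
   also have "\<dots> \<le> 0 + t * (- \<delta>)" using c t by (intro add_mono mult_left_mono rl) auto
   finally show ?thesis by (simp add: norm_mult mult.commute)
  qed
  show ?thesis unfolding HI_rotate[OF al] by (rule exp_bound_integral(2)[OF _ b d]) (auto intro!: continuous_intros)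
 qed
 then show ?thesis using d by blast
qed

section \<open>Values of the Scorer function at 0\<close>

text \<open>Substituting s = t^3 / 3 directly would produce s^(k/3 - 1), unbounded at 0. Integrating
  by parts first raises the exponent to k/3, so that the substitution rule for continuous integrands
  applies.\<close>

lemma integral_mono_substitution:
 assumes k: "k = 1 \<or> k = 2" and T: "T \<ge> 0"
 shows "of_nat k * integral {0..T} (%t. t ^ (k - 1) * exp (- (t ^ 3) / 3)) =
  T ^ k * exp (- (T ^ 3) / 3) + 3 powr (k / 3) * integral {0..T ^ 3 / 3} (%s::real. s powr (k / 3) * exp (- s))"
proof -
 let ?g = "%t::real. t ^ 3 / 3"
 let ?b = "%s::real. s powr (k / 3) * exp (- s)"
 let ?f = "%t. t^2 *\<^sub>R (?g t powr (k / 3) * exp (- ?g t))"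
 have sub: "(?f has_integral
   integral {?g 0..?g T} ?b) {0..T}"
 proof (rule has_integral_substitution[where c = 0 and d = "?g T"])
  show "?g ` {0..T} \<subseteq> {0..?g T}" by auto
  show "continuous_on {0..?g T} (%s. s powr (k / 3) * exp (- s))"
   by (intro continuous_intros continuous_on_subset[OF continuous_on_powr_const]) (use k in auto)
  show "(?g has_real_derivative x^2) (at x within {0..T})" for x by (auto intro!: derivative_eq_intros)
 qed (use T in auto)
 let ?a = "%t. exp (- (t ^ 3) / 3)"
 let ?d = "%t. t ^ (k + 2) * ?a t"
 let ?k = "3 powr (k / 3)"
 have e: "?f t = (1 / ?k) * ?d t" if "t \<in> {0..T}" for t
 proof (cases "t = 0")
  case False
  then have t: "t > 0" using that by simp
  have "(t ^ 3) powr (k / 3) = (t powr 3) powr (k / 3)" using t by simp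
  also have "\<dots> = t powr k" by (simp only: powr_powr) simp
  also have "\<dots> = t ^ k" using t by (rule powr_realpow)
  finally show ?thesis by (simp add: powr_divide power2_eq_square)
 qed (use k in auto)
 let ?h = "integral {0..T ^ 3 / 3} ?b"
 have s1: "((%t. (1 / ?k) * ?d t) has_integral
   ?h) {0..T}"
  using sub by (subst has_integral_cong[OF e[symmetric]]) auto
 have s2: "(?d has_integral
   ?k * ?h) {0..T}"
  using has_integral_mult_right[OF s1, of "?k"] by simp
 let ?e = "%k t. of_nat k * (t ^ (k - 1) * ?a t)"
 have "((%t. ?e k t - ?d t) has_integral
   (T ^ k * exp (- (T ^ 3) / 3) - 0 ^ k * exp (- (0 ^ 3) / 3))) {0..T}"
 proof (rule fundamental_theorem_of_calculus[OF T])
  fix t assume "t \<in> {0..T}"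
  let ?c = "?e k t - ?d t"
  let ?l = "%t::real. t ^ k * ?a t"
  have "(?l has_real_derivative
   ?c) (at t within {0..T})"
   by (rule derivative_eq_intros | simp add: power2_eq_square)+
  then show "(?l has_vector_derivative
   ?c) (at t within {0..T})"
   unfolding has_real_derivative_iff_has_vector_derivative .
 qed
 from has_integral_add[OF this s2]
 have "((%t. ?e k t) has_integral
   (T ^ k * exp (- (T ^ 3) / 3) + ?k * ?h)) {0..T}"
  using k by auto
 from integral_unique[OF this] show ?thesis by simp
qed

lemma integral_cubic_limit:
 assumes k: "k = 1 \<or> k = 2"
 shows "((%T. integral {0..T} (%t. t ^ (k - 1) * exp (- (t ^ 3) / 3))) \<longlongrightarrow> 3 powr (k / 3) * Gamma (k / 3 + 1) / k) at_top"
proof -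
 have a: "real k / 3 > 0" using k by auto
 let ?G = "%s::real. s powr (k / 3) * exp (- s)"
 have cub: "filterlim (%T::real. T ^ 3 / 3) at_top at_top" by real_asymp
 let ?e = "Gamma (k / 3 + 1)"
 have gs: "((%t. t powr (k / 3) * exp (- (1 * t))) has_integral ?e / 1 powr (k / 3 + 1)) {0..}"
  by (rule Gamma_integral_scaled[OF a]) simp
 let ?b = "%t. complex_of_real (?G t)"
 have "((%N. integral {0..N} (%t. of_real (?G t))) \<longlongrightarrow> integral {0..} ?b) at_top"
 proof (rule improper_tendsto[where c = "1/2"])
  show "continuous_on {0..} ?b" by (intro continuous_intros continuous_on_powr_const a)
  let ?d = "exp (k / 3 * ln (k / 3 / (1/2)) - k / 3)"
  show "norm (complex_of_real (?G t)) \<le> ?d * exp (- (1/2 * t))" if "t \<ge> 0" for t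
  proof -
   have "?G t \<le> (?d * exp (1/2 * t)) * exp (- t)" by (intro mult_right_mono powr_exp_bound a that) auto
   also have "\<dots> = ?d * exp (- (1/2 * t))" by (simp add: mult_exp_exp)
   finally show ?thesis unfolding norm_of_real by simp
  qed
 qed simp
 moreover have "integral {0..} ?b = of_real ?e" using integral_unique[OF has_integral_of_real[OF gs]] by simp
 moreover have "integral {0..N} ?b = of_real (integral {0..N} ?G)" for N
 proof (rule integral_unique, rule has_integral_of_real, rule integrable_integral, rule integrable_continuous_real)
  show "continuous_on {0..N} ?G" by (intro continuous_intros continuous_on_subset[OF continuous_on_powr_const[OF a]]) auto
 qed
 ultimately have "((%N. integral {0..N} ?G) \<longlongrightarrow> ?e) at_top" by (simp add: tendsto_of_real_iff)
 from filterlim_compose[OF this cub]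
 have l1: "((%T. integral {0..T ^ 3 / 3} ?G) \<longlongrightarrow> ?e) at_top" .
 have l2: "((%T::real. T ^ k * exp (- (T ^ 3) / 3)) \<longlongrightarrow> 0) at_top" using k by (elim disjE; simp only:; real_asymp)
 let ?a = "%T. T ^ k * exp (- (T ^ 3) / 3) + 3 powr (k / 3) * integral {0..T ^ 3 / 3} ?G"
 have l3: "((%T. (?a T) / k)
   \<longlongrightarrow> (0 + 3 powr (k / 3) * ?e) / k) at_top"
  by (intro tendsto_intros l1 l2) (use k in auto)
 show ?thesis
 proof (rule Lim_transform_eventually)
  show "((%T. (?a T) / k)
   \<longlongrightarrow> 3 powr (k / 3) * ?e / k) at_top" using l3 by simp
  show "\<forall>\<^sub>F T in at_top. (?a T) / k =
    integral {0..T} (%t. t ^ (k - 1) * exp (- (t ^ 3) / 3))"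
   using eventually_ge_at_top[of 0]
  proof eventually_elim
   case (elim T)
   show ?case unfolding integral_mono_substitution[OF k elim, symmetric] using k by auto
  qed
 qed
qed

lemma HI_0: "HI 0 = of_real (3 powr (1/3) * Gamma (4/3))"
proof -
 have "((%N. integral {0..N} (%t. exp (- (of_real t ^ 3) / 3 + 0 * of_real t))) \<longlongrightarrow> HI 0) at_top"
  unfolding HI_def
  by (rule improper_tendsto[OF _ HI_bound[of 0 0]]) (auto intro!: continuous_intros)
 moreover have "integral {0..N} (%t. exp (- (complex_of_real t ^ 3) / 3 + 0 * of_real t)) = of_real (integral {0..N} (%t. exp (- (t ^ 3) / 3)))" for N
 proof (rule integral_unique)
  have "((%t. exp (- (t ^ 3) / 3)) has_integral integral {0..N} (%t. exp (- (t ^ 3) / 3))) {0..N}"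
   by (intro integrable_integral integrable_continuous_real continuous_intros) auto
  from has_integral_complex_of_real[OF this]
  show "((%t. exp (- (complex_of_real t ^ 3) / 3 + 0 * of_real t)) has_integral of_real (integral {0..N} (%t. exp (- (t ^ 3) / 3)))) {0..N}"
   by (simp add: exp_of_real[symmetric])
 qed
 moreover have "((%N. complex_of_real (integral {0..N} (%t. exp (- (t ^ 3) / 3)))) \<longlongrightarrow> of_real (3 powr (1/3) * Gamma (4/3))) at_top"
  using tendsto_of_real[OF integral_cubic_limit[of 1], where 'a = complex] by simp
 ultimately show ?thesis using tendsto_unique[OF trivial_limit_at_top_linorder] by auto
qed

lemma HI_deriv_0: "deriv HI 0 = of_real (3 powr (2/3) * Gamma (5/3) / 2)"
proof -
 let ?b = "%t z. exp (- (complex_of_real t ^ 3) / 3 + z * of_real t)"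
 have "(%N. integral {0..real N} (%t. 1 * (of_real t * exp (- (of_real t ^ 3) / 3 + 0 * of_real t))))
  \<longlonglongrightarrow> deriv (%z. integral {0..} (%t. 1 * ?b t z)) 0"
 proof (rule improper_deriv[where \<kappa> = 1 and d = 1])
  show "norm (1 * ?b t z) \<le> exp ((1 + 1) * (1 + 3 * (1 + 1))) * exp (- (1 * t))" if "z \<in> ball 0 1" "t \<ge> 0" for z t
   using HI_bound[of z 1 t] that by simp
  show "((%z. ?b t z) has_field_derivative of_real t * exp (- (of_real t ^ 3) / 3 + z * of_real t)) (at z)" for z t
   by (rule DERIV_exp_linear)
 qed (auto intro!: continuous_intros simp: case_prod_unfold)
 then have 1: "(%N. integral {0..real N} (%t. of_real t * exp (- (of_real t ^ 3) / 3))) \<longlonglongrightarrow> deriv HI 0"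
  by (simp add: HI_def[abs_def])
 let ?a = "%t. t * exp (- (t ^ 3) / 3)"
 let ?c = "%t. of_real t * exp (- (complex_of_real t ^ 3) / 3)"
 have 2: "integral {0..N} ?c = of_real (integral {0..N} ?a)" for N
 proof (rule integral_unique)
  have "(?a has_integral integral {0..N} ?a) {0..N}" by (intro integrable_integral integrable_continuous_real continuous_intros) auto
  from has_integral_complex_of_real[OF this]
  show "(?c has_integral of_real (integral {0..N} ?a)) {0..N}" by (simp add: exp_of_real[symmetric])
 qed
 have "((%N. complex_of_real (integral {0..N} ?a)) \<longlongrightarrow> of_real (3 powr (2/3) * Gamma (5/3) / 2)) at_top"
  using tendsto_of_real[OF integral_cubic_limit[of 2], where 'a = complex] by simp
 from filterlim_compose[OF this filterlim_real_sequentially]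
 show ?thesis by (rule LIMSEQ_unique[OF 1[unfolded 2]])
qed

section \<open>Power series and differential equation of Ai\<close>

definition ai_c :: "nat => complex" where
 "ai_c n = of_real (3 powr (- 2 * real n - 2/3)) / (fact n * Gamma (of_nat n + 2/3))"

definition ai_d :: "nat => complex" where
 "ai_d n = of_real (3 powr (- 2 * real n - 4/3)) / (fact n * Gamma (of_nat n + 4/3))"

lemma not_nonpos_Int_aux: "x > 0 ==> complex_of_real x \<notin> \<int>\<^sub>\<le>\<^sub>0"
 by (auto elim!: nonpos_Ints_cases simp: complex_eq_iff)

lemma ai_rec_aux:
 fixes c :: "nat => complex" and b e :: real
 assumes c: "\<And>n. c n = of_real (3 powr (- 2 * real n - e)) / (fact n * Gamma (of_nat n + of_real b))" and b: "b > 0"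
 shows "c n = c (Suc n) * (9 * of_nat (Suc n) * (of_nat n + of_real b))"
proof -
 let ?b = "of_nat n + of_real b"
 have p: "?b = of_real (real n + b)" by simp
 let ?a = "of_nat n + complex_of_real b"
 have nz: "?a \<notin> \<int>\<^sub>\<le>\<^sub>0" unfolding p by (rule not_nonpos_Int_aux) (use b in simp)
 have nz0: "?a \<noteq> 0" using nz by auto
 have G: "Gamma (of_nat (Suc n) + complex_of_real b) = ?b * Gamma ?b" using Gamma_plus1[OF nz] by (simp add: algebra_simps)
 have Gnz: "Gamma ?a \<noteq> 0" using nz by (simp add: Gamma_eq_zero_iff)
 let ?c = "3 powr (- 2 * real (Suc n) - e)"
 have "?c = 3 powr (- 2 * real n - e) * 3 powr (-2)" by (simp add: powr_add[symmetric] algebra_simps)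
 then have P: "?c = 3 powr (- 2 * real n - e) / 9" by (simp add: powr_minus_divide)
 have al: "X / (f * g) = X / 9 / (s * f * (w * g)) * (9 * s * w)" if "f \<noteq> 0" "g \<noteq> 0" "s \<noteq> 0" "w \<noteq> 0" for X f g s w :: complex
  using that by simp
 have sn: "complex_of_nat (Suc n) \<noteq> 0" by (simp del: of_nat_Suc)
 show ?thesis unfolding c G P fact_Suc of_real_divide of_real_numeral
 using al[OF fact_nonzero Gnz sn nz0] by (simp only:)
qed

lemma ai_c_rec: "ai_c n = ai_c (Suc n) * (of_nat (3 * n + 3) * of_nat (3 * n + 2))"
 using ai_rec_aux[of ai_c "2/3" "2/3" n] by (simp add: ai_c_def algebra_simps)

lemma ai_d_rec: "ai_d n = ai_d (Suc n) * (of_nat (3 * n + 4) * of_nat (3 * n + 3))"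
 using ai_rec_aux[of ai_d "4/3" "4/3" n] by (simp add: ai_d_def algebra_simps)

text \<open>Each step divides by at least n + 1, so |c n| <= |c 0| / n! and the exponential series
  dominates.\<close>

lemma summable_rec_aux:
 fixes c :: "nat => complex"
 assumes "\<And>n. \<exists>M\<ge>Suc n. c n = c (Suc n) * of_nat M"
 shows "summable (%n. c n * x ^ n)"
proof -
 let ?a = "%n. norm (c 0) / fact n"
 have b: "norm (c n) \<le> ?a n" for n
 proof (induction n)
  case (Suc n)
  obtain M where M: "M \<ge> Suc n" "c n = c (Suc n) * of_nat M" using assms by auto
  have "norm (c (Suc n)) * Suc n \<le> norm (c (Suc n)) * M" using M by (intro mult_left_mono) auto
  also have "\<dots> = norm (c n)" using M by (simp add: norm_mult)
  also have "\<dots> \<le> ?a n" by (rule Suc)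
  finally have "norm (c (Suc n)) \<le> ?a n / Suc n" by (subst pos_le_divide_eq) auto
  also have "\<dots> = norm (c 0) / fact (Suc n)" by simp
  finally show ?case .
 qed simp
 let ?b = "%n. norm (c 0) * (norm x ^ n /\<^sub>R fact n)"
 have "summable ?b" by (intro summable_mult summable_exp_generic)
 then show ?thesis
 proof (rule summable_comparison_test'[where N = 0])
  fix n
  have "norm (c n * x ^ n) \<le> ?a n * norm x ^ n" unfolding norm_mult norm_power by (intro mult_right_mono b) auto
  then show "norm (c n * x ^ n) \<le> ?b n" by (simp add: field_simps)
 qed
qed

text \<open>The two series of \<open>Ai\<close> interleaved into one power series, to which termwise
  differentiation applies.\<close>

definition ai_e :: "nat => complex" where
 "ai_e k = (if k mod 3 = 0 then ai_c (k div 3) else if k mod 3 = 1 then - ai_d (k div 3) else 0)"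

lemma ai_e_sums: "(%k. ai_e k * z ^ k) sums Ai z"
proof -
 let ?b = "\<Sum>n. ai_c n * z ^ (3 * n)"
 have sc: "(%n. ai_c n * z ^ (3 * n)) sums ?b"
 proof (rule summable_sums)
  have "\<exists>M\<ge>Suc n. ai_c n = ai_c (Suc n) * of_nat M" for n
   by (rule exI[of _ "(3 * n + 3) * (3 * n + 2)"]) (use ai_c_rec[of n] in "simp only: of_nat_mult, simp")
  from summable_rec_aux[of ai_c "z ^ 3", OF this] show "summable (%n. ai_c n * z ^ (3 * n))" by (simp add: power_mult)
 qed
 let ?a = "\<Sum>n. ai_d n * z ^ (3 * n + 1)"
 let ?c = "%n. ai_d n * z ^ (3 * n + 1)"
 have sd: "?c sums ?a"
 proof (rule summable_sums)
  have "\<exists>M\<ge>Suc n. ai_d n = ai_d (Suc n) * of_nat M" for n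
   by (rule exI[of _ "(3 * n + 4) * (3 * n + 3)"]) (use ai_d_rec[of n] in "simp only: , simp add: algebra_simps")
  from summable_mult2[OF summable_rec_aux[of ai_d "z ^ 3", OF this], of z] show "summable ?c"
   by (simp only: power_add power_mult power_one_right mult.assoc)
 qed
 have r0: "k \<in> range (%n::nat. 3 * n) \<longleftrightarrow> k mod 3 = 0" for k by auto
 let ?d = "range (%n::nat. 3 * n + 1)"
 have r1: "k \<in> ?d \<longleftrightarrow> k mod 3 = 1" for k
 proof
  assume "k mod 3 = 1"
  then have "k = 3 * (k div 3) + 1" by presburger
  then show "k \<in> ?d" by simp
 next
  assume "k \<in> ?d"
  then obtain n where "k = 3 * n + 1" by auto
  then show "k mod 3 = 1" by simp
 qed
 have m1: "strict_mono (%n::nat. 3 * n)" "strict_mono (%n::nat. 3 * n + 1)" by (auto simp: strict_mono_def)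
 have "(%k. if k mod 3 = 0 then ai_c (k div 3) * z ^ k else 0) sums ?b"
  using sums_mono_reindex[OF m1(1), of "%k. if k mod 3 = 0 then ai_c (k div 3) * z ^ k else 0"] sc r0 by simp
 moreover have "(%k. if k mod 3 = 1 then ai_d (k div 3) * z ^ k else 0) sums ?a"
 proof -
  have "(%n. if (3 * n + 1) mod 3 = 1 then ai_d ((3 * n + 1) div 3) * z ^ (3 * n + 1) else 0) = ?c"
  proof
   fix n :: nat
   have "(3 * n + 1) mod 3 = 1" "(3 * n + 1) div 3 = n" by auto
   then show "(if (3 * n + 1) mod 3 = 1 then ai_d ((3 * n + 1) div 3) * z ^ (3 * n + 1) else 0) = ai_d n * z ^ (3 * n + 1)" by simp
  qed
  then show ?thesis using sums_mono_reindex[OF m1(2), of "%k. if k mod 3 = 1 then ai_d (k div 3) * z ^ k else 0"] sd r1 by simp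
 qed
 ultimately have "(%k. (if k mod 3 = 0 then ai_c (k div 3) * z ^ k else 0) - (if k mod 3 = 1 then ai_d (k div 3) * z ^ k else 0))
   sums (?b - ?a)"
  by (rule sums_diff)
 moreover have "(%k. (if k mod 3 = 0 then ai_c (k div 3) * z ^ k else 0) - (if k mod 3 = 1 then ai_d (k div 3) * z ^ k else 0)) = (%k. ai_e k * z ^ k)"
  by (auto simp: ai_e_def)
 moreover have "?b - ?a = Ai z" unfolding Ai_def ai_c_def ai_d_def by (simp add: mult.commute)
 ultimately show ?thesis by simp
qed

lemma ai_e_rec: "of_nat (k + 3) * of_nat (k + 2) * ai_e (k + 3) = ai_e k"
proof -
 consider n where "k = 3 * n" | n where "k = 3 * n + 1" | n where "k = 3 * n + 2"
 proof -
  have "k mod 3 = 0 \<or> k mod 3 = 1 \<or> k mod 3 = 2" by auto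
  moreover have "k = 3 * (k div 3) + k mod 3" by simp
  ultimately show ?thesis using that[of "k div 3"] by linarith
 qed
 then show ?thesis
 proof cases
  case 1
  then show ?thesis using ai_c_rec[of n] 1 by (simp add: ai_e_def)
 next
  case 2
  then have "(k + 3) div 3 = Suc n" "k div 3 = n" "(k + 3) mod 3 = 1" "k mod 3 = 1" by auto
  then show ?thesis using ai_d_rec[of n] 2 by (simp add: ai_e_def add_ac)
 next
  case 3
  then have "(k + 3) mod 3 = 2" "k mod 3 = 2" by presburger+
  then show ?thesis by (simp add: ai_e_def)
 qed
qed

lemma Ai_powser: "Ai z = (\<Sum>k. ai_e k * z ^ k)" using sums_unique[OF ai_e_sums] .

lemma Ai_derivs:
 shows "(Ai has_field_derivative (\<Sum>k. diffs ai_e k * z ^ k)) (at z)"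
  and "((%z. \<Sum>k. diffs ai_e k * z ^ k) has_field_derivative z * Ai z) (at z)"
proof -
 have s: "summable (%k. ai_e k * z ^ k)" for z using ai_e_sums sums_summable by auto
 have s1: "summable (%k. diffs ai_e k * z ^ k)" for z by (rule termdiff_converges_all[OF s])
 show "(Ai has_field_derivative (\<Sum>k. diffs ai_e k * z ^ k)) (at z)"
  unfolding Ai_powser[abs_def] by (rule termdiffs_strong_converges_everywhere[OF s])
 let ?a = "diffs (diffs ai_e)"
 let ?b = "%z. \<Sum>k. diffs ai_e k * z ^ k"
 have "(?b has_field_derivative (\<Sum>k. ?a k * z ^ k)) (at z)" by (rule termdiffs_strong_converges_everywhere[OF s1])
 moreover have "(\<Sum>k. ?a k * z ^ k) = z * Ai z"
 proof (rule sums_unique[symmetric])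
  have "?a (Suc k) = ai_e k" for k using ai_e_rec[of k] by (simp add: diffs_def numeral_3_eq_3 mult_ac)
  then have "(%k. ?a (Suc k) * z ^ Suc k) sums (z * Ai z)" using sums_mult[OF ai_e_sums, of z z] by (simp add: mult_ac)
  moreover have "?a 0 = 0" by (simp add: diffs_def ai_e_def)
  ultimately show "(%k. ?a k * z ^ k) sums (z * Ai z)" by (subst (asm) sums_Suc_iff) simp
 qed
 ultimately show "(?b has_field_derivative z * Ai z) (at z)" by simp
qed

lemma Ai_ode: "ode2 (%z. z) UNIV (%_. 0) Ai" by (rule ode2I[OF open_UNIV Ai_derivs]) simp

lemma Ai_0: "Ai 0 = ai_c 0" and Ai_deriv_0: "deriv Ai 0 = - ai_d 0"
unfolding Ai_powser DERIV_imp_deriv[OF Ai_derivs(1)] by (auto simp: ai_e_def diffs_def)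

lemma Gamma_third: "Gamma (1/3) * Gamma (2/3 :: complex) = 2 * of_real (pi / sqrt 3)"
proof -
 have "Gamma (1/3) * Gamma (1 - 1/3 :: complex) = of_real pi / sin (of_real pi * (1/3))" by (rule Gamma_reflection_complex)
 also have "of_real pi * (1/3) = complex_of_real (pi / 3)" by simp
 also have "sin (of_real (pi / 3)) = of_real (sqrt 3 / 2)" by (simp only: sin_of_real sin_60)
 finally show ?thesis by simp
qed

text \<open>The reflection formula Gamma (1/3) Gamma (2/3) = 2 pi / sqrt 3 converts the Gamma values
  of one function into those of the other. The signs differ because Ai has negative derivative at
  0.\<close>

lemma Hi_Ai_0: "HI 0 = of_real (2 * pi / sqrt 3) * Ai 0"
 and Hi_Ai_deriv_0: "deriv HI 0 = - of_real (2 * pi / sqrt 3) * deriv Ai 0"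
proof -
 let ?b = "3 :: complex"
 let ?c = "Gamma (1/3)"
 have G1: "complex_of_real (Gamma (4/3)) = ?c / 3"
  using Gamma_plus1[of "1/?b"] not_nonpos_Int_aux[of "1/3"] by (simp flip: Gamma_complex_of_real add: field_simps)
 have G2: "complex_of_real (Gamma (5/3)) = Gamma (2/3) * 2 / 3"
  using Gamma_plus1[of "2/?b"] not_nonpos_Int_aux[of "2/3"] by (simp flip: Gamma_complex_of_real add: field_simps)
 have nz: "Gamma (2/?b) \<noteq> 0" "Gamma (1/?b) \<noteq> 0"
  using not_nonpos_Int_aux[of "2/3"] not_nonpos_Int_aux[of "1/3"] by (simp_all add: Gamma_eq_zero_iff)
 let ?a = "of_real (2 * pi / sqrt 3)"
 have T: "?c = ?a / Gamma (2/?b)" "Gamma (2/3) = ?a / Gamma (1/?b)" using Gamma_third nz by (simp_all add: field_simps)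
 have P1: "3 powr (1/3) / 3 = (3::real) powr (- (2/3))" and P2: "3 powr (2/3) / 3 = (3::real) powr (- (1/3))"
  and P3: "(3::real) powr (- (4/3)) * 3 = 3 powr (- (1/3))"
  using powr_diff[of "3::real" "1/3" 1] powr_diff[of "3::real" "2/3" 1] powr_add[of "3::real" "-(4/3)" 1] by auto
 have "HI 0 = of_real (3 powr (1/3) / 3) * ?c" unfolding HI_0 by (simp add: G1)
 also have "\<dots> = ?a * (of_real (3 powr (- (2/3))) / Gamma (2/3))" unfolding P1 T(1) by simp
 also have "of_real (3 powr (- (2/3))) / Gamma (2/3) = Ai 0" unfolding Ai_0 ai_c_def by simp
 finally show "HI 0 = ?a * Ai 0" .
 have G43: "Gamma (4/?b) = ?c / 3" using G1 by (simp flip: Gamma_complex_of_real)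
 have "deriv HI 0 = of_real (3 powr (2/3) / 3) * Gamma (2/3)" unfolding HI_deriv_0 by (simp add: G2)
 also have "\<dots> = ?a * (of_real (3 powr (- (4/3)) * 3) / ?c)" unfolding P2 P3 T(2) by simp
 also have "of_real (3 powr (- (4/3)) * 3) / ?c = ai_d 0" unfolding ai_d_def by (simp add: G43)
 finally show "deriv HI 0 = - ?a * deriv Ai 0" unfolding Ai_deriv_0 by simp
qed

text \<open>Both sides solve \<open>y'' = x y\<close> with equal initial values at \<open>0\<close>, for every cube root of unity.\<close>

lemma HI_connection:
 assumes om: "\<omega> ^ 3 = 1"
 shows "HI x - \<omega> * HI (\<omega> * x) = of_real (2 * pi / sqrt 3) * (1 - \<omega>) * Ai (\<omega>^2 * x)"
proof -
 define K where "K = complex_of_real (2 * pi / sqrt 3)"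
 let ?c = "\<omega>^2"
 let ?d = "K * (1 - \<omega>)"
 define D where "D = (%x. (HI x - \<omega> * HI (\<omega> * x)) - ?d * Ai (?c * x))"
 have o: "?c * \<omega> = 1" "\<omega> * ?c = 1" "?c^2 * ?c = 1" using om by (auto simp: power2_eq_square power3_eq_cube mult_ac)
 let ?f = "%z. HI (\<omega> * z)"
 have "ode2 (%z. ?c * (\<omega> * z)) UNIV (%z. ?c * 1) ?f" by (rule ode2_chain_linear[OF HI_ode]) auto
 then have h1: "ode2 (%z. z) UNIV (%z. ?c) ?f" using o by (simp add: mult.assoc[symmetric])
 have h2: "ode2 (%z. z) UNIV (%z. 1 - \<omega> * ?c) (%z. HI z - \<omega> * HI (\<omega> * z))"
  by (intro ode2_diff ode2_cmult HI_ode h1 open_UNIV)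
 let ?b = "%z. Ai (?c * z)"
 have "ode2 (%z. ?c^2 * (?c * z)) UNIV (%z. ?c^2 * 0) ?b" by (rule ode2_chain_linear[OF Ai_ode]) auto
 then have a1: "ode2 (%z. z) UNIV (%z. 0) ?b" unfolding mult.assoc[symmetric] o by simp
 have "ode2 (%z. z) UNIV (%z. (1 - \<omega> * ?c) - ?d * 0) D" unfolding D_def by (intro ode2_diff ode2_cmult h2 a1 open_UNIV)
 then have D: "ode2 (%z. z) UNIV (%z. 0) D" unfolding o by simp
 let ?e = "HI has_field_derivative deriv HI 0"
 have H': "?e (at (\<omega> * 0))" "?e (at 0)"
  "(Ai has_field_derivative deriv Ai 0) (at (?c * 0))"
  using ode2_derivs(1)[OF HI_ode open_UNIV, of 0] ode2_derivs(1)[OF Ai_ode open_UNIV, of 0] by auto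
 have L: "((%x. c * x) has_field_derivative c) (at 0)" for c :: complex by simp
 let ?a = "deriv HI 0 - \<omega> * (deriv HI 0 * \<omega>)"
 have "(D has_field_derivative ?a - ?d * (deriv Ai 0 * ?c)) (at 0)" unfolding D_def
  by (intro DERIV_diff DERIV_cmult H'(2) DERIV_chain2[where g = "%x. \<omega> * x", OF H'(1) L] DERIV_chain2[where g = "%x. ?c * x", OF H'(3) L])
 then have "deriv D 0 = ?a - ?d * (deriv Ai 0 * ?c)" by (rule DERIV_imp_deriv)
 also have "\<dots> = - K * deriv Ai 0 * (1 - ?c * \<omega>)"
  unfolding Hi_Ai_deriv_0 K_def[symmetric] by (simp add: algebra_simps power2_eq_square)
 finally have D1: "deriv D 0 = 0" unfolding o by simp
 have D0: "D 0 = 0" unfolding D_def mult_zero_right Hi_Ai_0 K_def[symmetric] by (simp add: algebra_simps)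
 have "D x = 0" by (rule ode2_unique[OF D open_UNIV connected_UNIV holomorphic_on_ident UNIV_I D0 D1 UNIV_I])
 then show ?thesis by (simp add: D_def K_def)
qed

section \<open>The functions Wi and their differences\<close>

definition om :: complex where "om = exp (2 * pi * \<i> / 3)"

lemma om_alt: "om = Complex (- (1/2)) (sqrt 3 / 2)"
proof -
 have "om = cis (2 * pi / 3)" by (simp add: om_def cis_conv_exp mult_ac)
 then show ?thesis by (simp add: complex_eq_iff cos_120 sin_120)
qed

lemma om_pow: "om ^ 3 = 1" "om^2 = exp (- 2 * pi * \<i> / 3)" "(om^2)^3 = 1"
proof -
 have "om ^ 3 = exp (of_nat 3 * (2 * pi * \<i> / 3))" unfolding om_def by (rule exp_of_nat_mult[symmetric])
 also have "of_nat 3 * (2 * pi * \<i> / 3) = 2 * of_real pi * \<i>" by simp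
 also have "exp \<dots> = 1" by simp
 finally show 1: "om ^ 3 = 1" .
 let ?a = "2 * pi * \<i> / 3 + 2 * pi * \<i> / 3"
 have "om^2 = exp ?a" unfolding om_def power2_eq_square by (rule exp_add[symmetric])
 also have "?a = 2 * of_real pi * \<i> + (- 2 * pi * \<i> / 3)" by simp
 also have "exp \<dots> = exp (- 2 * pi * \<i> / 3)" by (subst exp_add) simp
 finally show "om^2 = exp (- 2 * pi * \<i> / 3)" .
 have "(om^2)^3 = (om ^ 3)^2" by simp
 then show "(om^2)^3 = 1" unfolding 1 by simp
qed

definition wom :: "int => int => complex" where
 "wom j k = (if (j, k) = (-1, 1) then 1 else if (j, k) = (0, 1) then om else om\<^sup>2)"

lemma wom_cube: "wom j k ^ 3 = 1" using om_pow by (simp add: wom_def)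

lemma Wi_HI: "Wi j k = (%x. wom j k * HI (wom j k * x))" unfolding Wi_def wom_def Hi_HI om_pow(2) by (auto simp: om_def mult.commute)

lemma HI_deriv_at: "(HI has_field_derivative deriv HI z) (at z)" by (rule ode2_derivs(1)[OF HI_ode open_UNIV UNIV_I])

lemma Wi_deriv: "(Wi j k has_field_derivative (wom j k)\<^sup>2 * deriv HI (wom j k * x)) (at x)"
proof -
 have L: "((%x. wom j k * x) has_field_derivative wom j k) (at x)" by simp
 from DERIV_cmult[OF DERIV_chain2[where g = "%x. wom j k * x", OF HI_deriv_at L], of "wom j k"]
 show ?thesis unfolding Wi_HI by (simp add: power2_eq_square mult_ac)
qed

lemma Wi_holo: "Wi j k holomorphic_on S" using Wi_deriv by (meson holomorphic_onI field_differentiable_at_within field_differentiable_def)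

lemma Ai_rot_alt: "Ai_rot 0 x = Ai x" "Ai_rot 1 x = Ai (om^2 * x)" "Ai_rot (-1) x = Ai (om * x)"
 unfolding Ai_rot_def om_pow(2) by (simp_all add: om_def mult.commute)

lemma Ai_holo: "Ai holomorphic_on S" using ode2_holo[OF Ai_ode] by auto

lemma Ai_rot_holo: "Ai_rot l holomorphic_on S" unfolding Ai_rot_def[abs_def]
 by (rule holomorphic_on_compose_gen[OF _ Ai_holo[of UNIV], unfolded o_def]) (auto intro!: holomorphic_intros)

lemma Ai_rot_deriv: "(Ai_rot l has_field_derivative deriv (Ai_rot l) x) (at x)"
 using holomorphic_derivI[OF Ai_rot_holo[of l UNIV] open_UNIV UNIV_I] .

text \<open>The factors of \<open>Ai_rot 1\<close> and \<open>Ai_rot (-1)\<close> in the differences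
  of the functions \<open>Wi\<close>; \<open>om * cW1\<close> is 2 pi i, the factor in the third
  difference.\<close>

definition cW1 :: complex where "cW1 = of_real (2 * pi / sqrt 3) * (1 - om)"
definition cW2 :: complex where "cW2 = of_real (2 * pi / sqrt 3) * (1 - om^2)"

lemma cW_alt: "om * cW1 = 2 * pi * \<i>" "om^2 * cW2 = - (2 * pi * \<i>)" "cW1 \<noteq> 0" "cW2 \<noteq> 0"
unfolding om_alt power2_eq_square cW1_def cW2_def by (auto simp: complex_eq_iff field_simps)

lemma Wi_diff:
 shows "Wi (-1) 1 x - Wi 0 1 x = cW1 * Ai_rot 1 x"
  and "Wi (-1) 1 x - Wi (-1) 0 x = cW2 * Ai_rot (-1) x"
  and "Wi 0 1 x - Wi (-1) 0 x = 2 * pi * \<i> * Ai_rot 0 x"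
proof -
 have w: "wom (-1) 1 = 1" "wom 0 1 = om" "wom (-1) 0 = om^2" by (simp_all add: wom_def)
 show "Wi (-1) 1 x - Wi 0 1 x = cW1 * Ai_rot 1 x" using HI_connection[OF om_pow(1), of x] by (simp add: Wi_HI w Ai_rot_alt cW1_def)
 have "(om^2)^2 = om ^ 3 * om" by (simp add: power2_eq_square power3_eq_cube)
 then have "(om^2)^2 = om" unfolding om_pow by simp
 then show "Wi (-1) 1 x - Wi (-1) 0 x = cW2 * Ai_rot (-1) x" using HI_connection[OF om_pow(3), of x] by (simp add: Wi_HI w Ai_rot_alt cW2_def)
 have o3: "om * om^2 = 1" using om_pow(1) by (simp add: power3_eq_cube power2_eq_square mult.assoc)
 \<comment> \<open>The first connection formula at om x; multiplied by om it relates the two rotated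
   functions to each other.\<close>
 have c: "HI (om * x) - om * HI (om * (om * x)) = cW1 * Ai (om^2 * (om * x))"
  using HI_connection[OF om_pow(1), of "om * x"] by (simp add: cW1_def)
 have "om^2 * (om * x) = (om * om^2) * x" by simp
 then have e1: "om^2 * (om * x) = x" unfolding o3 by simp
 have "om * HI (om * x) - om^2 * HI (om^2 * x) = (om * cW1) * Ai x" using c unfolding e1 by (simp add: algebra_simps power2_eq_square)
 then show "Wi 0 1 x - Wi (-1) 0 x = 2 * pi * \<i> * Ai_rot 0 x" unfolding cW_alt by (simp add: Wi_HI w Ai_rot_alt)
qed

lemma Wi_diff_deriv:
 shows "deriv (Wi (-1) 1) x - deriv (Wi 0 1) x = cW1 * deriv (Ai_rot 1) x"
  and "deriv (Wi (-1) 1) x - deriv (Wi (-1) 0) x = cW2 * deriv (Ai_rot (-1)) x"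
  and "deriv (Wi 0 1) x - deriv (Wi (-1) 0) x = 2 * pi * \<i> * deriv (Ai_rot 0) x"
proof -
 have D: "(Wi j k has_field_derivative deriv (Wi j k) x) (at x)" for j k using holomorphic_derivI[OF Wi_holo[of j k UNIV] open_UNIV UNIV_I] .
 have *: "deriv (Wi j k) x - deriv (Wi j' k') x = c * deriv (Ai_rot l) x"
  if e: "\<And>x. Wi j k x - Wi j' k' x = c * Ai_rot l x" for j k j' k' c l
 proof (rule DERIV_unique)
  let ?a = "%x. Wi j k x - Wi j' k' x"
  show "(?a has_field_derivative (deriv (Wi j k) x - deriv (Wi j' k') x)) (at x)" by (intro DERIV_diff D)
  show "(?a has_field_derivative (c * deriv (Ai_rot l) x)) (at x)" unfolding e by (intro DERIV_cmult Ai_rot_deriv)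
 qed
 show "deriv (Wi (-1) 1) x - deriv (Wi 0 1) x = cW1 * deriv (Ai_rot 1) x"
  and "deriv (Wi (-1) 1) x - deriv (Wi (-1) 0) x = cW2 * deriv (Ai_rot (-1)) x"
  and "deriv (Wi 0 1) x - deriv (Wi (-1) 0) x = 2 * pi * \<i> * deriv (Ai_rot 0) x"
  by (rule *, rule Wi_diff)+
qed

section \<open>Expansion of the Scorer functions for large argument\<close>

lemma deriv_inverse_power:
 fixes x :: complex assumes "x \<noteq> 0"
 shows "((%x. a / x ^ n) has_field_derivative (- (of_nat n * a) / x ^ Suc n)) (at x)"
proof (cases n)
 case 0
 then show ?thesis by simp
next
 case (Suc k)
 have p: "((%x. x ^ n) has_field_derivative of_nat n * (1 * x ^ (n - 1))) (at x)" using DERIV_power[OF DERIV_ident, of n x UNIV] by simp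
 let ?a = "0 * x ^ n - a * (of_nat n * (1 * x ^ (n - 1)))"
 have "((%x. a / x ^ n) has_field_derivative ?a / (x ^ n * x ^ n)) (at x)"
  by (rule DERIV_divide[OF DERIV_const p power_not_zero[OF assms]])
 also have "?a / (x ^ n * x ^ n) = - (of_nat n * a) / x ^ Suc n" using assms by (simp add: Suc field_simps)
 finally show ?thesis .
qed

lemma bc_airy:
 assumes "x \<noteq> 0"
 shows "bc (%z. z) (%_. 1) s x = - (fact (3 * s) / (fact s * 3 ^ s)) / x ^ (3 * s + 1)"
 using assms
proof (induction s arbitrary: x)
 case (Suc s)
 let ?c = "- (fact (3 * s) / (fact s * 3 ^ s)) :: complex"
 have o: "open (- {0::complex})" by auto
 let ?d = "bc (%z. z) (%_. 1)"
 have ev: "\<forall>\<^sub>F z in nhds y. ?d s z = ?c / z ^ (3 * s + 1)" if "y \<noteq> 0" for y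
  by (rule eventually_mono[OF eventually_nhds_in_open[OF o]]) (use that Suc.IH in auto)
 let ?a = "of_nat (3 * s + 1)"
 let ?b = "deriv (?d s)"
 have d1: "?b y = - (?a * ?c) / y ^ (3 * s + 2)" if "y \<noteq> 0" for y
  using deriv_cong_ev[OF ev[OF that] refl] DERIV_imp_deriv[OF deriv_inverse_power[OF that, of ?c "3 * s + 1"]] by simp
 have "\<forall>\<^sub>F z in nhds x. ?b z = - (?a * ?c) / z ^ (3 * s + 2)"
  by (rule eventually_mono[OF eventually_nhds_in_open[OF o]]) (use Suc.prems d1 in auto)
 from deriv_cong_ev[OF this refl] have "?d (Suc s) x = of_nat (3 * s + 2) * ?a * ?c / x ^ (3 * Suc s + 1)" using DERIV_imp_deriv[OF deriv_inverse_power[OF Suc.prems, of "- (?a * ?c)" "3 * s + 2"]] by (simp add: deriv2_alt numeral_3_eq_3 mult_ac)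
 also have "of_nat (3 * s + 2) * ?a * ?c = - (fact (3 * Suc s) / (fact (Suc s) * 3 ^ Suc s))"
 proof -
  have f3: "(fact (3 * Suc s) :: complex) = of_nat (3 * s + 3) * of_nat (3 * s + 2) * ?a * fact (3 * s)" by (simp add: numeral_3_eq_3)
  have n: "(of_nat (3 * s + 3) :: complex) = 3 * of_nat (Suc s)" by simp
  have alg: "3 * S * b * a * F / (S * f * (3 * t)) = b * a * (F / (f * t))" if "S \<noteq> 0" "f \<noteq> 0" "t \<noteq> 0" for S b a F f t :: complex
   using that by simp
  have S0: "of_nat (Suc s) \<noteq> (0 :: complex)" by (simp del: of_nat_Suc)
  show ?thesis unfolding f3 n fact_Suc power_Suc alg[OF S0 fact_nonzero power_not_zero[OF zero_neq_numeral[symmetric]]] by simp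
 qed
 finally show ?case by simp
qed simp

lemma bc_airy_deriv:
 assumes "x \<noteq> 0"
 shows "deriv (bc (%z. z) (%_. 1) s) x = (fact (3 * s + 1) / (fact s * 3 ^ s)) / x ^ (3 * s + 2)"
proof -
 let ?c = "- (fact (3 * s) / (fact s * 3 ^ s)) :: complex"
 have o: "open (- {0::complex})" by auto
 have ev: "\<forall>\<^sub>F z in nhds x. bc (%z. z) (%_. 1) s z = ?c / z ^ (3 * s + 1)"
  by (rule eventually_mono[OF eventually_nhds_in_open[OF o]]) (use assms bc_airy in auto)
 show ?thesis using deriv_cong_ev[OF ev refl] DERIV_imp_deriv[OF deriv_inverse_power[OF assms, of ?c "3 * s + 1"]] by simp
qed

text \<open>The inner sums of \<open>J\<close>. With l = u^(2/3), minus \<open>airyP\<close> divided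
  by l x and \<open>airyQ\<close> divided by (l x)^2 are the truncated expansions of
  \<open>Wi\<close> and its derivative at l x, in the directions where these are algebraic.\<close>

definition airyP :: "nat => real => complex => complex" where
 "airyP m u x = (\<Sum>k=0..m. fact (3*k) / (fact k * (3 * of_real u ^ 2 * x ^ 3) ^ k))"

definition airyQ :: "nat => real => complex => complex" where
 "airyQ m u x = (\<Sum>k=0..m. fact (3*k+1) / (fact k * (3 * of_real u ^ 2 * x ^ 3) ^ k))"

text \<open>Inside the sums only the cube of the argument occurs, so the cube root of unity c
  survives in the prefactors alone and the three functions \<open>Wi\<close> share one
  expansion.\<close>

lemma airyP_bc:
 assumes u: "u > 0" and x: "x \<noteq> 0" and c: "c ^ 3 = 1"
 shows "(\<Sum>s<Suc m. bc (%z. z) (%_. 1) s (c * x) / of_real u ^ (2 * s + 2)) = - (airyP m u x / (c * x * of_real u ^ 2))"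
  and "(\<Sum>s<Suc m. deriv (bc (%z. z) (%_. 1) s) (c * x) / of_real u ^ (2 * s + 2)) = airyQ m u x / ((c * x)^2 * of_real u ^ 2)"
proof -
 have cx: "c * x \<noteq> 0" using c x by auto
 have p3: "(c * x) ^ (3 * s) = (x ^ 3) ^ s" for s using c by (simp add: power_mult_distrib power_mult)
 let ?b = "of_real u ^ 2"
 have t: "a / (f * 3 ^ s) / ((c * x) ^ (3 * s) * w) / (of_real u ^ (2 * s) * ?b) = a / (f * (3 * ?b * x ^ 3) ^ s) / (w * ?b)"
  for a f w :: complex and s
  unfolding p3 by (simp add: power_mult_distrib power_mult[symmetric])
 let ?c = "bc (%z. z) (%_. 1)"
 show "(\<Sum>s<Suc m. ?c s (c * x) / of_real u ^ (2 * s + 2)) = - (airyP m u x / (c * x * ?b))"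
  unfolding airyP_def sum_divide_distrib sum_negf[symmetric] atLeast0AtMost lessThan_Suc_atMost[symmetric] by (rule sum.cong[OF refl]) ((unfold bc_airy[OF cx] power_add power_one_right minus_divide_left[symmetric] t, rule))
 let ?a = "%z s. deriv (?c s) (c * x) / of_real u ^ (2 * s + 2)"
 show "(\<Sum>s<Suc m. ?a z s) = airyQ m u x / ((c * x)^2 * ?b)"
  unfolding airyQ_def sum_divide_distrib atLeast0AtMost lessThan_Suc_atMost[symmetric]
 proof (rule sum.cong[OF refl])
  fix s
  show "?a z s = fact (3 * s + 1) / (fact s * (3 * ?b * x ^ 3) ^ s) / ((c * x)^2 * ?b)"
   unfolding bc_airy_deriv[OF cx] power_add[of _ "3 * s" 2] power_add[of _ "2 * s" 2] t ..
 qed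
qed

text \<open>This scaling brings the Scorer function into the form to which the bootstrap applies,
  with f = x and p = 1.\<close>

lemma HI_scaled_ode:
 assumes u: "u > 0"
 shows "ode2 (%x. of_real (u^2) * x) UNIV (%_. 1) (%x. HI (of_real (u powr (2/3)) * x) / of_real (u powr (4/3)))"
proof -
 define l where "l = u powr (2/3)"
 have l: "l > 0" "l^2 = u powr (4/3)" "l ^ 3 = u^2" using u by (simp_all add: l_def powr_power)
 let ?a = "ode2 (%z. (of_real l)^2 * (of_real l * z))"
 have "?a UNIV (%z. (of_real l)^2 * 1) (%z. HI (of_real l * z))" by (rule ode2_chain_linear[OF HI_ode]) auto
 from ode2_cmult[OF this open_UNIV, of "1 / (of_real l)^2"]
 have "?a UNIV (%z. 1) (%z. HI (of_real l * z) / (of_real l)^2)" using l(1) by simp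
 moreover have eq: "(%z. (complex_of_real l)^2 * (of_real l * z)) = (%z. of_real (u^2) * z)"
  unfolding l(3)[symmetric] by (simp add: power3_eq_cube power2_eq_square fun_eq_iff)
 moreover have "(complex_of_real l)^2 = of_real (u powr (4/3))" by (simp only: l(2)[symmetric] of_real_power)
 ultimately show ?thesis by (simp only: l_def)
qed

text \<open>\<open>HI_sector_bound\<close> supplies the boundedness that
  \<open>bootstrap_deriv\<close> asks for. Undoing the scaling multiplies the error u^(-2 m - 4) by
  l^2 = u^(4/3) for the function and by l = u^(2/3) for the derivative.\<close>

lemma Wi_expansion:
 assumes al: "\<bar>\<alpha>\<bar> < pi / 6" and x0: "Re (cis \<alpha> * (wom j k * x0)) < 0"
 shows "\<exists>\<rho>>0. \<exists>K. \<forall>\<^sub>F u in at_top. \<forall>x\<in>ball x0 \<rho>.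
  norm (Wi j k (of_real (u powr (2/3)) * x) + airyP m u x / (of_real (u powr (2/3)) * x)) \<le> K / (u ^ (2*m+2) * u powr (2/3)) \<and>
  norm (deriv (Wi j k) (of_real (u powr (2/3)) * x) - airyQ m u x / (of_real (u powr (2/3)) * x)\<^sup>2) \<le> K / (u ^ (2*m+2) * u powr (4/3))"
proof -
 define c where "c = wom j k"
 have c: "c ^ 3 = 1" unfolding c_def by (rule wom_cube)
 then have "norm c ^ 3 = 1" by (metis norm_one norm_power)
 then have nc: "norm c = 1" using power_eq_1_iff[of "norm c" 3] by simp
 let ?p = "ball (c * x0)"
 let ?q = "%l x. of_real l * x"
 obtain r1 C where r1: "r1 > 0" and C: "\<And>x l. x \<in> ?p r1 ==> l \<ge> 1 ==> norm (HI (?q l x)) \<le> C"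
  using HI_sector_bound[OF al x0] unfolding c_def by blast
 have cx0: "c * x0 \<noteq> 0" using x0 unfolding c_def by auto
 define r where "r = min r1 (norm (c * x0))"
 have r: "r > 0" "r \<le> r1" using r1 cx0 by (auto simp: r_def)
 have nz: "x \<noteq> 0" if "x \<in> ?p r" for x using that by (auto simp: r_def)
 let ?a = "%u x. of_real (u powr (2/3)) * x"
 define y where "y = (%u x. HI (?a u x) / of_real (u powr (4/3)))"
 have ev1: "\<forall>\<^sub>F u in at_top. ode2 (%x. of_real (u^2) * x) (?p r) (%_. 1) (y u)"
  using eventually_gt_at_top[of 0] by eventually_elim (unfold y_def, rule ode2_subset[OF HI_scaled_ode], auto)
 have ev2: "\<forall>\<^sub>F u in at_top. \<forall>x\<in>?p r. norm (y u x) \<le> C" using eventually_ge_at_top[of 1]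
 proof eventually_elim
  case (elim u)
  show ?case
  proof
   fix x assume "x \<in> ?p r"
   then have x: "x \<in> ?p r1" using r by auto
   have p1: "u powr (2/3) \<ge> 1" "u powr (4/3) \<ge> 1" using elim by (auto intro!: ge_one_powr_ge_zero)
   have H: "norm (HI (?a u x)) \<le> C" using C[OF x p1(1)] .
   then have "norm (HI (?a u x)) / u powr (4/3) \<le> C / 1" using p1 order_trans[OF norm_ge_zero H] by (intro frac_le) auto
   then show "norm (y u x) \<le> C" unfolding y_def norm_divide by simp
  qed
 qed
 let ?k = "%K u. K / u ^ (2 * Suc m + 2)"
 let ?v = "bc (%z. z) (%_. 1)"
 obtain \<rho> K where rho: "\<rho> > 0" "\<rho> \<le> r" and K: "\<forall>\<^sub>F u in at_top. \<forall>z\<in>?p \<rho>.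
  norm (y u z - (\<Sum>s<Suc m. ?v s z / of_real u ^ (2 * s + 2))) \<le> ?k K u \<and>
  norm (deriv (y u) z - (\<Sum>s<Suc m. deriv (?v s) z / of_real u ^ (2 * s + 2))) \<le> ?k K u"
  using bootstrap_deriv[OF holomorphic_on_ident holomorphic_on_const r(1) nz ev1 ev2, of "Suc m"] by auto
 let ?e = "%u x. norm (deriv (Wi j k) (?a u x) - airyQ m u x / (?a u x)^2)"
 let ?s = "%u. u ^ (2*m+2)"
 let ?l = "%u x. norm (Wi j k (?a u x) + airyP m u x / (?a u x)) \<le> K / (?s u * u powr (2/3))"
 let ?r = "%u x. ?e u x \<le> K / (?s u * u powr (4/3))"
 have "\<forall>\<^sub>F u in at_top. \<forall>x\<in>ball x0 \<rho>.
  ?l u x \<and>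
  ?r u x"
  using K eventually_gt_at_top[of 0]
 proof eventually_elim
  case (elim u)
  define l where "l = u powr (2/3)"
  have l: "l > 0" "l^2 = u powr (4/3)" "l ^ 3 = u^2" using elim(2) by (simp_all add: l_def powr_power)
  have ul: "of_real u ^ 2 = of_real l ^ 3" by (simp add: l(3)[symmetric] flip: of_real_power)
  show ?case
  proof
   fix x assume x: "x \<in> ball x0 \<rho>"
   have "dist (c * x0) (c * x) = norm c * dist x0 x" by (simp add: dist_norm flip: right_diff_distrib norm_mult)
   then have cx: "c * x \<in> ?p \<rho>" using x nc by simp
   then have "c * x \<in> ?p r" using rho by auto
   then have cxn: "c * x \<noteq> 0" by (rule nz)
   then have xn: "x \<noteq> 0" and cn: "c \<noteq> 0" by auto
   let ?f = "deriv HI (of_real l * (c * x))"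
   have yd: "(y u has_field_derivative ?f / of_real l) (at (c * x))"
   proof -
    have L: "((%x. ?q l x) has_field_derivative of_real l) (at (c * x))" by simp
    from DERIV_cdivide[OF DERIV_chain2[where g = "%x. ?q l x", OF HI_deriv_at L], of "(of_real l)^2"]
    show ?thesis unfolding y_def l(2)[symmetric] using l(1) by (simp add: l_def power2_eq_square)
   qed
   let ?d = "HI (of_real l * (c * x)) / (of_real l)^2 + airyP m u x / (c * x * of_real l ^ 3)"
   have e1: "norm ?d \<le> ?k K u" using bspec[OF elim(1) cx] unfolding airyP_bc[OF elim(2) xn c] y_def l(2)[symmetric] ul by (simp add: l_def)
   let ?b = "?f / of_real l - airyQ m u x / ((c * x)^2 * of_real l ^ 3)"
   have e2: "norm ?b \<le> ?k K u" using bspec[OF elim(1) cx] unfolding airyP_bc[OF elim(2) xn c] DERIV_imp_deriv[OF yd] ul by simp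
   have uu: "u ^ (2 * Suc m + 2) = u ^ (2 * m + 2) * l ^ 3" unfolding l(3) by (simp add: power2_eq_square)
   let ?h = "Wi j k (?q l x) + airyP m u x / (?q l x)"
   have "?h = c * (of_real l)^2 * ?d"
    unfolding Wi_HI c_def[symmetric] using l(1) cn by (simp add: distrib_left mult_ac power2_eq_square power3_eq_cube)
   then have "norm ?h =
     l^2 * norm ?d"
    using nc by (simp add: norm_mult norm_power)
   also have "\<dots> \<le> l^2 * (?k K u)" by (intro mult_left_mono e1) auto
   also have "\<dots> = K / (?s u * l)" unfolding uu by (simp add: power2_eq_square power3_eq_cube)
   finally have 1: "norm ?h \<le> K / (?s u * l)" .
   have dW: "deriv (Wi j k) (?q l x) = c^2 * ?f"
    using DERIV_imp_deriv[OF Wi_deriv, of j k "?q l x"] unfolding c_def[symmetric] by (simp add: mult_ac)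
   let ?g = "deriv (Wi j k) (?q l x) - airyQ m u x / (?q l x)^2"
   have "?g = c^2 * of_real l * ?b" unfolding dW using l(1) cn by (simp add: right_diff_distrib power2_eq_square power3_eq_cube)
   then have "norm ?g =
     l * norm ?b"
    using l(1) nc by (simp add: norm_mult norm_power)
   also have "\<dots> \<le> l * (?k K u)" by (intro mult_left_mono e2) (use l in auto)
   also have "\<dots> = K / (?s u * l^2)" unfolding uu by (simp add: power2_eq_square power3_eq_cube)
   finally have 2: "norm ?g \<le> K / (?s u * l^2)" .
   show "?l u x \<and>
    ?r u x"
    unfolding l_def[symmetric] l(2)[symmetric] using 1 2 by blast
  qed
 qed
 then show ?thesis using rho(1) by auto
qed

section \<open>The variables\<close>

definition cutp :: "complex set" where "cutp = {z. Im z = 0 \<longrightarrow> Re z > -1}"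

text \<open>On the segment t = 1 + \<tau> (z - 1) the factor \<open>csqrt (t - 1)\<close> splits as
  \<open>sqrt \<tau> * csqrt (z - 1)\<close>. What remains is this integral, the factor of \<xi>
  that is analytic also across (-1,1].\<close>

definition xiI :: "complex => complex" where
 "xiI z = integral {0..1} (\<lambda>\<tau>. of_real (sqrt \<tau>) * csqrt (2 + of_real \<tau> * (z - 1)))"

lemma open_cutp: "open cutp"
proof -
 let ?a = "{z. Im z < 0} \<union> {z. Im z > 0} \<union> {z. Re z > -1}"
 have "cutp = ?a" by (auto simp: cutp_def)
 moreover have "open ?a" by (intro open_Un open_halfspace_Im_lt open_halfspace_Im_gt open_halfspace_Re_gt)
 ultimately show ?thesis by simp
qed

lemma csqrt_of_real_mult: "x \<ge> 0 ==> csqrt (of_real x * z) = of_real (sqrt x) * csqrt z"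
proof (cases "x = 0")
 case False
 assume "x \<ge> 0"
 then have x: "x > 0" using False by simp
 show ?thesis
 by (rule csqrt_unique) (((use x in "simp add: power_mult_distrib flip: of_real_power"))[1], ((use x csqrt_principal[of z] in auto))[1])
qed simp

lemma xi_xiI: "\<xi> z = csqrt (z - 1) ^ 3 * xiI z"
proof -
 have "\<xi> z = integral {0..1} (%x. sqrt_z2m1 (linepath 1 z x) * (z - 1))" unfolding \<xi>_def contour_integral_integral by simp
 also have "\<dots> = integral {0..1} (%x. (csqrt (z - 1) * (z - 1)) * (of_real (sqrt x) * csqrt (2 + of_real x * (z - 1))))"
 proof (rule integral_cong)
  fix x :: real assume x: "x \<in> {0..1}"
  have 1: "linepath 1 z x - 1 = of_real x * (z - 1)" "linepath 1 z x + 1 = 2 + of_real x * (z - 1)"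
   by (simp_all add: linepath_def scaleR_conv_of_real algebra_simps)
  show "sqrt_z2m1 (linepath 1 z x) * (z - 1) = (csqrt (z - 1) * (z - 1)) * (of_real (sqrt x) * csqrt (2 + of_real x * (z - 1)))"
   unfolding sqrt_z2m1_def 1 using x by (subst csqrt_of_real_mult) auto
 qed
 also have "\<dots> = (csqrt (z - 1) * (z - 1)) * xiI z" unfolding xiI_def by (rule integral_mult_right)
 also have "csqrt (z - 1) * (z - 1) = csqrt (z - 1) * (csqrt (z - 1))^2" by simp
 also have "\<dots> = csqrt (z - 1) ^ 3" by (simp add: power3_eq_cube power2_eq_square)
 finally show ?thesis .
qed

lemma zeta_xiI: "\<zeta> z = (z - 1) * (3/2 * xiI z) powr (2/3)"
proof (cases "z = 1")
 case False
 then show ?thesis unfolding xi_xiI \<zeta>_def by simp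
qed (simp add: \<zeta>_def)

lemma xi_arg_notin:
 assumes "z \<in> cutp" "0 \<le> t" "t \<le> 1"
 shows "2 + of_real t * (z - 1) \<notin> \<real>\<^sub>\<le>\<^sub>0"
proof
 assume "2 + of_real t * (z - 1) \<in> \<real>\<^sub>\<le>\<^sub>0"
 then have *: "t * Im z = 0" "2 + t * (Re z - 1) \<le> 0" by (auto simp: complex_nonpos_Reals_iff)
 show False
 proof (cases "t = 0")
  case False
  then have "Re z > -1" using * assms by (auto simp: cutp_def)
  then have "t * (Re z - 1) > t * (-2)" using False assms by (intro mult_strict_left_mono) auto
  then show False using * assms by simp
 qed (use * in simp)
qed

lemma continuous_csqrt_arg:
 assumes "z \<in> cutp"
 shows "continuous_on {0..1} (%t. csqrt (2 + of_real t * (z - 1)))"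
 by (rule continuous_on_compose2[OF continuous_on_csqrt]) (use xi_arg_notin[OF assms] in "auto intro!: continuous_intros")

lemma xiI_holo: "xiI holomorphic_on cutp"
proof -
 have "xiI field_differentiable at z0" if z0: "z0 \<in> cutp" for z0
 proof -
  obtain r where r: "r > 0" "ball z0 r \<subseteq> cutp" using open_cutp z0 open_contains_ball by blast
  let ?e = "%t z. 2 + of_real t * (z - 1)"
  let ?a = "%t z. csqrt (?e t z)"
  let ?b = "%t. of_real (sqrt t)"
  let ?d = "%t z. ?b t * (of_real t / (2 * ?a t z))"
  have "(%z. integral (cbox 0 1) (%t::real. ?b t * ?a t z)) holomorphic_on ball z0 r"
  proof (rule leibniz_rule_holomorphic[where fx = "%z t. ?d t z"])
   fix z :: complex and t :: real assume "z \<in> ball z0 r" "t \<in> cbox 0 1"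
   then have n: "?e t z \<notin> \<real>\<^sub>\<le>\<^sub>0" using xi_arg_notin r by auto
   have L: "((%z. ?e t z) has_field_derivative of_real t) (at z within ball z0 r)" by (auto intro!: derivative_eq_intros)
   show "((%z. ?b t * ?a t z) has_field_derivative
     ?d t z) (at z within ball z0 r)"
    using DERIV_cmult[OF DERIV_chain2[where f = csqrt and g = "%z. ?e t z", OF has_field_derivative_csqrt[OF n] L], of " (sqrt t)"]
     by (simp add: field_simps)
  next
   fix z assume "z \<in> ball z0 r"
   then show "(%t. ?b t * ?a t z) integrable_on cbox 0 1"
    using r by (intro integrable_continuous) (auto intro!: continuous_intros continuous_csqrt_arg)
  next
   let ?c = "continuous_on (ball z0 r \<times> cbox 0 (1::real))"
   have c: "?c (%p. csqrt (2 + of_real (snd p) * (fst p - 1)))" by (rule continuous_on_compose2[OF continuous_on_csqrt])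
     (use r xi_arg_notin in "auto intro!: continuous_intros")
   have "?c (%p. of_real (sqrt (snd p)) * (of_real (snd p) / (2 * csqrt (2 + of_real (snd p) * (fst p - 1)))))"
    by (intro continuous_intros c) (use r xi_arg_notin in force)
   then show "continuous_on (ball z0 r \<times> cbox 0 1) (%(z, t). ?d t z)" by (simp add: case_prod_unfold)
  qed simp
  then have "xiI holomorphic_on ball z0 r" by (simp add: xiI_def[abs_def])
  then show ?thesis using r(1) by (intro holomorphic_on_imp_differentiable_at[of _ "ball z0 r"]) auto
 qed
 then show ?thesis by (simp add: holomorphic_on_def field_differentiable_at_within)
qed

section \<open>Arguments of \<xi> and \<zeta> in the upper half plane\<close>

lemma integral_pos_Re_aux:
 fixes g :: "real => complex"
 assumes g: "continuous_on {0..1} g" and l: "bounded_linear (l :: complex => real)"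
  and nn: "\<And>t. t \<in> {0..1} ==> l (g t) \<ge> 0" and t0: "t0 \<in> {0..1}" "l (g t0) > 0"
 shows "l (integral {0..1} g) > 0"
proof -
 have gi: "g integrable_on {0..1}" by (rule integrable_continuous_real[OF g])
 let ?a = "integral {0..1} (%t. l (g t))"
 have e: "l (integral {0..1} g) = ?a" using integral_linear[OF gi l] by (simp add: o_def)
 have c: "continuous_on {0..1} (%t. l (g t))" using bounded_linear.continuous_on[OF l g] .
 have "?a \<ge> 0" by (rule integral_nonneg[OF integrable_continuous_real[OF c] nn])
 moreover have "?a \<noteq> 0"
 proof
  assume z: "?a = 0"
  have "l (g t0) = 0" by (rule integral_eq_0_iff[OF c, THEN iffD1, rule_format]) (use nn t0 z in auto)
  then show False using t0 by simp
 qed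
 ultimately show ?thesis using e by simp
qed

lemma xiI_cont_integrand:
 assumes "z \<in> cutp"
 shows "continuous_on {0..1} (%t. of_real (sqrt t) * csqrt (2 + of_real t * (z - 1)))"
 by (intro continuous_intros continuous_csqrt_arg assms)

lemma Re_csqrt_pos:
 assumes "w \<notin> \<real>\<^sub>\<le>\<^sub>0"
 shows "Re (csqrt w) > 0"
proof -
 have "cmod w + Re w > 0"
 proof (cases "Im w = 0")
  case True
  then have "Re w > 0" using assms by (auto simp: complex_nonpos_Reals_iff)
  then show ?thesis using norm_ge_zero[of w] by linarith
 next
  case False
  then have "\<bar>Re w\<bar>^2 < (cmod w)^2" by (simp add: cmod_power2)
  then have "\<bar>Re w\<bar> < cmod w" by (rule power2_less_imp_less) simp
  then show ?thesis by simp
 qed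
 then show ?thesis by simp
qed

lemma Im_csqrt_pos:
 assumes "Im w > 0"
 shows "Im (csqrt w) > 0"
proof -
 have "\<bar>Re w\<bar>^2 < (cmod w)^2" using assms by (simp add: cmod_power2)
 then have "\<bar>Re w\<bar> < cmod w" by (rule power2_less_imp_less) simp
 then show ?thesis using assms by simp
qed

lemma xiI_Re_pos: "z \<in> cutp ==> Re (xiI z) > 0" unfolding xiI_def
proof (rule integral_pos_Re_aux[OF _ bounded_linear_Re, of _ 1])
 assume z: "z \<in> cutp"
 let ?a = "%t. of_real (sqrt t) * csqrt (2 + of_real t * (z - 1))"
 show "continuous_on {0..1} ?a" by (rule xiI_cont_integrand[OF z])
 show "Re (?a t) \<ge> 0" if "t \<in> {0..1}" for t using that Re_csqrt by (simp del: csqrt.simps)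
 show "Re (of_real (sqrt 1) * csqrt (2 + of_real 1 * (z - 1))) > 0" using Re_csqrt_pos[OF xi_arg_notin[OF z, of 1]] by simp
qed simp

text \<open>The values csqrt (2 + t (z - 1)) turn from the positive axis at t = 0 to csqrt (z + 1)
  at t = 1, so the argument of \<open>xiI\<close> lies strictly between 0 and half the argument of z
  + 1.\<close>

lemma xiI_Im_bounds:
 assumes z: "Im z > 0"
 shows "Im (xiI z) > 0" and "Im (xiI z * cnj (csqrt (z + 1))) < 0"
proof -
 have zc: "z \<in> cutp" using z by (simp add: cutp_def)
 let ?a = "%t. csqrt (2 + of_real t * (z - 1))"
 have p: "Im (?a t) > 0" if "t > 0" for t by (rule Im_csqrt_pos) (use that z in simp)
 have p0: "Im (?a t) \<ge> 0" if "t \<ge> 0" for t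
 proof (cases "t = 0")
  case False then show ?thesis using p[of t] that by simp
 qed (simp del: csqrt.simps)
 let ?c = "%t. of_real (sqrt t) * ?a t"
 show "Im (xiI z) > 0" unfolding xiI_def
 proof (rule integral_pos_Re_aux[OF xiI_cont_integrand[OF zc] bounded_linear_Im, of 1])
  show "Im (?c t) \<ge> 0" if "t \<in> {0..1}" for t using that p0[of t] by simp
  show "Im (of_real (sqrt 1) * csqrt (2 + of_real 1 * (z - 1))) > 0" using p[of 1] by simp
 qed simp
 define c where "c = csqrt (z + 1)"
 have "z + 1 \<notin> \<real>\<^sub>\<le>\<^sub>0" using z by (auto simp: complex_nonpos_Reals_iff)
 then have cp: "Re c > 0" "Im c > 0" using Re_csqrt_pos Im_csqrt_pos[of "z + 1"] z by (auto simp: c_def simp del: csqrt.simps)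
 have neg: "Im (?a t * cnj c) \<le> 0" "t < 1 ==> Im (?a t * cnj c) < 0" if t: "t \<in> {0..1}" for t
 proof -
  let ?w = "2 + of_real t * (z - 1)" and ?p = "?a t"
  have rp: "Re ?p > 0" by (rule Re_csqrt_pos, rule xi_arg_notin[OF zc]) (use t in auto)
  have ip: "Im ?p \<ge> 0" using p0 t by simp
  let ?b = "?p * cnj c"
  have re: "Re ?b > 0" using rp ip cp by (simp add: add_pos_nonneg)
  \<comment> \<open>Squaring removes the roots: as the real part of \<open>?b\<close> is positive,
    the sign of its imaginary part is that of Im (?b^2) = - 2 (1 - t) Im z.\<close>
  have "Im (?b^2) = Im (?w * cnj (z + 1))" unfolding power_mult_distrib c_def by (simp flip: complex_cnj_power)
  moreover have "Im (?b^2) = 2 * Re ?b * Im ?b" by (simp only: Im_power2)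
  moreover have "Im (?w * cnj (z + 1)) = - (2 * (1 - t) * Im z)" by (simp add: algebra_simps)
  ultimately have e: "Re ?b * Im ?b = - ((1 - t) * Im z)" by linarith
  show "Im ?b \<le> 0"
  proof (rule ccontr)
   assume "\<not> ?thesis"
   then have "Re ?b * Im ?b > 0" using re by simp
   moreover have "(1 - t) * Im z \<ge> 0" using t z by auto
   ultimately show False using e by simp
  qed
  show "Im ?b < 0" if "t < 1"
  proof (rule ccontr)
   assume "\<not> ?thesis"
   then have "Re ?b * Im ?b \<ge> 0" using re by simp
   moreover have "(1 - t) * Im z > 0" using that z by auto
   ultimately show False using e by simp
  qed
 qed
 have bl: "bounded_linear (%w. - Im (w * cnj c))"
  by (intro bounded_linear_minus bounded_linear_compose[OF bounded_linear_Im] bounded_linear_mult_left)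
 have "- Im (xiI z * cnj c) > 0" unfolding xiI_def
 proof (rule integral_pos_Re_aux[OF xiI_cont_integrand[OF zc] bl, of "1/4"])
  have e: "- Im (?c t * cnj c) = sqrt t * - Im (?a t * cnj c)" for t by (simp add: right_diff_distrib)
  show "- Im (?c t * cnj c) \<ge> 0" if "t \<in> {0..1}" for t unfolding e using neg(1)[OF that] that by (intro mult_nonneg_nonneg) auto
  show "- Im (of_real (sqrt (1/4)) * csqrt (2 + of_real (1/4) * (z - 1)) * cnj c) > 0" using neg(2)[of "1/4"] by simp
 qed simp
 then show "Im (xiI z * cnj (csqrt (z + 1))) < 0" by (simp add: c_def)
qed

lemma csqrt_rcis: "Im w > 0 ==> csqrt w = rcis (sqrt (cmod w)) (Arg w / 2)"
proof (rule csqrt_unique)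
 assume w: "Im w > 0"
 let ?a = "rcis (sqrt (cmod w)) (Arg w / 2)"
 show "?a^2 = w" by (simp add: power2_eq_square rcis_mult rcis_cmod_Arg)
 have "cos (Arg w / 2) > 0" using Arg_lt_pi[of w] w by (intro cos_gt_zero_pi) auto
 moreover have "cmod w > 0" using w by auto
 ultimately show "Re ?a > 0 \<or> Re ?a = 0 \<and> 0 \<le> Im ?a" by simp
qed

lemma powr_rcis: "w \<noteq> 0 ==> w powr of_real s = rcis (cmod w powr s) (s * Arg w)"
 by (simp add: powr_def exp_eq_polar rcis_def Arg_def)

text \<open>With a and q the arguments of z - 1 and \<open>xiI\<close>, \<zeta> has argument
  \<theta> = a + 2 q / 3 and \<xi> has argument 3 a / 2 + q. The window for q from
  \<open>xiI_Im_bounds\<close> becomes a window for \<theta>, from which the sign conditions in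
  \<open>zeta_facts\<close> are read off.\<close>

lemma zeta_polar:
 assumes z: "Im z > 0"
 obtains r r' \<theta> where "r > 0" "r' > 0" "\<zeta> z = rcis r \<theta>" "\<xi> z = rcis r' (3 / 2 * \<theta>)"
  "Arg (z - 1) < \<theta>" "\<theta> < Arg (z - 1) + Arg (z + 1) / 3"
proof -
 define a b q where "a = Arg (z - 1)" and "b = Arg (z + 1)" and "q = Arg (xiI z)"
 have zc: "z \<in> cutp" using z by (simp add: cutp_def)
 have a: "0 < a" "a < pi" unfolding a_def using Arg_lt_pi[of "z - 1"] z by auto
 have b: "0 < b" "b < pi" unfolding b_def using Arg_lt_pi[of "z + 1"] z by auto
 have re: "Re (xiI z) > 0" by (rule xiI_Re_pos[OF zc])
 have x0: "xiI z \<noteq> 0" using re by auto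
 let ?a = "cmod (xiI z)"
 have q0: "0 < q" "q < pi / 2"
 proof -
  show "0 < q" unfolding q_def using Arg_lt_pi[of "xiI z"] xiI_Im_bounds(1)[OF z] by auto
  have "?a * cos q = Re (xiI z)" using rcis_cmod_Arg[of "xiI z"] unfolding q_def by (metis Re_rcis)
  then have "cos q > 0" using re by (metis norm_ge_zero not_less zero_less_mult_iff)
  moreover have "q \<le> pi" unfolding q_def by (rule Arg_le_pi)
  ultimately show "q < pi / 2" using cos_monotone_0_pi_le[of "pi/2" q] by force
 qed
 have qb: "q < b / 2"
 proof (rule ccontr)
  assume "\<not> ?thesis"
  then have "sin (q - b / 2) \<ge> 0" using q0 b by (intro sin_ge_zero) auto
  moreover have "Im (xiI z * cnj (csqrt (z + 1))) = ?a * sqrt (cmod (z + 1)) * sin (q - b / 2)"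
  proof -
   have "xiI z * cnj (csqrt (z + 1)) = rcis ?a q * cnj (rcis (sqrt (cmod (z + 1))) (b / 2))"
    using csqrt_rcis[of "z + 1"] z rcis_cmod_Arg[of "xiI z"] by (simp add: q_def b_def)
   also have "\<dots> = rcis (?a * sqrt (cmod (z + 1))) (q - b / 2)" by (simp add: rcis_def cis_cnj cis_mult)
   finally show ?thesis by simp
  qed
  ultimately have "Im (xiI z * cnj (csqrt (z + 1))) \<ge> 0" by simp
  then show False using xiI_Im_bounds(2)[OF z] by simp
 qed
 define m where "m = cmod (3/2 * xiI z) powr (2/3)"
 have m: "m > 0" unfolding m_def using x0 by simp
 have z1: "z - 1 \<noteq> 0" using z by auto
 have zt: "\<zeta> z = rcis (cmod (z - 1) * m) (a + 2 / 3 * q)"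
 proof -
  have Arg32: "Arg (3/2 * xiI z) = q" using Arg_times_of_real[of "3/2" "xiI z"] by (simp add: q_def)
  have "(3/2 * xiI z) powr (2/3) = (3/2 * xiI z) powr of_real (2/3)" by simp
  also have "\<dots> = rcis m (2/3 * q)" using powr_rcis[of "3/2 * xiI z" "2/3"] x0 by (simp only: m_def Arg32) simp
  finally have "\<zeta> z = rcis (cmod (z - 1)) a * rcis m (2/3 * q)" unfolding zeta_xiI a_def by (simp add: rcis_cmod_Arg)
  then show ?thesis by (simp add: rcis_mult)
 qed
 have xt: "\<xi> z = rcis (sqrt (cmod (z - 1)) ^ 3 * ?a) (3 / 2 * (a + 2 / 3 * q))"
 proof -
  have "\<xi> z = rcis (sqrt (cmod (z - 1)) ^ 3) (3 / 2 * a) * rcis ?a q" using csqrt_rcis[of "z - 1"] z unfolding xi_xiI q_def by (simp add: DeMoivre2 a_def rcis_cmod_Arg)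
  then show ?thesis by (simp add: rcis_mult algebra_simps)
 qed
 show ?thesis by (rule that[OF _ _ zt xt]) (use m z1 x0 q0 qb in "auto simp: a_def b_def")
qed

text \<open>The sum of the two arguments is located by the signs of the real and imaginary parts of
  z^2 - 1 = (z - 1) (z + 1), the argument of z - 1 alone by the sign of Re z - 1.\<close>

lemma Arg_sum_facts:
 assumes "Im z > 0"
 shows "0 < Arg (z - 1)" "Arg (z - 1) < pi" "0 < Arg (z + 1)" "Arg (z + 1) < pi"
  "Re z \<ge> 0 ==> Arg (z - 1) + Arg (z + 1) \<le> pi"
  "Re z > 0 ==> Re (z^2) \<ge> 1 ==> Arg (z - 1) + Arg (z + 1) \<le> pi / 2"
  "Arg (z - 1) < pi / 2 ==> Re z > 1" "Re z \<le> 1 ==> Arg (z - 1) \<ge> pi / 2" "Re z \<le> 0 ==> Arg (z - 1) > pi / 2"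
proof -
 let ?a = "Arg (z - 1)" and ?b = "Arg (z + 1)"
 show a: "0 < ?a" "?a < pi" using Arg_lt_pi[of "z - 1"] assms by auto
 show b: "0 < ?b" "?b < pi" using Arg_lt_pi[of "z + 1"] assms by auto
 have nz: "z - 1 \<noteq> 0" "z + 1 \<noteq> 0" using assms by (auto simp: complex_eq_iff)
 define R where "R = cmod (z - 1) * cmod (z + 1)"
 have R: "R > 0" using nz by (simp add: R_def)
 have "rcis R (?a + ?b) = (z - 1) * (z + 1)" unfolding R_def rcis_mult[symmetric] by (simp add: rcis_cmod_Arg)
 also have "\<dots> = z^2 - 1" by (simp add: power2_eq_square algebra_simps)
 finally have e: "rcis R (?a + ?b) = z^2 - 1" .
 have im: "R * sin (?a + ?b) = 2 * Re z * Im z" using arg_cong[OF e, of Im] by (simp add: Im_power2)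
 have re: "R * cos (?a + ?b) = Re (z^2) - 1" using arg_cong[OF e, of Re] by simp
 show s1: "?a + ?b \<le> pi" if "Re z \<ge> 0"
 proof (rule ccontr)
  assume "\<not> ?thesis"
  then have "R * sin (?a + ?b) < 0" using a b sin_lt_zero R by (simp add: mult_pos_neg)
  moreover have "2 * Re z * Im z \<ge> 0" using that assms by simp
  ultimately show False using im by simp
 qed
 show "?a + ?b \<le> pi / 2" if h: "Re z > 0" "Re (z^2) \<ge> 1"
 proof (rule ccontr)
  assume "\<not> ?thesis"
  then have "R * cos (?a + ?b) < 0" using s1 h cos_lt_zero_pi[of "?a + ?b"] R by (simp add: mult_pos_neg)
  then show False using re h by simp
 qed
 let ?c = "cmod (z - 1) * cos ?a"
 have ra: "?c = Re z - 1" using arg_cong[OF rcis_cmod_Arg[of "z - 1"], of Re] by simp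
 have cm: "cmod (z - 1) > 0" using nz by simp
 show "Re z > 1" if "?a < pi / 2"
 proof -
  have "cos ?a > 0" using that a by (intro cos_gt_zero_pi) auto
  then have "?c > 0" using cm by simp
  then show ?thesis using ra by simp
 qed
 then show "?a \<ge> pi / 2" if "Re z \<le> 1" using that by (meson not_less)
 show "?a > pi / 2" if "Re z \<le> 0"
 proof (rule ccontr)
  assume "\<not> ?thesis"
  then have "cos ?a \<ge> 0" using a by (intro cos_ge_zero) auto
  then have "?c \<ge> 0" by simp
  then show False using ra that by simp
 qed
qed

text \<open>\<theta> lies in (0, 4 pi / 3). Re \<zeta> >= 0 means \<theta> <= pi / 2, and then a
  turn by 2 pi / 3 leads into the left half plane. Re \<xi> < 0 forces \<theta> > pi / 3, and then a
  turn by less than pi / 6, as \<open>HI_rotate\<close> permits, suffices.\<close>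

lemma zeta_facts:
 assumes z: "Im z > 0"
 shows "Re (\<zeta> z) \<ge> 0 ==> Re z > 1 \<and> Re (om * \<zeta> z) < 0"
  and "Re z > 0 ==> Re (z^2) \<ge> 1 ==> Re (\<zeta> z) > 0"
  and "Re z < 0 ==> Re (\<zeta> z) < 0"
  and "Re (\<xi> z) < 0 ==> \<exists>\<alpha>. \<bar>\<alpha>\<bar> < pi / 6 \<and> Re (cis \<alpha> * \<zeta> z) < 0"
  and "0 \<le> Re z ==> Re z \<le> 1 ==> Re (\<xi> z) < 0"
proof -
 note A = Arg_sum_facts[OF z]
 obtain r r' \<theta> where r: "r > 0" "r' > 0" and zt: "\<zeta> z = rcis r \<theta>" and xt: "\<xi> z = rcis r' (3 / 2 * \<theta>)"
  and th: "Arg (z - 1) < \<theta>" "\<theta> < Arg (z - 1) + Arg (z + 1) / 3"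
  by (rule zeta_polar[OF z])
 have th4: "0 < \<theta>" "\<theta> < 4 * pi / 3" using th A(1-4) by auto
 have cneg: "cos x < 0" if "pi / 2 < x" "x < 3 * pi / 2" for x using cos_gt_zero_pi[of "x - pi"] that by simp
 let ?a = "cos (3 / 2 * \<theta>)"
 let ?b = "cos \<theta>"
 let ?c = "Re (\<zeta> z)"
 have rez: "?c = r * ?b" and rex: "Re (\<xi> z) = r' * ?a" unfolding zt xt by simp_all
 show "Re z > 1 \<and> Re (om * \<zeta> z) < 0" if h: "?c \<ge> 0"
 proof -
  have "\<theta> \<le> pi / 2"
  proof (rule ccontr)
   assume "\<not> ?thesis"
   then have "?b < 0" using th4 by (intro cneg) auto
   then have "r * ?b < 0" using r by (simp add: mult_pos_neg)
   then show False using h rez by simp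
  qed
  then have "Re z > 1" using A(7) th by simp
  moreover have "om * \<zeta> z = rcis r (2 * pi / 3 + \<theta>)"
  proof -
   have o: "om = rcis 1 (2 * pi / 3)" by (simp add: om_def rcis_def cis_conv_exp mult_ac)
   show ?thesis unfolding zt o rcis_mult by simp
  qed
  moreover have "cos (2 * pi / 3 + \<theta>) < 0" using \<open>\<theta> \<le> pi / 2\<close> th4 by (intro cneg) auto
  ultimately show ?thesis using r by (simp add: mult_pos_neg)
 qed
 show "?c > 0" if "Re z > 0" "Re (z^2) \<ge> 1"
 proof -
  have "?b > 0" using A(6)[OF that] th th4 by (intro cos_gt_zero_pi) auto
  then show ?thesis unfolding rez using r by simp
 qed
 show "?c < 0" if "Re z < 0"
 proof -
  have "?b < 0" using A(9) that th th4 by (intro cneg) auto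
  then show ?thesis unfolding rez using r by (simp add: mult_pos_neg)
 qed
 show "\<exists>\<alpha>. \<bar>\<alpha>\<bar> < pi / 6 \<and> Re (cis \<alpha> * \<zeta> z) < 0" if h: "Re (\<xi> z) < 0"
 proof -
  have c: "?a < 0" using h r unfolding rex by (simp add: mult_less_0_iff)
  have t1: "\<theta> > pi / 3"
  proof (rule ccontr)
   assume "\<not> ?thesis"
   then have "?a \<ge> 0" using th4 by (intro cos_ge_zero) auto
   then show False using c by simp
  qed
  \<comment> \<open>Midpoint of the interval from max 0 (pi / 2 - \<theta>) to pi / 6, which is
    nonempty since \<theta> > pi / 3.\<close>
  define \<alpha> where "\<alpha> = (pi / 6 + max 0 (pi / 2 - \<theta>)) / 2"
  have al: "0 < \<alpha>" "\<alpha> < pi / 6" "\<alpha> > pi / 2 - \<theta>" unfolding \<alpha>_def using t1 by (auto simp: max_def field_simps)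
  have "cos (\<alpha> + \<theta>) < 0" using al th4 by (intro cneg) auto
  then have "Re (cis \<alpha> * \<zeta> z) < 0" unfolding zt using r by simp (simp add: cos_add)
  then show ?thesis using al by (intro exI[of _ \<alpha>]) auto
 qed
 show "Re (\<xi> z) < 0" if "0 \<le> Re z" "Re z \<le> 1"
 proof -
  have "?a < 0" using th A(1-5) A(8)[OF that(2)] that by (intro cneg) (auto simp: field_simps)
  then show ?thesis unfolding rex using r by (simp add: mult_pos_neg)
 qed
qed

lemma xiI_real:
 assumes "x > -1"
 shows "xiI (of_real x) = of_real (Re (xiI (of_real x)))"
proof -
 let ?a = "%t. csqrt (2 + of_real t * (of_real x - 1))"
 let ?b = "%t. of_real (sqrt t) * ?a t"
 have "cnj (xiI (of_real x)) = integral {0..1} (%t. cnj (?b t))" unfolding xiI_def by (rule integral_cnj)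
 also have "\<dots> = xiI (of_real x)" unfolding xiI_def
 proof (rule integral_cong)
  fix t :: real assume t: "t \<in> {0..1}"
  have n: "2 + complex_of_real t * (of_real x - 1) \<notin> \<real>\<^sub>\<le>\<^sub>0" using assms xi_arg_notin[of "of_real x" t] t by (simp add: cutp_def)
  show "cnj (?b t) = ?b t" by (simp add: cnj_csqrt[OF n])
 qed
 finally show ?thesis by (simp add: Reals_cnj_iff)
qed

lemma xiI_cnj:
 assumes "z \<in> cutp"
 shows "xiI (cnj z) = cnj (xiI z)"
proof -
 let ?a = "%t. cnj (of_real (sqrt t) * csqrt (2 + of_real t * (z - 1)))"
 have "cnj (xiI z) = integral {0..1} ?a" unfolding xiI_def by (rule integral_cnj)
 also have "\<dots> = xiI (cnj z)" unfolding xiI_def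
 proof (rule integral_cong)
  fix t :: real assume t: "t \<in> {0..1}"
  have n: "2 + of_real t * (z - 1) \<notin> \<real>\<^sub>\<le>\<^sub>0" using xi_arg_notin[OF assms] t by simp
  show "?a t = of_real (sqrt t) * csqrt (2 + of_real t * (cnj z - 1))" by (simp add: cnj_csqrt[OF n])
 qed
 finally show ?thesis by simp
qed

lemma zeta_cnj: "z \<in> cutp ==> \<zeta> (cnj z) = cnj (\<zeta> z)"
 unfolding zeta_xiI using xiI_Re_pos[of z] by (simp add: xiI_cnj cnj_powr)

lemma xi_cnj: "Im z \<noteq> 0 ==> \<xi> (cnj z) = cnj (\<xi> z)"
proof -
 assume z: "Im z \<noteq> 0"
 have n: "z - 1 \<notin> \<real>\<^sub>\<le>\<^sub>0" using z by (auto simp: complex_nonpos_Reals_iff)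
 show ?thesis using z cnj_csqrt[OF n] unfolding xi_xiI by (simp add: cutp_def xiI_cnj)
qed

lemma xi_holo: "\<xi> holomorphic_on {z. Im z = 0 \<longrightarrow> Re z > 1}"
proof -
 have "(%z. csqrt (z - 1) ^ 3 * xiI z) holomorphic_on {z. Im z = 0 \<longrightarrow> Re z > 1}"
  by (intro holomorphic_intros holomorphic_on_subset[OF xiI_holo])
   (auto simp: cutp_def complex_nonpos_Reals_iff)
 then show ?thesis by (simp add: xi_xiI[abs_def])
qed

lemma open_xi_dom: "open {z. Im z = 0 \<longrightarrow> Re z > 1}"
proof -
 let ?a = "{z. Im z < 0} \<union> {z. Im z > 0} \<union> {z. Re z > 1}"
 have "{z. Im z = 0 \<longrightarrow> Re z > 1} = ?a" by auto
 moreover have "open ?a" by (intro open_Un open_halfspace_Im_lt open_halfspace_Im_gt open_halfspace_Re_gt)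
 ultimately show ?thesis by simp
qed

section \<open>Monotonicity and symmetry of Re \<xi>\<close>

lemma continuous_on_csqrt_upper: "continuous_on ({w. Im w > 0} \<union> {0}) csqrt" unfolding continuous_on_eq_continuous_within
proof
 fix w let ?b = "{w. Im w > 0} \<union> {0}"
 assume w: "w \<in> ?b"
 show "continuous (at w within ?b) csqrt"
 proof (cases "w = 0")
  case True
  let ?a = "at 0 within ?b"
  have "((%x. sqrt (cmod x)) \<longlongrightarrow> sqrt (cmod 0)) ?a" by (rule tendsto_real_sqrt[OF tendsto_norm[OF tendsto_ident_at]])
  then have "((%x. norm (csqrt x)) \<longlongrightarrow> 0) ?a" by simp
  then have "(csqrt \<longlongrightarrow> 0) ?a" by (rule tendsto_norm_zero_cancel)
  then show ?thesis using True by (simp add: continuous_within)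
 next
  case False
  then have "w \<notin> \<real>\<^sub>\<le>\<^sub>0" using w by (auto simp: complex_nonpos_Reals_iff)
  then show ?thesis by (rule continuous_within_csqrt)
 qed
qed

lemma sqrt_z2m1_upper_continuous: "continuous_on ({w. Im w > 0} \<union> {1}) sqrt_z2m1"
proof -
 let ?a = "continuous_on ({w. Im w > 0} \<union> {1})"
 have 1: "?a (%t. csqrt (t - 1))" by (rule continuous_on_compose2[OF continuous_on_csqrt_upper]) (auto intro!: continuous_intros)
 have 2: "?a (%t. csqrt (t + 1))"
  by (rule continuous_on_compose2[OF continuous_on_csqrt]) (auto intro!: continuous_intros simp: complex_nonpos_Reals_iff)
 show ?thesis using continuous_on_mult[OF 1 2] by (simp only: sqrt_z2m1_def[abs_def])
qed

lemma sqrt_z2m1_upper_holo: "sqrt_z2m1 holomorphic_on {w. Im w > 0}"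
 unfolding sqrt_z2m1_def by (intro holomorphic_intros) (auto simp: complex_nonpos_Reals_iff)

text \<open>Path independence from the triangle 1, z, z'. Its vertex 1 lies on the boundary of the
  upper half plane, where the integrand is continuous but branches.\<close>

lemma xi_diff:
 assumes z: "Im z > 0" and z': "Im z' > 0"
 shows "\<xi> z' - \<xi> z = integral {0..1} (%x. sqrt_z2m1 (linepath z z' x) * (z' - z))"
proof -
 let ?a = "convex hull {1, z, z'}"
 have hull: "?a \<subseteq> {w. Im w > 0} \<union> {1}"
 proof
  fix x assume "x \<in> ?a"
  then obtain c0 p q where pq: "p \<ge> 0" "q \<ge> 0" "c0 + p + q = 1" "x = c0 *\<^sub>R 1 + p *\<^sub>R z + q *\<^sub>R z'"
   unfolding convex_hull_3 by auto
  show "x \<in> {w. Im w > 0} \<union> {1}"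
  proof (cases "p = 0 \<and> q = 0")
   case False
   have nn: "p * Im z \<ge> 0" "q * Im z' \<ge> 0" using pq z z' by auto
   have "p * Im z \<noteq> 0 \<or> q * Im z' \<noteq> 0" using False z z' by simp
   then have "p * Im z + q * Im z' > 0" using nn by linarith
   then show ?thesis using pq(4) by simp
  qed (use pq in simp)
 qed
 have "(sqrt_z2m1 has_contour_integral 0) (linepath 1 z +++ linepath z z' +++ linepath z' 1)"
 proof (rule Cauchy_theorem_triangle_cofinite[where S = "{1}"])
  show "continuous_on ?a sqrt_z2m1" by (rule continuous_on_subset[OF sqrt_z2m1_upper_continuous hull])
  show "sqrt_z2m1 field_differentiable at x" if "x \<in> interior ?a - {1}" for x
   by (rule holomorphic_on_imp_differentiable_at[OF sqrt_z2m1_upper_holo open_halfspace_Im_gt]) (use that hull interior_subset in blast)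
 qed simp
 then have "contour_integral (linepath 1 z) sqrt_z2m1 + contour_integral (linepath z z') sqrt_z2m1 + contour_integral (linepath z' 1) sqrt_z2m1 = 0"
  by (rule has_chain_integral_chain_integral3)
 moreover have "contour_integral (linepath z' 1) sqrt_z2m1 = - contour_integral (linepath 1 z') sqrt_z2m1"
 proof (rule contour_integral_reverse_linepath)
  have "closed_segment z' 1 \<subseteq> ?a" unfolding segment_convex_hull by (rule hull_mono) auto
  then show "continuous_on (closed_segment z' 1) sqrt_z2m1" using continuous_on_subset[OF sqrt_z2m1_upper_continuous] hull by simp
 qed
 ultimately show ?thesis unfolding \<xi>_def contour_integral_integral by (simp add: algebra_simps)
qed

lemma linepath_upper: "Im z > 0 ==> Im z' > 0 ==> x \<in> {0..1} ==> Im (linepath z z' x) > 0"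
proof -
 assume h: "Im z > 0" "Im z' > 0" "x \<in> {0..1}"
 have "closed_segment z z' \<subseteq> {w. Im w > 0}" by (rule closed_segment_subset) (use h in "auto intro: convex_halfspace_Im_gt")
 moreover have "linepath z z' x \<in> closed_segment z z'" using h by (simp add: linepath_in_path)
 ultimately show ?thesis by auto
qed

lemma sqrt_z2m1_upper:
 assumes "Im z > 0"
 shows "Im (sqrt_z2m1 z) > 0" "sqrt_z2m1 (- cnj z) = - cnj (sqrt_z2m1 z)" "Re z < 0 ==> Re (sqrt_z2m1 z) < 0"
proof -
 let ?c = "%z. sqrt_z2m1 z"
 have pos: "Im (?c z) > 0" if "Im z > 0" for z
 proof -
  have "z - 1 \<notin> \<real>\<^sub>\<le>\<^sub>0" "z + 1 \<notin> \<real>\<^sub>\<le>\<^sub>0" using that by (auto simp: complex_nonpos_Reals_iff)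
  then have "Re (csqrt (z - 1)) > 0" "Re (csqrt (z + 1)) > 0" using Re_csqrt_pos by blast+
  moreover have "Im (csqrt (z - 1)) > 0" "Im (csqrt (z + 1)) > 0" by (intro Im_csqrt_pos; use that in simp)+
  ultimately show ?thesis unfolding sqrt_z2m1_def times_complex.sel by (intro add_pos_pos mult_pos_pos)
 qed
 show p: "Im (?c z) > 0" by (rule pos[OF assms])
 have sq: "(sqrt_z2m1 w)^2 = w^2 - 1" for w unfolding sqrt_z2m1_def power_mult_distrib power2_csqrt by (simp add: power2_eq_square algebra_simps)
 let ?a = "sqrt_z2m1 (- cnj z)"
 let ?b = "cnj (?c z)"
 have "?a^2 = ?b^2" by (simp add: sq flip: complex_cnj_power)
 then have "?a = ?b \<or> ?a = - ?b" by (simp add: power2_eq_iff)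
 moreover have "Im ?a > 0" by (rule pos) (use assms in simp)
 ultimately show "?a = - ?b" using p by auto
 show "Re (?c z) < 0" if "Re z < 0"
 proof (rule ccontr)
  assume "\<not> ?thesis"
  then have "2 * Re (?c z) * Im (?c z) \<ge> 0" using p by simp
  moreover have "2 * Re (?c z) * Im (?c z) = 2 * Re z * Im z" using arg_cong[OF sq[of z], of Im] by (simp add: Im_power2)
  moreover have "2 * Re z * Im z < 0" using that assms by (simp add: mult_neg_pos)
  ultimately show False by simp
 qed
qed

lemma sqrt_z2m1_line_integrable:
 assumes "Im z > 0" "Im z' > 0"
 shows "continuous_on {0..1} (%x. sqrt_z2m1 (linepath z z' x) * (z' - z))"
 by (intro continuous_intros continuous_on_compose2[OF sqrt_z2m1_upper_continuous continuous_on_linepath]) (use linepath_upper[OF assms] in auto)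

text \<open>In the second quadrant the root has negative real part, so a step to the left, with
  negative increment, raises Re \<xi>.\<close>

lemma xi_left_mono:
 assumes "Im z > 0" "Re z < 0" "h \<ge> 0"
 shows "Re (\<xi> z) \<le> Re (\<xi> (z - of_real h))"
proof -
 let ?z' = "z - of_real h"
 have z': "Im ?z' > 0" using assms by simp
 let ?a = "%x. Re (sqrt_z2m1 (linepath z ?z' x) * (?z' - z))"
 have "Re (\<xi> ?z' - \<xi> z) = integral {0..1} ?a" unfolding xi_diff[OF assms(1) z']
  using integral_linear[OF integrable_continuous_real[OF sqrt_z2m1_line_integrable[OF assms(1) z']] bounded_linear_Re, symmetric]
  by (simp only: o_def)
 also have "\<dots> \<ge> 0"
 proof (rule integral_nonneg)
  show "?a integrable_on {0..1}" by (intro integrable_continuous_real continuous_intros sqrt_z2m1_line_integrable assms z')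
  fix x :: real assume x: "x \<in> {0..1}"
  have l: "linepath z ?z' x = z - of_real (x * h)" by (simp add: linepath_def scaleR_conv_of_real algebra_simps)
  have "x * h \<ge> 0" using x assms by simp
  then have "Re (sqrt_z2m1 (linepath z ?z' x)) < 0" unfolding l using assms by (intro sqrt_z2m1_upper(3)) auto
  then show "0 \<le> ?a x" using assms by (simp add: mult_nonpos_nonneg)
 qed
 finally show ?thesis by simp
qed

lemma xi_reflect:
 assumes "Im z > 0"
 shows "Re (\<xi> (- cnj z)) = Re (\<xi> z)"
proof -
 have z': "Im (- cnj z) > 0" using assms by simp
 \<comment> \<open>The base point i is fixed by the reflection of z to - cnj z, and the reflection
   conjugates the increments of \<xi> measured from it.\<close>
 have i: "Im \<i> > 0" by simp
 let ?a = "%x. cnj (sqrt_z2m1 (linepath \<i> z x) * (z - \<i>))"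
 have "\<xi> (- cnj z) - \<xi> \<i> = integral {0..1} ?a" unfolding xi_diff[OF i z']
 proof (rule integral_cong)
  fix x :: real assume x: "x \<in> {0..1}"
  have l: "linepath \<i> (- cnj z) x = - cnj (linepath \<i> z x)" by (simp add: linepath_def)
  show "sqrt_z2m1 (linepath \<i> (- cnj z) x) * (- cnj z - \<i>) = ?a x"
   unfolding l sqrt_z2m1_upper(2)[OF linepath_upper[OF i assms x]] by (simp add: algebra_simps)
 qed
 also have "\<dots> = cnj (\<xi> z - \<xi> \<i>)" unfolding xi_diff[OF i assms] by (rule integral_cnj[symmetric])
 finally have "Re (\<xi> (- cnj z) - \<xi> \<i>) = Re (\<xi> z - \<xi> \<i>)" by simp
 then show ?thesis by simp
qed

lemma xi_strip_neg:
 assumes "Im z \<noteq> 0" "\<bar>Re z\<bar> \<le> 1"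
 shows "Re (\<xi> z) < 0"
proof -
 have up: "Re (\<xi> z) < 0" if h: "Im z > 0" "\<bar>Re z\<bar> \<le> 1" for z
 proof (cases "Re z \<ge> 0")
  case True then show ?thesis using zeta_facts(5)[OF h(1)] h(2) by simp
 next
  case False
  then show ?thesis using zeta_facts(5)[of "- cnj z"] h xi_reflect[OF h(1)] by simp
 qed
 show ?thesis
 proof (cases "Im z > 0")
  case False
  then have "Re (\<xi> (cnj z)) < 0" using assms by (intro up) auto
  then show ?thesis using xi_cnj[OF assms(1)] by simp
 qed (use up assms in simp)
qed

lemma xi_real_pos:
 assumes "x > 1"
 shows "Re (\<xi> (of_real x)) > 0"
proof -
 have "Re (xiI (of_real x)) > 0" using assms by (intro xiI_Re_pos) (simp add: cutp_def)
 then show ?thesis using assms unfolding xi_xiI by (subst xiI_real) (auto simp flip:)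
qed

text \<open>On [-1,1] the root is purely imaginary, hence so is \<xi>(-1): the boundary curves
  belong to the level 0.\<close>

lemma xi_minus1: "Re (\<xi> (-1)) = 0"
proof -
 let ?a = "%x. linepath 1 (-1) x"
 let ?b = "integral {0..1}"
 have "\<xi> (-1) = ?b (%x. sqrt_z2m1 (?a x) * (-1 - 1))" unfolding \<xi>_def contour_integral_integral by simp
 also have "\<dots> = ?b (%x. \<i> * of_real (- 2 * (sqrt (2 * x) * sqrt (2 - 2 * x))))"
 proof (rule integral_cong)
  fix x :: real assume x: "x \<in> {0..1}"
  have l: "?a x - 1 = complex_of_real (- (2 * x))" "?a x + 1 = complex_of_real (2 - 2 * x)" by (simp_all add: linepath_def scaleR_conv_of_real)
  show "sqrt_z2m1 (?a x) * (-1 - 1) = \<i> * of_real (- 2 * (sqrt (2 * x) * sqrt (2 - 2 * x)))" using x unfolding sqrt_z2m1_def l by simp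
 qed
 also have "\<dots> = \<i> * ?b (%x. of_real (- 2 * (sqrt (2 * x) * sqrt (2 - 2 * x))))" by simp
 also have "?b (%x. complex_of_real (- 2 * (sqrt (2 * x) * sqrt (2 - 2 * x)))) =
   of_real (?b (%x. - 2 * (sqrt (2 * x) * sqrt (2 - 2 * x))))"
  by (intro integral_unique has_integral_of_real integrable_integral integrable_continuous_real continuous_intros)
 finally show ?thesis by simp
qed

section \<open>The domain\<close>

text \<open>Explicit form of \<open>Zdom\<close>; \<open>Sdom\<close> is the region on the far side
  of the boundary curves. Off the real axis the sign of Re \<xi> tells the two apart in the left
  half plane.\<close>

definition Tdom :: "complex set" where
 "Tdom = {z. Re z < 0 \<longrightarrow> (if Im z = 0 then Re z > -1 else Re (\<xi> z) < 0)}"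

definition Sdom :: "complex set" where
 "Sdom = {z. Re z < 0 \<and> (if Im z = 0 then Re z < -1 else Re (\<xi> z) > 0)}"

lemma Tdom_Sdom: "Tdom \<inter> Sdom = {}" "- level_curves = Tdom \<union> Sdom"
 by (auto simp: Tdom_def Sdom_def level_curves_def xi_minus1 complex_eq_iff split:)

lemma Tdom_cnj: "cnj z \<in> Tdom \<longleftrightarrow> z \<in> Tdom" by (auto simp: Tdom_def xi_cnj)

lemma open_nonreal_xi: "open {z. Re z < 0 \<and> Im z \<noteq> 0 \<and> Re (\<xi> z) < 0}"
 and open_nonreal_xi': "open {z. Re z < 0 \<and> Im z \<noteq> 0 \<and> Re (\<xi> z) > 0}"
proof -
 let ?U = "{z. Re z < 0} \<inter> ({z. Im z < 0} \<union> {z. Im z > 0})"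
 have U: "open ?U" by (intro open_Int open_Un open_halfspace_Re_lt open_halfspace_Im_lt open_halfspace_Im_gt)
 have c: "continuous_on ?U (%z. Re (\<xi> z))"
  by (intro continuous_intros holomorphic_on_imp_continuous_on holomorphic_on_subset[OF xi_holo]) auto
 have "open (?U \<inter> (%z. Re (\<xi> z)) -` {..<0})" "open (?U \<inter> (%z. Re (\<xi> z)) -` {0<..})"
  by (rule continuous_open_preimage[OF c U open_lessThan], rule continuous_open_preimage[OF c U open_greaterThan])
 moreover have "?U \<inter> (%z. Re (\<xi> z)) -` {..<0} = {z. Re z < 0 \<and> Im z \<noteq> 0 \<and> Re (\<xi> z) < 0}"
  "?U \<inter> (%z. Re (\<xi> z)) -` {0<..} = {z. Re z < 0 \<and> Im z \<noteq> 0 \<and> Re (\<xi> z) > 0}" by auto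
 ultimately show "open {z. Re z < 0 \<and> Im z \<noteq> 0 \<and> Re (\<xi> z) < 0}" "open {z. Re z < 0 \<and> Im z \<noteq> 0 \<and> Re (\<xi> z) > 0}" by auto
qed

lemma open_Tdom: "open Tdom"
proof -
 let ?a = "{z. Re z > -1} \<inter> {z. Re z < 1}"
 let ?b = "?a \<union> {z. Re z > 0} \<union> {z. Re z < 0 \<and> Im z \<noteq> 0 \<and> Re (\<xi> z) < 0}"
 have "Tdom = ?b" using xi_strip_neg by (fastforce simp: Tdom_def split: if_splits)
 moreover have "open ?b" by (intro open_Int open_Un open_halfspace_Re_lt open_halfspace_Re_gt open_nonreal_xi)
 ultimately show ?thesis by simp
qed

text \<open>A real point p < -1 lies on the cut of \<xi>. Reflection moves the upper half of a
  neighbourhood to one of - p > 1, where \<xi> is analytic with positive real part, and the lower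
  half follows by conjugation.\<close>

lemma open_Sdom: "open Sdom"
proof (subst open_subopen, intro ballI)
 fix p assume p: "p \<in> Sdom"
 show "\<exists>T. open T \<and> p \<in> T \<and> T \<subseteq> Sdom"
 proof (cases "Im p = 0")
  case False
  then show ?thesis using p open_nonreal_xi'
   by (intro exI[of _ "{z. Re z < 0 \<and> Im z \<noteq> 0 \<and> Re (\<xi> z) > 0}"]) (auto simp: Sdom_def)
 next
  case True
  then have px: "Re p < -1" using p by (simp add: Sdom_def)
  define x where "x = - Re p"
  have x: "x > 1" "p = - of_real x" using px True by (auto simp: x_def complex_eq_iff)
  let ?D = "{z. Im z = 0 \<longrightarrow> Re z > 1}"
  have "continuous_on ?D (%z. Re (\<xi> z))" by (intro continuous_intros holomorphic_on_imp_continuous_on xi_holo)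
  then have o: "open (?D \<inter> (%z. Re (\<xi> z)) -` {0<..})" by (rule continuous_open_preimage[OF _ open_xi_dom open_greaterThan])
  moreover have "of_real x \<in> ?D \<inter> (%z. Re (\<xi> z)) -` {0<..}" using x xi_real_pos by simp
  ultimately obtain e where e: "e > 0" "ball (of_real x) e \<subseteq> ?D \<inter> (%z. Re (\<xi> z)) -` {0<..}"
   using open_contains_ball by blast
  define e' where "e' = min e (x - 1)"
  have e': "e' > 0" "e' \<le> e" "e' \<le> x - 1" using e x by (auto simp: e'_def)
  have up: "Re (\<xi> z) > 0" if z: "z \<in> ball p e'" "Im z > 0" for z
  proof -
   have "dist (of_real x) (- cnj z) = dist p z"
   proof -
    have "of_real x - - cnj z = cnj (of_real x + z)" by simp
    moreover have "p - z = - (of_real x + z)" unfolding x(2) by simp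
    ultimately show ?thesis unfolding dist_norm by (simp only: norm_minus_cancel complex_mod_cnj)
   qed
   then have "- cnj z \<in> ball (of_real x) e" using z e' by simp
   then show ?thesis using e xi_reflect[OF z(2)] by auto
  qed
  have "ball p e' \<subseteq> Sdom"
  proof
   fix z assume z: "z \<in> ball p e'"
   have "Re z < -1"
   proof -
    have "\<bar>Re (z - p)\<bar> \<le> norm (z - p)" by (rule abs_Re_le_cmod)
    then show ?thesis using z e' by (simp add: dist_norm norm_minus_commute x_def)
   qed
   moreover have "Re (\<xi> z) > 0" if "Im z \<noteq> 0"
   proof (cases "Im z > 0")
    case False
    have "dist p (cnj z) = dist p z" using True by (simp add: dist_norm cmod_def)
    then have "Re (\<xi> (cnj z)) > 0" using False that z by (intro up) auto
    then show ?thesis using xi_cnj[OF that] by simp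
   qed (use up z in blast)
   ultimately show "z \<in> Sdom" by (auto simp: Sdom_def)
  qed
  then show ?thesis using e' by (intro exI[of _ "ball p e'"]) auto
 qed
qed

text \<open>By \<open>xi_left_mono\<close>, Re \<xi> does not increase to the right in the second
  quadrant, so it stays negative until the imaginary axis is reached.\<close>

lemma Tdom_right:
 assumes "z \<in> Tdom" "h \<ge> 0"
 shows "z + of_real h \<in> Tdom"
proof -
 have up: "z + of_real h \<in> Tdom" if z: "z \<in> Tdom" "Im z > 0" for z
 proof (cases "Re z + h < 0")
  case True
  have "Re (\<xi> (z + of_real h)) \<le> Re (\<xi> (z + of_real h - of_real h))" by (rule xi_left_mono) (use z True assms(2) in auto)
  then show ?thesis using z assms(2) by (auto simp: Tdom_def)
 qed (auto simp: Tdom_def)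
 consider "Im z > 0" | "Im z = 0" | "Im z < 0" by linarith
 then show ?thesis
 proof cases
  case 2
  then show ?thesis using assms by (auto simp: Tdom_def)
 next
  case 3
  have "cnj (z + of_real h) \<in> Tdom" using up[of "cnj z"] 3 assms(1) Tdom_cnj by simp
  then show ?thesis using Tdom_cnj by blast
 qed (use up assms in blast)
qed

text \<open>\<open>Tdom\<close> and \<open>Sdom\<close> are open, disjoint and cover the complement
  of the curves, so the component of 1 stays in \<open>Tdom\<close>. Conversely a horizontal segment
  joins each point of \<open>Tdom\<close> to the closed right half plane.\<close>

lemma Zdom_Tdom: "Zdom = Tdom"
proof
 have con: "connected Zdom" unfolding Zdom_def by simp
 have sub: "Zdom \<subseteq> Tdom \<union> Sdom" unfolding Zdom_def using connected_component_subset Tdom_Sdom(2) by blast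
 have "1 \<in> Zdom" unfolding Zdom_def by (auto simp: level_curves_def)
 moreover have "1 \<in> Tdom" by (simp add: Tdom_def)
 ultimately show "Zdom \<subseteq> Tdom" using connectedD[OF con open_Tdom open_Sdom] Tdom_Sdom(1) sub by auto
 show "Tdom \<subseteq> Zdom"
 proof
  fix p assume p: "p \<in> Tdom"
  have RH: "{z. Re z \<ge> 0} \<subseteq> Zdom" unfolding Zdom_def
   by (rule connected_component_maximal) (auto intro!: convex_connected convex_halfspace_Re_ge simp: level_curves_def)
  define q where "q = p + of_real \<bar>Re p\<bar>"
  let ?a = "closed_segment p q"
  have "?a \<subseteq> Tdom"
  proof
   fix x assume "x \<in> ?a"
   then obtain s where s: "0 \<le> s" "x = (1 - s) *\<^sub>R p + s *\<^sub>R q" unfolding closed_segment_def by blast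
   show "x \<in> Tdom" using Tdom_right[OF p, of "s * \<bar>Re p\<bar>"] s unfolding q_def by (simp add: scaleR_conv_of_real algebra_simps)
  qed
  then have seg: "?a \<subseteq> - level_curves" using Tdom_Sdom(2) by auto
  have "q \<in> Zdom" using RH by (auto simp: q_def)
  moreover have "connected_component (- level_curves) q p" unfolding connected_component_def using seg by (intro exI[of _ "?a"]) auto
  ultimately show "p \<in> Zdom" unfolding Zdom_def using connected_component_trans by (simp, blast)
 qed
qed

lemma open_Zdom: "open Zdom" by (simp add: Zdom_Tdom open_Tdom)

lemma connected_Zdom: "connected Zdom" unfolding Zdom_def by simp

lemma Zdom_cutp: "Zdom \<subseteq> cutp" by (auto simp: Zdom_Tdom Tdom_def cutp_def split:)

lemma Zdom_right_half: "Re z \<ge> 0 ==> z \<in> Zdom" by (simp add: Zdom_Tdom Tdom_def)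

text \<open>If p were not in \<open>Zdom\<close>, the whole ray from p to the left would avoid
  \<open>Zdom\<close> by \<open>Tdom_right\<close>, hence avoid X. It is connected and unbounded, so
  p could not be inside X.\<close>

lemma inside_Zdom:
 assumes "X \<subseteq> Zdom"
 shows "inside X \<subseteq> Zdom"
proof
 fix p assume p: "p \<in> inside X"
 show "p \<in> Zdom"
 proof (rule ccontr)
  assume np: "p \<notin> Zdom"
  define L where "L = (%h. p - of_real h) ` {0::real..}"
  have "L \<subseteq> - X"
  proof
   fix x assume "x \<in> L"
   then obtain h where h: "h \<ge> 0" "x = p - of_real h" by (auto simp: L_def)
   show "x \<in> - X" using Tdom_right[of x h] h np assms Zdom_Tdom by auto
  qed
  moreover have "connected L" unfolding L_def by (intro connected_continuous_image continuous_intros) auto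
  moreover have "p \<in> L" unfolding L_def by rule auto
  ultimately have "L \<subseteq> connected_component_set (- X) p" by (intro connected_component_maximal)
  then obtain B where B: "\<forall>x\<in>L. norm x \<le> B" using p unfolding inside_def bounded_iff by blast
  let ?a = "\<bar>B\<bar> + norm p + 1"
  have "p - of_real ?a \<in> L" unfolding L_def by (intro imageI) simp
  then have "norm (p - of_real ?a) \<le> B" using B by simp
  moreover have "norm (complex_of_real ?a) \<le> norm (p - of_real ?a) + norm p"
   using norm_triangle_ineq2[of "of_real ?a" p] by (simp add: norm_minus_commute)
  moreover have "norm (complex_of_real ?a) = \<bar>B\<bar> + norm p + 1" unfolding norm_of_real by simp
  ultimately show False by simp
 qed
qed

section \<open>Logarithms and fourth roots of \<zeta>\<close>

definition hz :: "complex => complex" where "hz z = (3/2 * xiI z) powr (2/3)"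

lemma zeta_hz: "\<zeta> z = (z - 1) * hz z" by (simp add: zeta_xiI hz_def)

lemma xiI_not_nonpos: "z \<in> cutp ==> 3/2 * xiI z \<notin> \<real>\<^sub>\<le>\<^sub>0"
 using xiI_Re_pos[of z] by (auto simp: complex_nonpos_Reals_iff)

lemma hz_nz: "z \<in> cutp ==> hz z \<noteq> 0" using xiI_Re_pos[of z] by (auto simp: hz_def)

lemma hz_holo: "hz holomorphic_on cutp" unfolding hz_def[abs_def] by (intro holomorphic_intros xiI_holo xiI_not_nonpos)

lemma zeta_holo: "\<zeta> holomorphic_on cutp" unfolding zeta_hz[abs_def] by (intro holomorphic_intros hz_holo)

lemma zeta_nz: "z \<in> cutp ==> z \<noteq> 1 ==> \<zeta> z \<noteq> 0" by (simp add: zeta_hz hz_nz)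

lemma xi_nz: "z \<in> cutp ==> z \<noteq> 1 ==> \<xi> z \<noteq> 0" using xiI_Re_pos[of z] by (auto simp: xi_xiI)

lemma cutp_plus1: "z \<in> cutp ==> z + 1 \<notin> \<real>\<^sub>\<le>\<^sub>0" by (auto simp: cutp_def complex_nonpos_Reals_iff)

lemma Ln_hz:
 assumes "z \<in> cutp"
 shows "Ln (hz z) = 2/3 * Ln (3/2 * xiI z)"
proof -
 have w: "Re (3/2 * xiI z) > 0" using xiI_Re_pos[OF assms] by simp
 then have nz: "3/2 * xiI z \<noteq> 0" by auto
 have "\<bar>Im (Ln (3/2 * xiI z))\<bar> < pi / 2" using Re_Ln_pos_lt[OF nz] w by simp
 moreover have "hz z = exp (2/3 * Ln (3/2 * xiI z))" unfolding hz_def powr_def using nz by simp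
 ultimately show ?thesis by simp
qed

text \<open>In the upper half plane the argument of \<open>hz\<close> is \<theta> - arg (z - 1),
  which lies between 0 and arg (z + 1) / 3. The bound pi makes the logarithm of hz / (z + 1) the
  difference of the logarithms.\<close>

lemma hz_arg:
 assumes "z \<in> cutp"
 shows "\<bar>Im (Ln (hz z)) - Im (Ln (z + 1))\<bar> < pi"
proof -
 have up: "\<bar>Im (Ln (hz z)) - Im (Ln (z + 1))\<bar> < pi" if z: "Im z > 0" for z
 proof -
  have zc: "z \<in> cutp" using z by (simp add: cutp_def)
  let ?a = "Arg (z - 1)"
  obtain r r' \<theta> where r: "r > 0" "\<zeta> z = rcis r \<theta>"
   and th: "?a < \<theta>" "\<theta> < ?a + Arg (z + 1) / 3"
   by (rule zeta_polar[OF z])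
  note A = Arg_sum_facts[OF z]
  have z1: "z - 1 \<noteq> 0" "z + 1 \<noteq> 0" using z by (auto simp: complex_eq_iff)
  have "hz z = rcis r \<theta> / rcis (cmod (z - 1)) ?a" unfolding rcis_cmod_Arg r(2)[symmetric] zeta_hz using z1 by simp
  also have "\<dots> = rcis (r / cmod (z - 1)) (\<theta> - ?a)" by (rule rcis_divide)
  finally have "Arg (hz z) = \<theta> - ?a" using A th r z1 by (simp add: Arg_rcis)
  then have "Im (Ln (hz z)) = \<theta> - ?a" using hz_nz[OF zc] by (simp add: Arg_def)
  moreover have "Im (Ln (z + 1)) = Arg (z + 1)" using z1 by (simp add: Arg_def)
  ultimately show ?thesis using A th by simp
 qed
 consider "Im z > 0" | "Im z = 0" | "Im z < 0" by linarith
 then show ?thesis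
 proof cases
  case 2
  then have zr: "z = of_real (Re z)" "Re z > -1" using assms by (auto simp: cutp_def complex_eq_iff)
  have x: "xiI z = of_real (Re (xiI z))" using xiI_real[OF zr(2)] zr(1) by simp
  have "3/2 * xiI z = of_real (3/2 * Re (xiI z))" using arg_cong[OF x, of "%w. 3/2 * w"] by simp
  then have "Im (Ln (hz z)) = 0" using xiI_Re_pos[OF assms] unfolding Ln_hz[OF assms] by (simp only: Ln_of_real) simp
  moreover have "z + 1 = of_real (Re z + 1)" using zr(1) by simp
  then have "Im (Ln (z + 1)) = 0" using zr(2) by (simp only: Ln_of_real) simp
  ultimately show ?thesis by simp
 next
  case 3
  have z': "cnj z \<in> cutp" using 3 by (simp add: cutp_def)
  have "Ln (hz (cnj z)) = cnj (Ln (hz z))"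
   unfolding Ln_hz[OF assms] Ln_hz[OF z'] xiI_cnj[OF assms] using cnj_Ln[OF xiI_not_nonpos[OF assms]] by simp
  then have 1: "Im (Ln (hz (cnj z))) = - Im (Ln (hz z))" by simp
  have "Ln (cnj z + 1) = cnj (Ln (z + 1))" using cnj_Ln[OF cutp_plus1[OF assms]] by simp
  then have 2: "Im (Ln (cnj z + 1)) = - Im (Ln (z + 1))" by simp
  show ?thesis using up[of "cnj z"] 3 1 2 by simp
 qed (use up in blast)
qed

text \<open>The right-hand side is analytic at z = 1 too, but there \<zeta> / (z^2 - 1) is 0 / 0 =
  0, so the left-hand side is 0 and the formula fails.\<close>

lemma quot_root4_alt:
 assumes "z \<in> cutp" "z \<noteq> 1"
 shows "quot_root4 z = exp ((Ln (hz z) - Ln (z + 1)) / 4)"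
proof -
 have z1: "z + 1 \<noteq> 0" using cutp_plus1[OF assms(1)] by auto
 have f: "z^2 - 1 = (z - 1) * (z + 1)" by (simp add: power2_eq_square algebra_simps)
 have q: "\<zeta> z / (z^2 - 1) = hz z / (z + 1)" unfolding zeta_hz f using assms by simp
 have e: "hz z / (z + 1) = exp (Ln (hz z) - Ln (z + 1))" using hz_nz[OF assms(1)] z1 by (simp add: exp_diff)
 have "Ln (hz z / (z + 1)) = Ln (hz z) - Ln (z + 1)" unfolding e by rule (use hz_arg[OF assms(1)] in "auto")
 then show ?thesis unfolding quot_root4_def q powr_def using hz_nz[OF assms(1)] z1 by simp
qed

lemma quot_root4_holo: "quot_root4 holomorphic_on cutp - {1}"
proof -
 have "(%z. exp ((2/3 * Ln (3/2 * xiI z) - Ln (z + 1)) / 4)) holomorphic_on cutp - {1}"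
  by (intro holomorphic_intros holomorphic_on_subset[OF xiI_holo]) (use xiI_not_nonpos cutp_plus1 in auto)
 then show ?thesis by (rule holomorphic_transform) (auto simp: quot_root4_alt Ln_hz)
qed

text \<open>With all roots written as exponentials of logarithms the identity becomes linear. It
  explains the weight 1 / \<zeta>^(3/2) in the second term of \<open>J\<close>: it converts the
  prefactor of \<open>B\<close> into that of \<open>A\<close>.\<close>

lemma root4_identity:
 assumes "z \<in> cutp" "z \<noteq> 1"
 shows "quot_root4 z * \<zeta>_root4 z * z2m1_root4 z * \<zeta> z = 3/2 * \<xi> z"
  and "quot_root4 z \<noteq> 0" "\<zeta>_root4 z \<noteq> 0" "z2m1_root4 z \<noteq> 0"
proof -
 have z1: "z - 1 \<noteq> 0" "z + 1 \<noteq> 0" using assms cutp_plus1[OF assms(1)] by auto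
 have w0: "3/2 * xiI z \<noteq> 0" using xiI_not_nonpos[OF assms(1)] by auto
 have h: "hz z \<noteq> 0" by (rule hz_nz[OF assms(1)])
 let ?a = "exp (Ln (z - 1) / 4)"
 have zr: "\<zeta>_root4 z = ?a * exp (Ln (hz z) / 4)" unfolding \<zeta>_root4_def zeta_hz using z1 h by (simp add: powr_def)
 have z2: "z2m1_root4 z = ?a * exp (Ln (z + 1) / 4)" unfolding z2m1_root4_def using z1 by (simp add: powr_def)
 have c: "csqrt (z - 1) = exp (Ln (z - 1) / 2)" by (rule csqrt_exp_Ln[OF z1(1)])
 have e1: "z - 1 = exp (Ln (z - 1))" using z1 by simp
 have e2: "hz z = exp (Ln (hz z))" using h by simp
 let ?b = "quot_root4 z * \<zeta>_root4 z * z2m1_root4 z * \<zeta> z"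
 have "?b =
   exp ((Ln (hz z) - Ln (z + 1)) / 4) * (?a * exp (Ln (hz z) / 4)) * (?a * exp (Ln (z + 1) / 4)) * (exp (Ln (z - 1)) * exp (Ln (hz z)))"
  unfolding quot_root4_alt[OF assms] zr z2 zeta_hz using e1 e2 by simp
 also have "\<dots> = exp (3 * (Ln (z - 1) / 2) + 3/2 * Ln (hz z))" unfolding mult_exp_exp by (rule arg_cong[of _ _ exp]) (simp add: field_simps)
 also have "\<dots> = csqrt (z - 1) ^ 3 * exp (Ln (3/2 * xiI z))"
  unfolding c exp_add Ln_hz[OF assms(1)] using exp_of_nat_mult[of 3 "Ln (z - 1) / 2"] by simp
 also have "exp (Ln (3/2 * xiI z)) = 3/2 * xiI z" using w0 by simp
 finally show "?b = 3/2 * \<xi> z" unfolding xi_xiI by simp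
 show "quot_root4 z \<noteq> 0" "\<zeta>_root4 z \<noteq> 0" "z2m1_root4 z \<noteq> 0" unfolding quot_root4_alt[OF assms] zr z2 by simp_all
qed

section \<open>The coefficients\<close>

lemma entire_primitive:
 fixes f :: "complex => complex"
 assumes "f holomorphic_on UNIV"
 shows "\<exists>P. P holomorphic_on UNIV \<and> (\<forall>z. (P has_field_derivative f z) (at z)) \<and>
  (\<forall>a b. contour_integral (linepath a b) f = P b - P a)"
proof -
 obtain P where P: "\<And>z. (P has_field_derivative f z) (at z)" using holomorphic_convex_primitive'[OF convex_UNIV open_UNIV assms] by auto
 have "contour_integral (linepath a b) f = P b - P a" for a b
  using contour_integral_unique[OF contour_integral_primitive[of UNIV P f "linepath a b"]] P by auto
 moreover have "P holomorphic_on UNIV" using P by (auto simp: holomorphic_on_open)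
 ultimately show ?thesis using P by auto
qed

lemma deriv_parity:
 fixes f :: "complex => complex"
 assumes f: "f holomorphic_on UNIV" and p: "\<And>b. f (- b) = c * f b"
 shows "deriv f (- b) = - c * deriv f b"
proof -
 have D: "(f has_field_derivative deriv f x) (at x)" for x using holomorphic_derivI[OF f open_UNIV UNIV_I] .
 have 1: "((%x. f (- x)) has_field_derivative deriv f (- b) * - 1) (at b)"
  by (rule DERIV_chain2[where g = "%x. - x", OF D]) (auto intro!: derivative_eq_intros)
 have 2: "((%x. f (- x)) has_field_derivative c * deriv f b) (at b)" unfolding p by (rule DERIV_cmult[OF D])
 have "- deriv f (- b) = c * deriv f b" using DERIV_unique[OF 1 2] by simp
 then show ?thesis by (metis minus_minus mult_minus_left)
qed

text \<open>The derivative of E_j has parity opposite to j, so the integrand g has the parity of k =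
  s - 1 and its primitives have the parity of s up to a constant.\<close>

lemma E_holo_parity: "E s holomorphic_on UNIV \<and> (\<forall>b. E s (- b) = (-1) ^ s * E s b)"
proof (induction s rule: less_induct)
 case (less s)
 consider "s = 0" | "s = 1" | "s = 2" | n where "s = Suc (Suc (Suc n))" by (cases rule: E.cases) auto
 then show ?case
 proof cases
  case 1
  then show ?thesis by simp
 next
  case 2
  then show ?thesis by (auto intro!: holomorphic_intros)
 next
  case 3
  then have s2: "s = Suc (Suc 0)" by simp
  show ?thesis unfolding s2 by (auto intro!: holomorphic_intros)
 next
  case 4
  define k where "k = Suc (Suc n)"
  have IHh: "E j holomorphic_on UNIV" and IHp: "\<And>b. E j (- b) = (-1) ^ j * E j b" if "j \<le> k" for j
   using less.IH[of j] that 4 by (auto simp: k_def)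
  let ?a = "%j. deriv (E (k - j))"
  let ?d = "%j p. deriv (E j) p * ?a j p"
  define g where "g = (%p. (p^2 - 1)^2 * (\<Sum>j=1..Suc n. ?d j p))"
  have gh: "g holomorphic_on UNIV" unfolding g_def by (intro holomorphic_intros holomorphic_deriv IHh) (auto simp: k_def)
  have dp: "deriv (E j) (- p) = - ((-1) ^ j) * deriv (E j) p" if "j \<le> k" for j p by (rule deriv_parity[OF IHh[OF that] IHp[OF that]])
  have gp: "g (- p) = (-1) ^ k * g p" for p
  proof -
   have "(\<Sum>j=1..Suc n. deriv (E j) (- p) * ?a j (- p)) = (\<Sum>j=1..Suc n. (-1) ^ k * (?d j p))"
   proof (rule sum.cong[OF refl])
    fix j assume j: "j \<in> {1..Suc n}"
    have jk: "j \<le> k" "k - j \<le> k" using j by (auto simp: k_def)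
    show "deriv (E j) (- p) * ?a j (- p) = (-1) ^ k * (?d j p)" using jk unfolding dp[OF jk(1)] dp[OF jk(2)] by (simp flip: power_add)
   qed
   also have "\<dots> = (-1) ^ k * (\<Sum>j=1..Suc n. ?d j p)" by (rule sum_distrib_left[symmetric])
   finally show ?thesis unfolding g_def power2_minus by (simp only: mult.left_commute)
  qed
  obtain P where P: "P holomorphic_on UNIV" "\<And>z. (P has_field_derivative g z) (at z)"
   "\<And>a b. contour_integral (linepath a b) g = P b - P a"
   using entire_primitive[OF gh] by auto
  define \<sigma> :: complex where "\<sigma> = (if odd k then 1 else 0)"
  have Es: "E s = (%b. 1/2 * (b^2 - 1)^2 * deriv (E k) b + 1/2 * (P b - P \<sigma>))"
   unfolding 4 E.simps unfolding k_def[symmetric] \<sigma>_def[symmetric] unfolding g_def[symmetric] P(3) ..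
  have Pp: "P (- b) = (-1) ^ Suc k * P b + (1 - (-1) ^ Suc k) * P 0" for b
  proof -
   let ?e = "%b. P (- b) - (-1) ^ Suc k * P b"
   let ?b = "%b. ?e b"
   have D: "(?b has_field_derivative (g (- b) * - 1 - (-1) ^ Suc k * g b)) (at b within UNIV)" for b
   proof -
    have m: "((%x. - x) has_field_derivative -1) (at b)" for b :: complex by (auto intro!: derivative_eq_intros)
    have "((%b. P (- b)) has_field_derivative (g (- b) * - 1)) (at b)"
     by (rule DERIV_chain2[where f = P and g = "%x. - x", OF P(2) m])
    then show ?thesis by (intro DERIV_diff DERIV_cmult P(2))
   qed
   have "(?b has_field_derivative 0) (at b within UNIV)" for b using D[of b] unfolding gp by simp
   then have "\<exists>c. \<forall>b\<in>UNIV. ?e b = c" by (intro has_field_derivative_zero_constant[OF convex_UNIV])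
   then obtain c where c: "\<And>b. ?e b = c" by auto
   show ?thesis using c[of 0] c[of b] by (simp add: algebra_simps)
  qed
  have par: "P (- b) - P \<sigma> = (-1) ^ s * (P b - P \<sigma>)" for b
  \<comment> \<open>For odd k a primitive of g is even with any lower limit, here 1. For even k it
    is odd when it vanishes at 0, and accordingly the lower limit is 0.\<close>
  proof (cases "odd k")
   case True
   then show ?thesis using 4 unfolding Pp by (auto simp: k_def)
  next
   case False
   then show ?thesis using 4 unfolding Pp by (auto simp: k_def \<sigma>_def)
  qed
  have sk: "(-1) ^ s = - ((-1::complex) ^ k)" using 4 by (simp add: k_def)
  have "E s holomorphic_on UNIV" unfolding Es by (intro holomorphic_intros holomorphic_deriv IHh P(1)) auto
  moreover have "E s (- b) = (-1) ^ s * E s b" for b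
  unfolding Es par dp[OF order_refl] sk by (simp add: field_simps)
  ultimately show ?thesis by simp
 qed
qed

lemmas E_holo = E_holo_parity[THEN conjunct1]

lemmas E_parity = E_holo_parity[THEN conjunct2, rule_format]

lemma E_compose_holo [holomorphic_intros]:
 "f holomorphic_on S ==> (%z. E s (f z)) holomorphic_on S"
 using holomorphic_on_compose_gen[OF _ E_holo, of f S s] by (auto simp: o_def)

text \<open>The factors of \<open>J\<close> as functions of \<open>\<beta>\<close>, \<open>\<xi>\<close>, \<open>\<zeta>\<close> and \<open>v = 1/u\<close>. Across the cut \<open>(-1,1)\<close> both \<open>\<beta>\<close> and
 \<open>\<xi>\<close> change sign, which leaves the first factor invariant and changes the sign of the second.\<close>

definition ecG :: "nat => complex => complex => complex => complex" where
 "ecG m v b x = exp (\<Sum>s=1..m. (E (2 * s) b + (-1) ^ (2 * s) * a_tilde (2 * s) / of_nat (2 * s) / x ^ (2 * s)) * v ^ (2 * s))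
   * cosh (\<Sum>s=0..m. (E (2 * s + 1) b + (-1) ^ (2 * s + 1) * a_tilde (2 * s + 1) / of_nat (2 * s + 1) / x ^ (2 * s + 1)) * v ^ (2 * s + 1))"

definition esG :: "nat => complex => complex => complex => complex" where
 "esG m v b x = exp (\<Sum>s=1..m. (E (2 * s) b + (-1) ^ (2 * s) * a_coeff (2 * s) / of_nat (2 * s) / x ^ (2 * s)) * v ^ (2 * s))
   * sinh (\<Sum>s=0..m. (E (2 * s + 1) b + (-1) ^ (2 * s + 1) * a_coeff (2 * s + 1) / of_nat (2 * s + 1) / x ^ (2 * s + 1)) * v ^ (2 * s + 1))"

lemma exp_cosh_ecG: "exp_cosh m u z = ecG m (1 / of_real u) (\<beta> z) (\<xi> z)"
 unfolding exp_cosh_def ecG_def calE_tilde_def by (simp only: power_inverse divide_inverse mult_1)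

lemma exp_sinh_esG: "exp_sinh m u z = esG m (1 / of_real u) (\<beta> z) (\<xi> z)"
 unfolding exp_sinh_def esG_def calE_def by (simp only: power_inverse divide_inverse mult_1)

lemma even_term_minus:
 "(E (2 * s) (- b) + a / (- x) ^ (2 * s)) = (E (2 * s) b + a / x ^ (2 * s))"
 "(E (2 * s + 1) (- b) + a / (- x) ^ (2 * s + 1)) = - (E (2 * s + 1) b + a / x ^ (2 * s + 1))"
 unfolding E_parity by simp_all

lemma ecG_minus: "ecG m v (- b) (- x) = ecG m v b x" unfolding ecG_def even_term_minus mult_minus_left sum_negf cosh_minus ..

lemma esG_minus: "esG m v (- b) (- x) = - esG m v b x" unfolding esG_def even_term_minus mult_minus_left sum_negf sinh_minus mult_minus_right ..

text \<open>A holomorphic pair that agrees with (\<beta>, \<xi>) up to a common sign. The sign may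
  depend on the point: near (-1,1) it differs above and below the cut.\<close>

definition branch :: "complex set => (complex => complex) => (complex => complex) => bool" where
 "branch S b x \<longleftrightarrow> open S \<and> S \<subseteq> cutp - {1} \<and> b holomorphic_on S \<and> x holomorphic_on S \<and>
   (\<forall>z\<in>S. x z \<noteq> 0 \<and> ((\<beta> z = b z \<and> \<xi> z = x z) \<or> (\<beta> z = - b z \<and> \<xi> z = - x z)))"

lemma branch_exists:
 assumes "z0 \<in> cutp" "z0 \<noteq> 1"
 obtains S b x where "branch S b x" "z0 \<in> S"
proof (cases "Im z0 = 0 \<longrightarrow> Re z0 > 1")
 case True
 let ?S = "{z. Im z = 0 \<longrightarrow> Re z > 1}"
 have n: "z - 1 \<notin> \<real>\<^sub>\<le>\<^sub>0" "z + 1 \<notin> \<real>\<^sub>\<le>\<^sub>0" if "z \<in> ?S" for z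
  using that by (auto simp: complex_nonpos_Reals_iff)
 have nz: "sqrt_z2m1 z \<noteq> 0" if "z \<in> ?S" for z using n[OF that] by (auto simp: sqrt_z2m1_def)
 have "\<beta> holomorphic_on ?S" unfolding \<beta>_def[abs_def] using nz unfolding sqrt_z2m1_def by (intro holomorphic_intros n)
 moreover have sub: "?S \<subseteq> cutp - {1}" by (auto simp: cutp_def)
 ultimately show ?thesis using open_xi_dom xi_holo xi_nz that True unfolding branch_def by blast
next
 case False
 then have z0: "Im z0 = 0" "-1 < Re z0" "Re z0 < 1" using assms by (auto simp: cutp_def complex_eq_iff)
 let ?S = "{z. Re z > -1} \<inter> {z. Re z < 1}"
 have n: "1 - z \<notin> \<real>\<^sub>\<le>\<^sub>0" "z + 1 \<notin> \<real>\<^sub>\<le>\<^sub>0" if "z \<in> ?S" for z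
  using that by (auto simp: complex_nonpos_Reals_iff)
 \<comment> \<open>In the strip this square root of z - 1 is analytic, whereas
   \<open>csqrt (z - 1)\<close> jumps on (-1,1).\<close>
 define g where "g = (%z. \<i> * csqrt (1 - z))"
 define b where "b = (%z. z / (g z * csqrt (z + 1)))"
 define x where "x = (%z. g z ^ 3 * xiI z)"
 have sub: "?S \<subseteq> cutp - {1}" by (auto simp: cutp_def)
 have nz: "g z \<noteq> 0" "csqrt (z + 1) \<noteq> 0" "xiI z \<noteq> 0" if "z \<in> ?S" for z
  using n[OF that] xiI_not_nonpos[of z] that sub by (auto simp: g_def)
 have gh: "g holomorphic_on ?S" unfolding g_def by (intro holomorphic_intros n)
 have bh: "b holomorphic_on ?S" unfolding b_def by (intro holomorphic_intros gh n) (use nz in auto)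
 have xh: "x holomorphic_on ?S" unfolding x_def by (intro holomorphic_intros gh holomorphic_on_subset[OF xiI_holo]) (use sub in auto)
 have gs: "csqrt (z - 1) = g z \<or> csqrt (z - 1) = - g z" if "z \<in> ?S" for z
 proof -
  have "(csqrt (z - 1))^2 = (g z)^2" unfolding g_def power_mult_distrib by simp
  then show ?thesis by (simp only: power2_eq_iff)
 qed
 have "branch ?S b x" unfolding branch_def
 proof (intro conjI ballI)
  fix z assume z: "z \<in> ?S"
  show "x z \<noteq> 0" using nz[OF z] by (simp add: x_def)
  show "(\<beta> z = b z \<and> \<xi> z = x z) \<or> (\<beta> z = - b z \<and> \<xi> z = - x z)"
   using gs[OF z] unfolding \<beta>_def sqrt_z2m1_def xi_xiI b_def x_def by (elim disjE) simp_all
 qed (use bh xh sub open_halfspace_Re_gt open_halfspace_Re_lt in auto)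
 then show ?thesis using that z0 by simp
qed

text \<open>\<open>exp_cosh\<close> is invariant under the common sign change and
  \<open>exp_sinh\<close> is odd, as is \<xi>; so \<open>exp_cosh\<close> and
  \<open>exp_sinh\<close> divided by \<xi> coincide with expressions in a local branch.\<close>

lemma ec_es_holo:
 shows "exp_cosh m u holomorphic_on cutp - {1}" and "(%z. exp_sinh m u z / \<xi> z) holomorphic_on cutp - {1}"
proof -
 let ?a = "%z. exp_sinh m u z / \<xi> z"
 have "exp_cosh m u field_differentiable at z0 \<and> ?a field_differentiable at z0" if z0: "z0 \<in> cutp - {1}" for z0
 proof -
  obtain S b x where S: "branch S b x" "z0 \<in> S" using branch_exists z0 by blast
  have h: "open S" "b holomorphic_on S" "x holomorphic_on S" "\<And>z. z \<in> S ==> x z \<noteq> 0"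
   and alt: "\<And>z. z \<in> S ==> (\<beta> z = b z \<and> \<xi> z = x z) \<or> (\<beta> z = - b z \<and> \<xi> z = - x z)"
   using S unfolding branch_def by auto
  let ?b = "1 / of_real u"
  have "(%z. ecG m ?b (b z) (x z)) holomorphic_on S" "(%z. esG m ?b (b z) (x z) / x z) holomorphic_on S"
   unfolding ecG_def esG_def cosh_field_def sinh_field_def by (intro holomorphic_intros ; use h in auto)+
  moreover have "ecG m ?b (b z) (x z) = exp_cosh m u z" "esG m ?b (b z) (x z) / x z = exp_sinh m u z / \<xi> z" if "z \<in> S" for z
   using alt[OF that] unfolding exp_cosh_ecG exp_sinh_esG by (auto simp: ecG_minus esG_minus)
  ultimately have "exp_cosh m u holomorphic_on S" "?a holomorphic_on S" by (blast intro: holomorphic_transform)+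
  then show ?thesis using holomorphic_on_imp_differentiable_at[OF _ h(1) S(2)] by simp
 qed
 then show "exp_cosh m u holomorphic_on cutp - {1}" "?a holomorphic_on cutp - {1}"
  by (auto simp: holomorphic_on_def field_differentiable_at_within)
qed

lemma ec_es_bound:
 assumes "z0 \<in> cutp" "z0 \<noteq> 1"
 shows "\<exists>r>0. \<exists>C. \<forall>z\<in>ball z0 r. \<forall>u\<ge>1. norm (exp_cosh m u z) \<le> C \<and> norm (exp_sinh m u z) \<le> C"
proof -
 obtain S b x where S: "branch S b x" "z0 \<in> S" using branch_exists assms by blast
 have h: "open S" "b holomorphic_on S" "x holomorphic_on S" "\<And>z. z \<in> S ==> x z \<noteq> 0"
  and alt: "\<And>z. z \<in> S ==> (\<beta> z = b z \<and> \<xi> z = x z) \<or> (\<beta> z = - b z \<and> \<xi> z = - x z)"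
  using S unfolding branch_def by auto
 obtain r where r: "r > 0" "cball z0 r \<subseteq> S" using h(1) S(2) open_contains_cball by blast
 \<comment> \<open>The variable v = 1/u runs over the compact interval [0,1], which makes the bounds
   uniform for u >= 1.\<close>
 let ?K = "cbox 0 (1::real) \<times> cball z0 r"
 let ?c = "continuous_on ?K"
 have bc: "?c (%p. E s (b (snd p)))" for s
  by (rule continuous_on_compose2[OF holomorphic_on_imp_continuous_on[OF E_compose_holo[OF h(2)]]]) (use r in "auto intro!: continuous_intros")
 have xc: "?c (%p. x (snd p))"
  by (rule continuous_on_compose2[OF holomorphic_on_imp_continuous_on[OF h(3)]]) (use r in "auto intro!: continuous_intros")
 have xn: "x (snd p) \<noteq> 0" if "p \<in> ?K" for p using that h(4) r by auto
 let ?a = "%p. ecG m (of_real (fst p)) (b (snd p)) (x (snd p))"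
 have "?c ?a" unfolding ecG_def by (intro continuous_intros bc xc) (use xn in auto)
 then have "bounded (?a ` ?K)" by (intro compact_imp_bounded compact_continuous_image compact_Times compact_cbox compact_cball)
 then obtain C1 where C1: "\<forall>y\<in>?a ` ?K. norm y \<le> C1" unfolding bounded_iff by blast
 let ?b = "%p. esG m (of_real (fst p)) (b (snd p)) (x (snd p))"
 have "?c ?b" unfolding esG_def by (intro continuous_intros bc xc) (use xn in auto)
 then have "bounded (?b ` ?K)" by (intro compact_imp_bounded compact_continuous_image compact_Times compact_cbox compact_cball)
 then obtain C2 where C2: "\<forall>y\<in>?b ` ?K. norm y \<le> C2" unfolding bounded_iff by blast
 have "norm (exp_cosh m u z) \<le> max C1 C2 \<and> norm (exp_sinh m u z) \<le> max C1 C2" if z: "z \<in> ball z0 r" and u: "u \<ge> 1" for u z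
 proof -
  have K: "(1 / u, z) \<in> ?K" using z u by auto
  have zS: "z \<in> S" using z r by auto
  let ?d = "snd (1 / u, z)"
  have "norm (exp_cosh m u z) = norm (ecG m (of_real (fst (1 / u, z))) (b ?d) (x ?d))"
   using alt[OF zS] unfolding exp_cosh_ecG by (auto simp: ecG_minus)
  also have "\<dots> \<le> C1" using C1 K by blast
  finally have 1: "norm (exp_cosh m u z) \<le> C1" .
  have "norm (exp_sinh m u z) = norm (esG m (of_real (fst (1 / u, z))) (b ?d) (x ?d))"
   using alt[OF zS] unfolding exp_sinh_esG by (auto simp: esG_minus)
  also have "\<dots> \<le> C2" using C2 K by blast
  finally show ?thesis using 1 by auto
 qed
 then show ?thesis using r(1) by blast
qed

lemma J_alt: "J m u z = - exp_cosh m u z * airyP m u (\<zeta> z) + 1 / (of_real u * (3/2)) * (exp_sinh m u z / \<xi> z) * airyQ m u (\<zeta> z)"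
 unfolding J_def airyP_def airyQ_def by simp

lemma J_holo:
 assumes "u \<noteq> 0"
 shows "J m u holomorphic_on cutp - {1}"
proof -
 have P: "(%z. airyP m u (\<zeta> z)) holomorphic_on cutp - {1}" "(%z. airyQ m u (\<zeta> z)) holomorphic_on cutp - {1}"
  unfolding airyP_def airyQ_def by (intro holomorphic_intros holomorphic_on_subset[OF zeta_holo]; use zeta_nz in auto)+
 show ?thesis unfolding J_alt[abs_def]
 by (intro holomorphic_intros ec_es_holo P) (use in auto)
qed

section \<open>Inhomogeneous solutions by Laplace integrals\<close>

text \<open>These exponents satisfy pp - qq = R - 3/2 and 2 pp = u/2 - 3/2 + R. The first relation
  keeps the leftover power of |1 - T| bounded, the second balances exp (u t / 2) up to a factor
  independent of u.\<close>

definition pp :: "real => nat => real" where "pp u R = u / 4 - 3 / 4 + real R / 2"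
definition qq :: "real => nat => real" where "qq u R = u / 4 + 3 / 4 - real R / 2"

text \<open>For \<open>R \<le> 1\<close>, \<open>k = z^R (1+T)^p (1-T)^(-q) exp (-u z^2 T / 2)\<close> satisfies
 \<open>k'' - u^2 (z^2 - 1) k = \<partial>/\<partial>T (2 u (1 - T^2) k)\<close>. Hence integrals of \<open>k\<close> over \<open>T\<close> from \<open>0\<close> to \<open>-1\<close> or to
 infinity are particular solutions. The branch of \<open>(1+T)^p\<close> is the one continuous in the lower half plane.\<close>

definition pF :: "real => nat => complex => complex" where
 "pF u R T = exp (- (\<i> * pi * pp u R / 2)) * (\<i> * (1 + T)) powr of_real (pp u R) * (1 - T) powr (- of_real (qq u R))"

text \<open>The z-dependent factor of the kernel and its first two z-derivatives. The forms of
  \<open>g1\<close> and \<open>g2\<close> are those for R = 0 and R = 1, where the term R (R - 1)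
  z^(R - 2) vanishes.\<close>

definition g0 :: "nat => complex => complex => complex" where
 "g0 R c z = z ^ R * exp (c * z^2)"
definition g1 :: "nat => complex => complex => complex" where
 "g1 R c z = (of_nat R + 2 * c * z ^ (R + 1)) * exp (c * z^2)"
definition g2 :: "nat => complex => complex => complex" where
 "g2 R c z = (2 * c * of_nat (2 * R + 1) * z ^ R + 4 * c^2 * z ^ (R + 2)) * exp (c * z^2)"

lemma g_derivs:
 assumes "R \<le> 1"
 shows "(g0 R c has_field_derivative g1 R c z) (at z)" "(g1 R c has_field_derivative g2 R c z) (at z)"
proof -
 let ?a = "%z. exp (c * z^2)"
 have e: "(?a has_field_derivative ?a z * (2 * c * z)) (at z)" for z by (rule derivative_eq_intros | simp)+
 consider "R = 0" | "R = 1" using assms by linarith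
 then show "(g0 R c has_field_derivative g1 R c z) (at z)" "(g1 R c has_field_derivative g2 R c z) (at z)"
 proof (atomize (full), cases)
  case 1
  have "((%z. 2 * c * z * ?a z) has_field_derivative 2 * c * ?a z + ?a z * (2 * c * z) * (2 * c * z)) (at z)"
   by (rule DERIV_mult[OF _ e]) (rule | simp)+
  then show "(g0 R c has_field_derivative g1 R c z) (at z) \<and> (g1 R c has_field_derivative g2 R c z) (at z)"
   using e[of z] unfolding 1 g0_def[abs_def] g1_def[abs_def] g2_def by (simp add: power2_eq_square algebra_simps)
 next
  case 2
  have "((%z. z * ?a z) has_field_derivative 1 * ?a z + ?a z * (2 * c * z) * z) (at z)" by (rule DERIV_mult[OF DERIV_ident e])
  moreover have "((%z. (1 + 2 * c * z^2) * ?a z) has_field_derivative (4 * c * z) * ?a z + ?a z * (2 * c * z) * (1 + 2 * c * z^2)) (at z)"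
   by (rule DERIV_mult[OF _ e]) (rule derivative_eq_intros | simp)+
  ultimately show "(g0 R c has_field_derivative g1 R c z) (at z) \<and> (g1 R c has_field_derivative g2 R c z) (at z)"
   unfolding 2 g0_def[abs_def] g1_def[abs_def] g2_def by (simp add: power2_eq_square algebra_simps)
 qed
qed

lemma g_cont:
 fixes c :: "real => complex"
 assumes "continuous_on UNIV c"
 shows "continuous_on UNIV (%(z, t). g0 R (c t) z)" "continuous_on UNIV (%(z, t). g1 R (c t) z)"
  "continuous_on UNIV (%(z, t). g2 R (c t) z)"
 unfolding g0_def g1_def g2_def case_prod_beta
 by (auto intro!: continuous_intros continuous_on_compose2[OF assms])

definition pdom :: "complex set" where "pdom = {T. Im T < 0 \<or> (Im T = 0 \<and> -1 < Re T \<and> Re T < 1)}"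

lemma pF_deriv:
 assumes "T \<in> pdom"
 shows "(pF u R has_field_derivative pF u R T * (of_real (pp u R) / (1 + T) + of_real (qq u R) / (1 - T))) (at T)"
proof -
 let ?e = "\<real>\<^sub>\<le>\<^sub>0"
 have n: "\<i> * (1 + T) \<notin> ?e" "1 - T \<notin> ?e" using assms by (auto simp: pdom_def complex_nonpos_Reals_iff)
 have 1: "((%w. w powr a) has_field_derivative w powr a * (a / w)) (at w)" if "w \<notin> ?e" for w a :: complex
 using has_field_derivative_powr[OF that, of a] by (simp add: powr_diff mult.commute)
 let ?b = "of_real (pp u R)"
 let ?d = "%T. \<i> * (1 + T)"
 have d1: "((%T. (?d T) powr ?b) has_field_derivative (?d T) powr ?b * (?b / (?d T)) * \<i>) (at T)"
  by (rule DERIV_chain2[where f = "%w. w powr ?b" and g = "%T. \<i> * (1 + T)", OF 1[OF n(1)]]) (rule derivative_eq_intros | simp)+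
 let ?c = "of_real (qq u R)"
 have d2: "((%T. (1 - T) powr (- ?c)) has_field_derivative (1 - T) powr (- ?c) * (- ?c / (1 - T)) * - 1) (at T)"
  by (rule DERIV_chain2[where f = "%w. w powr (- ?c)" and g = "%T. 1 - T", OF 1[OF n(2)]]) (rule derivative_eq_intros | simp)+
 let ?a = "(?d T) powr ?b * (?b / (?d T)) * \<i> * (1 - T) powr (- ?c) + (1 - T) powr (- ?c) * (- ?c / (1 - T)) * - 1 * (?d T) powr ?b"
 let ?f = "exp (- (\<i> * pi * pp u R / 2)) *
  ?a"
 have "(pF u R has_field_derivative ?f) (at T)"
  unfolding pF_def[abs_def] mult.assoc by (intro DERIV_cmult) (use DERIV_mult[OF d1 d2] in "simp only: mult.assoc")
 also have "?f = pF u R T * (?b / (1 + T) + ?c / (1 - T))"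
 proof -
  have 1: "?b / (?d T) * \<i> = ?b / (1 + T)" by simp
  show ?thesis unfolding pF_def mult.assoc 1 by (simp add: 1[ ] algebra_simps)
 qed
 finally show ?thesis .
qed

lemma pF_0: "pF u R 0 = 1"
proof -
 have "\<i> powr of_real (pp u R) = exp (\<i> * pi * pp u R / 2)" by (simp add: powr_def mult_ac)
 then show ?thesis unfolding pF_def by (simp flip: exp_add)
qed

lemma pF_norm: "norm (pF u R T) = norm (1 + T) powr pp u R * norm (1 - T) powr (- qq u R)"
unfolding pF_def by (simp add: norm_powr_real_powr' norm_mult)

text \<open>u > 3 ensures pp > 0, so that (1 + T)^pp is continuous at its branch point T =
  -1.\<close>

lemma pF_cont:
 assumes "u > 3"
 shows "continuous_on {T. Im T \<le> 0 \<and> (Im T = 0 \<longrightarrow> Re T < 1)} (pF u R)"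
 unfolding pF_def[abs_def]
 by (intro continuous_intros) (use assms in "auto simp: pp_def ")

text \<open>Closed convex sector of directions from -1 through -i to 1 - i. It contains all rays of
  integration and keeps away from the singularity T = 1.\<close>

definition psec :: "complex set" where "psec = {T. Im T \<le> 0 \<and> Re T + Im T \<le> 0}"

lemma psec_bound:
 assumes "T \<in> psec"
 shows "norm (1 - T) \<ge> (1 + norm T) / 3" "norm (1 + T) \<le> 3 * norm (1 - T)"
proof -
 have r: "2 * Re T \<le> 3/2 * norm T"
 proof (cases "Re T \<le> 0")
  case True
  then show ?thesis using norm_ge_zero[of T] by linarith
 next
  case False
  then have "(Re T)^2 \<le> (Im T)^2" using assms by (auto simp: psec_def abs_le_square_iff[symmetric])
  then have "(4/3 * Re T)^2 \<le> (norm T)^2"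
  proof -
   have "(4/3 * Re T)^2 = 16/9 * (Re T)^2" by (simp add: power2_eq_square)
   then show ?thesis using \<open>(Re T)^2 \<le> (Im T)^2\<close> zero_le_power2[of "Im T"] unfolding cmod_power2 by linarith
  qed
  then have "4/3 * Re T \<le> norm T" by (rule power2_le_imp_le) simp
  then show ?thesis by simp
 qed
 have "(norm (1 - T))^2 \<ge> 1 - 3/2 * norm T + (norm T)^2" using r unfolding cmod_power2 by (simp add: power2_eq_square algebra_simps)
 \<comment> \<open>With x = |T|, 18 times the difference is 16 x^2 - 31 x + 16, and completing the
   square there produces 4 x - 31/8.\<close>
 also have "1 - 3/2 * norm T + (norm T)^2 \<ge> ((1 + norm T) / 3)^2"
 using zero_le_power2[of "4 * norm T - 31/8"] by (simp add: power2_eq_square field_simps)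
 finally show 1: "norm (1 - T) \<ge> (1 + norm T) / 3" by simp
 show "norm (1 + T) \<le> 3 * norm (1 - T)" using 1 norm_triangle_ineq[of 1 T] by simp
qed

text \<open>If |1 + T| <= M |1 - T|, the modulus is at most M^pp |1 - T|^(R - 3/2), and |1 - T| >=
  1/3 bounds the second factor by 9. The dependence on u is confined to M^pp, where M may vary with
  T.\<close>

lemma pF_quot_bound:
 assumes u: "u > 3" and R: "R \<le> 1" and T: "T \<in> psec" and M: "norm (1 + T) \<le> M * norm (1 - T)"
 shows "norm (pF u R T) \<le> 9 * M powr pp u R"
proof -
 have p: "pp u R > 0" using u by (simp add: pp_def)
 let ?a = "norm (1 - T)"
 have n: "?a \<ge> 1/3" by (rule order_trans[OF _ psec_bound(1)[OF T]]) simp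
 have "norm (1 + T) powr pp u R \<le> (M * ?a) powr pp u R" using M p by (intro powr_mono2) auto
 also have "\<dots> = M powr pp u R * ?a powr pp u R" by (simp add: powr_mult)
 finally have "norm (pF u R T) \<le> M powr pp u R * ?a powr pp u R * ?a powr (- qq u R)" unfolding pF_norm by (intro mult_right_mono) auto
 also have "\<dots> = M powr pp u R * ?a powr (real R - 3/2)"
 unfolding pp_def qq_def mult.assoc powr_add[symmetric] by simp
 also have "\<dots> \<le> M powr pp u R * (1/3) powr (real R - 3/2)" using n R by (intro mult_left_mono powr_mono2') auto
 also have "(1/3::real) powr (real R - 3/2) = 3 powr (3/2 - real R)" using powr_minus_divide[of 3 "real R - 3/2"] by (simp add: powr_divide)
 also have "M powr pp u R * 3 powr (3/2 - real R) \<le> M powr pp u R * (3::real) powr 2" by (intro mult_left_mono powr_mono) auto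
 finally show ?thesis by simp
qed

lemma pF_bound: "u > 3 ==> R \<le> 1 ==> T \<in> psec ==> norm (pF u R T) \<le> 9 * 3 powr pp u R"
 by (rule pF_quot_bound psec_bound | assumption)+

lemma psec_scale: "d \<in> psec ==> t \<ge> 0 ==> of_real t * d \<in> psec"
 by (auto simp: psec_def mult_nonneg_nonpos simp flip: distrib_left)

lemma psec_add: "T \<in> psec ==> T' \<in> psec ==> T + T' \<in> psec" by (auto simp: psec_def)

lemma psec_sub: "psec \<subseteq> {T. Im T \<le> 0 \<and> (Im T = 0 \<longrightarrow> Re T < 1)}" by (auto simp: psec_def)

definition kint :: "real => nat => complex => complex => complex" where
 "kint u R z T = pF u R T * g0 R (- (of_real u / 2) * T) z"

definition kPhi :: "real => nat => complex => complex => complex" where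
 "kPhi u R z T = 2 * of_real u * (1 - T^2) * kint u R z T"

lemma Re_of_real_mult: "Re (of_real a * b) = a * Re b" by simp

lemma norm_kint: "norm (kint u R z T) = norm (pF u R T) * norm z ^ R * exp (- (u / 2 * Re (z^2 * T)))"
proof -
 have "Re (- (of_real u / 2) * T * z^2) = - (u / 2 * Re (z^2 * T))"
 proof -
  have "- (of_real u / 2) * T * z^2 = of_real (- (u / 2)) * (z^2 * T)" by simp
  then show ?thesis by (simp only: Re_of_real_mult)
 qed
 then show ?thesis unfolding kint_def g0_def norm_mult norm_power by simp
qed

lemma kPhi_deriv:
 assumes R: "R \<le> 1" and T: "T \<in> pdom"
 shows "(kPhi u R z has_field_derivative pF u R T * (g2 R (- (of_real u / 2) * T) z - of_real (u^2) * (z^2 - 1) * g0 R (- (of_real u / 2) * T) z)) (at T)"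
proof -
 define p q where "p = complex_of_real (pp u R)" and "q = complex_of_real (qq u R)"
 let ?f = "of_real u / 2"
 define e where "e = (%T. exp (- ?f * T * z^2))"
 have nz: "1 + T \<noteq> 0" "1 - T \<noteq> 0" using T by (auto simp: pdom_def complex_eq_iff)
 note dF = pF_deriv[OF T, of u R, folded p_def q_def]
 have de: "(e has_field_derivative e T * (- ?f * z^2)) (at T)" unfolding e_def by (rule derivative_eq_intros | simp)+
 have dq: "((%T. 2 * of_real u * (1 - T^2) * z ^ R) has_field_derivative 2 * of_real u * (- 2 * T) * z ^ R) (at T)"
  by (rule derivative_eq_intros | simp)+
 let ?a = "%T. 2 * of_real u * (1 - T^2) * z ^ R"
 let ?c = "p / (1 + T) + q / (1 - T)"
 let ?b = "pF u R T * ?c * e T + e T * (- ?f * z^2) * pF u R T"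
 let ?d = "%T. (?a T) * (pF u R T * e T)"
 let ?e = "2 * of_real u * (- 2 * T) * z ^ R * (pF u R T * e T) +
   ?b * (?a T)"
 have D: "(?d has_field_derivative
   ?e) (at T)"
  by (rule DERIV_mult[OF dq DERIV_mult[OF dF de]])
 have key: "?c * (1 - T^2) = p * (1 - T) + q * (1 + T)"
 proof -
  have 1: "(a / x + b / y) * (x * y) = a * y + b * x" if "x \<noteq> 0" "y \<noteq> 0" for a b x y :: complex
   using that by (simp add: field_simps)
  have 2: "1 - T^2 = (1 + T) * (1 - T)" by (simp add: power2_eq_square algebra_simps)
  show ?thesis unfolding 2 by (rule 1[OF nz])
 qed
 define X where "X = p / (1 + T) + q / (1 - T)"
 have pq: "p = of_real u / 4 - 3 / 4 + of_nat R / 2" "q = of_real u / 4 + 3 / 4 - of_nat R / 2" by (simp_all add: p_def q_def pp_def qq_def)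
 have "?e = pF u R T * e T * z ^ R * (2 * of_real u * (- 2 * T + ?c * (1 - T^2)) - of_real u ^ 2 * z^2 * (1 - T^2))"
  unfolding X_def[symmetric] by (simp add: algebra_simps power2_eq_square)
 also have "\<dots> = pF u R T * (g2 R (- ?f * T) z - of_real (u^2) * (z^2 - 1) * g0 R (- ?f * T) z)"
 proof -
  have y: "2 * of_real u * (- 2 * T + (p * (1 - T) + q * (1 + T))) = (of_real u)^2 - of_real u * T * (2 * of_nat R + 1)"
   unfolding pq by (simp add: field_simps power2_eq_square)
  show ?thesis unfolding key y g2_def g0_def e_def by (simp add: algebra_simps power2_eq_square)
 qed
 finally have fin: "(?d has_field_derivative
   pF u R T * (g2 R (- ?f * T) z - of_real (u^2) * (z^2 - 1) * g0 R (- ?f * T) z)) (at T)"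
  using D by simp
 show ?thesis using fin unfolding kPhi_def kint_def g0_def e_def by (simp add: mult_ac)
qed

lemma ray_vector_derivative:
 assumes "(f has_field_derivative f') (at (of_real t * d))"
 shows "((%t. f (of_real t * d)) has_vector_derivative d * f') (at t)"
proof -
 have "((%t. of_real t * d) has_vector_derivative d) (at t)" by (rule derivative_eq_intros | simp)+
 from field_vector_diff_chain_at[OF this, of f f'] assms show ?thesis by (simp add: o_def)
qed

lemma kPhi_ray_deriv:
 assumes "R \<le> 1" "of_real t * d \<in> pdom"
 shows "((%t. kPhi u R z (of_real t * d)) has_vector_derivative (d * pF u R (of_real t * d)) *
  (g2 R (- (of_real u / 2) * (of_real t * d)) z - of_real (u^2) * (z^2 - 1) * g0 R (- (of_real u / 2) * (of_real t * d)) z)) (at t)"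
   using ray_vector_derivative[OF kPhi_deriv[OF assms]] by (simp add: mult.assoc)

text \<open>The factor - 1 / (2 u) compensates the boundary value 2 u z^R of \<open>kPhi\<close> at
  T = 0. The other boundary terms vanish, at T = -1 through 1 - T^2 and at infinity through the
  exponential. The segment serves both imaginary infinities, each ray \<open>vray d\<close> one
  cone.\<close>

definition vseg :: "real => nat => complex => complex" where
 "vseg u R z = - (1 / (2 * of_real u)) * integral {0..1} (%t. - 1 * kint u R z (of_real t * - 1))"

definition vray :: "complex => real => nat => complex => complex" where
 "vray d u R z = - (1 / (2 * of_real u)) * integral {0..} (%t. d * kint u R z (of_real t * d))"

lemma kcont:
 assumes "u > 3" "continuous_on A g" "g ` A \<subseteq> {T. Im T \<le> 0 \<and> (Im T = 0 \<longrightarrow> Re T < 1)}"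
 shows "continuous_on A (%t. pF u R (g t))" "continuous_on A (%t. kint u R z (g t))" "continuous_on A (%t. kPhi u R z (g t))"
proof -
 show 1: "continuous_on A (%t. pF u R (g t))" by (rule continuous_on_compose2[OF pF_cont[OF assms(1)] assms(2,3)])
 show 2: "continuous_on A (%t. kint u R z (g t))" unfolding kint_def g0_def by (intro continuous_intros 1 assms(2))
 show "continuous_on A (%t. kPhi u R z (g t))" unfolding kPhi_def by (intro continuous_intros 2 assms(2))
qed

lemma gray_cont:
 "continuous_on UNIV (%(z, t). g0 R (- (of_real u / 2) * (of_real t * d)) z)"
 "continuous_on UNIV (%(z, t). g1 R (- (of_real u / 2) * (of_real t * d)) z)"
 "continuous_on UNIV (%(z, t). g2 R (- (of_real u / 2) * (of_real t * d)) z)"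
 by (rule g_cont; intro continuous_intros)+

lemma kPhi_0: "kPhi u R z 0 = 2 * of_real u * z ^ R" by (simp add: kPhi_def kint_def g0_def pF_0)

lemma vseg_ode:
 assumes u: "u > 3" and R: "R \<le> 1"
 shows "weber u UNIV (%z. z ^ R) (vseg u R)"
proof -
 have sub: "(%t. of_real t * - 1) ` {0..1} \<subseteq> {T. Im T \<le> 0 \<and> (Im T = 0 \<longrightarrow> Re T < 1)}" by auto
 let ?b = "continuous_on {0..1}"
 have cc: "?b (%t::real. complex_of_real t * - 1)" by (intro continuous_intros)
 let ?a = "%t. of_real t * - 1"
 have "weber u UNIV (%z. kPhi u R z (of_real 1 * - 1) - kPhi u R z (of_real 0 * - 1))
  (%z. integral {0..1} (%t. (- 1 * pF u R (?a t)) * g0 R (- (of_real u / 2) * ?a t) z))"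
 proof (rule ode2_integral[where \<Phi> = "%z t. kPhi u R z (?a t)", OF _ _ g_derivs[OF R] gray_cont])
  show "?b (%t. - 1 * pF u R (?a t))" by (intro continuous_on_mult_left kcont(1)[OF u cc sub])
  show "?b (%t. kPhi u R z (?a t))" for z by (rule kcont(3)[OF u cc sub])
  fix z t assume t: "t \<in> {0<..<1::real}"
  then have "of_real t * - 1 \<in> pdom" by (simp add: pdom_def)
  then show "((%t. kPhi u R z (?a t)) has_vector_derivative - 1 * pF u R (?a t) *
     (g2 R (- (of_real u / 2) * ?a t) z - of_real (u^2) * (z^2 - 1) * g0 R (- (of_real u / 2) * ?a t) z)) (at t)"
   by (rule kPhi_ray_deriv[OF R])
 qed simp
 from ode2_cmult[OF this open_UNIV, of "- (1 / (2 * of_real u))"] show ?thesis unfolding vseg_def[abs_def] kint_def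
   by (rule ode2_cong) (use u in \<open>auto simp: kPhi_0 kPhi_def[of _ _ _ "-1"] \<close>)
qed

definition cone :: "complex => complex set" where "cone d = {z. Re (z^2 * d) > 0}"

lemma kint_bound:
 assumes "u > 3" "R \<le> 1" "T \<in> psec"
 shows "norm (kint u R z T) \<le> 9 * 3 powr pp u R * norm z ^ R * exp (- (u / 2 * Re (z^2 * T)))"
 unfolding norm_kint by (intro mult_right_mono pF_bound assms) auto

lemma open_cone: "open (cone d)" unfolding cone_def by (intro open_Collect_less continuous_intros)

lemma vray_ode:
 assumes u: "u > 3" and R: "R \<le> 1" and d: "d \<in> psec" "Im d < 0"
 shows "weber u (cone d) (%z. z ^ R) (vray d u R)"
proof -
 let ?k = "%t. of_real t * d"
 have sub: "?k ` {0..} \<subseteq> {T. Im T \<le> 0 \<and> (Im T = 0 \<longrightarrow> Re T < 1)}" using psec_sub psec_scale[OF d(1)] by auto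
 let ?l = "continuous_on {0..}"
 have cc: "?l (%t::real. ?k t)" by (intro continuous_intros)
 let ?c = "%z. Re (z^2 * d)"
 let ?h = "9 * 3 powr pp u R"
 let ?e = "%u z t. ?h * norm z ^ R * exp (- (u / 2 * ?c z * t))"
 have kb: "norm (kint u R z (?k t)) \<le> ?e u z t" if "t \<ge> 0" for z t
 using Re_of_real_mult[of t "z^2 * d"] kint_bound[OF u R psec_scale[OF d(1) that], of z] by (simp add: mult_ac)
 let ?a = "%u t. - (of_real u / 2) * ?k t"
 let ?f = "%u z t. kPhi u R z (?k t)"
 let ?g = "%u t. d * pF u R (?k t)"
 have "weber u (cone d) (%z. 0 - kPhi u R z (of_real 0 * d))
  (%z. integral {0..} (%t. (?g u t) * g0 R (?a u t) z))"
 proof (rule ode2_improper[where \<Phi> = "%z t. ?f u z t", OF _ open_cone g_derivs[OF R] gray_cont])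
  show "?l (%t. ?g u t)" by (intro continuous_on_mult_left kcont(1)[OF u cc sub])
  show "?l (%t. ?f u z t)" for z by (rule kcont(3)[OF u cc sub])
 next
  fix z t assume t: "t > (0::real)"
  then have "?k t \<in> pdom" using d by (simp add: pdom_def mult_pos_neg)
  then show "((%t. ?f u z t) has_vector_derivative ?g u t *
     (g2 R (?a u t) z - of_real (u^2) * (z^2 - 1) * g0 R (?a u t) z)) (at t)"
   by (rule kPhi_ray_deriv[OF R])
 next
  fix z assume z: "z \<in> cone d"
  define k where "k = u / 2 * ?c z"
  have k: "k > 0" using z u by (simp add: k_def cone_def)
  define C where "C = 2 * u * (?h * norm z ^ R)"
  let ?d = "%t. 1 + t^2 * (norm d)^2"
  have b: "norm (?f u z t) \<le> C * ?d t * exp (- (k * t))" if t: "t \<ge> 0" for t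
  proof -
   have "norm (1 - ?k t^2) \<le> 1 + t^2 * (norm d)^2"
    using norm_triangle_ineq4[of 1 "?k t^2"] by (simp add: norm_power norm_mult power_mult_distrib)
   then have "norm (?f u z t) \<le> 2 * u * ?d t * (?e u z t)" unfolding kPhi_def norm_mult using u by (intro mult_mono kb t) auto
   then show ?thesis unfolding C_def k_def by (simp only: mult_ac)
  qed
  have "((%t. C * ?d t * exp (- (k * t))) \<longlongrightarrow> 0) at_top" using k by real_asymp
  then show "((%t. ?f u z t) \<longlongrightarrow> 0) at_top"
   by (rule Lim_null_comparison[rotated]) (use b in "auto intro: eventually_mono[OF eventually_ge_at_top[of 0]]")
 next
  fix z0 assume z0: "z0 \<in> cone d"
  define k where "k = Re (z0^2 * d) / 2"
  have k: "k > 0" using z0 by (simp add: k_def cone_def)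
  have "open {z. ?c z > k}" by (intro open_Collect_less continuous_intros)
  moreover have "z0 \<in> {z. ?c z > k}" using k by (simp only: k_def mem_Collect_eq)
  ultimately obtain r where r: "r > 0" "cball z0 r \<subseteq> {z. ?c z > k}" using open_contains_cball by blast
  let ?b = "%t z. norm ((?g u t) * g0 R (?a u t) z)"
  have "?b t z \<le>
    norm d * (?h * (norm z0 + r) ^ R) * exp (- (u / 2 * k * t))" if z: "z \<in> cball z0 r" and t: "t \<ge> 0" for z t
  proof -
   have "?b t z = norm d * norm (kint u R z (?k t))" unfolding kint_def norm_mult by simp
   also have "\<dots> \<le> norm d * (?e u z t)" by (intro mult_left_mono kb[OF t]) simp
   also have "\<dots> \<le> norm d * (?h * (norm z0 + r) ^ R * exp (- (u / 2 * k * t)))"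
   proof (intro mult_mono power_mono order_refl iffD2[OF exp_le_cancel_iff])
    show "norm z \<le> norm z0 + r" using z norm_triangle_sub[of z z0] by (simp add: dist_norm norm_minus_commute)
    show "- (u / 2 * ?c z * t) \<le> - (u / 2 * k * t)" using r(2) z u t by (auto simp: mult_right_mono)
   qed (use r in auto)
   finally show ?thesis by simp
  qed
  moreover have "cball z0 r \<subseteq> cone d" using r k by (auto simp: cone_def)
  moreover have "u / 2 * k > 0" using u k by simp
  ultimately show "\<exists>r>0. cball z0 r \<subseteq> cone d \<and> (\<exists>C. \<exists>\<kappa>>0. \<forall>z\<in>cball z0 r. \<forall>t\<ge>0.
   ?b t z \<le> C * exp (- (\<kappa> * t)))"
   using r(1) by blast
 qed
 from ode2_cmult[OF this open_cone, of "- (1 / (2 * of_real u))"] show ?thesis unfolding vray_def[abs_def] kint_def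
  by (rule ode2_cong[OF _ open_cone]) (use u in "auto simp: kPhi_0 mult.assoc")
qed

text \<open>Since 2 pp <= u / 2, a growth exp (2 \<rho> t) of |1 + T| / |1 - T| costs at most exp (u
  \<rho> t / 2). So Re (z^2 d) > \<rho> yields decay for all u at once.\<close>

lemma kint_ray_quot_bound:
 assumes u: "u > 3" and R: "R \<le> 1" and d: "d \<in> psec" and t: "t \<ge> 0" and \<rho>: "\<rho> \<ge> 0"
  and M: "norm (1 + of_real t * d) \<le> exp (2 * \<rho> * t) * norm (1 - of_real t * d)"
 shows "norm (kint u R z (of_real t * d)) \<le> 9 * norm z ^ R * exp (- (u / 2 * (Re (z^2 * d) - \<rho>) * t))"
proof -
 have p: "2 * pp u R \<le> u / 2" using R by (simp add: pp_def)
 let ?b = "norm (pF u R (of_real t * d))"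
 let ?d = "exp (2 * \<rho> * t) powr pp u R"
 have "?b \<le> 9 * ?d" by (rule pF_quot_bound[OF u R psec_scale[OF d t] M])
 also have "?d = exp (2 * pp u R * (\<rho> * t))" by (simp add: powr_def)
 also have "\<dots> \<le> exp (u / 2 * (\<rho> * t))" using mult_right_mono[OF p, of "\<rho> * t"] \<rho> t by simp
 finally have F: "?b \<le> 9 * exp (u / 2 * (\<rho> * t))" by simp
 let ?a = "u / 2 * (t * Re (z^2 * d))"
 let ?c = "norm (kint u R z (of_real t * d))"
 have r: "?c = ?b * norm z ^ R * exp (- ?a)" using Re_of_real_mult[of t "z^2 * d"] unfolding norm_kint by (simp only: mult.left_commute)
 have "?c \<le> 9 * exp (u / 2 * (\<rho> * t)) * norm z ^ R * exp (- ?a)" unfolding r by (intro mult_right_mono F) auto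
 also have "\<dots> = 9 * norm z ^ R * exp (u / 2 * (\<rho> * t) + - ?a)" unfolding exp_add by simp
 also have "u / 2 * (\<rho> * t) + - ?a = - (u / 2 * (Re (z^2 * d) - \<rho>) * t)" by (simp add: algebra_simps)
 finally show ?thesis .
qed

lemma kint_ray_cont:
 assumes u: "u > 3" and d: "d \<in> psec"
 shows "continuous_on {0..} (%t::real. d * kint u R z (of_real t * d))"
using psec_sub psec_scale[OF d] by (intro continuous_on_mult_left kcont(2)[OF u]) (auto intro!: continuous_intros)

lemma vray_bound:
 assumes u: "u > 3" and R: "R \<le> 1" and d: "d \<in> psec" and \<rho>: "\<rho> \<ge> 0" "Re (z^2 * d) > \<rho>"
  and M: "\<And>t. t \<ge> 0 ==> norm (1 + of_real t * d) \<le> exp (2 * \<rho> * t) * norm (1 - of_real t * d)"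
 shows "norm (vray d u R z) \<le> 9 * norm d * norm z ^ R / (u^2 * (Re (z^2 * d) - \<rho>))"
proof -
 let ?a = "Re (z^2 * d) - \<rho>"
 let ?b = "norm d * (9 * norm z ^ R)"
 have "norm (integral {0..} (%t. d * kint u R z (of_real t * d))) \<le> ?b / (u / 2 * ?a)"
 proof (rule exp_bound_integral(2)[OF kint_ray_cont[OF u d]])
  fix t :: real assume t: "t \<ge> 0"
  show "norm (d * kint u R z (of_real t * d)) \<le> ?b * exp (- (u / 2 * ?a * t))"
   unfolding norm_mult mult.assoc[of "norm d"] by (intro mult_left_mono kint_ray_quot_bound[OF u R d t \<rho>(1) M[OF t]]) auto
 qed (use u \<rho> in simp)
 then have "norm (vray d u R z) \<le> 1 / (2 * u) * (?b / (u / 2 * ?a))"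
  unfolding vray_def norm_mult using u by (intro mult_mono) (auto simp: norm_divide)
 also have "\<dots> = 9 * norm d * norm z ^ R / (u^2 * ?a)" using \<rho> by (simp add: power2_eq_square)
 finally show ?thesis .
qed

text \<open>Directions for which the ray integrals converge in cones around the positive real axis
  (\<open>dA\<close>) and the positive imaginary axis (\<open>dB\<close>).\<close>

definition dA :: complex where "dA = Complex 1 (-1)"
definition dB :: complex where "dB = Complex (-1) (-1)"

lemma dAB_psec: "dA \<in> psec" "dB \<in> psec" "- 1 \<in> psec" by (auto simp: psec_def dA_def dB_def)

text \<open>With y = 2 t the squared moduli are 1 + y + y^2/2 and 1 - y + y^2/2, whose product is 1
  + y^4/4 >= 1. Hence their quotient is at most the square of the first, and exp y bounds the
  first.\<close>

lemma dA_quot: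
 assumes t: "t \<ge> 0"
 shows "norm (1 + of_real t * dA) \<le> exp (2 * 1 * t) * norm (1 - of_real t * dA)"
proof -
 define y where "y = 2 * t"
 have y: "y \<ge> 0" using t by (simp add: y_def)
 let ?b = "1 + y + y^2 / 2"
 have q: "exp y \<ge> ?b" by (rule exp_lower_Taylor_quadratic[OF y])
 let ?a = "1 - y + y^2 / 2"
 have pos: "?a \<ge> 0" using zero_le_power2[of "y - 1"] by (simp add: power2_eq_square algebra_simps)
 have "1 \<le> 1 + y ^ 4 / 4" by simp
 also have "\<dots> = ?b * ?a" by (simp add: power2_eq_square power4_eq_xxxx algebra_simps)
 also have "\<dots> \<le> exp y * ?a" by (rule mult_right_mono[OF q pos])
 finally have 1: "1 \<le> exp y * ?a" .
 have "?b \<le> exp y * 1" using q by simp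
 also have "\<dots> \<le> exp y * (exp y * ?a)" using 1 by simp
 finally have 2: "?b \<le> (exp y)^2 * ?a" by (simp add: power2_eq_square)
 let ?c = "of_real t * dA"
 have "(norm (1 + ?c))^2 = ?b" "(norm (1 - ?c))^2 = ?a" unfolding cmod_power2 dA_def y_def by (simp_all add: power2_eq_square algebra_simps)
 then have "(norm (1 + ?c))^2 \<le> (exp y * norm (1 - ?c))^2" using 2 by (simp only: power_mult_distrib)
 then show ?thesis by (simp add: y_def)
qed

lemma dB_quot:
 assumes t: "t \<ge> 0"
 shows "norm (1 + of_real t * dB) \<le> exp (2 * 0 * t) * norm (1 - of_real t * dB)"
proof -
 have "(norm (1 + of_real t * dB))^2 \<le> (norm (1 - of_real t * dB))^2"
  unfolding cmod_power2 dB_def using t by (simp add: power2_eq_square algebra_simps)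
 then show ?thesis by simp
qed

lemma vray_rotate:
 assumes u: "u > 3" and R: "R \<le> 1" and d: "d \<in> psec" "d' \<in> psec" and z: "z \<in> cone d" "z \<in> cone d'"
 shows "vray d u R z = vray d' u R z"
proof -
 let ?a = "Re (z^2 * d')"
 let ?b = "Re (z^2 * d)"
 define \<kappa> where "\<kappa> = u / 2 * min ?b ?a"
 have k: "\<kappa> > 0" using u z by (simp add: \<kappa>_def cone_def)
 let ?e = "%a d b. of_real a * d + of_real b * d'"
 let ?W = "{(?e a d b) |a b. a \<ge> 0 \<and> b \<ge> 0}"
 have sub: "?W \<subseteq> psec" using psec_add psec_scale d by auto
 have "integral {0..} (%t. d * kint u R z (of_real t * d)) = integral {0..} (%t. d' * kint u R z (of_real t * d'))"
 proof (rule ray_rotation[OF _ _ _ k])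
  show "continuous_on ?W (kint u R z)" by (rule kcont(2)[OF u continuous_on_id]) (use sub psec_sub in auto)
 next
  fix w assume w: "w \<in> interior ?W"
  have "interior ?W \<subseteq> interior {T. Im T \<le> 0}" by (rule interior_mono) (use sub psec_def in auto)
  also have "{T. Im T \<le> 0} = {T. \<i> \<bullet> T \<le> 0}" by simp
  also have "interior \<dots> = {T. \<i> \<bullet> T < 0}" by (rule interior_halfspace_le) simp
  finally have "w \<in> pdom" using w by (auto simp: pdom_def)
  then have "pF u R field_differentiable at w" using pF_deriv field_differentiable_def by blast
  moreover have "(%T. z ^ R * exp (- (of_real u / 2) * T * z^2)) field_differentiable at w"
   by (rule holomorphic_on_imp_differentiable_at[of _ UNIV]) (auto intro!: holomorphic_intros)
  ultimately show "kint u R z field_differentiable at w" unfolding kint_def[abs_def] g0_def by (rule field_differentiable_mult)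
 next
  fix a b :: real assume ab: "a \<ge> 0" "b \<ge> 0"
  have T: "?e a d b \<in> psec" using sub ab by auto
  let ?c = "?e a d b"
  let ?d = "9 * 3 powr pp u R * norm z ^ R"
  have "norm (kint u R z ?c) \<le> ?d * exp (- (u / 2 * Re (z^2 * ?c)))" by (rule kint_bound[OF u R T])
  also have "Re (z^2 * ?c) = a * ?b + b * ?a" by (simp add: algebra_simps)
  also have "?d * exp (- (u / 2 * (a * ?b + b * ?a))) \<le>
   ?d * exp (- (\<kappa> * (a + b)))"
  proof (intro mult_left_mono iffD2[OF exp_le_cancel_iff])
   have "u / 2 * (a * min ?b ?a + b * min ?b ?a) \<le> u / 2 * (a * ?b + b * ?a)" using ab u by (intro add_mono mult_left_mono) auto
   then show "- (u / 2 * (a * ?b + b * ?a)) \<le> - (\<kappa> * (a + b))"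
   proof -
    have "\<kappa> * (a + b) = u / 2 * (a * m + b * m)" if "m = min ?b ?a" for m
     unfolding \<kappa>_def that[symmetric] by (simp add: algebra_simps)
    from this[OF refl] show ?thesis
     using \<open>u / 2 * (a * min (Re (z^2 * d)) (Re (z^2 * d')) + b * min (Re (z^2 * d)) (Re (z^2 * d'))) \<le> u / 2 * (a * Re (z^2 * d) + b * Re (z^2 * d'))\<close> by simp
   qed
  qed auto
  finally show "norm (kint u R z ?c) \<le> ?d * exp (- (\<kappa> * (a + b)))" .
 qed
 then show ?thesis unfolding vray_def by simp
qed

text \<open>From (1 - t) / (1 + t) <= exp (- 2 t) the factor \<open>pF\<close> is at most exp (- 2
  pp t), while for Re (z^2) <= 1 the exponential contributes at most exp (u t / 2). The exponents
  cancel up to (3/2 - R) t, whence exp (3/2).\<close>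

lemma vseg_bound:
 assumes u: "u > 3" and R: "R \<le> 1" and z: "Re (z^2) \<le> 1"
 shows "norm (vseg u R z) \<le> exp (3/2) * norm z ^ R / (2 * u)"
proof -
 have p: "pp u R > 0" using u by (simp add: pp_def)
 let ?f = "%t. exp (- 2 * t)"
 have key: "1 - t \<le> ?f t * (1 + t)" if t: "0 \<le> t" for t :: real
 proof -
  \<comment> \<open>Multiplied by exp t, the claim compares (1 + t) exp (- t) with (1 - t) exp t.
    They agree at 0, and their difference has derivative t (exp t - exp (- t)).\<close>
  have "(1 + 0) * exp (- 0) - (1 - 0) * exp (0::real) \<le> (1 + t) * exp (- t) - (1 - t) * exp t"
  proof (rule DERIV_nonneg_imp_nondecreasing[OF t])
   fix x :: real assume x: "0 \<le> x" "x \<le> t"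
   let ?b = "%t. (1 + t) * exp (- t) - (1 - t) * exp t"
   have "(?b has_real_derivative x * (exp x - exp (- x))) (at x)" by (rule derivative_eq_intros | simp add: algebra_simps)+
   then show "\<exists>y. (?b has_real_derivative y) (at x) \<and> 0 \<le> y" using x by auto
  qed
  then have "(1 - t) * exp t * exp (- t) \<le> (1 + t) * exp (- t) * exp (- t)" by simp
  moreover have "?f t = exp (- t) * exp (- t)" "exp t * exp (- t) = 1" unfolding exp_add[symmetric] by simp_all
  ultimately show ?thesis by (simp only: mult.assoc mult_1_right mult.commute[of "1 + t"])
 qed
 let ?a = "%t. of_real t * - 1"
 let ?c = "exp (3/2) * norm z ^ R"
 let ?d = "%t. kint u R z (?a t)"
 let ?e = "%t. complex_of_real t * - 1"
 have b: "norm (- 1 * ?d t) \<le> ?c" if t: "t \<in> {0..1}" for t :: real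
 proof -
  have n: "norm (1 + ?e t) = 1 - t" "norm (1 - ?e t) = 1 + t"
   using t norm_of_real[of "1 - t", where 'a = complex] norm_of_real[of "1 + t", where 'a = complex] by auto
  have "norm (pF u R (?a t)) \<le> (?f t * (1 + t)) powr pp u R * (1 + t) powr (- qq u R)" using key t p unfolding pF_norm n by (intro mult_right_mono powr_mono2) auto
  also have "\<dots> = ?f t powr pp u R * (1 + t) powr (pp u R + - qq u R)" unfolding powr_add by (simp add: powr_mult)
  also have "\<dots> \<le> ?f t powr pp u R * 1"
  proof -
   have "(1 + t) powr (pp u R + - qq u R) \<le> (1 + t) powr 0" using t R by (intro powr_mono) (auto simp: pp_def qq_def)
   then show ?thesis using t by simp
  qed
  also have "\<dots> = exp (- (2 * pp u R * t))" by (simp add: powr_def)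
  finally have F: "norm (pF u R (?a t)) \<le> exp (- (2 * pp u R * t))" .
  have zt: "t * Re (z^2) \<le> t * 1" using z t by (intro mult_left_mono) auto
  have rt: "(3/2 - real R) * t \<le> 3/2" using t mult_mono[of "3/2 - real R" "3/2" t 1] by simp
  have "norm (- 1 * ?d t) \<le> exp (- (2 * pp u R * t)) * norm z ^ R * exp (- (u / 2 * Re (z^2 * ?a t)))"
   unfolding norm_mult norm_kint using F by (simp add: mult_right_mono)
  also have "\<dots> = exp (- (2 * pp u R * t) + u / 2 * (t * Re (z^2))) * norm z ^ R" unfolding exp_add by simp
  also have "\<dots> \<le> exp (- (2 * pp u R * t) + u / 2 * (t * 1)) * norm z ^ R" using zt u by (intro mult_right_mono) auto
  also have "- (2 * pp u R * t) + u / 2 * (t * 1) = (3/2 - real R) * t" by (simp add: pp_def algebra_simps)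
  also have "exp ((3/2 - real R) * t) * norm z ^ R \<le> ?c" using rt by (intro mult_right_mono) auto
  finally show ?thesis .
 qed
 have sub: "(%t. of_real t * - 1) ` {0..1} \<subseteq> {T. Im T \<le> 0 \<and> (Im T = 0 \<longrightarrow> Re T < 1)}" by auto
 have cc: "continuous_on {0..1} (%t::real. ?e t)" by (intro continuous_intros)
 have "norm (integral {0..1} (%t. - 1 * ?d t)) \<le> ?c * (1 - 0)"
 proof (rule integral_bound[OF _ _ b])
  show "continuous_on {0..1} (%t. - 1 * ?d t)" by (rule continuous_on_mult_left[OF kcont(2)[OF u cc sub]])
 qed simp_all
 then have "norm (vseg u R z) \<le> 1 / (2 * u) * ?c" unfolding vseg_def norm_mult using u by (intro mult_mono) (auto simp: norm_divide)
 then show ?thesis by simp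
qed

section \<open>Parabolic cylinder functions\<close>

text \<open>\<open>powr_exp_bound\<close> with c = 1 combined with 1 + |v| <= 2 + v^2/4, which
  leaves half of the Gaussian exponent as an integrable majorant.\<close>

lemma powr_gauss_bound:
 fixes n v :: real
 assumes "n > 0"
 shows "(1 + \<bar>v\<bar>) powr n * exp (- (v^2) / 2) \<le> exp (n * ln n - n + 2) * exp (- (v^2) / 4)"
proof -
 let ?a = "1 + \<bar>v\<bar>"
 have "?a powr n \<le> exp (n * ln (n / 1) - n) * exp (1 * ?a)" by (rule powr_exp_bound) (use assms in auto)
 also have "\<dots> \<le> exp (n * ln n - n) * exp (2 + v^2 / 4)"
 using zero_le_power2[of "\<bar>v\<bar> / 2 - 1"] by (simp add: power2_eq_square algebra_simps)
 finally have "?a powr n * exp (- (v^2) / 2) \<le> exp (n * ln n - n) * exp (2 + v^2 / 4) * exp (- (v^2) / 2)" by simp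
 also have "\<dots> = exp (n * ln n - n + 2) * exp (- (v^2) / 4)" unfolding exp_add[symmetric] by rule (simp add: field_simps)
 finally show ?thesis .
qed

text \<open>The shift t = k + v turns the quotient into the integral of (1 + v/k)^n exp (- v^2/2)
  over v >= - k, which tends to the Gaussian integral by dominated convergence.\<close>

lemma laplace_aux:
 fixes n :: real
 assumes n: "n > 0"
 shows "(%k::nat. integral {0..} (%t. t powr n * exp (- ((t - real k)^2) / 2)) / real k powr n) \<longlonglongrightarrow> sqrt (2 * pi)"
proof -
 let ?b = "%t k. exp (- ((t - real k)^2) / 2)"
 define f where "f = (%k t. indicator {0..} t * (t powr n * ?b t k))"
 define F where "F = (%k v. f k (real k + 1 * v) / real k powr n)"
 define C where "C = exp (n * ln n - n + 2)"
 have nd: "exp (- (x^2) / (2 * \<sigma>^2)) = sqrt (2 * pi * \<sigma>^2) * normal_density 0 \<sigma> x" if "\<sigma> > 0" for \<sigma> x :: real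
  using that unfolding normal_density_def by simp
 let ?g = "integrable lborel"
 let ?h = "%v. C * exp (- (v^2) / 4)"
 have g4: "?g (%v::real. ?h v)"
 using nd[of "sqrt 2"] by simp
 let ?a = "%v. exp (- (v^2) / 2)"
 let ?l = "%v. \<bar>v\<bar>"
 have bnd: "norm (F k v) \<le> ?h v" for k v
 proof (cases "k = 0 \<or> real k + v < 0")
  case True
  then show ?thesis by (auto simp: F_def f_def C_def)
 next
  case False
  then have k: "real k \<ge> 1" and v: "real k + v \<ge> 0" by auto
  have "?l v * 1 \<le> ?l v * real k" by (intro mult_left_mono) (use k in auto)
  then have q: "(real k + v) / real k \<le> 1 + ?l v" using k by (simp add: field_simps)
  have "norm (F k v) = ((real k + v) / real k) powr n * ?a v" using v by (simp add: F_def f_def powr_divide)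
  also have "\<dots> \<le> (1 + ?l v) powr n * ?a v" using n v q by (intro mult_right_mono powr_mono2) auto
  also have "\<dots> \<le> ?h v" unfolding C_def by (rule powr_gauss_bound[OF n])
  finally show ?thesis .
 qed
 have meas: "F k \<in> borel_measurable lborel" for k unfolding F_def f_def by measurable
 have lim: "(%k. F k v) \<longlonglongrightarrow> ?a v" for v
 proof -
  have "(%k. ((real k + v) / real k) powr n * ?a v) \<longlonglongrightarrow> 1 powr n * ?a v"
  by real_asymp
  moreover have "\<forall>\<^sub>F k in sequentially. ((real k + v) / real k) powr n * ?a v = F k v"
   using eventually_ge_at_top[of "nat \<lceil>?l v + 1\<rceil>"]
  proof eventually_elim
   case (elim k)
   then have "real k \<ge> ?l v + 1" by linarith
   then show ?case by (simp add: F_def f_def powr_divide)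
  qed
  ultimately show ?thesis by (simp add: Lim_transform_eventually)
 qed
 let ?e = "integral\<^sup>L lborel"
 let ?d = "%k. ?e (F k)"
 let ?f = "?d \<longlonglongrightarrow> ?e (%v::real. ?a v)"
 have I: "?f"
  and FI: "?g (F k)" for k
 proof -
  show "?f" by (rule integral_dominated_convergence[OF _ _ g4]) (use meas lim bnd in auto)
  show "?g (F k)" by (rule Bochner_Integration.integrable_bound[OF g4 meas]) (intro AE_I2 order_trans[OF bnd], simp only: real_norm_def)
 qed
 have gauss: "?e (%v::real. ?a v) = sqrt (2 * pi)" using nd[of 1] by simp
 let ?k = "%t k. integral {0..} (%t. t powr n * ?b t k)"
 have "\<forall>\<^sub>F k in sequentially. ?e (F k) = ?k t k / real k powr n" using eventually_gt_at_top[of 0]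
 proof eventually_elim
  case (elim k)
  have "?g (%v. real k powr n * F k v)" by (intro integrable_mult_right FI)
  then have fi: "?g (f k)" using elim lborel_integrable_real_affine_iff[of 1 "f k" "real k"] unfolding F_def by simp
  let ?p = "?e (%v. f k (real k + 1 * v))"
  have "?e (F k) = ?p / real k powr n" unfolding F_def by simp
  also have "?p = ?e (f k)" using lborel_integral_real_affine[of 1 "f k" "real k"] by simp
  also have "\<dots> = ?k t k" using set_borel_integral_eq_integral(2)[of "{0..}" "%t. t powr n * ?b t k"] fi
   unfolding set_integrable_def set_lebesgue_integral_def f_def by simp
  finally show ?case .
 qed
 with I show ?thesis unfolding gauss by (rule Lim_transform_eventually)
qed

text \<open>The exponent - a - 1/2 in the asymptotics of U(a, z) for a = - u / 2.\<close>

definition nn :: "real => real" where "nn u = u / 2 - 1 / 2"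

definition Yint :: "real => complex => complex" where
 "Yint u w = integral {0..} (%t. of_real (t powr nn u * exp (- (t^2) / 2)) * exp (w * of_real t))"

text \<open>Up to the factor Gamma (u/2 + 1/2) this is the integral representation of U(u/2, - i
  sqrt (2 u) z), the solution bounded at i infinity.\<close>

definition Y1 :: "real => complex => complex" where
 "Y1 u z = exp (of_real (u / 2) * z^2) * Yint u (\<i> * of_real (sqrt (2 * u)) * z)"

definition hY :: "real => complex => real => complex" where
 "hY u z t = exp (of_real (u / 2) * z^2 + \<i> * of_real (sqrt (2 * u)) * z * of_real t)"

lemma Y1_hY: "Y1 u z = integral {0..} (%t. of_real (t powr nn u * exp (- (t^2) / 2)) * hY u z t)"
proof -
 have "Y1 u z = integral {0..} (%t. exp (of_real (u / 2) * z^2) * (of_real (t powr nn u * exp (- (t^2) / 2)) * exp (\<i> * of_real (sqrt (2 * u)) * z * of_real t)))"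
  unfolding Y1_def Yint_def by (rule integral_mult_right[symmetric])
 then show ?thesis unfolding hY_def exp_add by (simp add: mult_ac)
qed

lemma gauss_weight:
 fixes w :: complex
 assumes u: "u > 3" and t: "t \<ge> 0" and M: "Re w \<le> M"
 shows "norm (of_real (t powr nn u * exp (- (t^2) / 2)) * exp (w * of_real t)) \<le> exp (nn u * ln (nn u) - nn u + (M + 2)^2 / 2) * exp (- (1 * t))"
proof -
 have n: "nn u > 0" using u by (simp add: nn_def)
 let ?a = "exp (nn u * ln (nn u) - nn u)"
 have p: "t powr nn u \<le> ?a * exp t" using powr_exp_bound[OF n, of 1 t] t by simp
 have "Re w * t \<le> M * t" using M t by (intro mult_right_mono) auto
 then have e: "norm (exp (w * of_real t)) \<le> exp (M * t)" by simp
 have "norm (of_real (t powr nn u * exp (- (t^2) / 2)) * exp (w * of_real t)) \<le> (?a * exp t * exp (- (t^2) / 2)) * exp (M * t)"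
  unfolding norm_mult[of _ "exp (w * of_real t)"] norm_of_real by (intro mult_mono e) (use p in "auto simp: intro!: ")
 also have "\<dots> = ?a * exp (t - t^2 / 2 + M * t)" by (simp add: flip: exp_add)
 also have "\<dots> \<le> ?a * exp ((M + 2)^2 / 2 - t)"
 using zero_le_power2[of "t - (M + 2)"] by (simp add: power2_eq_square field_simps)
 also have "\<dots> = exp (nn u * ln (nn u) - nn u + (M + 2)^2 / 2) * exp (- (1 * t))" unfolding mult_exp_exp by simp
 finally show ?thesis .
qed

lemma weight_cont: "u > 3 ==> continuous_on {0..} (%t. of_real (t powr nn u * exp (- (t^2) / 2)) :: complex)"
 by (intro continuous_intros continuous_on_powr_const) (auto simp: nn_def)

lemma Y1_ode:
 assumes u: "u > 3"
 shows "weber u UNIV (%_. 0) (Y1 u)"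
proof -
 define s where "s = complex_of_real (sqrt (2 * u))"
 have s2: "s * s = 2 * of_real u" using u unfolding s_def of_real_mult[symmetric] by simp
 let ?c = "%t. complex_of_real (t powr nn u * exp (- (t^2) / 2))"
 let ?f = "%u z t. of_real u * z + \<i> * s * of_real t"
 define h1 where "h1 = (%z t. (?f u z t) * hY u z t)"
 define h2 where "h2 = (%z t. (of_real u + (?f u z t)^2) * hY u z t)"
 \<comment> \<open>The primitive vanishes at t = 0 and at infinity, so the equation comes out
   homogeneous.\<close>
 define Phi where "Phi = (%z t. 2 * of_real u * of_real t * ?c t * hY u z t)"
 have D1: "((%z. hY u z t) has_field_derivative h1 z t) (at z)" for z t
  unfolding hY_def h1_def s_def by (rule derivative_eq_intros | simp)+
 have D2: "((%z. h1 z t) has_field_derivative h2 z t) (at z)" for z t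
 proof -
  have "((%z. of_real u * z + \<i> * s * of_real t) has_field_derivative of_real u) (at z)" by (rule derivative_eq_intros | simp)+
  from DERIV_mult[OF this D1[where t = t]] show ?thesis unfolding h1_def h2_def by (simp add: power2_eq_square algebra_simps)
 qed
 have hb: "norm (?c t * hY u z t) \<le> exp (u / 2 * M^2) * exp (nn u * ln (nn u) - nn u + (sqrt (2 * u) * M + 2)^2 / 2) * exp (- (1 * t))"
  if M: "norm z \<le> M" and t: "t \<ge> 0" for z t M
 proof -
  let ?l = "of_real (sqrt (2 * u))"
  have "norm (\<i> * ?l * z) \<le> sqrt (2 * u) * M" using M u by (simp add: norm_mult)
  then have "Re (\<i> * ?l * z) \<le> sqrt (2 * u) * M" by (rule order_trans[OF complex_Re_le_cmod])
  note g = gauss_weight[OF u t this]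
  let ?e = "of_real (u / 2) * z^2"
  have eq: "?c t * hY u z t = exp ?e * (?c t * exp (\<i> * ?l * z * of_real t))" unfolding hY_def exp_add by simp
  have e: "norm (exp ?e) \<le> exp (u / 2 * M^2)"
  proof -
   have "norm ?e \<le> u / 2 * M^2" using M u by (simp add: norm_mult norm_power power_mono)
   then show ?thesis using complex_Re_le_cmod[of "of_real (u / 2) * z^2"] by simp
  qed
  show ?thesis unfolding eq norm_mult[of "exp ?e"] mult.assoc[of "exp (u / 2 * M^2)"] by (intro mult_mono g e) simp_all
 qed
 have "weber u UNIV (%z. 0 - Phi z 0) (%z. integral {0..} (%t. ?c t * hY u z t))"
 proof (rule ode2_improper[where \<Phi> = Phi, OF weight_cont[OF u] open_UNIV D1 D2])
  show "continuous_on UNIV (%(z, t). hY u z t)" "continuous_on UNIV (%(z, t). h1 z t)" "continuous_on UNIV (%(z, t). h2 z t)"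
   unfolding h1_def h2_def hY_def case_prod_beta by (intro continuous_intros)+
  show "continuous_on {0..} (Phi z)" for z
   unfolding Phi_def hY_def by (intro continuous_intros weight_cont[OF u, THEN continuous_on_subset] order_refl)
 next
  fix z t assume t: "t > (0::real)"
  have c': "((%t. t powr nn u * exp (- (t^2) / 2)) has_real_derivative (t powr nn u * exp (- (t^2) / 2)) * (nn u / t - t)) (at t)"
   by (rule derivative_eq_intros refl | use t in "simp add: powr_diff field_simps")+
  let ?b = "of_real (nn u) / of_real t - of_real t"
  have cv: "(?c has_vector_derivative ?c t * ?b) (at t)"
  using has_vector_derivative_of_real[OF c', where 'a = complex] by simp
  have hv: "((%t. hY u z t) has_vector_derivative \<i> * s * z * hY u z t) (at t)"
  proof -
   have "((%T. exp (of_real (u / 2) * z^2 + \<i> * s * z * T)) has_field_derivative \<i> * s * z * exp (of_real (u / 2) * z^2 + \<i> * s * z * (of_real t * 1))) (at (of_real t * 1))"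
    by (rule derivative_eq_intros | simp)+
   from ray_vector_derivative[OF this] show ?thesis unfolding hY_def s_def by simp
  qed
  have tv: "((%t. 2 * of_real u * of_real t) has_vector_derivative 2 * complex_of_real u) (at t)" by (rule derivative_eq_intros | simp)+
  let ?a = "2 * of_real u * of_real t * (?c t * ?b) + 2 * of_real u * ?c t"
  let ?g = "2 * of_real u * of_real t * ?c t"
  let ?h = "\<i> * s * z * hY u z t"
  have "(Phi z has_vector_derivative ?g * ?h +
    ?a * hY u z t) (at t)"
   unfolding Phi_def by (rule has_vector_derivative_mult[OF has_vector_derivative_mult[OF tv cv] hv])
  also have "?g * ?h +
    ?a * hY u z t
    = ?c t * (h2 z t - of_real (u^2) * (z^2 - 1) * hY u z t)"
  proof -
   have tt: "of_real t * ?b = of_real (nn u) - of_real t * complex_of_real t" using t by (simp add: right_diff_distrib)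
   have nu: "2 * of_real (nn u) = of_real u - (1 :: complex)" unfolding nn_def by (simp add: field_simps)
   have "?g * ?h +
    ?a * hY u z t
    = ?c t * hY u z t * (2 * of_real u * \<i> * s * z * of_real t + of_real u * (2 * (of_real t * ?b)) + 2 * of_real u)"
    by (simp add: algebra_simps)
   also have "\<dots> = ?c t * hY u z t * (2 * of_real u * \<i> * s * z * of_real t + of_real u * (of_real u - 1 - 2 * (of_real t * of_real t)) + 2 * of_real u)"
   by (simp add: nu tt)
   also have "2 * of_real u * \<i> * s * z * of_real t + of_real u * (of_real u - 1 - 2 * (of_real t * of_real t)) + 2 * of_real u
    = of_real u + (?f u z t)^2 - of_real (u^2) * (z^2 - 1) + (s * s - 2 * of_real u) * (of_real t * of_real t)"
    by (simp add: power2_eq_square algebra_simps)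
   finally show ?thesis unfolding h2_def s2 by (simp add: algebra_simps)
  qed
  finally show "(Phi z has_vector_derivative ?c t * (h2 z t - of_real (u^2) * (z^2 - 1) * hY u z t)) (at t)" .
 next
  fix z :: complex
  define C where "C = exp (u / 2 * (norm z)^2) * exp (nn u * ln (nn u) - nn u + (sqrt (2 * u) * norm z + 2)^2 / 2)"
  have l: "((%t. 2 * u * t * (C * exp (- (1 * t)))) \<longlongrightarrow> 0) at_top" by real_asymp
  have b: "norm (Phi z t) \<le> 2 * u * t * (C * exp (- (1 * t)))" if t: "t \<ge> 0" for t
  proof -
   let ?k = "norm (2 * complex_of_real u * of_real t)"
   have "norm (Phi z t) = ?k * norm (?c t * hY u z t)" unfolding Phi_def by (simp only: norm_mult)
   also have "?k = 2 * u * t" using u t by (simp add: norm_mult)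
   finally show ?thesis using hb[OF order_refl t, of z, folded C_def] u t by (simp only:) (intro mult_left_mono; simp)
  qed
  show "(Phi z \<longlongrightarrow> 0) at_top" by (rule Lim_null_comparison[OF eventually_mono[OF eventually_ge_at_top[of 0] b] l])
 next
  fix z0 :: complex
  let ?d = "exp (nn u * ln (nn u) - nn u + (sqrt (2 * u) * (norm z0 + 1) + 2)^2 / 2)"
  have "norm (?c t * hY u z t) \<le> exp (u / 2 * (norm z0 + 1)^2) * ?d * exp (- (1 * t))" if "z \<in> cball z0 1" "t \<ge> 0" for z t
   by (rule hb) (use that norm_triangle_sub[of z z0] in "auto simp: dist_norm norm_minus_commute")
  then show "\<exists>d>0. cball z0 d \<subseteq> UNIV \<and> (\<exists>C. \<exists>\<kappa>>0. \<forall>z\<in>cball z0 d. \<forall>t\<ge>0. norm (?c t * hY u z t) \<le> C * exp (- (\<kappa> * t)))"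
   by (intro exI[of _ 1] conjI exI[of _ "exp (u / 2 * (norm z0 + 1)^2) * ?d"]) auto
 qed
 then show ?thesis unfolding Y1_hY[abs_def] by (simp add: Phi_def)
qed

lemma weight_exp_cont:
 fixes w :: complex
 assumes "u > 3"
 shows "continuous_on {0..} (%t. of_real (t powr nn u * exp (- (t^2) / 2)) * exp (w * of_real t))"
 by (rule continuous_on_mult[OF weight_cont[OF assms]]) (intro continuous_intros)

lemma Yint_bound:
 assumes u: "u > 3" and w: "Re w \<le> 0"
 shows "norm (Yint u w) \<le> exp (nn u * ln (nn u) - nn u + 2)"
proof -
 have "norm (Yint u w) \<le> exp (nn u * ln (nn u) - nn u + (0 + 2)^2 / 2) / 1" unfolding Yint_def
  by (rule exp_bound_integral(2)[OF weight_exp_cont[OF u] gauss_weight[OF u _ w]]) auto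
 then show ?thesis by simp
qed

lemma Y1_bddr: "u > 3 ==> bddr \<i> (Y1 u)" and Y1_imag_bound: "u > 3 ==> y \<ge> 0 ==> norm (Y1 u (of_real y * \<i>)) \<le> exp (nn u * ln (nn u) - nn u + 2)"
proof -
 let ?a = "%u. exp (nn u * ln (nn u) - nn u + 2)"
 let ?b = "%y. of_real y * \<i>"
 have b: "norm (Y1 u (?b y)) \<le> ?a u" if u: "u > 3" and y: "y \<ge> 0" for u y
 proof -
  have "norm (exp (of_real (u / 2) * ?b y^2)) \<le> 1" using u by (simp add: power_mult_distrib)
  moreover have "Re (\<i> * of_real (sqrt (2 * u)) * ?b y) \<le> 0" using u y by simp
  ultimately have "norm (Y1 u (?b y)) \<le> 1 * ?a u" unfolding Y1_def norm_mult by (intro mult_mono Yint_bound[OF u]) auto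
  then show ?thesis by simp
 qed
 show "u > 3 ==> y \<ge> 0 ==> norm (Y1 u (?b y)) \<le> ?a u" by (rule b)
 show "u > 3 ==> bddr \<i> (Y1 u)" by (rule bddrI, rule eventually_mono[OF eventually_ge_at_top[of 0]], rule b)
qed

text \<open>Up to constants, the growth of Y1 at - i k / sqrt (2 u) and of U at i k and - i k.
  Comparison along these sequences replaces asymptotics along full rays.\<close>

definition gk :: "real => nat => real" where "gk u k = exp ((real k)^2 / 4) * real k powr nn u"

lemma Y1_seq:
 assumes u: "u > 3"
 shows "(%k. Y1 u (- \<i> * of_real (real k / sqrt (2 * u))) / of_real (gk u k)) \<longlonglongrightarrow> of_real (sqrt (2 * pi))"
  and "(%k. Y1 u (\<i> * of_real (real k / sqrt (2 * u))) / of_real (gk u k)) \<longlonglongrightarrow> 0"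
proof -
 have n: "nn u > 0" using u by (simp add: nn_def)
 define s where "s = sqrt (2 * u)"
 have s: "s > 0" "s^2 = 2 * u" using u by (simp_all add: s_def)
 let ?a = "%k. - \<i> * of_real (real k / s)"
 let ?b = "%t k. exp (- ((t - real k)^2) / 2)"
 let ?f = "integral {0..}"
 have Y: "Y1 u (?a k) / of_real (gk u k) =
   of_real (?f (%t. t powr nn u * ?b t k) / real k powr nn u)" for k
 proof -
  define I where "I = ?f (%t. t powr nn u * ?b t k)"
  have "of_real (u / 2) * ?a k^2 = of_real (- (u / 2 * ((real k)^2 / s^2)))" by (simp add: power_mult_distrib power_divide)
  also have "u / 2 * ((real k)^2 / s^2) = (real k)^2 / 4" using u unfolding s(2) by simp
  finally have 1: "exp (of_real (u / 2) * ?a k^2) = of_real (exp (- ((real k)^2 / 4)))" by (simp only: exp_of_real)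
  have 2: "\<i> * of_real s * ?a k = of_real (real k)" using s by simp
  let ?c = "exp ((real k)^2 / 2)"
  define G where "G = (%t. ?c * (t powr nn u * ?b t k))"
  let ?d = "%t. exp (- (t^2) / 2)"
  let ?e = "%t. of_real (t powr nn u * ?d t) * exp (complex_of_real (real k) * of_real t)"
  have wG: "?e t = of_real (G t)" for t
  proof -
   have eqn: "?d t * exp (real k * t) = ?c * ?b t k" unfolding exp_add[symmetric] by rule (simp add: power2_eq_square field_simps)
   have "?e t = of_real (t powr nn u * (?d t * exp (real k * t)))" by (simp flip: exp_of_real)
   then show ?thesis unfolding eqn G_def by (simp only: mult.left_commute)
  qed
  have ci: "(%t. complex_of_real (G t)) integrable_on {0..}" unfolding wG[symmetric]
   by (rule exp_bound_integral(1)[OF weight_exp_cont[OF u] gauss_weight[OF u, where M = "real k"]]) auto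
  have "G integrable_on {0..}" using integrable_linear[OF ci bounded_linear_Re] by (simp add: o_def)
  then have "Yint u (of_real (real k)) = of_real (?f G)"
   unfolding Yint_def wG by (intro integral_unique has_integral_of_real integrable_integral)
  also have "?f G = ?c * I" unfolding I_def G_def by (rule integral_mult_right)
  finally have "Y1 u (?a k) = of_real (exp (- ((real k)^2 / 4)) * ?c * I)" unfolding Y1_def s_def[symmetric] 1 2 by simp
  also have "exp (- ((real k)^2 / 4)) * ?c = exp ((real k)^2 / 4)" by (simp flip: exp_add)
  finally show ?thesis unfolding gk_def I_def[symmetric] by simp
 qed
 show "(%k. Y1 u (- \<i> * of_real (real k / sqrt (2 * u))) / of_real (gk u k)) \<longlonglongrightarrow> of_real (sqrt (2 * pi))"
  unfolding s_def[symmetric] Y by (rule tendsto_of_real[OF laplace_aux[OF n]])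
 define C where "C = exp (nn u * ln (nn u) - nn u + 2)"
 have b: "norm (Y1 u (\<i> * of_real (real k / s)) / of_real (gk u k)) \<le> C / gk u k" for k
 proof -
  have "norm (Y1 u (\<i> * of_real (real k / s))) \<le> C" using Y1_imag_bound[OF u, of "real k / s"] s unfolding C_def by (simp add: mult.commute)
  moreover have "gk u k \<ge> 0" by (simp add: gk_def)
  ultimately show ?thesis by (simp add: norm_divide divide_right_mono)
 qed
 have l: "(%k. C / gk u k) \<longlonglongrightarrow> 0" unfolding gk_def by real_asymp
 show "(%k. Y1 u (\<i> * of_real (real k / sqrt (2 * u))) / of_real (gk u k)) \<longlonglongrightarrow> 0"
  unfolding s_def[symmetric] by (rule Lim_null_comparison[OF always_eventually[OF allI[OF b]] l])
qed

lemma weber_reflect: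
 assumes "weber u UNIV (%_. 0) y"
 shows "weber u UNIV (%_. 0) (%z. y (- z))"
 using ode2_chain_linear[OF assms open_UNIV open_UNIV, of "-1"] by simp

lemma weber_zero:
 assumes "weber u UNIV (%_. 0) d" "d 0 = 0" "deriv d 0 = 0"
 shows "d z = 0"
proof -
 have "(%z. of_real (u^2) * (z^2 - 1)) holomorphic_on UNIV" by (intro holomorphic_intros)
 from ode2_unique[OF assms(1) open_UNIV connected_UNIV this UNIV_I assms(2,3) UNIV_I] show ?thesis .
qed

lemma weber_parity_span:
 assumes y: "weber u UNIV (%_. 0) y" and v: "weber u UNIV (%_. 0) v" and nz: "y 0 \<noteq> 0" "deriv y 0 \<noteq> 0"
 shows "\<exists>a b. \<forall>z. v z = a * y z + b * y (- z)"
proof -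
 let ?a = "deriv v 0 / deriv y 0"
 define a b where "a = (v 0 / y 0 + ?a) / 2" and "b = (v 0 / y 0 - ?a) / 2"
 define d where "d = (%z. v z - (a * y z + b * y (- z)))"
 have o: "weber u UNIV (%z. 0 - (a * 0 + b * 0)) d" unfolding d_def by (intro ode2_diff ode2_add ode2_cmult open_UNIV weber_reflect y v)
 have D: "(y has_field_derivative deriv y z) (at z)" "(v has_field_derivative deriv v z) (at z)" for z
  using ode2_derivs(1)[OF y] ode2_derivs(1)[OF v] by auto
 have "((%z. y (- z)) has_field_derivative deriv y (- 0) * - 1) (at 0)"
  by (rule DERIV_chain2[where f = y and g = "%z. - z", OF D(1)]) (rule derivative_eq_intros | simp)+
 then have "(d has_field_derivative deriv v 0 - (a * deriv y 0 + b * (deriv y (- 0) * - 1))) (at 0)"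
  unfolding d_def by (intro DERIV_diff DERIV_add DERIV_cmult D)
 then have "deriv d 0 = deriv v 0 - (a - b) * deriv y 0" by (simp add: DERIV_imp_deriv algebra_simps)
 moreover have "a - b = ?a" "a + b = v 0 / y 0" by (simp_all add: a_def b_def field_simps)
 ultimately have "deriv d 0 = 0" "d 0 = 0" using nz by (simp_all add: d_def flip: distrib_right)
 then have "d z = 0" for z using o by - (rule weber_zero[of u d], simp_all)
 then show ?thesis unfolding d_def by auto
qed

text \<open>If Y1 or its derivative vanished at 0, Y1 would be odd or even, although it grows like
  \<open>gk\<close> towards - i infinity and is bounded at i infinity.\<close>

lemma Y1_nondegenerate:
 assumes u: "u > 3"
 shows "Y1 u 0 \<noteq> 0" "deriv (Y1 u) 0 \<noteq> 0"
proof -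
 let ?b = "deriv (Y1 u)"
 have key: False if e: "e = 1 \<or> e = - 1" and d: "Y1 u 0 = e * Y1 u 0" "?b 0 = - e * ?b 0" for e
 proof -
  define d where "d = (%z. Y1 u z - e * Y1 u (- z))"
  have o: "weber u UNIV (%z. 0 - e * 0) d" unfolding d_def by (intro ode2_diff ode2_cmult open_UNIV weber_reflect Y1_ode[OF u])
  have D: "(Y1 u has_field_derivative ?b z) (at z)" for z using ode2_derivs(1)[OF Y1_ode[OF u]] by auto
  have "((%z. Y1 u (- z)) has_field_derivative ?b (- 0) * - 1) (at 0)"
   by (rule DERIV_chain2[where f = "Y1 u" and g = "%z. - z", OF D]) (rule derivative_eq_intros | simp)+
  then have "(d has_field_derivative ?b 0 - e * (?b (- 0) * - 1)) (at 0)" unfolding d_def by (intro DERIV_diff DERIV_cmult D)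
  then have "deriv d 0 = ?b 0 + e * ?b 0" by (simp add: DERIV_imp_deriv)
  also have "\<dots> = 0" using that(3) unfolding eq_neg_iff_add_eq_0[symmetric] mult_minus_left .
  finally have "deriv d 0 = 0" .
  have "d 0 = 0" using that(2) by (simp add: d_def)
  have "d z = 0" for z by (rule weber_zero[of u d]) (use o \<open>d 0 = 0\<close> \<open>deriv d 0 = 0\<close> in simp_all)
  then have eq: "Y1 u z = e * Y1 u (- z)" for z unfolding d_def by (rule eq_iff_diff_eq_0[THEN iffD2])
  let ?a = "%k. of_real (real k / sqrt (2 * u))"
  let ?c = "%k. e * (Y1 u (\<i> * ?a k) / of_real (gk u k))"
  have L: "?c \<longlonglongrightarrow> e * 0" by (rule tendsto_mult_left[OF Y1_seq(2)[OF u]])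
  have Q: "?c k = Y1 u (- \<i> * ?a k) / of_real (gk u k)" for k using eq[of "- \<i> * ?a k"] by simp
  show False using L LIMSEQ_unique[OF _ Y1_seq(1)[OF u]] unfolding Q by fastforce
 qed
 show "Y1 u 0 \<noteq> 0" using key[of "-1"] by auto
 show "?b 0 \<noteq> 0" using key[of 1] by auto
qed

definition al :: "real => complex" where "al u = (- \<i>) powr of_real (nn u) / of_real (sqrt (2 * pi))"
definition al' :: "real => complex" where "al' u = \<i> powr of_real (nn u) / of_real (sqrt (2 * pi))"

lemma U_seq:
 assumes U: "parabolic_cylinder_U U" and u: "u > 3" and s: "\<sigma> = \<i> \<or> \<sigma> = - \<i>"
 shows "(%k. U (- u / 2) (\<sigma> * of_real (real k)) / of_real (gk u k)) \<longlonglongrightarrow> \<sigma> powr of_real (nn u)"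
proof -
 \<comment> \<open>\<delta> = pi / 8 gives the sector |Arg z| <= 5 pi / 8, which contains both
   imaginary directions.\<close>
 let ?a = "{z. \<bar>Arg z\<bar> \<le> 3/4 * pi - pi / 8}"
 let ?G = "inf at_infinity (principal ?a)"
 let ?g = "%z. z powr (- of_real (- u / 2) - 1/2) * exp (- z\<^sup>2 / 4)"
 have "U (- u / 2) \<sim>[?G] ?g"
  by (rule U[unfolded parabolic_cylinder_U_def, THEN spec[where x = "- u / 2"], THEN conjunct2, THEN conjunct2, THEN spec[where x = "pi / 8"], THEN mp]) simp
 moreover have fl: "filterlim (%k. \<sigma> * of_real (real k)) ?G sequentially"
 proof (rule filterlim_inf[THEN iffD2], intro conjI filterlim_principal[THEN iffD2])
  have "filterlim (%k. norm (\<sigma> * of_real (real k))) at_top sequentially" using s by (auto simp: norm_mult filterlim_real_sequentially)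
  then show "filterlim (%k. \<sigma> * of_real (real k)) at_infinity sequentially" by (rule filterlim_norm_at_top_imp_at_infinity)
  show "\<forall>\<^sub>F k in sequentially. \<sigma> * of_real (real k) \<in> ?a" using eventually_gt_at_top[of 0]
  proof eventually_elim
   case (elim k)
   then show ?case using Arg_times_of_real[of "real k" \<sigma>] s by (auto simp: mult.commute)
  qed
 qed
 ultimately have "(%k. U (- u / 2) (\<sigma> * of_real (real k))) \<sim>[sequentially] (%k. ?g (\<sigma> * of_real (real k)))"
  by (rule asymp_equiv_compose')
 moreover have g: "?g (\<sigma> * of_real (real k)) = \<sigma> powr of_real (nn u) * of_real (gk u k)" for k
 proof -
  have a: "- (\<sigma> * of_real (real k))\<^sup>2 / 4 = of_real ((real k)^2 / 4)" using s by (auto simp: power_mult_distrib)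
  have b: "(\<sigma> * of_real (real k)) powr of_real (nn u) = \<sigma> powr of_real (nn u) * of_real (real k powr nn u)"
  proof -
   have "(of_real (real k) * \<sigma>) powr of_real (nn u) = of_real (real k) powr of_real (nn u) * \<sigma> powr of_real (nn u)"
    by (rule powr_times_real_left) simp_all
   also have "of_real (real k) powr of_real (nn u) = complex_of_real (real k powr nn u)" by (rule powr_of_real) simp
   finally show ?thesis by (simp only: mult.commute)
  qed
  have c: "- of_real (- u / 2) - 1/2 = complex_of_real (nn u)" by (simp add: nn_def)
  show ?thesis unfolding c a b exp_of_real gk_def of_real_mult by (simp only: mult_ac)
 qed
 moreover have nz: "\<sigma> powr of_real (nn u) \<noteq> 0" using s by auto
 moreover have ev: "\<forall>\<^sub>F k in sequentially. gk u k \<noteq> 0" by (simp add: gk_def)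
 ultimately have "(%k. U (- u / 2) (\<sigma> * of_real (real k)) / (\<sigma> powr of_real (nn u) * of_real (gk u k))) \<longlonglongrightarrow> 1"
  by (intro asymp_equivD_strong) (auto elim!: eventually_mono)
 from tendsto_mult_left[OF this, of "\<sigma> powr of_real (nn u)"] show ?thesis using nz by simp
qed

text \<open>Y1 (z) and Y1 (- z) span all solutions. In each imaginary direction one of them is
  negligible against \<open>gk\<close>, so the asymptotics of U at i infinity and at - i infinity
  determine one coefficient each.\<close>

lemma U_Y1:
 assumes U: "parabolic_cylinder_U U" and u: "u > 3"
 shows "U (- u / 2) (of_real (sqrt (2 * u)) * z) = al u * Y1 u z + al' u * Y1 u (- z)"
proof -
 define s where "s = complex_of_real (sqrt (2 * u))"
 have s2: "s^2 = 2 * of_real u" using u unfolding s_def of_real_power[symmetric] by simp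
 have s0: "s \<noteq> 0" using u by (simp add: s_def)
 have "ode2 (%z. z^2 / 4 + of_real (- u / 2)) UNIV (%_. 0) (U (- u / 2))"
  using U[unfolded parabolic_cylinder_U_def, THEN spec[where x = "- u / 2"]] unfolding ode2_def by (simp only:) simp
 from ode2_chain_linear[OF this open_UNIV open_UNIV, of s]
 have "ode2 (%z. s^2 * ((s * z)^2 / 4 + of_real (- u / 2))) UNIV (%_. 0) (%z. U (- u / 2) (s * z))" by simp
 moreover have "(%z. s^2 * ((s * z)^2 / 4 + of_real (- u / 2))) = (%z. of_real (u^2) * (z^2 - 1))"
  unfolding power_mult_distrib s2 by (simp add: power2_eq_square algebra_simps)
 ultimately have w: "weber u UNIV (%_. 0) (%z. U (- u / 2) (s * z))" by simp
 obtain a b where ab: "\<And>z. U (- u / 2) (s * z) = a * Y1 u z + b * Y1 u (- z)"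
  using weber_parity_span[OF Y1_ode[OF u] w Y1_nondegenerate[OF u]] by auto
 let ?z = "%k. of_real (real k / sqrt (2 * u))"
 have sz: "s * (\<sigma> * ?z k) = \<sigma> * of_real (real k)" for \<sigma> k using s0 by (simp add: s_def)
 let ?a = "%u k. of_real (gk u k)"
 have lim: "(%k. a * (Y1 u (\<sigma> * ?z k) / ?a u k) + b * (Y1 u (- \<sigma> * ?z k) / ?a u k)) \<longlonglongrightarrow> \<sigma> powr of_real (nn u)"
  if "\<sigma> = \<i> \<or> \<sigma> = - \<i>" for \<sigma> using U_seq[OF U u that] unfolding sz[symmetric] ab by (simp add: add_divide_distrib)
 have "(%k. a * (Y1 u (\<i> * ?z k) / ?a u k) + b * (Y1 u (- \<i> * ?z k) / ?a u k)) \<longlonglongrightarrow> a * 0 + b * of_real (sqrt (2 * pi))"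
  by (rule tendsto_add[OF tendsto_mult_left[OF Y1_seq(2)[OF u]] tendsto_mult_left[OF Y1_seq(1)[OF u]]])
 from LIMSEQ_unique[OF this lim[of \<i>]] have b: "b = al' u" unfolding al'_def by (simp add: field_simps)
 have "(%k. a * (Y1 u (- \<i> * ?z k) / ?a u k) + b * (Y1 u (- (- \<i>) * ?z k) / ?a u k)) \<longlonglongrightarrow> a * of_real (sqrt (2 * pi)) + b * 0"
  unfolding minus_minus by (rule tendsto_add[OF tendsto_mult_left[OF Y1_seq(1)[OF u]] tendsto_mult_left[OF Y1_seq(2)[OF u]]])
 from LIMSEQ_unique[OF this lim[of "- \<i>"]] have a: "a = al u" unfolding al_def by (simp add: field_simps)
 show ?thesis using ab[of z] unfolding a b s_def .
qed

section \<open>The connection coefficient on the imaginary axis\<close>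

lemma improper_shift:
 fixes f :: "real => complex"
 assumes f: "continuous_on {0..} f" and b: "\<And>t. t \<ge> 0 ==> norm (f t) \<le> C * exp (- (c * t))" and c: "c > 0"
 shows "integral {0..} f = integral {0..1} f + integral {0..} (%t. f (t + 1))"
proof -
 have f': "continuous_on {0..} (%t. f (t + 1))" by (rule continuous_on_compose2[OF f]) (auto intro!: continuous_intros)
 have b': "norm (f (t + 1)) \<le> (C * exp (- c)) * exp (- (c * t))" if "t \<ge> 0" for t
  using b[of "t + 1"] that by (simp add: distrib_left mult_ac exp_diff exp_minus divide_inverse)
 let ?a = "integral {0..1} f + integral {0..} (%t. f (t + 1))"
 have "((%N. integral {0..1} f + integral {0..N} (%t. f (t + 1))) \<longlongrightarrow> ?a) at_top"
  by (intro tendsto_add tendsto_const improper_tendsto[OF f' b' c])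
 moreover have "\<forall>\<^sub>F N in at_top. integral {0..1} f + integral {0..N} (%t. f (t + 1)) = integral {0..N + 1} f"
  using eventually_ge_at_top[of 0]
 proof eventually_elim
  case (elim N)
  have i: "f integrable_on {0..N + 1}" by (rule integrable_continuous_real, rule continuous_on_subset[OF f]) auto
  show ?case using integral_shift_Icc_real[of 0 N f 1] Henstock_Kurzweil_Integration.integral_combine[of 0 1 "N + 1" f] i elim by (simp add: o_def add.commute)
 qed
 ultimately have "((%N. integral {0..N + 1} f) \<longlongrightarrow> ?a) at_top" by (rule Lim_transform_eventually)
 moreover have "((%N. integral {0..N + 1} f) \<longlongrightarrow> integral {0..} f) at_top"
  by (rule filterlim_compose[OF improper_tendsto[OF f b c]]) (assumption | real_asymp)+
 ultimately show ?thesis using tendsto_unique trivial_limit_at_top_linorder by blast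
qed

definition KV :: "real => nat => complex" where
 "KV u R = - (1 / (2 * of_real u)) * \<i> ^ R * exp (- (\<i> * pi * pp u R))"

text \<open>On the negative axis the ray continues the segment, so the difference is an integral
  over T = - (1 + t), t >= 0. There (1 + T)^pp has phase exp (- i pi pp), since the branch passes
  below -1, and a Laplace integral with large parameter u y^2 / 2 is left.\<close>

lemma vseg_vray_imag:
 assumes u: "u > 3" and R: "R \<le> 1" and y: "y > 0"
 shows "vseg u R (of_real y * \<i>) - vray (- 1) u R (of_real y * \<i>) =
  KV u R * of_real (y ^ R * exp (- (u / 2 * y^2))) *
   integral {0..} (%t. of_real (t powr pp u R * exp (- (u / 2 * y^2 * t))) * of_real ((2 + t) powr (- qq u R)))"
proof -
 define z where "z = of_real y * \<i>"
 have z2: "z^2 = of_real (- (y^2))" by (simp add: z_def power_mult_distrib)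
 define f where "f = (%t. - 1 * kint u R z (of_real t * - 1))"
 have "(- 1 :: complex) \<in> psec" using dAB_psec by simp
 note fc = kint_ray_cont[OF u this, of R z, folded f_def]
 let ?g = "u / 2 * y^2"
 let ?c = "%u t. exp (- (?g * t))"
 have fb: "norm (f t) \<le> 9 * 3 powr pp u R * norm z ^ R * ?c u t" if "t \<ge> 0" for t
  using kint_bound[OF u R psec_scale[OF dAB_psec(3) that], of z] unfolding f_def z2 by (simp add: mult_ac)
 have "?g > 0" using u y by simp
 note sh = improper_shift[OF fc fb this]
 let ?h = "\<i> * pi * pp u R"
 let ?e = "exp (- ?h)"
 let ?a = "- (\<i> ^ R) * ?e * of_real (y ^ R * exp (- ?g))"
 let ?b = "%t. of_real ((2 + t) powr (- qq u R))"
 let ?l = "%t. t powr pp u R"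
 have f1: "f (t + 1) = ?a * (of_real (?l t * ?c u t) * ?b t)" if t: "t \<ge> 0" for t
 proof -
  let ?p = "of_real (t + 1) * - 1"
  let ?q = "of_real t * (- \<i>)"
  have e1: "\<i> * (1 + ?p) = ?q" by simp
  have e2: "1 - ?p = of_real (2 + t)" by simp
  let ?d = "of_real (pp u R)"
  have "?q powr ?d = of_real t powr ?d * (- \<i>) powr ?d" using t by (intro powr_times_real_left) auto
  also have "of_real t powr ?d = complex_of_real (?l t)" using t by (rule powr_of_real)
  also have "(- \<i>) powr ?d = exp (- (?h / 2))" by (simp add: powr_def mult_ac)
  finally have p1: "?q powr ?d = of_real (?l t) * exp (- (?h / 2))" .
  have p2: "complex_of_real (2 + t) powr (- of_real (qq u R)) = ?b t" using powr_of_real[of "2 + t" "- qq u R"] t by simp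
  have h: "exp (- (?h / 2)) * exp (- (?h / 2)) = ?e" unfolding exp_add[symmetric] by (rule arg_cong[of _ _ exp]) (simp add: field_simps)
  let ?f = "?p"
  have pf: "pF u R ?f = ?e * (of_real (?l t) * ?b t)" unfolding pF_def e1 e2 p1 p2 h[symmetric] by (simp only: mult_ac)
  have "- (of_real u / 2) * ?f * z^2 = of_real (- ?g + - (?g * t))" unfolding z2 by (simp add: algebra_simps)
  then have g: "g0 R (- (of_real u / 2) * ?f) z = z ^ R * (of_real (exp (- ?g)) * of_real (?c u t))"
   unfolding g0_def by (simp only: exp_of_real exp_add of_real_mult)
  have zR: "z ^ R = of_real (y ^ R) * \<i> ^ R" unfolding z_def power_mult_distrib by simp
  show ?thesis unfolding f_def kint_def pf g zR of_real_mult by (simp only: mult_ac mult_minus_left mult_minus_right mult_1)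
 qed
 define I where "I = integral {0..} (%t. complex_of_real (?l t * ?c u t) * ?b t)"
 let ?k = "integral {0..} (%t. f (t + 1))"
 have a: "?k = ?a * I" unfolding I_def integral_mult_right[symmetric] by (rule integral_cong) (use f1 in auto)
 have "a - b = c * (s - i)" if "a = - c * i" "b = - c * s" for a b c s i :: complex using that by (simp add: algebra_simps)
 from this[OF vseg_def[of u R z, folded f_def] vray_def[of "-1" u R z, folded f_def]]
 have b: "vseg u R z - vray (- 1) u R z = 1 / (2 * of_real u) * ?k" using sh by simp
 show ?thesis unfolding z_def[symmetric] KV_def I_def[symmetric] b a by simp
qed

lemma Y1_imag:
 "Y1 u (of_real y * \<i>) = of_real (exp (- (u / 2 * y^2))) *
  integral {0..} (%t. of_real (t powr nn u * exp (- (sqrt (2 * u) * y * t))) * of_real (exp (- (t^2) / 2)))"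
proof -
 let ?a = "of_real y * \<i>"
 have "of_real (u / 2) * ?a^2 = of_real (- (u / 2 * y^2))" by (simp add: power_mult_distrib)
 moreover have "exp (\<i> * of_real (sqrt (2 * u)) * ?a * of_real t) = of_real (exp (- (sqrt (2 * u) * y * t)))" for t
 proof -
  have "\<i> * a * (b * \<i>) * c = (\<i> * \<i>) * (a * b * c)" for a b c by (simp only: mult_ac)
  then have "\<i> * of_real (sqrt (2 * u)) * ?a * of_real t = of_real (- (sqrt (2 * u) * y * t))" by simp
  then show ?thesis by (simp only: exp_of_real)
 qed
 ultimately show ?thesis unfolding Y1_def Yint_def by (simp only: exp_of_real of_real_mult mult_ac)
qed

definition cR :: "real => nat => real" where "cR u R = u / 4 - real R / 2 + 3 / 4"

text \<open>The coefficient - 2 pi i rho al of Y1 for R <= 1, where the hypergeometric factor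
  reduces to 1 / Gamma (cR u R); see \<open>cV_rho\<close>.\<close>

definition cV :: "real => nat => complex" where
 "cV u R = - (2 * pi * \<i>) * of_real (2 powr (- u / 4 + real R - 5 / 4) * u powr (- real R / 2 - 1) / Gamma (cR u R)) * al u"

text \<open>For R <= 1 the numbers pp + 1 and cR are x and x + 1/2 in some order, where x = u/4 +
  1/4 and 2 x = nn + 1. So Legendre's duplication formula relates the Gamma factors of the two
  Watson limits.\<close>

lemma cV_alt:
 assumes u: "u > 3" and R: "R \<le> 1"
 shows "KV u R * of_real ((u / 2) powr (- (pp u R + 1)) * (Gamma (pp u R + 1) * 2 powr (- qq u R))) =
  cV u R * of_real (sqrt (2 * u) powr (- (nn u + 1)) * Gamma (nn u + 1))"
proof -
 define x where "x = u / 4 + 1 / 4"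
 have x: "x > 0" using u by (simp add: x_def)
 have pos: "Gamma x > 0" "Gamma (x + 1/2) > 0" "Gamma (2 * x) > 0" using x by auto
 have nni: "complex_of_real a \<notin> \<int>\<^sub>\<le>\<^sub>0" if "a > 0" for a using that by (rule not_nonpos_Int_aux)
 have "Gamma (complex_of_real x) * Gamma (of_real (x + 1/2)) = exp ((1 - 2 * of_real x) * of_real (ln 2)) * of_real (sqrt pi) * Gamma (of_real (2 * x))"
  using Gamma_legendre_duplication[of "of_real x"] nni[of x] nni[of "x + 1/2"] x by simp
 also have "(1 - 2 * of_real x) * of_real (ln 2) = of_real ((1 - 2 * x) * ln 2)" by simp
 finally have "complex_of_real (Gamma x * Gamma (x + 1/2)) = of_real (exp ((1 - 2 * x) * ln 2) * sqrt pi * Gamma (2 * x))"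
  by (simp only: Gamma_complex_of_real exp_of_real of_real_mult[symmetric])
 then have leg: "Gamma x * Gamma (x + 1/2) = exp ((1 - 2 * x) * ln 2) * sqrt pi * Gamma (2 * x)" by (simp only: of_real_eq_iff)
 have n1: "nn u + 1 = 2 * x" by (simp add: nn_def x_def)
 let ?k = "pp u R + 1"
 have "{?k, cR u R} = {x, x + 1/2} \<and> ?k \<noteq> cR u R"
 proof -
  consider "R = 0" | "R = 1" using R by linarith
  then show ?thesis by cases (auto simp: pp_def cR_def x_def field_simps)
 qed
 then have prod: "Gamma ?k * Gamma (cR u R) = exp ((1 - 2 * x) * ln 2) * sqrt pi * Gamma (nn u + 1)"
  and cpos: "Gamma (cR u R) > 0"
  unfolding n1 leg[symmetric] using pos by (auto simp: doubleton_eq_iff)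
 have u0: "u > 0" using u by simp
 have lnu: "ln (u / 2) = ln u - ln 2" "ln (sqrt (2 * u)) = (ln 2 + ln u) / 2" using u0 by (simp_all add: ln_div ln_sqrt ln_mult)
 let ?f = "sqrt (2 * pi)"
 let ?l = "- ln 2 / 2"
 have sq: "sqrt pi = ?f * exp ?l"
 proof -
  have "sqrt 2 = exp (ln 2 / 2)" using powr_half_sqrt[of 2] by (simp add: powr_def)
  then have "sqrt 2 * exp ?l = 1" by (simp only:) (simp flip: exp_add)
  then show ?thesis by (simp add: real_sqrt_mult)
 qed
 let ?h = "\<i> * pi * (real R / 2)"
 have iR: "\<i> ^ R = exp ?h"
 proof -
  consider "R = 0" | "R = 1" using R by linarith
  then show ?thesis using cis_pi_half by cases (simp_all add: cis_conv_exp)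
 qed
 let ?c = "\<i> * pi * (nn u / 2)"
 have al: "al u = exp (- ?c) / of_real ?f" by (simp add: al_def powr_def mult_ac)
 let ?e = "\<i> * pi * pp u R"
 have phase: "\<i> ^ R * exp (- ?e) = \<i> * exp (- ?c)"
 proof -
  let ?p = "\<i> * pi * (1 / 2)"
  have "\<i> = exp ?p" using cis_pi_half by (simp add: cis_conv_exp)
  then have "\<i> * exp (- ?c) = exp (?p + - ?c)" by (simp only: exp_add)
  moreover have "\<i> ^ R * exp (- ?e) = exp (?h + - ?e)" unfolding iR by (simp only: exp_add)
  moreover have "?h + - ?e = ?p + - ?c" unfolding pp_def nn_def by (simp add: field_simps)
  ultimately show ?thesis by simp
 qed
 let ?a = "(u / 2) powr (- ?k) * (Gamma ?k * 2 powr (- qq u R))"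
 let ?b = "sqrt (2 * u) powr (- (nn u + 1)) * Gamma (nn u + 1)"
 let ?d = "2 powr (- u / 4 + real R - 5 / 4) * u powr (- real R / 2 - 1) / Gamma (cR u R)"
 have mag: "(1 / (2 * u)) * ?a =
   2 * pi * ?d / ?f * ?b"
 proof -
  let ?g = "Gamma (nn u + 1) / Gamma (cR u R)"
  have G: "Gamma ?k = exp ((1 - 2 * x) * ln 2) * (?f * exp ?l) * ?g" using prod cpos sq by (simp add: field_simps)
  have tp: "2 * pi / ?f = ?f" by (simp add: real_div_sqrt)
  have inv: "1 / (2 * u) = exp (- ln 2 - ln u)"
  proof -
   have "exp (- (ln 2 + ln u)) = inverse (2 * u)" unfolding exp_minus exp_add using u0 by simp
   moreover have "- (ln 2 + ln u) = - ln 2 - ln u" by simp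
   ultimately show ?thesis by (simp only: inverse_eq_divide)
  qed
  have "(1 / (2 * u)) * ?a =
   ?f * ?g * exp ((- ln 2 - ln u) + (- ?k * (ln u - ln 2)) + ((1 - 2 * x) * ln 2) + ?l + (- qq u R * ln 2))"
   unfolding G inv exp_add powr_def lnu using u0 by simp
  also have "(- ln 2 - ln u) + (- ?k * (ln u - ln 2)) + ((1 - 2 * x) * ln 2) + ?l + (- qq u R * ln 2)
   = (- u / 4 + real R - 5 / 4) * ln 2 + (- real R / 2 - 1) * ln u + - (nn u + 1) * ((ln 2 + ln u) / 2)"
   unfolding x_def pp_def qq_def nn_def by (simp add: field_simps)
  also have "?f * ?g * exp \<dots> =
   2 * pi / ?f * ?d * ?b"
   unfolding tp exp_add powr_def lnu using u0 by simp
  finally show ?thesis by simp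
 qed
 have "KV u R * of_real ?a = - (\<i> * exp (- ?c)) * of_real ((1 / (2 * u)) * ?a)" unfolding KV_def phase[symmetric] by simp
 also have "\<dots> = cV u R * of_real ?b" unfolding mag cV_def al by simp
 finally show ?thesis .
qed

lemma powr_cancel_left:
 fixes a b e :: real
 assumes "a > 0" "b \<ge> 0"
 shows "a powr (- e) * (a * b) powr e = b powr e"
 using assms by (simp add: powr_mult powr_minus)

text \<open>Both sides are exp (- u y^2 / 2) times Laplace integrals. Their Watson limits as y tends
  to infinity carry the same power of y because 2 (pp + 1) = R + nn + 1, and comparing the limits
  gives c.\<close>

lemma connection_constant:
 assumes u: "u > 3" and R: "R \<le> 1"
  and c: "\<forall>\<^sub>F y in at_top. vseg u R (of_real y * \<i>) - vray (- 1) u R (of_real y * \<i>) = c * Y1 u (of_real y * \<i>)"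
 shows "c = cV u R"
proof -
 define s where "s = sqrt (2 * u)"
 have s: "s > 0" using u by (simp add: s_def)
 have n: "nn u > 0" and p: "pp u R > 0" using u by (auto simp: nn_def pp_def)
 let ?q = "pp u R + 1"
 let ?s = "complex_of_real"
 let ?w = "integral {0..}"
 define W1 where "W1 = (%l. of_real (l powr ?q) * ?w (%t. of_real (t powr pp u R * exp (- (l * t))) * ?s ((2 + t) powr (- qq u R))))"
 let ?r = "nn u + 1"
 define W2 where "W2 = (%l. of_real (l powr ?r) * ?w (%t. of_real (t powr nn u * exp (- (l * t))) * ?s (exp (- (t^2) / 2))))"
 have q: "qq u R > 0" using u R by (simp add: qq_def)
 let ?h = "of_real (Gamma ?q) * of_real ((2 + 0) powr (- qq u R))"
 have L1: "(W1 \<longlongrightarrow> ?h) at_top" unfolding W1_def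
 proof (rule watson[OF p, where B = 1])
  show "continuous_on {0..} (%t. ?s ((2 + t) powr - qq u R))" by (intro continuous_intros) auto
  fix t :: real assume t: "t \<ge> 0"
  have "(2 + t) powr (- qq u R) \<le> (2 + t) powr 0" using t q by (intro powr_mono) auto
  then show "norm (?s ((2 + t) powr - qq u R)) \<le> 1" using t by simp
 qed
 let ?g = "Gamma ?r"
 let ?l = "of_real ?g * of_real (exp (- (0^2) / 2))"
 have L2: "(W2 \<longlongrightarrow> ?l) at_top" unfolding W2_def by (rule watson[OF n, where B = 1]) (auto intro!: continuous_intros)
 have f1: "filterlim (%y. u / 2 * y^2) at_top at_top" and f2: "filterlim (%y. s * y) at_top at_top" using u s by real_asymp+
 let ?a = "of_real ((u / 2) powr (- ?q))"
 let ?b = "%y. u / 2 * y^2"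
 let ?e = "?h"
 let ?v = "%y. KV u R * ?a * W1 (?b y)"
 have T1: "(?v \<longlongrightarrow>
   KV u R * ?a * ?e) at_top"
  by (rule tendsto_mult_left[OF filterlim_compose[OF L1 f1]])
 let ?d = "of_real (s powr (- ?r))"
 let ?f = "?l"
 have T2: "((%y. c * ?d * W2 (s * y)) \<longlongrightarrow>
   c * ?d * ?f) at_top"
  by (rule tendsto_mult_left[OF filterlim_compose[OF L2 f2]])
 have "\<forall>\<^sub>F y in at_top. ?v y = c * ?d * W2 (s * y)" using c eventually_gt_at_top[of 0]
 proof eventually_elim
  case (elim y)
  define I1 where "I1 = ?w (%t. of_real (t powr pp u R * exp (- (u / 2 * y^2 * t))) * ?s ((2 + t) powr (- qq u R)))"
  define I2 where "I2 = ?w (%t. of_real (t powr nn u * exp (- (s * y * t))) * ?s (exp (- (t^2) / 2)))"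
  define e where "e = exp (- ?b y)"
  let ?k = "KV u R * of_real (y ^ R) * I1"
  have "of_real e * ?k = of_real e * (c * I2)" using elim(1) unfolding vseg_vray_imag[OF u R elim(2)] Y1_imag I1_def I2_def s_def by (simp add: mult_ac)
  moreover have "of_real e \<noteq> 0" by (simp add: e_def)
  ultimately have eq: "?k = c * I2" by simp
  have y: "y > 0" by fact
  have "(u / 2) powr (- ?q) * ?b y powr ?q = (y^2) powr ?q" by (rule powr_cancel_left) (use u in auto)
  also have "\<dots> = y powr (2 * ?q)" using y by (simp add: powr_powr flip: powr_numeral)
  also have "2 * ?q = real R + ?r" by (simp add: pp_def nn_def)
  also have "y powr (real R + ?r) = y ^ R * y powr ?r" unfolding powr_add powr_realpow[OF y] ..
  finally have e1: "(u / 2) powr (- ?q) * ?b y powr ?q = y ^ R * y powr ?r" .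
  let ?p = "s powr (- ?r) * (s * y) powr ?r"
  have e2: "?p = y powr ?r" by (rule powr_cancel_left) (use s y in auto)
  have w: "W1 (?b y) = of_real (?b y powr ?q) * I1" "W2 (s * y) = of_real ((s * y) powr ?r) * I2" unfolding W1_def I1_def W2_def I2_def by rule+
  have "?v y = KV u R * of_real ((u / 2) powr (- ?q) * ?b y powr ?q) * I1" unfolding w of_real_mult by (simp only: mult_ac)
  also have "\<dots> = ?k * of_real (y powr ?r)" unfolding e1 of_real_mult by (simp only: mult_ac)
  also have "\<dots> = c * of_real ?p * I2" unfolding eq e2 by (simp only: mult_ac)
  also have "\<dots> = c * ?d * W2 (s * y)" unfolding w of_real_mult by (simp only: mult_ac)
  finally show ?case .
 qed
 from Lim_transform_eventually[OF T1 this] have "KV u R * ?a * ?e = c * ?d * ?f" using T2 tendsto_unique trivial_limit_at_top_linorder by blast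
 then have "cV u R * of_real (sqrt (2 * u) powr (- ?r) * ?g) = c * of_real (sqrt (2 * u) powr (- ?r) * ?g)"
  unfolding cV_alt[OF u R, symmetric] s_def by (simp add: mult_ac)
 moreover have "sqrt (2 * u) powr (- ?r) * ?g > 0" using s n unfolding s_def by (intro mult_pos_pos) auto
 ultimately show ?thesis by auto
qed

text \<open>The function 0, split as - y + y, is not exponentially large, so
  \<open>not_exp_large\<close> applies with v = - y.\<close>

lemma weber_poly_bddr:
 assumes "weber_ray u d \<sigma> S y a" "\<forall>\<^sub>F r in at_top. norm (y (of_real r * d)) \<le> K * r ^ N"
 shows "bddr d y"
by (rule weber_ray.not_exp_large[OF assms(1), where w = "%_. 0" and v = "%z. - y z" and K = K and N = N]) ((unfold exp_large_at_def, simp), (use assms(2) in simp_all))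

section \<open>Ray solutions near +infinity and i infinity\<close>

text \<open>Convex cones around the positive real and imaginary axes, overlapping at 1 + i. The
  slopes 2 and -1/4 are rational numbers between the roots 1 + sqrt 2 and 1 - sqrt 2 of the forms Re
  (z^2 dA) in y/x and Re (z^2 dB) in x/y.\<close>

definition Q1 :: "complex set" where "Q1 = {z. Re z > 0 \<and> - Re z / 4 < Im z \<and> Im z < 2 * Re z}"
definition Q2 :: "complex set" where "Q2 = {z. Im z > 0 \<and> - Im z / 4 < Re z \<and> Re z < 2 * Im z}"

lemma Q_open: "open Q1" "open Q2" unfolding Q1_def Q2_def by (auto intro!: open_Collect_conj open_Collect_less continuous_intros)

lemma Q_conn: "connected Q1" "connected Q2"
proof -
 let ?a = "%z. Re (Complex (-1/4) (-1) * cnj z)"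
 let ?b = "%z. Re (Complex (-1) (-1/4) * cnj z)"
 let ?c = "%z. Re (Complex (-2) 1 * cnj z)"
 let ?d = "%z. Re (Complex 1 (-2) * cnj z)"
 have c: "convex {z. Re z > 0}" "convex {z. ?a z < 0}" "convex {z. ?c z < 0}"
   "convex {z. Im z > 0}" "convex {z. ?b z < 0}" "convex {z. ?d z < 0}"
  using convex_halfspace_lt[of "Complex (-1/4) (-1)" 0] convex_halfspace_lt[of "Complex (-2) 1" 0]
   convex_halfspace_lt[of "Complex (-1) (-1/4)" 0] convex_halfspace_lt[of "Complex 1 (-2)" 0]
  by (simp_all add: convex_halfspace_Re_gt convex_halfspace_Im_gt inner_complex_def)
 let ?e = "{z. Re z > 0} \<inter> {z. ?a z < 0} \<inter> {z. ?c z < 0}"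
 let ?f = "{z. Im z > 0} \<inter> {z. ?b z < 0} \<inter> {z. ?d z < 0}"
 have "convex ?e"
  "convex ?f"
  by (rule convex_Int[OF convex_Int[OF c(1,2)] c(3)], rule convex_Int[OF convex_Int[OF c(4,5)] c(6)])
 moreover have "?e = Q1"
  "?f = Q2"
  by (auto simp: Q1_def Q2_def)
 ultimately show "connected Q1" "connected Q2" by (simp_all add: convex_connected)
qed

lemma Q_cone: "Q1 \<subseteq> cone dA" "Q2 \<subseteq> cone dB"
proof -
 show "Q1 \<subseteq> cone dA"
 proof
  fix z assume z: "z \<in> Q1"
  define x y where "x = Re z" and "y = Im z"
  have h: "x > 0" "- x / 4 < y" "y < 2 * x" using z by (auto simp: Q1_def x_def y_def)
  then have "(y + x / 4) * (2 * x - y) > 0" by simp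
  moreover have "x * x > 0" using h by simp
  moreover have "x * y \<ge> - (x * x) / 4" using mult_left_mono[of "- x / 4" y x] h by simp
  ultimately show "z \<in> cone dA" by (simp add: cone_def dA_def power2_eq_square x_def y_def algebra_simps)
 qed
 show "Q2 \<subseteq> cone dB"
 proof
  fix z assume z: "z \<in> Q2"
  define x y where "x = Re z" and "y = Im z"
  have h: "y > 0" "- y / 4 < x" "x < 2 * y" using z by (auto simp: Q2_def x_def y_def)
  then have "(x + y / 4) * (2 * y - x) > 0" by simp
  moreover have "y * y > 0" using h by simp
  moreover have "y * x \<ge> - (y * y) / 4" using mult_left_mono[of "- y / 4" x y] h by simp
  ultimately show "z \<in> cone dB" by (simp add: cone_def dB_def power2_eq_square x_def y_def algebra_simps)
 qed
qed

lemma Q1_Q2: "\<exists>z. z \<in> Q1 \<inter> Q2" by (rule exI[of _ "Complex 1 1"]) (simp add: Q1_def Q2_def)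

text \<open>Subtracting this multiple of Y1 gives the entire function that continues the ray
  solutions, \<open>vray dB\<close> on \<open>Q2\<close> and \<open>vray dA\<close> on
  \<open>Q1\<close>.\<close>

definition vinf :: "real => nat => complex => complex" where
 "vinf u R z = vseg u R z - cV u R * Y1 u z"

lemma vinf_ode: "u > 3 ==> R \<le> 1 ==> weber u UNIV (%z. z ^ R) (vinf u R)"
 using ode2_diff[OF vseg_ode ode2_cmult[OF Y1_ode open_UNIV] open_UNIV, of u R "cV u R"]
 unfolding vinf_def[abs_def] by simp

lemma dAB_psec': "Im dA < 0" "Im dB < 0" "norm dA \<le> 2" "norm dB \<le> 2" "Re dA = 1" "Re dB = -1"
 by (auto simp: dA_def dB_def cmod_def intro: real_le_lsqrt)

lemma vrayB_bound:
 assumes "u > 3" "R \<le> 1" "Re (z^2 * dB) > 0"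
 shows "norm (vray dB u R z) \<le> 18 * norm z ^ R / (u^2 * Re (z^2 * dB))"
proof -
 let ?a = "u^2 * (Re (z^2 * dB) - 0)"
 have "norm (vray dB u R z) \<le> 9 * norm dB * norm z ^ R / ?a"
  by (rule vray_bound[OF assms(1,2) dAB_psec(2)]) (use assms(3) dB_quot in simp_all)
 also have "\<dots> \<le> 18 * norm z ^ R / ?a" using dAB_psec'(4) assms by (intro divide_right_mono mult_right_mono) auto
 finally show ?thesis by simp
qed

lemma vrayA_bound:
 assumes "u > 3" "R \<le> 1" "Re (z^2 * dA) > 1"
 shows "norm (vray dA u R z) \<le> 18 * norm z ^ R / (u^2 * (Re (z^2 * dA) - 1))"
proof -
 let ?a = "u^2 * (Re (z^2 * dA) - 1)"
 have "norm (vray dA u R z) \<le> 9 * norm dA * norm z ^ R / ?a"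
  by (rule vray_bound[OF assms(1,2) dAB_psec(1)]) (use assms(3) dA_quot in simp_all)
 also have "\<dots> \<le> 18 * norm z ^ R / ?a" using dAB_psec'(3) assms by (intro divide_right_mono mult_right_mono) auto
 finally show ?thesis .
qed

lemma imag_in_Q2: "y > 0 ==> of_real y * \<i> \<in> Q2" by (simp add: Q2_def)

lemma imag_square: "(of_real y * \<i>)^2 = - of_real (y^2)" by (simp add: power_mult_distrib)

lemma Re_imag_dB: "Re ((of_real y * \<i>)^2 * dB) = y^2" unfolding imag_square by (simp add: dB_def)

lemma Y1_imag_nonzero:
 assumes u: "u > 3"
 shows "\<exists>y\<ge>1. Y1 u (of_real y * \<i>) \<noteq> 0"
proof (rule ccontr)
 assume "\<not> ?thesis"
 then have z: "Y1 u (of_real y * \<i>) = 0" if "y \<ge> 1" for y using that by simp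
 have "Y1 u 0 = 0"
 proof (rule holo_zero_on_ray[OF ode2_holo[OF Y1_ode[OF u]] open_UNIV connected_UNIV, of \<i> 1])
  show "Y1 u (of_real r * \<i>) = 0" if "1 < r" for r using z[of r] that by simp
 qed auto
 then show False using Y1_nondegenerate[OF u] by simp
qed

text \<open>\<open>vseg\<close> and the ray integral are both polynomially bounded towards i
  infinity, so their difference is a multiple of Y1. On the imaginary axis the ray may be turned to
  the direction -1, where \<open>connection_constant\<close> gives the multiple.\<close>

lemma vinf_vrayB:
 assumes u: "u > 3" and R: "R \<le> 1" and z: "z \<in> Q2"
 shows "vinf u R z = vray dB u R z"
proof -
 define D where "D = (%z. vseg u R z - vray dB u R z)"
 have ob: "weber u Q2 (%z. z ^ R) (vray dB u R)" using vray_ode[OF u R dAB_psec(2) dAB_psec'(2)] ode2_subset Q_cone(2) by simp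
 have oD: "weber u Q2 (%_. 0) D" using ode2_diff[OF ode2_subset[OF vseg_ode[OF u R] subset_UNIV] ob Q_open(2)] unfolding D_def by simp
 let ?f = "weber u Q2 (%_. 0) (Y1 u)"
 have oY: "?f" by (rule ode2_subset[OF Y1_ode[OF u] subset_UNIV])
 let ?b = "%a. of_real a * \<i>"
 obtain a where a: "a \<ge> 1" "Y1 u (?b a) \<noteq> 0" using Y1_imag_nonzero[OF u] by auto
 let ?e = "%r. of_real r * \<i>"
 have ray: "?e r \<in> Q2" if "r \<ge> a" for r using imag_in_Q2[of r] a(1) that by simp
 have wr: "weber_ray u \<i> (-1) Q2 D a" by (rule weber_ray.intro[OF _ _ _ Q_open(2) ray oD]) (use u a order_trans[of "-1" 0 "a^2"] in simp_all)
 let ?a = "%r. ?e r"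
 have "\<forall>\<^sub>F r in at_top. norm (D (?a r)) \<le> (exp (3/2) + 18) * r ^ R" using eventually_ge_at_top[of 1]
 proof eventually_elim
  case (elim r)
  have n: "norm (?a r) = r" using elim by (simp add: norm_mult)
  have r2: "r^2 \<ge> 1" using elim by simp
  have "norm (vseg u R (?a r)) \<le> exp (3/2) * r ^ R / (2 * u)" using vseg_bound[OF u R, of "?e r"] r2 n by (simp only: imag_square) simp
  also have "\<dots> \<le> exp (3/2) * r ^ R / 1" using u elim by (intro divide_left_mono) auto
  finally have 1: "norm (vseg u R (?a r)) \<le> exp (3/2) * r ^ R" by simp
  have "norm (vray dB u R (?a r)) \<le> 18 * r ^ R / (u^2 * r^2)" using vrayB_bound[OF u R, of "?e r"] elim unfolding n Re_imag_dB by simp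
  also have "\<dots> \<le> 18 * r ^ R / 1"
  proof (intro divide_left_mono)
   have "1 * 1 \<le> u^2 * r^2" using u r2 by (intro mult_mono) auto
   then show "1 \<le> u^2 * r^2" by simp
  qed (use u elim in auto)
  finally show ?case using 1 norm_triangle_ineq4[of "vseg u R (?a r)" "vray dB u R (?a r)"] unfolding D_def by (simp add: distrib_right)
 qed
 then have bD: "bddr \<i> D" by (rule weber_poly_bddr[OF wr])
 have pr: "Y1 u (?b a) * D z = D (?b a) * Y1 u z" if "z \<in> Q2" for z
 proof (rule weber_ray_proportional[where a = a and u = u and d = \<i> and \<sigma> = "-1" and S = Q2])
  show "?f" "weber u Q2 (%_. 0) D" by (fact , fact)
  show "bddr \<i> (Y1 u)" "bddr \<i> D" by (fact Y1_bddr[OF u], fact)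
  show "- 1 \<le> a^2" by (rule order_trans[of _ 0]) auto
 qed (use u a that ray Q_open Q_conn in simp_all)
 define c where "c = D (?b a) / Y1 u (?b a)"
 have Dc: "D z = c * Y1 u z" if "z \<in> Q2" for z using pr[OF that] a(2) by (simp add: c_def nonzero_eq_divide_eq mult.commute)
 have "c = cV u R"
 proof (rule connection_constant[OF u R])
  let ?d = "%y. of_real y * \<i>"
  show "\<forall>\<^sub>F y in at_top. vseg u R (?d y) - vray (- 1) u R (?d y) = c * Y1 u (?d y)" using eventually_gt_at_top[of 0]
  proof eventually_elim
   case (elim y)
   have "of_real y * \<i> \<in> cone (- 1)" using elim unfolding cone_def mem_Collect_eq imag_square by simp
   then have "vray dB u R (?d y) = vray (- 1) u R (?d y)" using Q_cone(2) imag_in_Q2[OF elim] by (intro vray_rotate[OF u R dAB_psec(2,3)]) auto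
   then show ?case using Dc[OF imag_in_Q2[OF elim]] unfolding D_def by simp
  qed
 qed
 then show ?thesis using Dc[OF z] unfolding D_def vinf_def by (simp add: algebra_simps)
qed

text \<open>On the overlap of the cones the ray turns from \<open>dB\<close> to \<open>dA\<close>,
  and analytic continuation does the rest.\<close>

lemma vinf_vrayA:
 assumes u: "u > 3" and R: "R \<le> 1" and z: "z \<in> Q1"
 shows "vinf u R z = vray dA u R z"
proof -
 obtain z0 where z0: "z0 \<in> Q1 \<inter> Q2" using Q1_Q2 by auto
 show ?thesis
 proof (rule analytic_continuation_open[where s = "Q1 \<inter> Q2" and s' = Q1 and f = "vinf u R" and g = "vray dA u R" and z = z])
  show "vray dA u R holomorphic_on Q1" by (rule holomorphic_on_subset[OF ode2_holo[OF vray_ode[OF u R dAB_psec(1) dAB_psec'(1)]] Q_cone(1)])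
  show "vinf u R holomorphic_on Q1" by (rule holomorphic_on_subset[OF ode2_holo[OF vinf_ode[OF u R]] subset_UNIV])
  show "vinf u R z = vray dA u R z" if "z \<in> Q1 \<inter> Q2" for z
  proof -
   have "vray dA u R z = vray dB u R z" using that Q_cone by (intro vray_rotate[OF u R dAB_psec(1,2)]) auto
   then show ?thesis using vinf_vrayB[OF u R] that by simp
  qed
 qed (use z z0 Q_open Q_conn in auto)
qed

section \<open>Arbitrary exponents R\<close>

text \<open>Coefficients of the terminating series F in \<open>gamma_mR\<close> without the
  reciprocal Gamma factors; r is real so that the parameter can be shifted down by 2.\<close>

definition ah :: "real => nat => real" where
 "ah r s = pochhammer (1 / 2 - r / 2) s * pochhammer (- r / 2) s * ((1 / 2) ^ s / fact s)"

lemma ah_0 [simp]: "ah r 0 = 1" by (simp add: ah_def)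

lemma ah_zero:
 assumes "s > R"
 shows "ah (real R) s = 0"
proof (cases "even R")
 case True
 then obtain k where k: "R = 2 * k" by auto
 have "pochhammer (- real R / 2) s = 0" unfolding pochhammer_eq_0_iff by (rule exI[of _ k]) (use k assms in auto)
 then show ?thesis by (simp add: ah_def)
next
 case False
 then obtain k where k: "R = 2 * k + 1" by (blast elim: oddE)
 have "pochhammer (1 / 2 - real R / 2) s = 0" unfolding pochhammer_eq_0_iff by (rule exI[of _ k]) (use k assms in "auto simp: field_simps")
 then show ?thesis by (simp add: ah_def)
qed

lemma ah_rec:
 "ah (r + 2) (Suc s) = ah r (Suc s) - (real s - r / 2 - 1 / 4) * ah r s + r * (r - 1) / 16 * (if s = 0 then 0 else ah (r - 2) (s - 1))"
proof -
 define x y where "x = 1 / 2 - r / 2" and "y = - r / 2"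
 let ?b = "pochhammer"
 define k where "k = ?b x s * ?b y s * ((1 / 2) ^ s / fact s)"
 have kap: "(1 / 2) ^ Suc n / fact (Suc n) = ((1 / 2) ^ n / fact n) / (2 * (real n + 1))" for n by simp
 have k2: "ah r s = k" by (simp add: k_def ah_def x_def y_def)
 have p: "?b (1 / 2 - (r + 2) / 2) (Suc s) = (x - 1) * ?b x s" "?b (- (r + 2) / 2) (Suc s) = (y - 1) * ?b y s"
  unfolding pochhammer_rec by (simp_all add: x_def y_def field_simps)
 let ?a = "2 * (real s + 1)"
 have k1: "ah (r + 2) (Suc s) = (x - 1) * (y - 1) * k / ?a" unfolding ah_def k_def p kap by simp
 have k3: "ah r (Suc s) = (x + s) * (y + s) * k / ?a" unfolding ah_def k_def x_def[symmetric] y_def[symmetric] pochhammer_Suc kap by simp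
 let ?c = "real s * k / 2"
 have k4: "r * (r - 1) / 16 * (if s = 0 then 0 else ah (r - 2) (s - 1)) = ?c"
 proof (cases s)
  case (Suc j)
  have q: "?b x (Suc j) = x * ?b (1 / 2 - (r - 2) / 2) j" "?b y (Suc j) = y * ?b (- (r - 2) / 2) j"
   unfolding pochhammer_rec x_def y_def by (simp_all add: field_simps)
  have "k = x * y * ah (r - 2) j / (2 * real s)" unfolding k_def ah_def Suc q by (simp add: mult_ac)
  moreover have "real s \<noteq> 0" using Suc by simp
  ultimately have "?c = x * y * ah (r - 2) j / 4" by simp
  also have "x * y = r * (r - 1) / 4" by (simp add: x_def y_def field_simps)
  finally have f: "?c = r * (r - 1) / 4 * ah (r - 2) j / 4" .
  show ?thesis unfolding f using Suc by simp
 qed simp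
 have s: "2 * (real s + 1) \<noteq> 0" by simp
 have "(x - 1) * (y - 1) * k / ?a = ((x + s) * (y + s) - (real s - r / 2 - 1 / 4) * ?a + real s * (real s + 1)) * k / ?a" unfolding x_def y_def by (simp add: field_simps)
 also have "\<dots> = (x + s) * (y + s) * k / ?a - (real s - r / 2 - 1 / 4) * k + ?c" by (simp add: divide_simps) (simp add: algebra_simps)
 finally show ?thesis unfolding k1 k2 k3 k4 .
qed

definition FR :: "real => nat => real" where
 "FR u R = (\<Sum>s\<le>R. ah (real R) s * rGamma (cR u R + real s))"

lemma FR_alt:
 assumes "M > R"
 shows "FR u R = (\<Sum>s<M. ah (real R) s * rGamma (cR u R + real s))"
 unfolding FR_def by (rule sum.mono_neutral_left) (use assms ah_zero in auto)

lemma hyperF_FR: "hyperF_reg (1/2 - of_nat R/2) (- of_nat R/2) (of_real u/4 - of_nat R/2 + 3/4) (1/2) = of_real (FR u R)"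
proof -
 let ?a = "%s. ah (real R) s * rGamma (cR u R + real s)"
 let ?d = "%s. of_real u/4 - of_nat R/2 + 3/4 + of_nat s"
 let ?b = "%s. rGamma (?d s)"
 let ?c = "complex_of_real"
 have t: "pochhammer (1/2 - of_nat R/2) s * pochhammer (- of_nat R/2) s * (1/2) ^ s * ?b s / fact s = ?c (?a s)" for s
 proof -
  have "pochhammer (1/2 - of_nat R/2) s = ?c (pochhammer (1/2 - real R/2) s)" "pochhammer (- of_nat R/2) s = ?c (pochhammer (- real R/2) s)"
   by (simp_all flip: pochhammer_of_real)
  moreover have "?d s = ?c (cR u R + real s)" by (simp add: cR_def)
  then have "?b s = ?c (rGamma (cR u R + real s))" by (simp only: rGamma_complex_of_real)
  ultimately show ?thesis by (simp add: ah_def)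
 qed
 have "(%s. of_real (?a s)) sums (\<Sum>s\<in>{..R}. ?c (?a s))" by (rule sums_finite) (use ah_zero in auto)
 then show ?thesis unfolding hyperF_reg_def t FR_def by (simp add: sums_iff)
qed

text \<open>Since u / 4 = (c + s - 1) - (s - R/2 - 1/4), multiplication by u / 4 shifts the
  reciprocal Gamma factor by one, and \<open>ah_rec\<close> compares coefficients. For R < 2 the
  term with the truncated index R - 2 carries the factor R (R - 1) = 0.\<close>

lemma FR_rec: "FR u (R + 2) = u / 4 * FR u R + real R * (real R - 1) / 16 * FR u (R - 2)"
proof -
 define c where "c = cR u R"
 define M where "M = R + 2"
 define r where "r = real R"
 have c2: "cR u (R + 2) = c - 1" by (simp add: c_def cR_def field_simps)
 have G: "u / 4 * rGamma (c + s) = rGamma (c + s - 1) - (s - r / 2 - 1 / 4) * rGamma (c + s)" for s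
 using rGamma_plus1[of "c + s - 1"] unfolding c_def cR_def r_def by (simp add: algebra_simps)
 let ?a = "%s. rGamma (c + real s)"
 let ?b = "real R * (real R - 1) / 16 * FR u (R - 2)"
 let ?c = "%s. if s = 0 then 0 else ah (r - 2) (s - 1)"
 have last: "?b = (\<Sum>s<M. (r * (r - 1) / 16 * ?c s) * ?a s)"
 proof (cases "R \<ge> 2")
  case True
  have c0: "cR u (R - 2) = c + 1" using True by (simp add: c_def cR_def field_simps)
  have r2: "real (R - 2) = r - 2" using True by (simp add: r_def)
  have "FR u (R - 2) = (\<Sum>s<Suc R. ah (r - 2) s * rGamma (c + 1 + real s))"
  proof -
   have "R - 2 < Suc R" by simp
   from FR_alt[OF this, of u] show ?thesis unfolding c0 r2 .
  qed
  also have "\<dots> = (\<Sum>s<M. ?c s * ?a s)" unfolding M_def add_2_eq_Suc' sum.lessThan_Suc_shift[of _ "Suc R"] by (simp add: add_ac)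
  finally show ?thesis unfolding r_def[symmetric] by (simp only: sum_distrib_left mult.assoc)
 next
  case False
  then have z: "r * (r - 1) / 16 = 0" by (cases) (auto simp: r_def)
  show ?thesis unfolding r_def[symmetric] z by simp
 qed
 have mid: "u / 4 * FR u R = rGamma (c - 1) + (\<Sum>s<M. (ah r (Suc s) - (real s - r / 2 - 1 / 4) * ah r s) * ?a s)"
 proof -
  have z: "ah r M = 0" unfolding r_def M_def by (rule ah_zero) simp
  have "u / 4 * FR u R = (\<Sum>s<M. ah r s * (u / 4 * ?a s))"
  proof -
   have "R < M" by (simp add: M_def)
   from FR_alt[OF this, of u] show ?thesis unfolding c_def r_def by (simp only: sum_distrib_left mult.left_commute)
  qed
  also have "\<dots> = (\<Sum>s<M. ah r s * rGamma (c + real s - 1)) - (\<Sum>s<M. (real s - r / 2 - 1 / 4) * ah r s * ?a s)"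
   unfolding G by (simp add: right_diff_distrib sum_subtractf mult_ac)
  also have "(\<Sum>s<M. ah r s * rGamma (c + real s - 1)) = (\<Sum>s<Suc M. ah r s * rGamma (c + real s - 1))" using z by simp
  also have "\<dots> = rGamma (c - 1) + (\<Sum>s<M. ah r (Suc s) * ?a s)" unfolding sum.lessThan_Suc_shift by simp
  finally show ?thesis by (simp add: left_diff_distrib sum_subtractf)
 qed
 have "FR u (R + 2) = (\<Sum>s<Suc M. ah (r + 2) s * rGamma (c - 1 + real s))"
 proof -
  have "R + 2 < Suc M" by (simp add: M_def)
  moreover have "real (R + 2) = r + 2" by (simp add: r_def)
  ultimately show ?thesis using FR_alt[of "R + 2" "Suc M" u] unfolding c2 by (simp only:)
 qed
 also have "\<dots> = u / 4 * FR u R + ?b" unfolding sum.lessThan_Suc_shift mid last ah_rec distrib_right sum.distrib by simp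
 finally show ?thesis .
qed

text \<open>The factor of \<open>gamma_mR\<close> that collects the dependence on R; the other
  factor \<open>Nn\<close> is the constant between U and \<open>w_airy A B 0\<close>.\<close>

definition rho :: "real => nat => real" where
 "rho u R = 2 powr (- u / 4 + real R - 5 / 4) * u powr (- real R / 2 - 1) * FR u R"

text \<open>The powers of 2 and u turn \<open>FR_rec\<close> into the homogeneous part of the
  recursion of \<open>Sol\<close>. Hence the connection coefficients for all R follow from those for
  R = 0 and R = 1.\<close>

lemma rho_rec:
 assumes u: "u > 0"
 shows "rho u (R + 2) = rho u R + real R * (real R - 1) / u^2 * rho u (R - 2)"
proof -
 let ?a = "- u / 4 + real R - 5 / 4"
 let ?b = "- real R / 2 - 1"
 define b where "b = 2 powr ?a * u powr ?b"
 have 1: "rho u (R + 2) = b * (4 / u) * FR u (R + 2)"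
 proof -
  have e: "- u / 4 + real (R + 2) - 5 / 4 = ?a + 2" "- real (R + 2) / 2 - 1 = ?b + - 1" by (simp_all add: field_simps)
  have "2 powr (- u / 4 + real (R + 2) - 5 / 4) = 2 powr ?a * 4" unfolding e(1) by (subst powr_add) simp
  moreover have "u powr (- real (R + 2) / 2 - 1) = u powr ?b * (1 / u)" unfolding e(2) using u by (subst powr_add) simp
  ultimately show ?thesis unfolding rho_def b_def by simp
 qed
 let ?c = "real R * (real R - 1)"
 have 2: "?c * rho u (R - 2) = ?c * (b * (u / 4) * FR u (R - 2))"
 proof (cases "R \<ge> 2")
  case True
  then have e: "- u / 4 + real (R - 2) - 5 / 4 = ?a + - 2" "- real (R - 2) / 2 - 1 = ?b + 1" by (simp_all add: field_simps)
  have "2 powr (- u / 4 + real (R - 2) - 5 / 4) = 2 powr ?a * (1 / 4)" unfolding e(1) by (subst powr_add) (simp add: powr_minus_divide)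
  moreover have "u powr (- real (R - 2) / 2 - 1) = u powr ?b * u" unfolding e(2) using u by (subst powr_add) simp
  ultimately show ?thesis unfolding rho_def b_def by simp
 next
  case False
  then show ?thesis by auto
 qed
 have "rho u R + ?c / u^2 * rho u (R - 2) = b * FR u R + (?c * rho u (R - 2)) / u^2" by (simp add: rho_def b_def)
 also have "\<dots> = b * (4 / u) * (u / 4 * FR u R + ?c / 16 * FR u (R - 2))" unfolding 2 using u by (simp add: field_simps power2_eq_square)
 finally show ?thesis unfolding 1 FR_rec ..
qed

lemma cV_rho:
 assumes "u > 3" "R \<le> 1"
 shows "cV u R = - (2 * pi * \<i>) * of_real (rho u R) * al u"
proof -
 have "R = 0 \<or> R = 1" using assms by auto
 then have "FR u R = rGamma (cR u R)" by (auto simp: FR_def ah_def)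
 then show ?thesis unfolding rho_def cV_def by (simp only: rGamma_inverse_Gamma divide_inverse[of _ "Gamma (cR u R)"])
qed

text \<open>The recursion results from applying the operator to z^R, which yields multiples of
  z^(R+2), z^R and z^(R-2). The seeds a, b for R = 0, 1 are arguments, so that one recursion serves
  all pairs.\<close>

fun Sol :: "(complex => complex) => (complex => complex) => real => nat => complex => complex" where
 "Sol a b u 0 z = a z"
| "Sol a b u (Suc 0) z = b z"
| "Sol a b u (Suc (Suc R)) z = Sol a b u R z + of_real (real R * (real R - 1) / u^2) * Sol a b u (R - 2) z - z ^ R / of_real (u^2)"

lemma Sol_induct [case_names 0 1 step]:
 assumes "P 0" "P 1" "\<And>R. P R ==> P (R - 2) ==> P (R + 2)"
 shows "P (R :: nat)"
proof (induction R rule: less_induct)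
 case (less R)
 consider "R = 0" | "R = 1" | S where "R = S + 2" by (metis One_nat_def add_2_eq_Suc' not0_implies_Suc)
 then show ?case
 proof cases
  case (3 S)
  then show ?thesis using assms(3)[of S] less.IH[of S] less.IH[of "S - 2"] by auto
 qed (use assms in auto)
qed

lemma Sol_ode:
 assumes u: "u > 0" and a: "weber u UNIV (%_. 1) a" and b: "weber u UNIV (%z. z) b"
 shows "weber u UNIV (%z. z ^ R) (Sol a b u R)"
proof (induction R rule: Sol_induct)
 case 0
 then show ?case using a by simp
next
 case 1
 then show ?case using b by simp
next
 case (step R)
 let ?a = "of_real (u^2)"
 let ?e = "%z. of_nat R * of_nat (R - 1) * z ^ (R - 2) - ?a * (z^2 - 1) * z ^ R"
 have p: "weber u UNIV ?e (%z. z ^ R)"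
 proof (rule ode2I[OF open_UNIV])
  show "((%z. z ^ R) has_field_derivative of_nat R * z ^ (R - 1)) (at z)" for z :: complex
   using DERIV_power[OF DERIV_ident, of R z] by simp
  show "((%z. of_nat R * z ^ (R - 1)) has_field_derivative of_nat R * (of_nat (R - 1) * z ^ (R - 1 - 1))) (at z)" for z :: complex
   using DERIV_cmult[OF DERIV_power[OF DERIV_ident, of "R - 1" z], of "of_nat R"] by simp
 qed (simp add: mult_ac numeral_2_eq_2)
 let ?b = "of_real (real R * (real R - 1) / u^2)"
 let ?d = "?e"
 let ?f = "%z. z ^ R + ?b * z ^ (R - 2) - 1 / ?a * ?d z"
 have "weber u UNIV ?f
  (%z. Sol a b u R z + ?b * Sol a b u (R - 2) z - 1 / ?a * z ^ R)"
  by (intro ode2_diff ode2_add ode2_cmult open_UNIV step p)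
 then show ?case
 proof (rule ode2_cong[OF _ open_UNIV])
  fix z :: complex
  have "of_real (real R * (real R - 1)) = of_nat R * complex_of_nat (R - 1)" by (cases R) simp_all
  moreover have "?a \<noteq> (0 :: complex)" using u by simp
  ultimately show "?f z = z ^ (R + 2)" unfolding of_real_divide by (simp only:) (simp add: field_simps power2_eq_square)
 qed (simp add: add_2_eq_Suc')
qed

text \<open>K depends neither on u nor on the seeds; the expansion for large u relies on this
  uniformity.\<close>

lemma Sol_bound:
 assumes C: "C \<ge> 0"
 shows "\<exists>K\<ge>0. \<forall>u\<ge>1. \<forall>a b z. norm (a z) \<le> C * (1 + norm z) \<longrightarrow> norm (b z) \<le> C * (1 + norm z) \<longrightarrow> norm (Sol a b u R z) \<le> K * (1 + norm z) ^ (R + 1)"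
proof (induction R rule: Sol_induct)
 case 0
 then show ?case using C by auto
next
 case 1
 have "C * (1 + norm z) \<le> C * (1 + norm z)^2" for z :: complex using C self_le_power[of "1 + norm z" 2] by (intro mult_left_mono) auto
 then show ?case using C by (intro exI[of _ C]) (auto simp: numeral_2_eq_2 intro: order_trans)
next
 case (step R)
 obtain K1 where K1: "K1 \<ge> 0" "\<And>u a b z. u \<ge> 1 ==> norm (a z) \<le> C * (1 + norm z) ==> norm (b z) \<le> C * (1 + norm z) ==> norm (Sol a b u R z) \<le> K1 * (1 + norm z) ^ (R + 1)"
  using step(1) by auto
 obtain K2 where K2: "K2 \<ge> 0" "\<And>u a b z. u \<ge> 1 ==> norm (a z) \<le> C * (1 + norm z) ==> norm (b z) \<le> C * (1 + norm z) ==> norm (Sol a b u (R - 2) z) \<le> K2 * (1 + norm z) ^ (R - 2 + 1)"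
  using step(2) by auto
 define r where "r = \<bar>real R * (real R - 1)\<bar>"
 have "norm (Sol a b u (R + 2) z) \<le> (K1 + r * K2 + 1) * (1 + norm z) ^ (R + 2 + 1)"
  if u: "u \<ge> 1" and h: "norm (a z) \<le> C * (1 + norm z)" "norm (b z) \<le> C * (1 + norm z)" for u a b z
 proof -
  have u2: "u^2 \<ge> 1" using u by simp
  define x where "x = 1 + norm z"
  have x: "x \<ge> 1" by (simp add: x_def)
  have "norm (Sol a b u R z) \<le> K1 * x ^ (R + 1)" unfolding x_def by (rule K1(2)[where a = a and b = b and u = u and z = z, OF u h])
  also have "\<dots> \<le> K1 * x ^ (R + 2 + 1)" using K1(1) x by (intro mult_left_mono power_increasing) auto
  finally have 1: "norm (Sol a b u R z) \<le> K1 * x ^ (R + 2 + 1)" .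
  let ?a = "norm (of_real (real R * (real R - 1) / u^2) * Sol a b u (R - 2) z)"
  have "?a \<le> r * norm (Sol a b u (R - 2) z)" using mult_left_mono[OF u2, of r] unfolding norm_mult norm_of_real by (intro mult_right_mono) (auto simp: divide_le_eq r_def)
  also have "\<dots> \<le> r * (K2 * x ^ (R - 2 + 1))" unfolding x_def by (intro mult_left_mono K2(2)[where a = a and b = b and u = u and z = z, OF u h]) (simp add: r_def)
  also have "\<dots> \<le> r * (K2 * x ^ (R + 2 + 1))" using K2(1) x by (intro mult_left_mono power_increasing) (auto simp: r_def)
  finally have 2: "?a \<le> r * K2 * x ^ (R + 2 + 1)" by simp
  let ?b = "norm (z ^ R / of_real (u^2))"
  have "?b = norm z ^ R / u^2" by (simp add: norm_divide norm_power)
  also have "\<dots> \<le> norm z ^ R / 1" using u2 by (intro divide_left_mono) auto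
  also have "\<dots> \<le> x ^ R" by (simp add: x_def power_mono)
  also have "\<dots> \<le> x ^ (R + 2 + 1)" using x by (intro power_increasing) auto
  finally have 3: "?b \<le> x ^ (R + 2 + 1)" by simp
  have "norm (Sol a b u (R + 2) z) \<le> norm (Sol a b u R z) + ?a + ?b"
   unfolding add_2_eq_Suc' Sol.simps by (intro order_trans[OF norm_triangle_ineq4] add_mono norm_triangle_ineq order_refl)
  also have "\<dots> \<le> (K1 + r * K2 + 1) * x ^ (R + 2 + 1)" using 1 2 3 by (simp add: distrib_right)
  finally show ?thesis unfolding x_def .
 qed
 moreover have "K1 + r * K2 + 1 \<ge> 0" using K1(1) K2(1) by (simp add: r_def)
 ultimately show ?case by auto
qed

lemma Sol_diff:
 assumes u: "u > 0" and "a z - a' z = k * of_real (rho u 0)" "b z - b' z = k * of_real (rho u 1)"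
 shows "Sol a b u R z - Sol a' b' u R z = k * of_real (rho u R)"
proof (induction R rule: Sol_induct)
 case (step R)
 have "Sol a b u (R + 2) z - Sol a' b' u (R + 2) z = (Sol a b u R z - Sol a' b' u R z) + of_real (real R * (real R - 1) / u^2) * (Sol a b u (R - 2) z - Sol a' b' u (R - 2) z)"
  by (simp add: algebra_simps)
 then show ?case unfolding step rho_rec[OF u] by (simp add: algebra_simps)
qed (use assms in auto)

lemma Sol_cnj:
 assumes "a (cnj z) = cnj (a z)" "b (cnj z) = cnj (b z)"
 shows "Sol a b u R (cnj z) = cnj (Sol a b u R z)"
proof (induction R rule: Sol_induct)
 case (step R)
 show ?case unfolding add_2_eq_Suc' Sol.simps step by simp
qed (use assms in auto)

lemma Sol_parity:
 assumes "a (- z) = a z" "b (- z) = - b z"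
 shows "Sol a b u R (- z) = (-1) ^ R * Sol a b u R z"
proof (induction R rule: Sol_induct)
 case (step R)
 let ?a = "of_real (real R * (real R - 1) / u^2)"
 have p: "?a * ((-1) ^ (R - 2) * x) = (-1) ^ R * (?a * x)" for x :: complex
 proof (cases "R \<ge> 2")
  case True
  then obtain S where "R = S + 2" using le_Suc_ex by (metis add.commute)
  then show ?thesis by simp
 next
  case False
  then show ?thesis by auto
 qed
 have "(- z) ^ R = (-1) ^ R * z ^ R" by (rule power_minus)
 moreover have "(-1) ^ (R + 2) = ((-1) ^ R :: complex)" by simp
 ultimately show ?case unfolding add_2_eq_Suc' Sol.simps step p by (simp only: distrib_left right_diff_distrib times_divide_eq_right)
qed (use assms in auto)

lemma imag_powr: "(- \<i>) powr of_real a = exp (- (\<i> * pi * a / 2))" "\<i> powr of_real a = exp (\<i> * pi * a / 2)"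
 by (simp_all add: powr_def mult_ac)

lemma pF_real:
 assumes "t \<in> {0..1}"
 shows "pF u R (of_real t * - 1) = of_real ((1 - t) powr pp u R * (1 + t) powr (- qq u R))"
proof -
 let ?b = "of_real (1 - t) * \<i>"
 have e1: "\<i> * (1 + of_real t * - 1) = ?b" and e2: "1 - of_real t * - 1 = of_real (1 + t)" by auto
 let ?a = "of_real (pp u R)"
 have "?b powr ?a = of_real (1 - t) powr ?a * \<i> powr ?a" by (rule powr_times_real_left) (use assms in auto)
 also have "of_real (1 - t) powr ?a = complex_of_real ((1 - t) powr pp u R)" by (rule powr_of_real) (use assms in auto)
 finally have 1: "?b powr ?a = of_real ((1 - t) powr pp u R) * exp (\<i> * pi * pp u R / 2)" unfolding imag_powr .
 have 2: "complex_of_real (1 + t) powr (- of_real (qq u R)) = of_real ((1 + t) powr (- qq u R))"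
  using powr_of_real[of "1 + t" "- qq u R"] assms by simp
 have "exp (- (\<i> * pi * pp u R / 2)) * exp (\<i> * pi * pp u R / 2) = 1" unfolding exp_add[symmetric] by simp
 then show ?thesis unfolding pF_def e1 e2 1 2 of_real_mult by (simp only: mult_ac mult_1)
qed

lemma vseg_cnj: "vseg u R (cnj z) = cnj (vseg u R z)"
proof -
 have k: "kint u R (cnj z) (of_real t * - 1) = cnj (kint u R z (of_real t * - 1))" if "t \<in> {0..1}" for t
  unfolding kint_def pF_real[OF that] g0_def by (simp add: exp_cnj)
 have "integral {0..1} (%t. - 1 * kint u R (cnj z) (of_real t * - 1)) = integral {0..1} (%t. cnj (- 1 * kint u R z (of_real t * - 1)))"
  by (rule integral_cong) (simp only: k complex_cnj_mult complex_cnj_minus complex_cnj_one)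
 then show ?thesis unfolding vseg_def by (simp add: integral_cnj)
qed

lemma vseg_parity: "vseg u 0 (- z) = vseg u 0 z" "vseg u 1 (- z) = - vseg u 1 z" by (simp_all add: vseg_def kint_def g0_def)

lemma Y1_cnj: "cnj (Y1 u (cnj z)) = Y1 u (- z)" unfolding Y1_hY integral_cnj hY_def by (simp add: exp_cnj)

section \<open>Identification of the solutions for the three pairs\<close>

text \<open>The solution for the pair (-1,1), built from the segment integrals. \<open>S01\<close>
  belongs to (0,1), and \<open>cnj (S01 u R (cnj z))\<close> to (-1,0).\<close>

definition S11 :: "real => nat => complex => complex" where
 "S11 u R = Sol (vseg u 0) (vseg u 1) u R"
definition S01 :: "real => nat => complex => complex" where
 "S01 u R = Sol (vinf u 0) (vinf u 1) u R"

lemma S_ode: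
 assumes "u > 3"
 shows "weber u UNIV (%z. z ^ R) (S11 u R)" "weber u UNIV (%z. z ^ R) (S01 u R)"
proof -
 let ?a = "weber u UNIV"
 have "?a (%_. 1) (vseg u 0)" "?a (%z. z) (vseg u 1)" "?a (%_. 1) (vinf u 0)" "?a (%z. z) (vinf u 1)"
  using vseg_ode[OF assms, of 0] vseg_ode[OF assms, of 1] vinf_ode[OF assms, of 0] vinf_ode[OF assms, of 1] by auto
 then show "?a (%z. z ^ R) (S11 u R)" "?a (%z. z ^ R) (S01 u R)"
  unfolding S11_def S01_def using assms by (simp_all only: Sol_ode)
qed

lemma S11_cnj: "S11 u R (cnj z) = cnj (S11 u R z)" unfolding S11_def by (intro Sol_cnj vseg_cnj)

lemma S11_parity: "S11 u R (- z) = (-1) ^ R * S11 u R z" unfolding S11_def by (intro Sol_parity vseg_parity)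

text \<open>\<open>Sol_diff\<close> propagates the relation from R = 0, 1. The second formula is the
  conjugate of the first, as \<open>S11\<close> is symmetric under conjugation and conjugation turns
  Y1 (z) into Y1 (- z).\<close>

lemma S_connection:
 assumes u: "u > 3"
 shows "S11 u R z - S01 u R z = - (2 * pi * \<i>) * of_real (rho u R) * (al u * Y1 u z)"
  and "S11 u R z - cnj (S01 u R (cnj z)) = 2 * pi * \<i> * of_real (rho u R) * (al' u * Y1 u (- z))"
proof -
 let ?a = "of_real (rho u R)"
 have 1: "S11 u R z - S01 u R z = (- (2 * pi * \<i>) * (al u * Y1 u z)) * ?a" for z
  unfolding S11_def S01_def by (rule Sol_diff) (use u in "simp_all add: vinf_def cV_rho")
 then show "S11 u R z - S01 u R z = - (2 * pi * \<i>) * ?a * (al u * Y1 u z)" by simp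
 have a: "cnj (al u) = al' u" unfolding al_def al'_def imag_powr by (simp add: exp_cnj)
 let ?b = "S11 u R z - cnj (S01 u R (cnj z))"
 have "?b = cnj (S11 u R (cnj z) - S01 u R (cnj z))" unfolding S11_cnj by simp
 also have "\<dots> = 2 * pi * \<i> * ?a * (al' u * Y1 u (- z))" unfolding 1 complex_cnj_mult a Y1_cnj by simp
 finally show "?b = 2 * pi * \<i> * ?a * (al' u * Y1 u (- z))" .
qed

lemma power_le_one_plus: "R \<le> 1 ==> x \<ge> 0 ==> x ^ R \<le> 1 + (x :: real)" by (cases R) auto

lemma S11_bound:
 shows "\<exists>K\<ge>0. \<forall>u>3. \<forall>z. Re (z^2) \<le> 1 \<longrightarrow> norm (S11 u R z) \<le> K * (1 + norm z) ^ (R + 1)"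
proof -
 let ?a = "%z. exp (3/2) * (1 + norm z)"
 obtain K where K: "K \<ge> 0" "\<And>u a b z. u \<ge> 1 ==> norm (a z) \<le> ?a z ==> norm (b z) \<le> ?a z ==> norm (Sol a b u R z) \<le> K * (1 + norm z) ^ (R + 1)"
  using Sol_bound[of "exp (3/2)" R] by auto
 have b: "norm (vseg u S z) \<le> ?a z" if u: "u > 3" and S: "S \<le> 1" and z: "Re (z^2) \<le> 1" for u S z
 proof -
  have "norm (vseg u S z) \<le> exp (3/2) * norm z ^ S / (2 * u)" by (rule vseg_bound[OF u S z])
  also have "\<dots> \<le> exp (3/2) * norm z ^ S / 1" using u by (intro divide_left_mono) auto
  also have "\<dots> \<le> ?a z" using power_le_one_plus[OF S] by simp
  finally show ?thesis .
 qed
 have "norm (S11 u R z) \<le> K * (1 + norm z) ^ (R + 1)" if "u > 3" "Re (z^2) \<le> 1" for u z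
  unfolding S11_def by (rule K(2)[of u "vseg u 0" z "vseg u 1"]) (use b[OF that(1) _ that(2)] that in auto)
 then show ?thesis using K(1) by auto
qed

lemma S01_bound:
 assumes k: "\<kappa> > 0"
 shows "\<exists>K\<ge>0. \<forall>u>3. \<forall>z. (z \<in> Q1 \<and> Re (z^2 * dA) \<ge> 1 + \<kappa>) \<or> (z \<in> Q2 \<and> Re (z^2 * dB) \<ge> \<kappa>) \<longrightarrow>
  norm (S01 u R z) \<le> K * (1 + norm z) ^ (R + 1)"
proof -
 define C where "C = 18 / \<kappa>"
 have C: "C \<ge> 0" using k by (simp add: C_def)
 let ?c = "%z. C * (1 + norm z)"
 obtain K where K: "K \<ge> 0" "\<And>u a b z. u \<ge> 1 ==> norm (a z) \<le> ?c z ==> norm (b z) \<le> ?c z ==> norm (Sol a b u R z) \<le> K * (1 + norm z) ^ (R + 1)"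
  using Sol_bound[OF C, of R] by auto
 have fin: "18 * norm z ^ S / (u^2 * x) \<le> ?c z" if u: "u > 3" and S: "S \<le> 1" and x: "x \<ge> \<kappa>" for u S x and z :: complex
 proof -
  have "1 * \<kappa> \<le> u^2 * x" using u x k by (intro mult_mono) auto
  then have "18 * norm z ^ S / (u^2 * x) \<le> 18 * norm z ^ S / \<kappa>" using k by (intro divide_left_mono) auto
  also have "\<dots> = C * norm z ^ S" by (simp add: C_def)
  also have "\<dots> \<le> ?c z" using power_le_one_plus[OF S] C by (intro mult_left_mono) auto
  finally show ?thesis .
 qed
 let ?d = "%z. z \<in> Q1 \<and> Re (z^2 * dA) \<ge> 1 + \<kappa>"
 let ?a = "%z. ?d z"
 let ?e = "%z. z \<in> Q2 \<and> Re (z^2 * dB) \<ge> \<kappa>"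
 let ?b = "%z. ?e z"
 have b: "norm (vinf u S z) \<le> ?c z" if u: "u > 3" and S: "S \<le> 1" and z: "?a z \<or> ?b z" for u S z using z
 proof
  assume z: "?d z"
  then have "norm (vinf u S z) \<le> 18 * norm z ^ S / (u^2 * (Re (z^2 * dA) - 1))" using vinf_vrayA[OF u S] vrayA_bound[OF u S, of z] k by simp
  also have "\<dots> \<le> ?c z" by (rule fin[OF u S]) (use z in linarith)
  finally show ?thesis .
 next
  assume z: "?e z"
  then have "norm (vinf u S z) \<le> 18 * norm z ^ S / (u^2 * Re (z^2 * dB))" using vinf_vrayB[OF u S] vrayB_bound[OF u S, of z] k by simp
  also have "\<dots> \<le> ?c z" by (rule fin[OF u S]) (use z in linarith)
  finally show ?thesis .
 qed
 have "norm (S01 u R z) \<le> K * (1 + norm z) ^ (R + 1)" if "u > 3" "?a z \<or> ?b z" for u z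
  unfolding S01_def by (rule K(2)[of u "vinf u 0" z "vinf u 1"]) (use b[OF that(1) _ that(2)] that in auto)
 then show ?thesis using K(1) by auto
qed

lemma growth_aux:
 fixes f :: "complex => complex"
 assumes K: "K \<ge> 0" and d: "norm d = 1" and b: "\<And>r. r \<ge> 2 ==> norm (f (of_real r * d)) \<le> K * (1 + norm (of_real r * d)) ^ N"
 shows "\<forall>\<^sub>F r in at_top. norm (f (of_real r * d)) \<le> K * 2 ^ N * r ^ N"
 using eventually_ge_at_top[of 2]
proof eventually_elim
 case (elim r)
 have n: "norm (of_real r * d) = r" using d elim by (simp add: norm_mult)
 have "norm (f (of_real r * d)) \<le> K * (1 + r) ^ N" using b[OF elim] unfolding n .
 also have "\<dots> \<le> K * (2 * r) ^ N" using K elim by (intro mult_left_mono power_mono) auto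
 finally show ?case by simp
qed

lemma S_growth:
 assumes u: "u > 3"
 shows "\<exists>K. \<forall>\<^sub>F r in at_top. norm (S11 u R (of_real r * \<i>)) \<le> K * r ^ (R + 1)"
  "\<exists>K. \<forall>\<^sub>F r in at_top. norm (S11 u R (of_real r * - \<i>)) \<le> K * r ^ (R + 1)"
  "\<exists>K. \<forall>\<^sub>F r in at_top. norm (S01 u R (of_real r * 1)) \<le> K * r ^ (R + 1)"
  "\<exists>K. \<forall>\<^sub>F r in at_top. norm (S01 u R (of_real r * \<i>)) \<le> K * r ^ (R + 1)"
proof -
 obtain K where K: "K \<ge> 0" "\<And>z. Re (z^2) \<le> 1 ==> norm (S11 u R z) \<le> K * (1 + norm z) ^ (R + 1)" using S11_bound u by blast
 obtain L where L: "L \<ge> 0" "\<And>z. (z \<in> Q1 \<and> Re (z^2 * dA) \<ge> 1 + 1) \<or> (z \<in> Q2 \<and> Re (z^2 * dB) \<ge> 1) ==> norm (S01 u R z) \<le> L * (1 + norm z) ^ (R + 1)"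
  using S01_bound[of 1] u by (metis zero_less_one)
 let ?a = "%r. of_real r * \<i>"
 have i2: "Re (?a r^2) \<le> 1" "Re ((of_real r * - \<i>)^2) \<le> 1" for r
  using order_trans[of "- (r^2)" 0 1] by (simp_all add: power_mult_distrib)
 show "\<exists>K. \<forall>\<^sub>F r in at_top. norm (S11 u R (?a r)) \<le> K * r ^ (R + 1)"
  by (rule , rule growth_aux[OF K(1) _ K(2)[OF i2(1)]]) simp
 show "\<exists>K. \<forall>\<^sub>F r in at_top. norm (S11 u R (of_real r * - \<i>)) \<le> K * r ^ (R + 1)"
  by (rule , rule growth_aux[OF K(1) _ K(2)[OF i2(2)]]) simp
 have sq: "r^2 \<ge> 2" if "r \<ge> 2" for r :: real using that mult_mono[of 2 r 1 r] by (simp add: power2_eq_square)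
 have 1: "of_real r * 1 \<in> Q1 \<and> Re ((of_real r * 1)^2 * dA) \<ge> 1 + 1" if "r \<ge> 2" for r
  using sq[OF that] that by (simp add: Q1_def dA_def)
 show "\<exists>K. \<forall>\<^sub>F r in at_top. norm (S01 u R (of_real r * 1)) \<le> K * r ^ (R + 1)"
  by (rule , rule growth_aux[OF L(1) _ L(2)[OF disjI1[OF 1]]]) simp_all
 have 2: "?a r \<in> Q2 \<and> Re (?a r^2 * dB) \<ge> 1" if "r \<ge> 2" for r using imag_in_Q2[of r] that unfolding Re_imag_dB by simp
 show "\<exists>K. \<forall>\<^sub>F r in at_top. norm (S01 u R (?a r)) \<le> K * r ^ (R + 1)"
  by (rule , rule growth_aux[OF L(1) _ L(2)[OF disjI2[OF 2]]]) simp_all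
qed

text \<open>Boundedness at - i infinity makes the slope of |y|^2 at 0 nonpositive in direction - i,
  hence nonnegative in direction i, and boundedness at i infinity then forces y = 0.\<close>

lemma weber_imag_zero':
 assumes u: "u > 0" and S: "open S" "connected S" and ray: "\<And>r. of_real r * \<i> \<in> S"
  and y: "weber u S (%_. 0) y" and b: "bddr \<i> y" "bddr (- \<i>) y" and z: "z \<in> S"
 shows "y z = 0"
proof -
 have ray': "of_real r * - \<i> \<in> S" for r using ray[of "- r"] by simp
 have p: "weber_ray u \<i> (-1) S y 0" by (rule weber_ray.intro[OF u _ _ S(1) ray y]) simp_all
 have m: "weber_ray u (-\<i>) (-1) S y 0" by (rule weber_ray.intro[OF u _ _ S(1) ray' y]) simp_all
 have nn: "Re (cnj (y (of_real 0 * \<i>)) * (\<i> * deriv y (of_real 0 * \<i>))) \<ge> 0" using weber_ray.bounded_psi_neg[OF m b(2)] by simp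
 have z0: "y (of_real r * \<i>) = 0" if "r > 0" for r by (rule weber_ray.bounded_zero[OF p b(1) nn that])
 show ?thesis by (rule holo_zero_on_ray[where y = y and z = z and S = S and d = "\<i>" and a = 0])
   (rule ode2_holo[OF y] S complex_i_not_zero ray z z0, assumption?)+
qed

lemma wR_weber: "wR_solution R j k u w ==> weber u UNIV (%z. z ^ R) w" by (simp add: wR_solution_def ode2_def)

lemma wR_diff_bddr:
 assumes u: "u > 3" and d: "d^2 = of_real \<sigma>" "\<sigma> = 1 \<or> \<sigma> = -1"
  and w: "weber u UNIV (%z. z ^ R) w" "\<not> exp_large_at d w" and S: "weber u UNIV (%z. z ^ R) S"
   "\<exists>K. \<forall>\<^sub>F r in at_top. norm (S (of_real r * d)) \<le> K * r ^ N"
 shows "bddr d (%z. w z - S z)"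
proof -
 obtain K where K: "\<forall>\<^sub>F r in at_top. norm (S (of_real r * d)) \<le> K * r ^ N" using S(2) by auto
 have "weber_ray u d \<sigma> UNIV (%z. w z - S z) 1" using ode2_diff[OF w(1) S(1) open_UNIV] by (intro weber_ray.intro[OF _ d open_UNIV UNIV_I]) (use u d in auto)
 from weber_ray.not_exp_large[OF this w(2) K] show ?thesis by simp
qed

lemma w11_unique:
 assumes u: "u > 3" and w: "wR_solution R (-1) 1 u w"
 shows "w z = S11 u R z"
proof -
 have ne: "\<not> exp_large_at \<i> w" "\<not> exp_large_at (- \<i>) w" using w by (simp_all add: wR_solution_def inf_dir_def)
 let ?a = "%z. w z - S11 u R z"
 have "?a z = 0"
 proof (rule weber_imag_zero'[where u = u and S = UNIV and z = z and y = "%z. ?a z"])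
  show "weber u UNIV (%_. 0) ?a" using ode2_diff[OF wR_weber[OF w] S_ode(1)[OF u, of R] open_UNIV] by simp
  show "bddr \<i> ?a" by (rule wR_diff_bddr[where \<sigma> = "-1", OF u _ _ wR_weber[OF w] ne(1) S_ode(1)[OF u] S_growth(1)[OF u]]) simp_all
  show "bddr (- \<i>) ?a" by (rule wR_diff_bddr[where \<sigma> = "-1", OF u _ _ wR_weber[OF w] ne(2) S_ode(1)[OF u] S_growth(2)[OF u]]) simp_all
 qed (use u in auto)
 then show ?thesis by simp
qed

text \<open>By \<open>U_Y1\<close> this is U(- u/2, sqrt (2 u) z).\<close>

definition w0Y :: "real => complex => complex" where
 "w0Y u z = al u * Y1 u z + al' u * Y1 u (- z)"

lemma al_nz: "al u \<noteq> 0" "al' u \<noteq> 0" by (simp_all add: al_def al'_def)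

lemma w0Y_ode: "u > 3 ==> weber u UNIV (%_. 0) (w0Y u)"
 using ode2_add[OF ode2_cmult[OF Y1_ode open_UNIV, of u "al u"] ode2_cmult[OF weber_reflect[OF Y1_ode] open_UNIV, of u "al' u"] ]
 unfolding w0Y_def[abs_def] by simp

lemma Y1_bddr': "u > 3 ==> bddr (- \<i>) (%z. Y1 u (- z))" using Y1_bddr[of u] by (simp add: bddr_def)

text \<open>A nonzero multiple bounded at i infinity would make Y1 (- z) bounded there; being
  bounded at - i infinity as well, it would vanish.\<close>

lemma w0Y_multiple_zero:
 assumes u: "u > 3" and b: "bddr \<i> (%z. c * w0Y u z)"
 shows "c = 0"
proof (rule ccontr)
 assume c: "c \<noteq> 0"
 let ?a = "%z. inverse (al' u) * (inverse c * (c * w0Y u z) - al u * Y1 u z)"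
 have "bddr \<i> ?a" by (intro bddr_cmult bddr_diff b Y1_bddr[OF u])
 moreover have "?a z = Y1 u (- z)" for z
 proof -
  have "inverse c * (c * w0Y u z) = w0Y u z" using c by simp
  moreover have "inverse (al' u) * (al' u * Y1 u (- z)) = Y1 u (- z)" using al_nz(2)[of u] by simp
  ultimately show ?thesis by (simp only: w0Y_def add_diff_cancel_left')
 qed
 ultimately have "Y1 u (- 0) = 0" by (intro weber_imag_zero'[where u = u and S = UNIV and z = 0 and y = "%z. Y1 u (- z)"] weber_reflect Y1_ode Y1_bddr') (use u in auto)
 then show False using Y1_nondegenerate[OF u] by simp
qed

text \<open>The difference is bounded at +infinity, hence a multiple of \<open>w0Y\<close>, and
  bounded at i infinity, hence the multiple is 0. The boundedness of \<open>w0Y\<close> at +infinity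
  will come from the recessive solution of Airy type.\<close>

lemma w01_unique:
 assumes u: "u > 3" and b0: "bddr 1 (w0Y u)" and w: "wR_solution R 0 1 u w"
 shows "w z = S01 u R z"
proof -
 define y where "y = (%z. w z - S01 u R z)"
 have ne: "\<not> exp_large_at 1 w" "\<not> exp_large_at \<i> w" using w by (simp_all add: wR_solution_def inf_dir_def)
 have yo: "weber u UNIV (%_. 0) y" using ode2_diff[OF wR_weber[OF w] S_ode(2)[OF u, of R] open_UNIV] unfolding y_def by simp
 have b1: "bddr 1 y" unfolding y_def
  by (rule wR_diff_bddr[where \<sigma> = 1, OF u _ _ wR_weber[OF w] ne(1) S_ode(2)[OF u] S_growth(3)[OF u]]) simp_all
 have bi: "bddr \<i> y" unfolding y_def
  by (rule wR_diff_bddr[where \<sigma> = "-1", OF u _ _ wR_weber[OF w] ne(2) S_ode(2)[OF u] S_growth(4)[OF u]]) simp_all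
 let ?a = "%u a. w0Y u (of_real a * 1)"
 obtain a where a: "a \<ge> 1" "?a u a \<noteq> 0"
 proof (rule ccontr)
  note obt = that
  assume h: "\<not> thesis"
  have z: "w0Y u z = 0" for z
  proof (rule holo_zero_on_ray[OF ode2_holo[OF w0Y_ode[OF u]] open_UNIV connected_UNIV, of 1 1])
   show "w0Y u (of_real r * 1) = 0" if "1 < r" for r using obt[of r] that h by auto
  qed auto
  have "bddr \<i> (%z. 1 * w0Y u z)" unfolding z bddr_def by (intro exI[of _ 0]) simp
  from w0Y_multiple_zero[OF u this] show False by simp
 qed
 have e: "?a u a * y z = y (of_real a * 1) * w0Y u z" for z
 proof (rule weber_ray_proportional[where a = a and u = u and d = 1 and \<sigma> = 1 and S = UNIV])
  show "weber u UNIV (%_. 0) (w0Y u)" "weber u UNIV (%_. 0) y" by (fact w0Y_ode[OF u], fact)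
 qed (use u a b0 b1 in auto)
 have "bddr \<i> (%z. ?a u a * y z)" by (rule bddr_cmult[OF bi])
 then have "y (of_real a * 1) = 0" unfolding e by (rule w0Y_multiple_zero[OF u])
 then have "?a u a * y z = 0" unfolding e by simp
 then show ?thesis using a(2) by (simp add: y_def)
qed

lemma w10_unique:
 assumes u: "u > 3" and b0: "bddr 1 (w0Y u)" and w: "wR_solution R (-1) 0 u w"
 shows "w z = cnj (S01 u R (cnj z))"
proof -
 define w' where "w' = (%z. cnj (w (cnj z)))"
 have ne: "\<not> exp_large_at (- \<i>) w" "\<not> exp_large_at 1 w" using w by (simp_all add: wR_solution_def inf_dir_def)
 have "weber u UNIV (%z. z ^ R) w'" using ode2_cnj[OF wR_weber[OF w] open_UNIV open_UNIV] unfolding w'_def by simp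
 moreover have "\<not> exp_large_at 1 w'" "\<not> exp_large_at \<i> w'" using ne unfolding exp_large_at_def w'_def by simp_all
 ultimately have "wR_solution R 0 1 u w'" by (simp add: wR_solution_def inf_dir_def ode2_def)
 from w01_unique[OF u b0 this, of "cnj z"] have "cnj (w z) = S01 u R (cnj z)" by (simp add: w'_def)
 then show ?thesis by (metis complex_cnj_cnj)
qed

text \<open>The differences of the \<open>Wi\<close> give 2 pi i \<open>Ai_rot 0\<close> = cW2
  \<open>Ai_rot (-1)\<close> - cW1 \<open>Ai_rot 1\<close>. With w0Y equal to N times the solution
  for l = 0, this yields two expressions for one solution D, one bounded at i infinity, the other at
  - i infinity. So D = 0, and the two terms are identified separately.\<close>

lemma airy_connection:
 assumes u: "u > 3" and N: "N \<noteq> 0"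
  and wo: "\<And>l. l \<in> {-1, 0, 1} ==> weber u Zdom (%_. 0) (w_airy A B l u) \<and> recessive_at (inf_dir l) (w_airy A B l u)"
  and U: "\<And>z. z \<in> Zdom ==> w0Y u z = N * w_airy A B 0 u z"
 shows "bddr 1 (w0Y u)"
  and "z \<in> Zdom ==> N * (cW1 * w_airy A B 1 u z) = - (2 * pi * \<i>) * (al u * Y1 u z)"
  and "z \<in> Zdom ==> N * (cW2 * w_airy A B (-1) u z) = 2 * pi * \<i> * (al' u * Y1 u (- z))"
proof -
 have r: "of_real r \<in> Zdom" if "r \<ge> 0" for r using Zdom_right_half[of "of_real r"] that by simp
 let ?d = "w_airy A B"
 have "bddr 1 (%z. N * ?d 0 u z)" using wo[of 0] by (intro bddr_cmult recessive_imp_bddr) (simp add: inf_dir_def)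
 moreover have "\<forall>\<^sub>F r in at_top. N * ?d 0 u (of_real r * 1) = w0Y u (of_real r * 1)"
  using eventually_ge_at_top[of 0] by eventually_elim (simp add: U r)
 ultimately show "bddr 1 (w0Y u)" by (rule bddr_cong)
 let ?c = "2 * pi * \<i>"
 let ?b = "%u z. ?c * ?d 0 u z"
 have lin: "?b u z = cW2 * ?d (-1) u z - cW1 * ?d 1 u z" for z
 proof -
  let ?x = "airy_arg u z"
  have "?c * Ai_rot 0 ?x = cW2 * Ai_rot (-1) ?x - cW1 * Ai_rot 1 ?x" using Wi_diff[of ?x] by (simp add: algebra_simps)
  moreover have "?c * deriv (Ai_rot 0) ?x = cW2 * deriv (Ai_rot (-1)) ?x - cW1 * deriv (Ai_rot 1) ?x"
   using Wi_diff_deriv[of ?x] by (simp add: algebra_simps)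
  moreover have "?b u z = (?c * Ai_rot 0 ?x) * A u z + (?c * deriv (Ai_rot 0) ?x) * B u z" unfolding w_airy_def by (simp add: algebra_simps)
  ultimately show ?thesis unfolding w_airy_def by (simp only:) (simp add: algebra_simps)
 qed
 define D where "D = (%z. ?c * (al u * Y1 u z) + N * (cW1 * ?d 1 u z))"
 let ?a = "%u z. N * (cW2 * ?d (-1) u z) - ?c * (al' u * Y1 u (- z))"
 have D': "D z = ?a u z" if "z \<in> Zdom" for z
 proof -
  have "?c * (al u * Y1 u z + al' u * Y1 u (- z)) = N * (?b u z)" using U[OF that] unfolding w0Y_def by simp
  then show ?thesis unfolding lin D_def by (simp add: algebra_simps)
 qed
 have ir: "of_real r * \<i> \<in> Zdom" "of_real r * - \<i> \<in> Zdom" for r by (rule Zdom_right_half, simp)+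
 have oD: "weber u Zdom (%_. 0) D"
  using ode2_add[OF ode2_cmult[OF ode2_cmult[OF ode2_subset[OF Y1_ode[OF u] subset_UNIV, of Zdom] open_Zdom, of "al u"] open_Zdom, of "?c"]
 ode2_cmult[OF ode2_cmult[OF conjunct1[OF wo[of 1]] open_Zdom, of ] open_Zdom, of ] open_Zdom] unfolding D_def by simp
 have b1: "bddr \<i> D" unfolding D_def using wo[of 1] by (intro bddr_add bddr_cmult Y1_bddr[OF u] recessive_imp_bddr) (simp add: inf_dir_def)
 have "bddr (- \<i>) (%z. ?a u z)"
  using wo[of "-1"] by (intro bddr_diff bddr_cmult Y1_bddr'[OF u] recessive_imp_bddr) (simp add: inf_dir_def)
 then have b2: "bddr (- \<i>) D" by (rule bddr_cong) (use D' ir in auto)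
 have D0: "D z = 0" if "z \<in> Zdom" for z by (rule weber_imag_zero'[OF _ open_Zdom connected_Zdom ir(1) oD b1 b2 that]) (use u in simp)
 show "N * (cW1 * ?d 1 u z) = - ?c * (al u * Y1 u z)" if "z \<in> Zdom"
  using D0[OF that] unfolding D_def by (simp add: eq_neg_iff_add_eq_0 add.commute)
 show "N * (cW2 * ?d (-1) u z) = ?c * (al' u * Y1 u (- z))" if "z \<in> Zdom" using D0[OF that] unfolding D'[OF that] by simp
qed

section \<open>The size of the connection factor\<close>

text \<open>One half of Stirling's formula, from the part [x, x + sqrt x] of the Gamma integral:
  there ln (1 + h/x) >= h/x - (h/x)^2 keeps the integrand above exp (-1) times its maximum.\<close>

lemma Gamma_lower:
 fixes x :: real
 assumes x: "x \<ge> 1"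
 shows "exp (- 1) * sqrt x * x powr x * exp (- x) \<le> Gamma (x + 1)"
proof -
 define f where "f = (%t. t powr x * exp (- (1 * t)))"
 have I: "(f has_integral Gamma (x + 1)) {0..}" using Gamma_integral_scaled[of x 1] x unfolding f_def by simp
 let ?a = "x powr x * exp (- x - 1)"
 let ?b = "integral {x..x + sqrt x}"
 have "?a * (x + sqrt x - x) \<le> ?b f"
 proof -
  have c: "f integrable_on {x..x + sqrt x}" unfolding f_def using x by (intro integrable_continuous_real continuous_intros) auto
  have "?b (%_. ?a) \<le> ?b f"
  proof (rule integral_le[OF integrable_const_ivl c])
   fix t assume t: "t \<in> {x..x + sqrt x}"
   define h where "h = t - x"
   have h: "0 \<le> h" "h \<le> sqrt x" using t by (auto simp: h_def)
   have sx: "sqrt x \<le> x" using x by (intro real_le_lsqrt) (auto simp: power2_eq_square)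
   have hx: "0 \<le> h / x" "h / x \<le> 1" using h x sx by auto
   have "h * h \<le> sqrt x * sqrt x" using h x by (intro mult_mono) auto
   then have "h * h / x \<le> 1" using x by simp
   moreover have "x * (h / x - (h / x)^2) = h - h * h / x" using x by (simp add: field_simps power2_eq_square)
   moreover have "x * (h / x - (h / x)^2) \<le> x * ln (1 + h / x)" using ln_one_plus_pos_lower_bound[OF hx] x by simp
   moreover have "ln t = ln x + ln (1 + h / x)"
   proof -
    have "ln t = ln (x * (1 + h / x))" using x by (simp add: h_def field_simps)
    also have "\<dots> = ln x + ln (1 + h / x)" using x hx by (intro ln_mult_pos) auto
    finally show ?thesis .
   qed
   ultimately have "x * ln x - x - 1 \<le> x * ln t - t" by (simp add: h_def distrib_left)
   moreover have "?a = exp (x * ln x - x - 1)" using x by (simp add: powr_def flip: exp_add)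
   moreover have "f t = exp (x * ln t - t)" using x t by (simp add: f_def powr_def flip: exp_add)
   ultimately show "?a \<le> f t" by simp
  qed
  then show ?thesis using x by (simp add: mult_ac)
 qed
 also have "?b f \<le> integral {0..} f"
  using x I by (intro integral_subset_le) (auto simp: f_def intro!: integrable_continuous_real continuous_intros)
 also have "integral {0..} f = Gamma (x + 1)" using I by auto
 moreover have "exp (- x - 1) = exp (- 1) * exp (- x)" by (simp flip: exp_add)
 ultimately show ?thesis by (simp add: mult_ac)
qed

lemma rGamma_shift_le:
 fixes c :: real
 assumes "c \<ge> 1"
 shows "0 < rGamma (c + real s)" "rGamma (c + real s) \<le> rGamma c"
proof -
 let ?a = "%s. rGamma (c + real s)"
 have pos: "?a s > 0" for s using assms by (simp add: rGamma_inverse_Gamma)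
 have "?a s \<le> rGamma c"
 proof (induction s)
  case (Suc s)
  have "1 * rGamma (c + real s + 1) \<le> (c + real s) * rGamma (c + real s + 1)"
   using assms pos[of "Suc s"] by (intro mult_right_mono) (auto simp: add_ac)
  also have "\<dots> = ?a s" by (rule rGamma_plus1)
  finally show ?case using Suc by (simp add: add_ac)
 qed simp
 then show "0 < ?a s" "?a s \<le> rGamma c" using pos by auto
qed

lemma FR_bound:
 assumes "cR u R \<ge> 1"
 shows "\<bar>FR u R\<bar> \<le> (\<Sum>s\<le>R. \<bar>ah (real R) s\<bar>) * rGamma (cR u R)"
proof -
 have "\<bar>FR u R\<bar> \<le> (\<Sum>s\<le>R. \<bar>ah (real R) s * rGamma (cR u R + real s)\<bar>)" unfolding FR_def by rule
 also have "\<dots> \<le> (\<Sum>s\<le>R. \<bar>ah (real R) s\<bar> * rGamma (cR u R))"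
  unfolding abs_mult using rGamma_shift_le[OF assms] by (intro sum_mono mult_left_mono) (auto simp: less_imp_le)
 finally show ?thesis by (simp add: sum_distrib_right)
qed

definition Nn :: "nat => (real => complex) => real => complex" where
 "Nn m \<epsilon> u = of_real (sqrt pi * 2 powr (3/4 - u/4) * u powr (u/4 - 1/12))
      * exp (- of_real u / 4 + (\<Sum>s=0..m. E (2 * s+1) 1 / of_real u ^ (2 * s+1)) + \<epsilon> u)"

lemma gamma_rho:
 shows "gamma_mR m R \<epsilon> u = of_real (rho u R) * Nn m \<epsilon> u"
proof -
 have "2 powr (- u/2 + real R - 1/2) = 2 powr (- u / 4 + real R - 5 / 4) * 2 powr (3/4 - u/4)"
  unfolding powr_add[symmetric] by (rule arg_cong[of _ _ "(powr) 2"]) (simp add: field_simps)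
 moreover have "u powr (u/4 - real R/2 - 13/12) = u powr (- real R / 2 - 1) * u powr (u/4 - 1/12)"
  unfolding powr_add[symmetric] by (rule arg_cong[of _ _ "(powr) u"]) (simp add: field_simps)
 ultimately show ?thesis unfolding gamma_mR_def rho_def Nn_def hyperF_FR by (simp only: mult_ac of_real_mult)
qed

text \<open>Put c = r/2 + 1/4, so u = 4 (x + c), and take logarithms. The exponent of u is x + 1/2 -
  4/3; its part x + 1/2 cancels against the Stirling factor sqrt x x^x up to (x + 1/2) ln (1 + c/x)
  <= 2 c, and u^(-4/3) is left.\<close>

lemma gamma_asymp:
 fixes r u :: real
 defines "x \<equiv> u / 4 - r / 2 - 1 / 4"
 assumes r: "r \<ge> 0" and x: "x \<ge> 1"
 shows "2 powr (- u / 2) * u powr (u / 4 - r / 2 - 13 / 12) * exp (- u / 4) * (exp x / (sqrt x * x powr x))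
  \<le> exp ((1 - 2 * (r / 2 + 1 / 4)) * ln 2 + (r / 2 + 1 / 4)) * u powr (- 4 / 3)"
proof -
 define c where "c = r / 2 + 1 / 4"
 have c: "c > 0" using r by (simp add: c_def)
 have u: "u = 4 * (x + c)" by (simp add: x_def c_def)
 have u0: "u > 0" using u x c by simp
 let ?d = "ln (1 + c / x)"
 let ?b = "ln x + ?d"
 have lnu: "ln u = 2 * ln 2 + ?b"
 proof -
  have "u = 4 * (x * (1 + c / x))" using u x by (simp add: field_simps)
  then have "ln u = ln 4 + ?b" using x c by (simp add: ln_mult_pos add_pos_pos)
  also have "ln (4 :: real) = 2 * ln 2" using ln_realpow[of 2 2] by simp
  finally show ?thesis .
 qed
 have "(x + 1/2) * ?d \<le> (x + 1/2) * (c / x)" using x c by (intro mult_left_mono ln_add_one_self_le_self) auto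
 also have "\<dots> \<le> c + c" using x c by (simp add: divide_le_eq)
 finally have b: "(x + 1/2) * ?d \<le> 2 * c" by simp
 let ?a = "u / 4 - r / 2 - 13 / 12"
 let ?c = "?a * ln u + - u / 4 + (x - (ln x / 2 + x * ln x))"
 have "2 powr (- u / 2) * u powr ?a * exp (- u / 4) * (exp x / (sqrt x * x powr x)) = exp (- u / 2 * ln 2 + ?c)"
  using u0 x powr_half_sqrt[of x] unfolding exp_add exp_diff by (simp add: powr_def)
 also have "- u / 2 * ln 2 + ?c = (1 - 2 * c) * ln 2 - c + (x + 1/2) * ?d + - 4 / 3 * ln u"
 proof -
  have "?a = (x + 1/2) - 4/3" by (simp add: x_def)
  then have e1: "?a * ln u = (x + 1/2) * (2 * ln 2 + ?b) - 4/3 * ln u" by (simp only: left_diff_distrib lnu[symmetric])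
  have u': "- u / 2 * ln 2 = - 2 * (x + c) * ln 2" "- u / 4 = - (x + c)" unfolding u by simp_all
  show ?thesis unfolding e1 u' by (simp add: field_simps)
 qed
 also have "exp ((1 - 2 * c) * ln 2 - c + (x + 1/2) * ?d + - 4 / 3 * ln u) \<le> exp (((1 - 2 * c) * ln 2 + c) + - 4 / 3 * ln u)" using b by simp
 also have "\<dots> = exp ((1 - 2 * c) * ln 2 + c) * u powr (- 4 / 3)" using u0 by (subst exp_add) (simp add: powr_def)
 finally show ?thesis unfolding c_def .
qed

lemma gamma_bound:
 assumes eps: "\<epsilon> \<in> O(%u. of_real (1 / u ^ (2*m+2)))"
 shows "\<exists>C. \<forall>\<^sub>F u in at_top. norm (gamma_mR m R \<epsilon> u) \<le> C * u powr (- 4 / 3)"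
proof -
 let ?q = "%u. \<epsilon> u"
 obtain ce where ce: "\<forall>\<^sub>F u in at_top. norm (?q u) \<le> ce * norm (complex_of_real (1 / u ^ (2*m+2)))"
  using landau_o.bigE[OF eps] by auto
 let ?f = "%s. norm (E (2 * s+1) 1)"
 let ?x = "\<bar>ce\<bar>"
 define M where "M = (\<Sum>s=0..m. ?f s) + ?x"
 define K0 where "K0 = (\<Sum>s\<le>R. \<bar>ah (real R) s\<bar>)"
 let ?s = "real R / 2"
 let ?e = "exp ((1 - 2 * (?s + 1 / 4)) * ln 2 + (?s + 1 / 4))"
 let ?l = "2 powr (real R - 1/2)"
 define K1 where "K1 = ?l * K0 * exp 1 * ?e * sqrt pi * exp M"
 have K0: "K0 \<ge> 0" by (simp add: K0_def)
 have "\<forall>\<^sub>F u in at_top. norm (gamma_mR m R ?q u) \<le> K1 * u powr (- 4 / 3)"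
  using ce eventually_ge_at_top[of "4 * (?s + 1/4 + 1)"] eventually_ge_at_top[of 1]
 proof eventually_elim
  case (elim u)
  define x where "x = u / 4 - ?s - 1 / 4"
  have x: "x \<ge> 1" using elim by (simp add: x_def)
  have cx: "cR u R = x + 1" by (simp add: cR_def x_def)
  let ?d = "exp x / (sqrt x * x powr x)"
  have "rGamma (cR u R) \<le> exp 1 * ?d"
  proof -
   let ?p = "exp (- 1) * sqrt x * x powr x * exp (- x)"
   have "0 < ?p" using x by simp
   then have "inverse (Gamma (x + 1)) \<le> inverse ?p" by (intro le_imp_inverse_le Gamma_lower[OF x])
   then show ?thesis unfolding cx rGamma_inverse_Gamma by (simp add: exp_minus divide_inverse mult_ac)
  qed
  then have F: "\<bar>FR u R\<bar> \<le> K0 * (exp 1 * ?d)"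
   using FR_bound[of u R] x K0 unfolding cx K0_def[symmetric] by (smt (verit) mult_left_mono)
  let ?b = "u powr (u / 4 - ?s - 13 / 12)"
  let ?g = "sqrt pi * 2 powr (3/4 - u/4) * u powr (u/4 - 1/12)"
  let ?r = "2 powr (- u / 2)"
  let ?v = "\<bar>rho u R\<bar>"
  have pw: "?v * ?g =
    ?l * ?r * ?b * sqrt pi * \<bar>FR u R\<bar>"
  proof -
   let ?w = "2 powr (- u / 4 + real R - 5 / 4)"
   have p1: "?w * 2 powr (3/4 - u/4) = ?l * ?r" unfolding powr_add[symmetric] by (rule arg_cong[of _ _ "(powr) 2"]) (simp add: field_simps)
   have p2: "u powr (- ?s - 1) * u powr (u/4 - 1/12) = ?b"
    unfolding powr_add[symmetric] by (rule arg_cong[of _ _ "(powr) u"]) (simp add: field_simps)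
   have p3: "?v = ?w * u powr (- ?s - 1) * \<bar>FR u R\<bar>" by (simp add: rho_def abs_mult)
   have p4: "(a * b * f) * (s * c * d) = (a * c) * (b * d) * s * f" for a b f s c d :: real by simp
   show ?thesis unfolding p3 p4 p1 p2 ..
  qed
  let ?a = "\<Sum>s=0..m. E (2 * s+1) 1 / of_real u ^ (2 * s+1)"
  let ?h = "norm (exp (- of_real u / 4 + ?a + ?q u))"
  have e: "?h \<le> exp (- u / 4) * exp M"
  proof -
   have u0: "u > 0" using elim by simp
   have u1: "1 / u ^ k \<le> 1" for k using elim by simp
   have "norm ?a \<le> (\<Sum>s=0..m. ?f s)"
   proof (rule order_trans[OF norm_sum sum_mono])
    fix s assume "s \<in> {0..m}"
    let ?k = "norm (E (2 * s+1) 1 / of_real u ^ (2 * s+1))"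
    have "?k = ?f s * (1 / u ^ (2 * s+1))" using u0 by (simp add: norm_divide norm_power norm_mult)
    also have "\<dots> \<le> ?f s * 1" by (intro mult_left_mono u1) simp
    finally show "?k \<le> ?f s" by simp
   qed
   moreover have "norm (?q u) \<le> ?x"
   proof -
    have "norm (?q u) \<le> ce * (1 / u ^ (2*m+2))" using u0 elim(1) unfolding norm_of_real by simp
    also have "\<dots> \<le> ?x * (1 / u ^ (2*m+2))" using elim by (intro mult_right_mono) auto
    also have "\<dots> \<le> ?x * 1" by (intro mult_left_mono u1) auto
    finally show ?thesis by simp
   qed
   ultimately have "norm (?a + ?q u) \<le> M" unfolding M_def by (intro norm_triangle_mono)
   then have "Re (?a + ?q u) \<le> M" by (rule order_trans[OF complex_Re_le_cmod])
   then show ?thesis unfolding exp_add[symmetric] by simp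
  qed
  have "norm (gamma_mR m R ?q u) = ?v * ?g *
    ?h"
   unfolding gamma_rho Nn_def norm_mult norm_of_real by simp
  also have "\<dots> \<le> (?l * ?r * ?b * sqrt pi * (K0 * (exp 1 * ?d))) * (exp (- u / 4) * exp M)"
   unfolding pw using F K0 x by (intro mult_mono e) auto
  also have "\<dots> = ?l * K0 * exp 1 * (?r * ?b * exp (- u / 4) * ?d) * sqrt pi * exp M" by simp
  also have "\<dots> \<le> ?l * K0 * exp 1 * (?e * u powr (- 4 / 3)) * sqrt pi * exp M"
   using gamma_asymp[of "real R" u, folded x_def] x K0 by (intro mult_right_mono mult_left_mono) auto
  also have "\<dots> = K1 * u powr (- 4 / 3)" unfolding K1_def by (simp only: mult_ac)
  finally show ?case .
 qed
 then show ?thesis by auto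
qed

section \<open>Local estimates\<close>

text \<open>Locally uniform order u^k with real k; exponents add in products, for which C >= 0 is
  recorded. \<open>locO_compact\<close> passes to compact sets.\<close>

definition locO :: "complex => (real => complex => complex) => real => bool" where
 "locO z0 F k \<longleftrightarrow> (\<exists>r>0. \<exists>C\<ge>0. \<forall>\<^sub>F u in at_top. \<forall>z\<in>ball z0 r. norm (F u z) \<le> C * u powr k)"

lemma locOI:
 assumes "r > 0" "\<forall>\<^sub>F u in at_top. \<forall>z\<in>ball z0 r. norm (F u z) \<le> C * u powr k"
 shows "locO z0 F k"
 unfolding locO_def
proof (rule exI[of _ r], rule conjI[OF assms(1)], rule exI[of _ "max C 0"], rule conjI)
 show "\<forall>\<^sub>F u in at_top. \<forall>z\<in>ball z0 r. norm (F u z) \<le> max C 0 * u powr k"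
  using assms(2) by eventually_elim (auto intro: order_trans[OF _ mult_right_mono])
qed (use assms in auto)

lemma locO_cong:
 assumes "locO z0 F k" "r > 0" "\<forall>\<^sub>F u in at_top. \<forall>z\<in>ball z0 r. F u z = H u z"
 shows "locO z0 H k"
proof -
 obtain r' C where r': "r' > 0" "\<forall>\<^sub>F u in at_top. \<forall>z\<in>ball z0 r'. norm (F u z) \<le> C * u powr k"
  using assms(1) unfolding locO_def by blast
 have "\<forall>\<^sub>F u in at_top. \<forall>z\<in>ball z0 (min r r'). norm (H u z) \<le> C * u powr k" using r'(2) assms(3)
 proof eventually_elim
  case (elim u)
  show ?case
  proof
   fix z assume z: "z \<in> ball z0 (min r r')"
   then have "z \<in> ball z0 r" "z \<in> ball z0 r'" by auto
   then show "norm (H u z) \<le> C * u powr k" using elim by metis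
  qed
 qed
 then show ?thesis using r'(1) assms(2) by (intro locOI[of "min r r'"]) auto
qed

lemma locO_add:
 assumes "locO z0 F k" "locO z0 H k"
 shows "locO z0 (%u z. F u z + H u z) k"
proof -
 obtain r C where r: "r > 0" "\<forall>\<^sub>F u in at_top. \<forall>z\<in>ball z0 r. norm (F u z) \<le> C * u powr k"
  using assms(1) unfolding locO_def by blast
 obtain r' C' where r': "r' > 0" "\<forall>\<^sub>F u in at_top. \<forall>z\<in>ball z0 r'. norm (H u z) \<le> C' * u powr k"
  using assms(2) unfolding locO_def by blast
 have "\<forall>\<^sub>F u in at_top. \<forall>z\<in>ball z0 (min r r'). norm (F u z + H u z) \<le> (C + C') * u powr k"
  using r(2) r'(2) by eventually_elim (auto simp: distrib_right intro!: norm_triangle_mono)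
 then show ?thesis using r(1) r'(1) by (intro locOI[of "min r r'"]) auto
qed

lemma locO_mult:
 assumes "locO z0 F k" "locO z0 H l"
 shows "locO z0 (%u z. F u z * H u z) (k + l)"
proof -
 obtain r C where r: "r > 0" "C \<ge> 0" "\<forall>\<^sub>F u in at_top. \<forall>z\<in>ball z0 r. norm (F u z) \<le> C * u powr k"
  using assms(1) unfolding locO_def by blast
 obtain r' C' where r': "r' > 0" "C' \<ge> 0" "\<forall>\<^sub>F u in at_top. \<forall>z\<in>ball z0 r'. norm (H u z) \<le> C' * u powr l"
  using assms(2) unfolding locO_def by blast
 have "\<forall>\<^sub>F u in at_top. \<forall>z\<in>ball z0 (min r r'). norm (F u z * H u z) \<le> (C * C') * u powr (k + l)" using r(3) r'(3)
 proof eventually_elim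
  case (elim u)
  show ?case
  proof
   fix z assume z: "z \<in> ball z0 (min r r')"
   have "norm (F u z * H u z) \<le> (C * u powr k) * (C' * u powr l)" unfolding norm_mult using elim z r by (intro mult_mono) auto
   then show "norm (F u z * H u z) \<le> (C * C') * u powr (k + l)" by (simp add: powr_add mult_ac)
  qed
 qed
 then show ?thesis using r(1) r'(1) by (intro locOI[of "min r r'"]) auto
qed

lemma locO_mono:
 assumes "locO z0 F k" "k \<le> l"
 shows "locO z0 F l"
proof -
 obtain r C where r: "r > 0" "C \<ge> 0" "\<forall>\<^sub>F u in at_top. \<forall>z\<in>ball z0 r. norm (F u z) \<le> C * u powr k"
  using assms(1) unfolding locO_def by blast
 have "\<forall>\<^sub>F u in at_top. \<forall>z\<in>ball z0 r. norm (F u z) \<le> C * u powr l" using r(3) eventually_ge_at_top[of 1]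
 proof eventually_elim
  case (elim u)
  have "C * u powr k \<le> C * u powr l" using elim assms(2) r(2) by (intro mult_left_mono powr_mono) auto
  then show ?case using elim by auto
 qed
 then show ?thesis using r(1) by (intro locOI)
qed

text \<open>The difference of products expands into three terms, each with the error of at least one
  factor; the three conditions on k are their orders.\<close>

lemma locO_prod_diff:
 assumes F: "locO z0 (%u z. F u z - F0 u z) a" "locO z0 F0 b" and H: "locO z0 (%u z. H u z - H0 u z) c" "locO z0 H0 d"
  and k: "a + d \<le> k" "b + c \<le> k" "a + c \<le> k"
 shows "locO z0 (%u z. F u z * H u z - F0 u z * H0 u z) k"
proof -
 have "locO z0 (%u z. (F u z - F0 u z) * (H u z - H0 u z) + (F u z - F0 u z) * H0 u z + F0 u z * (H u z - H0 u z)) k"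
  by (intro locO_add locO_mono[OF locO_mult[OF F(1) H(1)] k(3)] locO_mono[OF locO_mult[OF F(1) H(2)] k(1)] locO_mono[OF locO_mult[OF F(2) H(1)] k(2)])
 then show ?thesis by (simp add: algebra_simps)
qed

lemma locO_u:
 assumes "\<exists>C. \<forall>\<^sub>F u in at_top. norm (g u) \<le> C * u powr k"
 shows "locO z0 (%u z. g u) k"
proof -
 obtain C where "\<forall>\<^sub>F u in at_top. norm (g u) \<le> C * u powr k" using assms by auto
 then show ?thesis by (intro locOI[of 1 _ _ C]) (auto elim:)
qed

lemma locO_powr: "locO z0 (%u z. of_real (u powr k)) k" by (intro locO_u exI[of _ 1]) simp

lemma locO_z:
 assumes "f holomorphic_on S" "open S" "z0 \<in> S"
 shows "locO z0 (%u z. f z) 0"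
proof -
 obtain r where r: "r > 0" "cball z0 r \<subseteq> S" using assms(2,3) open_contains_cball by blast
 have "compact (f ` cball z0 r)" using r assms(1) by (intro compact_continuous_image) (auto intro: holomorphic_on_imp_continuous_on)
 then obtain C where C: "\<And>z. z \<in> cball z0 r ==> norm (f z) \<le> C"
  using compact_imp_bounded bounded_iff by (metis imageI)
 show ?thesis by (rule locOI[OF r(1), of _ _ C], rule eventually_mono[OF eventually_gt_at_top[of 0]]) (use C in auto)
qed

lemma locO_minus: "locO z0 F k ==> locO z0 (%u z. - F u z) k" by (simp add: locO_def)

lemma locO_diff: "locO z0 F k ==> locO z0 H k ==> locO z0 (%u z. F u z - H u z) k"
 using locO_add[OF _ locO_minus] by simp

lemma locO_sum:
 "finite A ==> (\<And>i. i \<in> A ==> locO z0 (F i) k) ==> locO z0 (%u z. \<Sum>i\<in>A. F i u z) k"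
proof (induction A rule: finite_induct)
 case empty
 show ?case by (rule locOI[of 1 _ _ 0]) auto
qed (auto intro!: locO_add)

lemma uniform_bigo_locO:
 assumes U: "\<forall>\<delta>>0. uniform_bigo {z. ball z \<delta> \<subseteq> Zdom - {1}} F (%u. 1 / u ^ n)" and z0: "z0 \<in> Zdom" "z0 \<noteq> 1"
 shows "locO z0 F (- real n)"
proof -
 obtain r where r: "r > 0" "ball z0 r \<subseteq> Zdom - {1}" using open_Zdom z0 open_contains_ball[of "Zdom - {1}"] by auto
 have sub: "ball z (r / 2) \<subseteq> Zdom - {1}" if "z \<in> ball z0 (r / 2)" for z
 proof -
  have "dist z0 w < r" if "dist z w < r / 2" for w using dist_triangle[of z0 w z] that \<open>z \<in> ball z0 (r / 2)\<close> by simp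
  then have "ball z (r / 2) \<subseteq> ball z0 r" by auto
  then show ?thesis using r(2) by simp
 qed
 obtain C where C: "\<forall>\<^sub>F u in at_top. \<forall>z\<in>{z. ball z (r / 2) \<subseteq> Zdom - {1}}. norm (F u z) \<le> C * (1 / u ^ n)"
  using U[THEN spec[where x = "r / 2"]] r(1) unfolding uniform_bigo_def by auto
 have "\<forall>\<^sub>F u in at_top. \<forall>z\<in>ball z0 (r / 2). norm (F u z) \<le> C * u powr (- real n)"
  using C eventually_gt_at_top[of 0]
 proof eventually_elim
  case (elim u)
  show ?case using elim(2) elim(1) sub by (simp add: powr_minus_divide powr_realpow)
 qed
 then show ?thesis by (rule locOI[rotated]) (use r in simp)
qed

lemma one_over_u_locO: "locO z0 (%u z. 1 / of_real u ^ n) (- real n)"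
 by (rule locO_u, rule exI[of _ 1], rule eventually_mono[OF eventually_gt_at_top[of 0]])
  (simp add: norm_divide norm_power powr_minus_divide powr_realpow)

lemma airyPQ_locO:
 assumes z0: "z0 \<in> cutp" "z0 \<noteq> 1"
 shows "locO z0 (%u z. airyP m u (\<zeta> z)) 0" "locO z0 (%u z. airyQ m u (\<zeta> z)) 0"
proof -
 have op: "open (cutp - {1})" using open_cutp by auto
 let ?c = "%z. \<zeta> z ^ 3"
 let ?b = "%u z. 3 * of_real u ^ 2 * ?c z"
 have t: "locO z0 (%u z. c / (d * (?b u z) ^ k)) 0" for c d :: complex and k
 proof -
  let ?a = "%z. d * (3 * ?c z) ^ k"
  have "(%z. c / ?a z) holomorphic_on cutp - {1}" if "d \<noteq> 0"
   by (intro holomorphic_intros holomorphic_on_subset[OF zeta_holo]) (use zeta_nz in auto)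
  then have "locO z0 (%u z. c / ?a z) 0"
  proof (cases "d = 0")
   case True
   then show ?thesis by (simp add: locO_z[of "%_. 0" UNIV])
  qed (use locO_z[OF _ op] z0 in auto)
  from locO_mult[OF this one_over_u_locO[of z0 "2 * k"]]
  have "locO z0 (%u z. c / ?a z * (1 / of_real u ^ (2 * k))) 0" by (rule locO_mono) simp
  moreover have "c / ?a z * (1 / of_real u ^ (2 * k)) = c / (d * (?b u z) ^ k)" for z u
  proof -
   have "3 * of_real u ^ 2 * ?c z = (3 * ?c z) * of_real u ^ 2" by simp
   then have "(?b u z) ^ k = (3 * ?c z) ^ k * of_real u ^ (2 * k)" by (simp only: power_mult_distrib power_mult)
   then show ?thesis by simp
  qed
  ultimately show ?thesis by (simp only:)
 qed
 show "locO z0 (%u z. airyP m u (\<zeta> z)) 0" "locO z0 (%u z. airyQ m u (\<zeta> z)) 0"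
  unfolding airyP_def airyQ_def by (intro locO_sum t; simp)+
qed

lemma ec_es_locO:
 assumes z0: "z0 \<in> cutp" "z0 \<noteq> 1"
 shows "locO z0 (exp_cosh m) 0" "locO z0 (exp_sinh m) 0"
proof -
 obtain r C where r: "r > 0" "\<forall>z\<in>ball z0 r. \<forall>u\<ge>1. norm (exp_cosh m u z) \<le> C \<and> norm (exp_sinh m u z) \<le> C"
  using ec_es_bound[OF z0] by blast
 show "locO z0 (exp_cosh m) 0" "locO z0 (exp_sinh m) 0"
  by (rule locOI[OF r(1), of _ _ C], rule eventually_mono[OF eventually_ge_at_top[of 1]], use r(2) in simp)+
qed

text \<open>\<xi> jumps across (-1,1), but its square (z - 1)^3 xiI^2 is analytic and has no zero
  other than 1 in the cut plane. The bound passes from 1 / \<xi>^2 to 1 / \<xi> by 2 x <= x^2 +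
  1.\<close>

lemma inv_xi_locO:
 assumes z0: "z0 \<in> cutp" "z0 \<noteq> 1"
 shows "locO z0 (%u z. 1 / \<xi> z) 0"
proof -
 have op: "open (cutp - {1})" using open_cutp by auto
 have x: "\<xi> z ^ 2 = (z - 1) ^ 3 * xiI z ^ 2" for z
 proof -
  have "(csqrt (z - 1) ^ 3)^2 = (csqrt (z - 1) ^ 2) ^ 3" unfolding power_mult[symmetric] by simp
  then show ?thesis unfolding xi_xiI power_mult_distrib by simp
 qed
 have "(%z. 1 / ((z - 1) ^ 3 * xiI z ^ 2)) holomorphic_on cutp - {1}"
  by (intro holomorphic_intros holomorphic_on_subset[OF xiI_holo]) (use xiI_Re_pos in force)+
 from locO_z[OF this op] z0 obtain r C where r: "r > 0" "C \<ge> 0" "\<forall>\<^sub>F u in at_top. \<forall>z\<in>ball z0 r. norm (1 / \<xi> z ^ 2) \<le> C * u powr 0" unfolding x locO_def by blast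
 let ?a = "%z. norm (1 / \<xi> z)"
 have "\<forall>\<^sub>F u in at_top. \<forall>z\<in>ball z0 r. ?a z \<le> (C + 1) * u powr 0" using r(3)
 proof eventually_elim
  case (elim u)
  show ?case
  proof
   fix z assume "z \<in> ball z0 r"
   then have "?a z^2 \<le> C * u powr 0" using elim by (simp add: norm_divide norm_power power_divide)
   moreover have "2 * ?a z \<le> ?a z^2 + 1" using zero_le_power2[of "?a z - 1"] by (simp add: power2_eq_square algebra_simps)
   ultimately show "?a z \<le> (C + 1) * u powr 0" using r(2) by auto
  qed
 qed
 then show ?thesis by (rule locOI[OF r(1)])
qed

lemma G_coeff_bc: "G_coeff R s = bc (%z. z^2 - 1) (%z. z ^ R) s" by (induction s) simp_all

text \<open>g stands for \<open>gamma_mR\<close> and is represented here by its order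
  u^(-4/3).\<close>

locale expn =
 fixes m R :: nat and A B :: "real => complex => complex" and g :: "real => complex" and G :: "real => complex => complex"
 assumes AB: "airy_type_coefficients m A B"
  and g: "\<exists>C. \<forall>\<^sub>F u in at_top. norm (g u) \<le> C * u powr (- 4 / 3)"
begin

definition WAB :: "int => int => real => complex => complex" where
 "WAB j k u z = Wi j k (airy_arg u z) * A u z + deriv (Wi j k) (airy_arg u z) * B u z"

text \<open>u^(-2/3) \<open>qJ\<close> is the expansion of \<open>WAB\<close>, common to all pairs.
  Accordingly \<open>err\<close> is what G leaves after subtraction of both formal
  expansions.\<close>

definition qJ :: "real => complex => complex" where
 "qJ u z = quot_root4 z * J m u z / \<zeta> z"

definition err :: "real => complex => complex" where
 "err u z = G u z - (\<Sum>s\<le>m. G_coeff R s z / of_real u ^ (2 * s + 2)) + g u * (of_real (u powr (-2/3)) * qJ u z)"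

lemma quot_zeta_locO:
 assumes z0: "z0 \<in> cutp" "z0 \<noteq> 1"
 shows "locO z0 (%u z. quot_root4 z) 0" "locO z0 (%u z. 1 / \<zeta> z) 0" "locO z0 (%u z. 1 / (\<zeta>_root4 z * z2m1_root4 z)) 0"
proof -
 have op: "open (cutp - {1})" using open_cutp by auto
 show q: "locO z0 (%u z. quot_root4 z) 0" by (rule locO_z[OF quot_root4_holo op]) (use z0 in simp)
 have "(%z. 1 / \<zeta> z) holomorphic_on cutp - {1}"
  by (intro holomorphic_intros holomorphic_on_subset[OF zeta_holo]) (use zeta_nz in auto)
 then show "locO z0 (%u z. 1 / \<zeta> z) 0" by (rule locO_z[OF _ op]) (use z0 in simp)
 have zz: "locO z0 (%u z. \<zeta> z) 0" by (rule locO_z[OF zeta_holo open_cutp z0(1)])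
 let ?a = "%z. quot_root4 z * (\<zeta> z * (1 / \<xi> z))"
 let ?b = "locO z0 (%u z. (2 / 3) * ?a z)"
 have "?b (0 + (0 + (0 + 0)))" by (intro locO_mult q zz inv_xi_locO z0 locO_z[of "%_. 2 / 3" UNIV]) auto
 then have "?b 0" by simp
 moreover obtain r where "r > 0" "ball z0 r \<subseteq> cutp - {1}" using op z0 open_contains_ball[of "cutp - {1}"] by auto
 moreover have "(2 / 3) * ?a z = 1 / (\<zeta>_root4 z * z2m1_root4 z)" if z: "z \<in> cutp - {1}" for z
  using root4_identity[of z] xi_nz[of z] z by (simp add: field_simps)
 ultimately show "locO z0 (%u z. 1 / (\<zeta>_root4 z * z2m1_root4 z)) 0" by (elim locO_cong) auto
qed

lemma qJ_locO:
 assumes z0: "z0 \<in> cutp" "z0 \<noteq> 1"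
 shows "locO z0 qJ 0"
proof -
 have s: "locO z0 (%u z. 1 / of_real u ^ 1 * (2 / 3)) (- real 1 + 0)"
  by (intro locO_mult one_over_u_locO locO_z[of "%_. 2 / 3" UNIV]) auto
 have "locO z0 (%u z. quot_root4 z * (- exp_cosh m u z * airyP m u (\<zeta> z) + (1 / of_real u ^ 1 * (2 / 3)) * (exp_sinh m u z * (1 / \<xi> z)) * airyQ m u (\<zeta> z)) * (1 / \<zeta> z)) (0 + (0 + 0) + 0)"
  by (intro locO_mult locO_add quot_zeta_locO ec_es_locO[THEN locO_minus] airyPQ_locO z0
   locO_mono[OF locO_mult[OF locO_mult[OF s locO_mult[OF ec_es_locO(2)[OF z0] inv_xi_locO[OF z0]]] airyPQ_locO(2)[OF z0]]]) simp
 then show ?thesis unfolding qJ_def[abs_def] J_alt by simp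
qed

lemma AB_locO:
 assumes z0: "z0 \<in> Zdom" "z0 \<noteq> 1"
 shows "locO z0 (%u z. A u z / quot_root4 z - exp_cosh m u z) (- real (2 * m + 2))"
  and "locO z0 (%u z. B u z * (of_real (u powr (1/3)) * \<zeta>_root4 z * z2m1_root4 z) - exp_sinh m u z) (- real (2 * m + 2))"
   by (rule uniform_bigo_locO[OF _ z0]; use AB in "simp add: airy_type_coefficients_def")+

text \<open>Wi, Wi', A and B have sizes u^(-2/3), u^(-4/3), 1 and u^(-1/3), each with relative error
  u^(-2m-2). So the second product is smaller than the first by 1/u, and
  \<open>root4_identity\<close> turns it into the second term of \<open>J\<close>.\<close>

lemma WAB_expansion:
 assumes z0: "z0 \<in> Zdom" "z0 \<noteq> 1" and al: "\<bar>\<alpha>\<bar> < pi / 6" and x0: "Re (cis \<alpha> * (wom j k * \<zeta> z0)) < 0"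
 shows "locO z0 (%u z. WAB j k u z - of_real (u powr (-2/3)) * qJ u z) (- real (2 * m + 2) - 2 / 3)"
proof -
 have zc: "z0 \<in> cutp" using z0 Zdom_cutp by auto
 let ?a = "%u. of_real (u powr (2/3))" and ?c = "real (2 * m + 2)" and ?\<kappa> = "%z. 1 / (\<zeta>_root4 z * z2m1_root4 z)"
 let ?W = "%u z. - airyP m u (\<zeta> z) * (of_real (u powr (-2/3)) * (1 / \<zeta> z))"
  and ?V = "%u z. airyQ m u (\<zeta> z) * (of_real (u powr (-4/3)) * (1 / \<zeta> z * (1 / \<zeta> z)))"
  and ?A = "%u z. quot_root4 z * exp_cosh m u z" and ?B = "%u z. of_real (u powr (-1/3)) * (?\<kappa> z * exp_sinh m u z)"
 let ?F = "%u z. (Wi j k (airy_arg u z) * A u z - ?W u z * ?A u z) + (deriv (Wi j k) (airy_arg u z) * B u z - ?V u z * ?B u z)"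
 obtain \<rho> K where K: "\<rho> > 0" "\<forall>\<^sub>F u in at_top. \<forall>x\<in>ball (\<zeta> z0) \<rho>.
  norm (Wi j k (?a u * x) + airyP m u x / (?a u * x)) \<le> K / (u ^ (2*m+2) * u powr (2/3)) \<and>
  norm (deriv (Wi j k) (?a u * x) - airyQ m u x / (?a u * x)^2) \<le> K / (u ^ (2*m+2) * u powr (4/3))"
  using Wi_expansion[OF al x0] by blast
 have "isCont \<zeta> z0" using zeta_holo zc open_cutp holomorphic_on_imp_continuous_on continuous_on_eq_continuous_at by blast
 then obtain r1 where r1: "r1 > 0" "\<And>z. dist z z0 < r1 ==> dist (\<zeta> z) (\<zeta> z0) < \<rho>" using K(1) unfolding continuous_at_eps_delta by blast
 have zr: "\<zeta> z \<in> ball (\<zeta> z0) \<rho>" if "z \<in> ball z0 r1" for z using r1(2)[of z] that by (simp add: dist_commute)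
 have pw: "K / (u ^ (2*m+2) * u powr a) = K * u powr (- ?c - a)" if "u > 0" for u a
 proof -
  have eq: "- ?c - a = - (?c + a)" by simp
  show ?thesis unfolding eq powr_minus_divide powr_add powr_realpow[OF that] by simp
 qed
 have WV: "?W u z = - airyP m u (\<zeta> z) / (?a u * \<zeta> z)" "?V u z = airyQ m u (\<zeta> z) / (?a u * \<zeta> z)^2" if "u > 0" for u z
 proof -
  have "u powr (4/3) = (u powr (2/3))^2" using that by (simp add: powr_powr flip: powr_realpow[of "u powr (2/3)" 2])
  then show "?W u z = - airyP m u (\<zeta> z) / (?a u * \<zeta> z)" "?V u z = airyQ m u (\<zeta> z) / (?a u * \<zeta> z)^2"
   by (simp_all add: powr_minus_divide power2_eq_square)
 qed
 have "\<forall>\<^sub>F u in at_top. \<forall>z\<in>ball z0 r1. norm (Wi j k (airy_arg u z) - ?W u z) \<le> K * u powr (- ?c - 2 / 3) \<and>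
  norm (deriv (Wi j k) (airy_arg u z) - ?V u z) \<le> K * u powr (- ?c - 4 / 3)"
  using K(2) eventually_gt_at_top[of 0]
 proof eventually_elim
  case (elim u)
  show ?case unfolding WV[OF elim(2)] pw[OF elim(2), symmetric] airy_arg_def using elim(1) zr by auto
 qed
 then have e: "locO z0 (%u z. Wi j k (airy_arg u z) - ?W u z) (- ?c - 2 / 3)" "locO z0 (%u z. deriv (Wi j k) (airy_arg u z) - ?V u z) (- ?c - 4 / 3)"
  by (auto intro!: locOI[OF r1(1), where C = K] elim: eventually_mono)
 note qz = quot_zeta_locO[OF zc z0(2)] and PQ = airyPQ_locO[OF zc z0(2)] and ab = AB_locO[OF z0] and es = ec_es_locO[OF zc z0(2)]
 obtain r where r: "r > 0" "ball z0 r \<subseteq> cutp - {1}" using open_cutp zc z0(2) open_contains_ball[of "cutp - {1}"] by auto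
 have A: "locO z0 (%u z. A u z - ?A u z) (0 + - ?c)" by (rule locO_cong[OF locO_mult[OF qz(1) ab(1)] r(1)], intro always_eventually)
   (use root4_identity(2) r(2) in "auto simp: right_diff_distrib ")
 have B: "locO z0 (%u z. B u z - ?B u z) (- 1 / 3 + 0 + - ?c)"
 proof (rule locO_cong[OF locO_mult[OF locO_mult[OF locO_powr qz(3)] ab(2)] r(1)], rule eventually_mono[OF eventually_gt_at_top[of 0]], rule ballI)
  fix u :: real and z assume u: "u > 0" and "z \<in> ball z0 r"
  then have "z \<in> cutp" "z \<noteq> 1" using r by auto
  note root4_identity(3,4)[OF this]
  moreover have "complex_of_real (u powr (- 1 / 3)) * of_real (u powr (1 / 3)) = 1"
   unfolding of_real_mult[symmetric] powr_add[symmetric] using u by simp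
  ultimately show "of_real (u powr (- 1 / 3)) * ?\<kappa> z * (B u z * (of_real (u powr (1/3)) * \<zeta>_root4 z * z2m1_root4 z) - exp_sinh m u z) = B u z - ?B u z"
   by (simp add: field_simps)
 qed
 have "locO z0 ?F (- ?c - 2 / 3)"
  by (intro locO_add locO_prod_diff[OF e(1) locO_mult[OF locO_minus[OF PQ(1)] locO_mult[OF locO_powr qz(2)]] A locO_mult[OF qz(1) es(1)]]
    locO_prod_diff[OF e(2) locO_mult[OF PQ(2) locO_mult[OF locO_powr locO_mult[OF qz(2) qz(2)]]] B locO_mult[OF locO_powr locO_mult[OF qz(3) es(2)]]]) simp_all
 then show ?thesis
 proof (rule locO_cong[OF _ r(1)], intro eventually_mono[OF eventually_gt_at_top[of 0]] ballI)
  fix u :: real and z assume u: "u > 0" and "z \<in> ball z0 r"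
  then have z: "z \<in> cutp" "z \<noteq> 1" using r by auto
  note ri = root4_identity[OF z]
  have zn: "\<zeta> z \<noteq> 0" "\<xi> z \<noteq> 0" using zeta_nz xi_nz z by auto
  have k: "?\<kappa> z * (1 / \<zeta> z) * X = 1 / (3/2 * \<xi> z) * quot_root4 z * X" for X using ri unfolding ri(1)[symmetric] by simp
  have up: "complex_of_real (u powr (-4/3)) * (of_real (u powr (-1/3)) * X) = of_real (u powr (-2/3)) * (1 / of_real u * X)" for X
  proof -
   have "u powr (-4/3) * u powr (-1/3) = u powr (-2/3) * u powr (-1)" unfolding powr_add[symmetric] by simp
   also have "u powr (-1) = 1 / u" using u by simp
   finally have "u powr (-4/3) * u powr (-1/3) = u powr (-2/3) * (1 / u)" .
   from arg_cong[OF this, of complex_of_real] show ?thesis by (simp add: mult.assoc[symmetric])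
  qed
  have "?V u z * ?B u z = of_real (u powr (-4/3)) * (of_real (u powr (-1/3)) * (?\<kappa> z * (1 / \<zeta> z) * (airyQ m u (\<zeta> z) * exp_sinh m u z * (1 / \<zeta> z))))"
   by (simp only: mult_ac)
  also note up also note k
  finally have VB: "?V u z * ?B u z = of_real (u powr (-2/3)) * (1 / of_real u * (1 / (3/2 * \<xi> z) * quot_root4 z * (airyQ m u (\<zeta> z) * exp_sinh m u z * (1 / \<zeta> z))))" .
  show "?F u z = WAB j k u z - of_real (u powr (-2/3)) * qJ u z"
   unfolding VB WAB_def qJ_def J_alt by (simp add: algebra_simps diff_divide_distrib)
 qed
qed

end

lemma locO_reflect:
 assumes "locO w0 F k" and f: "\<And>z w. dist (f z) (f w) = dist z w" "f z0 = w0" and n: "\<And>u z. norm (H u z) = norm (F u (f z))"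
 shows "locO z0 H k"
proof -
 obtain r C where r: "r > 0" "\<forall>\<^sub>F u in at_top. \<forall>z\<in>ball w0 r. norm (F u z) \<le> C * u powr k"
  using assms(1) unfolding locO_def by blast
 have "f z \<in> ball w0 r" if "z \<in> ball z0 r" for z using f(1)[of z0 z] f(2) that by simp
 then have "\<forall>\<^sub>F u in at_top. \<forall>z\<in>ball z0 r. norm (H u z) \<le> C * u powr k"
  using r(2) unfolding n by (auto elim!: eventually_mono)
 then show ?thesis by (rule locOI[OF r(1)])
qed

lemma dist_cnj_cnj: "dist (cnj z) (cnj w) = dist z w" by (simp add: dist_norm flip: complex_cnj_diff)

lemma locO_bounded_on:
 assumes S: "open S" "z0 \<in> S" and K: "\<And>u z. u > 3 ==> z \<in> S ==> norm (F u z) \<le> K * (1 + norm z) ^ n" "K \<ge> 0"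
 shows "locO z0 F 0"
proof -
 obtain r where r: "r > 0" "ball z0 r \<subseteq> S" using S open_contains_ball by blast
 let ?a = "K * (1 + (norm z0 + r)) ^ n"
 show ?thesis
 proof (rule locOI[OF r(1), where C = "?a"], rule eventually_mono[OF eventually_gt_at_top[of 3]], rule ballI)
  fix u :: real and z assume u: "u > 3" and z: "z \<in> ball z0 r"
  have "norm z \<le> norm z0 + r" using z norm_triangle_sub[of z z0] by (simp add: dist_norm norm_minus_commute)
  then have "K * (1 + norm z) ^ n \<le> ?a" using K(2) by (intro mult_left_mono power_mono) auto
  then show "norm (F u z) \<le> ?a * u powr 0" using K(1)[OF u] z r u by fastforce
 qed
qed

lemma S11_locO:
 assumes "Re (z0^2) < 1"
 shows "locO z0 (%u. S11 u R) 0"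
proof -
 obtain K where K: "K \<ge> 0" "\<forall>u>3. \<forall>z. Re (z^2) \<le> 1 \<longrightarrow> norm (S11 u R z) \<le> K * (1 + norm z) ^ (R + 1)" using S11_bound by blast
 have "open {z. Re (z^2) < 1}" by (intro open_Collect_less continuous_intros)
 then show ?thesis by (rule locO_bounded_on[where K = K and n = "R + 1"]) (use assms K in auto)
qed

definition Scond :: "complex => bool" where
 "Scond z \<longleftrightarrow> (z \<in> Q1 \<and> Re (z^2 * dA) > 1) \<or> (z \<in> Q2 \<and> Re (z^2 * dB) > 0)"

lemma S01_locO:
 assumes "Scond z0"
 shows "locO z0 (%u. S01 u R) 0"
 using assms unfolding Scond_def
proof
 assume z: "z0 \<in> Q1 \<and> Re (z0^2 * dA) > 1"
 define k where "k = (Re (z0^2 * dA) - 1) / 2"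
 have k: "k > 0" "Re (z0^2 * dA) > 1 + k" using z by (auto simp: k_def field_simps)
 obtain K where K: "K \<ge> 0" "\<forall>u>3. \<forall>z. (z \<in> Q1 \<and> Re (z^2 * dA) \<ge> 1 + k) \<or> (z \<in> Q2 \<and> Re (z^2 * dB) \<ge> k) \<longrightarrow> norm (S01 u R z) \<le> K * (1 + norm z) ^ (R + 1)"
  using S01_bound[OF k(1)] by blast
 have "open (Q1 \<inter> {z. Re (z^2 * dA) > 1 + k})" by (intro open_Int Q_open open_Collect_less continuous_intros)
 then show ?thesis by (rule locO_bounded_on[where K = K and n = "R + 1"]) (use k z K in "auto")
next
 assume z: "z0 \<in> Q2 \<and> Re (z0^2 * dB) > 0"
 define k where "k = Re (z0^2 * dB) / 2"
 have k: "k > 0" "Re (z0^2 * dB) > k" using z by (auto simp: k_def field_simps)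
 obtain K where K: "K \<ge> 0" "\<forall>u>3. \<forall>z. (z \<in> Q1 \<and> Re (z^2 * dA) \<ge> 1 + k) \<or> (z \<in> Q2 \<and> Re (z^2 * dB) \<ge> k) \<longrightarrow> norm (S01 u R z) \<le> K * (1 + norm z) ^ (R + 1)"
  using S01_bound[OF k(1)] by blast
 have "open (Q2 \<inter> {z. Re (z^2 * dB) > k})" by (intro open_Int Q_open open_Collect_less continuous_intros)
 then show ?thesis by (rule locO_bounded_on[where K = K and n = "R + 1"]) (use k z K in "auto")
qed

text \<open>The cones \<open>Q1\<close> and \<open>Q2\<close> cover the region: for y < 2 x one has
  Re (z^2 dA) = x^2 + y (2 x - y) > 1, and for y >= 2 x the term y^2 dominates Re (z^2 dB).\<close>

lemma Scond_right:
 assumes "Re z > 1" "Im z \<ge> 0"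
 shows "Scond z"
proof -
 define x y where "x = Re z" and "y = Im z"
 have x: "x > 1" "y \<ge> 0" using assms by (auto simp: x_def y_def)
 have xx: "x * x > 1" using x mult_strict_mono[of 1 x 1 x] by simp
 show ?thesis
 proof (cases "y < 2 * x")
  case True
  have "0 \<le> y * (2 * x - y)" using x True by simp
  then show ?thesis using xx x True unfolding Scond_def Q1_def by (intro disjI1) (simp add: dA_def power2_eq_square x_def y_def algebra_simps)
 next
  case False
  have "(2 * x) * (2 * x) \<le> y * y" using False x by (intro mult_mono) auto
  moreover have "x * y \<ge> 0" using x by simp
  ultimately have "y * y - x * x + 2 * (x * y) > 0" using xx by simp
  then show ?thesis using x False unfolding Scond_def Q2_def by (intro disjI2) (simp add: dB_def power2_eq_square x_def y_def algebra_simps)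
 qed
qed

lemma zeta_real_sign:
 assumes "x > -1"
 shows "\<exists>h>0. \<zeta> (of_real x) = of_real ((x - 1) * h)"
proof -
 define y where "y = Re (xiI (of_real x))"
 have c: "of_real x \<in> cutp" using assms by (simp add: cutp_def)
 have y: "y > 0" unfolding y_def by (rule xiI_Re_pos[OF c])
 have "hz (of_real x) = of_real (3/2 * y) powr of_real (2/3)" using xiI_real[OF assms] unfolding y_def hz_def by simp
 also have "\<dots> = of_real ((3/2 * y) powr (2/3))" by (rule powr_of_real) (use y in simp)
 finally show ?thesis using y unfolding zeta_hz by (intro exI[of _ "(3/2 * y) powr (2/3)"]) simp
qed

text \<open>Where Re \<zeta> >= 0 the pair (0,1) works, where Re \<zeta> < 0 and Re (z^2) < 1 the
  pair (-1,1). The rest lies in the left half plane; its mirror image - cnj z falls under the first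
  case, and there Re \<xi> < 0 makes \<open>Wi (-1) 1\<close> algebraic as well.\<close>

lemma upper_cases:
 assumes z: "z \<in> Zdom" "z \<noteq> 1" "Im z \<ge> 0"
 obtains "Scond z" "Re (om * \<zeta> z) < 0"
 | "Re (\<zeta> z) < 0" "Re (z^2) < 1"
 | \<alpha> where "Im z > 0" "Re z < 0" "Re (\<zeta> z) < 0" "Scond (- cnj z)" "Re (om * \<zeta> (- cnj z)) < 0"
   "\<bar>\<alpha>\<bar> < pi / 6" "Re (cis \<alpha> * \<zeta> (- cnj z)) < 0"
proof (cases "Im z = 0")
 case True
 obtain x where x: "z = of_real x" "x > -1" "x \<noteq> 1"
 using True z(1) Zdom_cutp z(2) by (auto simp: complex_eq_iff cutp_def)
 obtain h where h: "h > 0" "\<zeta> z = of_real ((x - 1) * h)" using zeta_real_sign[OF x(2)] x(1) by auto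
 show ?thesis
 proof (cases "x > 1")
  case True
  have "Re (om * \<zeta> z) < 0" using True h by (simp add: om_alt)
  moreover have "Scond z" using x True by (intro Scond_right) auto
  ultimately show ?thesis using that(1) by simp
 next
  case False
  have "Re (\<zeta> z) < 0" unfolding h(2) using False x(3) h(1) by (simp add: mult_neg_pos)
  moreover have "Re (z^2) < 1"
  using False x by (simp add: abs_square_less_1)
  ultimately show ?thesis using that(2) by simp
 qed
next
 case False
 then have i: "Im z > 0" using z by simp
 note F = zeta_facts[OF i]
 consider "Re (\<zeta> z) \<ge> 0" | "Re (\<zeta> z) < 0" "Re (z^2) < 1" | "Re (\<zeta> z) < 0" "Re (z^2) \<ge> 1" by linarith
 then show ?thesis
 proof cases
  case 1
  then show ?thesis using F(1) Scond_right[of z] i that(1) by auto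
 next
  case 2
  then show ?thesis using that(2) by simp
 next
  case 3
  have "Re z \<noteq> 0"
  proof
   assume "Re z = 0"
   then show False using 3(2) zero_le_square[of "Im z"] by (simp add: power2_eq_square)
  qed
  then have neg: "Re z < 0" using F(2) 3 by linarith
  define w where "w = - cnj z"
  have w: "Im w > 0" "Re w > 0" "Re (w^2) \<ge> 1" using i neg 3(2) by (auto simp: w_def power2_eq_square)
  note Fw = zeta_facts[OF w(1)]
  have pos: "Re (\<zeta> w) > 0" by (rule Fw(2)[OF w(2,3)])
  have "Re w > 1" "Re (om * \<zeta> w) < 0" using Fw(1) pos by auto
  moreover obtain \<alpha> where "\<bar>\<alpha>\<bar> < pi / 6" "Re (cis \<alpha> * \<zeta> w) < 0" using z(1) i neg xi_reflect[OF i] Fw(4) unfolding Zdom_Tdom Tdom_def w_def by (auto split:)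
  ultimately show ?thesis using that(3)[of \<alpha>] 3(1) Scond_right[of w] w(1) unfolding w_def by auto
 qed
qed

locale expn_G = expn +
 assumes G11: "\<forall>\<^sub>F u in at_top. \<forall>z\<in>Zdom. S11 u R z = g u * WAB (-1) 1 u z + G u z"
  and G01: "\<forall>\<^sub>F u in at_top. \<forall>z\<in>Zdom. S01 u R z = g u * WAB 0 1 u z + G u z"
  and G10: "\<forall>\<^sub>F u in at_top. \<forall>z\<in>Zdom. cnj (S01 u R (cnj z)) = g u * WAB (-1) 0 u z + G u z"
begin

definition sol_pair :: "int => int => (real => complex => complex) => bool" where
 "sol_pair j k W \<longleftrightarrow> (\<forall>\<^sub>F u in at_top. weber u UNIV (%z. z ^ R) (W u)) \<and>
   (\<forall>\<^sub>F u in at_top. \<forall>z\<in>Zdom. W u z = g u * WAB j k u z + G u z)"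

lemma sol_pairs: "sol_pair (-1) 1 (%u. S11 u R)" "sol_pair 0 1 (%u. S01 u R)" "sol_pair (-1) 0 (%u z. cnj (S01 u R (cnj z)))"
proof -
 let ?a = "%u. weber u UNIV (%z. z ^ R)"
 have 1: "\<forall>\<^sub>F u in at_top. ?a u (S11 u R)" "\<forall>\<^sub>F u in at_top. ?a u (S01 u R)"
  by (rule eventually_mono[OF eventually_gt_at_top[of 3]], rule S_ode, assumption)+
 have "\<forall>\<^sub>F u in at_top. ?a u (%z. cnj (S01 u R (cnj z)))" using 1(2)
 proof eventually_elim
  case (elim u)
  from ode2_cnj[OF elim open_UNIV open_UNIV] show ?case by simp
 qed
 then show "sol_pair (-1) 1 (%u. S11 u R)" "sol_pair 0 1 (%u. S01 u R)" "sol_pair (-1) 0 (%u z. cnj (S01 u R (cnj z)))"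
  using 1 G11 G01 G10 by (simp_all add: sol_pair_def)
qed

text \<open>\<open>bootstrap\<close> expands W and \<open>WAB_expansion\<close> the Airy-type part;
  their combination is \<open>err\<close>, which does not refer to the pair.\<close>

lemma err_pair:
 assumes z0: "z0 \<in> Zdom" "z0 \<noteq> 1" and W: "sol_pair j k W" "locO z0 W 0"
  and al: "\<bar>\<alpha>\<bar> < pi / 6" and x0: "Re (cis \<alpha> * (wom j k * \<zeta> z0)) < 0"
 shows "locO z0 err (- real (2 * m + 4))"
proof -
 obtain r1 C where r1: "r1 > 0" "\<forall>\<^sub>F u in at_top. \<forall>z\<in>ball z0 r1. norm (W u z) \<le> C * u powr 0"
  using W(2) unfolding locO_def by blast
 obtain r2 where r2: "r2 > 0" "ball z0 r2 \<subseteq> Zdom - {1}" using open_Zdom z0 open_contains_ball[of "Zdom - {1}"] by auto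
 define r where "r = min r1 r2"
 have r: "r > 0" "ball z0 r \<subseteq> ball z0 r1" "ball z0 r \<subseteq> Zdom - {1}" using r1 r2 by (auto simp: r_def)
 have nz: "z^2 - 1 \<noteq> 0" if "z \<in> ball z0 r" for z
 proof -
  have "z \<in> cutp" "z \<noteq> 1" using that r(3) Zdom_cutp by auto
  then show ?thesis by (auto simp: cutp_def power2_eq_1_iff)
 qed
 have "\<exists>\<rho>>0. \<rho> \<le> r \<and> (\<exists>K. \<forall>\<^sub>F u in at_top. \<forall>z\<in>ball z0 \<rho>.
  norm (W u z - (\<Sum>s<Suc m. bc (%z. z^2 - 1) (%z. z ^ R) s z / of_real u ^ (2 * s + 2))) \<le> K / u ^ (2 * Suc m + 2))"
 proof (rule bootstrap[OF _ _ r(1) nz])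
  show "\<forall>\<^sub>F u in at_top. ode2 (%z. of_real (u^2) * (z^2 - 1)) (ball z0 r) (%z. z ^ R) (W u)"
   using W(1) unfolding sol_pair_def by (auto elim!: eventually_mono intro: ode2_subset)
  show "\<forall>\<^sub>F u in at_top. \<forall>z\<in>ball z0 r. norm (W u z) \<le> C"
   using r1(2) eventually_gt_at_top[of 0] by eventually_elim (use r(2) in auto)
 qed (auto intro!: holomorphic_intros)
 then obtain \<rho> K where rho: "\<rho> > 0" "\<forall>\<^sub>F u in at_top. \<forall>z\<in>ball z0 \<rho>.
  norm (W u z - (\<Sum>s<Suc m. G_coeff R s z / of_real u ^ (2 * s + 2))) \<le> K / u ^ (2 * Suc m + 2)"
  unfolding G_coeff_bc by blast
 have T1: "locO z0 (%u z. W u z - (\<Sum>s<Suc m. G_coeff R s z / of_real u ^ (2 * s + 2))) (- real (2 * m + 4))"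
 proof (rule locOI[OF rho(1), where C = K])
  show "\<forall>\<^sub>F u in at_top. \<forall>z\<in>ball z0 \<rho>. norm (W u z - (\<Sum>s<Suc m. G_coeff R s z / of_real u ^ (2 * s + 2))) \<le> K * u powr (- real (2 * m + 4))"
   using rho(2) eventually_gt_at_top[of 0]
  proof eventually_elim
   case (elim u)
   show ?case using elim(1) unfolding powr_minus_divide powr_realpow[OF elim(2)] by (simp add: eval_nat_numeral)
  qed
 qed
 \<comment> \<open>The exponents - 4/3 of g and - (2 m + 2) - 2/3 of the error of \<open>WAB\<close>
   add up to - (2 m + 4).\<close>
 have T2: "locO z0 (%u z. g u * (WAB j k u z - of_real (u powr (-2/3)) * qJ u z)) (- real (2 * m + 4))"
  by (rule locO_mono[OF locO_mult[OF locO_u[OF g] WAB_expansion[OF z0 al x0]]]) simp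
 show ?thesis
 proof (rule locO_cong[OF locO_diff[OF T1 T2] r(1)])
  show "\<forall>\<^sub>F u in at_top. \<forall>z\<in>ball z0 r. W u z - (\<Sum>s<Suc m. G_coeff R s z / of_real u ^ (2 * s + 2)) - g u * (WAB j k u z - of_real (u powr (-2/3)) * qJ u z) = err u z"
   using conjunct2[OF W(1)[unfolded sol_pair_def]]
  proof eventually_elim
   case (elim u)
   show ?case
   using elim r(3) unfolding err_def lessThan_Suc_atMost by (auto simp: algebra_simps)
  qed
 qed
qed

lemma WAB_locO:
 assumes z0: "z0 \<in> Zdom" "z0 \<noteq> 1" and al: "\<bar>\<alpha>\<bar> < pi / 6" and x0: "Re (cis \<alpha> * (wom j k * \<zeta> z0)) < 0"
 shows "locO z0 (WAB j k) 0"
proof -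
 have zc: "z0 \<in> cutp" using z0 Zdom_cutp by auto
 have "locO z0 (%u z. (WAB j k u z - of_real (u powr (-2/3)) * qJ u z) + of_real (u powr (-2/3)) * qJ u z) 0"
  by (intro locO_add locO_mono[OF WAB_expansion[OF z0 al x0]] locO_mono[OF locO_mult[OF locO_powr qJ_locO[OF zc z0(2)]]]) simp_all
 then show ?thesis by simp
qed

lemma dom_pair:
 assumes z0: "z0 \<in> Zdom" and h: "Scond z0 \<and> Re (om * \<zeta> z0) < 0 \<or> Scond (cnj z0) \<and> Re (om * \<zeta> (cnj z0)) < 0"
 shows "\<exists>j k W. sol_pair j k W \<and> locO z0 W 0 \<and> Re (wom j k * \<zeta> z0) < 0"
 using h
proof
 assume "Scond z0 \<and> Re (om * \<zeta> z0) < 0"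
 then show ?thesis using sol_pairs(2) S01_locO[of z0 R] by (intro exI[of _ 0] exI[of _ 1] exI[of _ "%u. S01 u R"]) (simp add: wom_def)
next
 assume h: "Scond (cnj z0) \<and> Re (om * \<zeta> (cnj z0)) < 0"
 let ?a = "%u z. cnj (S01 u R (cnj z))"
 have "locO z0 ?a 0" by (rule locO_reflect[OF S01_locO[OF conjunct1[OF h]], of ]) (simp_all add: dist_cnj_cnj)
 moreover have "Re (om^2 * \<zeta> z0) < 0" using zeta_cnj[of z0] z0 Zdom_cutp h by (auto simp: om_alt power2_eq_square)
 ultimately show ?thesis using sol_pairs(3) by (intro exI[of _ "-1"] exI[of _ 0] exI[of _ "?a"]) (simp add: wom_def)
qed

lemma err_locO:
 assumes z0: "z0 \<in> Zdom" "z0 \<noteq> 1"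
 shows "locO z0 err (- real (2 * m + 4))"
proof -
 have zc: "z0 \<in> cutp" using z0 Zdom_cutp by auto
 define z' where "z' = (if Im z0 \<ge> 0 then z0 else cnj z0)"
 have z': "z' \<in> Zdom" "z' \<noteq> 1" "Im z' \<ge> 0" using z0 Tdom_cnj[of z0] by (auto simp: z'_def Zdom_Tdom)
 have zz: "z' = z0 \<or> z' = cnj z0" by (auto simp: z'_def)
 have zx: "Re (\<zeta> z0) = Re (\<zeta> z')" "Re (z0^2) = Re (z'^2)" "Re z0 = Re z'" using zz zeta_cnj[OF zc] by (auto simp: power2_eq_square)
 let ?b = "locO z0 (%u. S11 u R) 0"
 have direct: ?thesis if "?b" "Re (\<zeta> z0) < 0" by (rule err_pair[OF z0 sol_pairs(1) that(1), of 0]) (use that(2) in "simp_all add: wom_def")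
 show ?thesis
 proof (rule upper_cases[OF z'])
  assume h: "Scond z'" "Re (om * \<zeta> z') < 0"
  have "Scond z0 \<and> Re (om * \<zeta> z0) < 0 \<or> Scond (cnj z0) \<and> Re (om * \<zeta> (cnj z0)) < 0"
   using zz by rule (use h in "simp_all del: ")
  from dom_pair[OF z0(1) this] obtain j k W where W: "sol_pair j k W" "locO z0 W 0" "Re (wom j k * \<zeta> z0) < 0" by auto
  show ?thesis by (rule err_pair[OF z0 W(1,2), of 0]) (use W(3) in "simp_all del: ")
 next
  assume "Re (\<zeta> z') < 0" "Re (z'^2) < 1"
  then show ?thesis unfolding zx[symmetric] by (intro direct S11_locO)
 next
  fix \<alpha> assume h: "Im z' > 0" "Re z' < 0" "Re (\<zeta> z') < 0" "Scond (- cnj z')" "Re (om * \<zeta> (- cnj z')) < 0"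
   "\<bar>\<alpha>\<bar> < pi / 6" "Re (cis \<alpha> * \<zeta> (- cnj z')) < 0"
  define z1 where "z1 = - cnj z0"
  have z1: "z1 \<in> Zdom" "z1 \<noteq> 1" using h(1,2) zz by (auto intro!: Zdom_right_half simp: z1_def complex_eq_iff)
  have z1c: "z1 \<in> cutp" using z1 Zdom_cutp by auto
  have zz1: "- cnj z' = z1 \<or> - cnj z' = cnj z1" using zz by (auto simp: z1_def)
  have "Scond z1 \<and> Re (om * \<zeta> z1) < 0 \<or> Scond (cnj z1) \<and> Re (om * \<zeta> (cnj z1)) < 0"
   using zz1 by rule (use h(4,5) in "simp_all del: ")
  from dom_pair[OF z1(1) this] obtain j k W where W: "sol_pair j k W" "locO z1 W 0" "Re (wom j k * \<zeta> z1) < 0" by auto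
  have w1: "locO z1 (WAB j k) 0" by (rule WAB_locO[OF z1, of 0]) (use W(3) in "simp_all del: ")
  have "\<exists>\<alpha>. \<bar>\<alpha>\<bar> < pi / 6 \<and> Re (cis \<alpha> * \<zeta> z1) < 0" using zz1
  proof
   assume "- cnj z' = cnj z1"
   then show ?thesis using zeta_cnj[OF z1c] h(7) h(6) by (intro exI[of _ "- \<alpha>"]) simp
  qed (use h in auto)
  then obtain \<alpha>' where "\<bar>\<alpha>'\<bar> < pi / 6" "Re (cis \<alpha>' * (wom (-1) 1 * \<zeta> z1)) < 0" by (auto simp: wom_def)
  then have w2: "locO z1 (WAB (-1) 1) 0" by (rule WAB_locO[OF z1])
  \<comment> \<open>Near the mirror point z1 this is \<open>S11\<close>, as both pairs share G. W is
    bounded there and both functions \<open>WAB\<close> are algebraic, so \<open>S11\<close> is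
    bounded near z1, and by parity and conjugation near z0.\<close>
  let ?a = "%u z. W u z + g u * (WAB (-1) 1 u z - WAB j k u z)"
  have L: "locO z1 ?a 0" by (intro locO_add W(2) locO_mono[OF locO_mult[OF locO_u[OF g] locO_diff[OF w2 w1]]]) simp
  obtain r where r: "r > 0" "ball z1 r \<subseteq> Zdom" using open_Zdom z1 open_contains_ball by blast
  have ev: "\<forall>\<^sub>F u in at_top. \<forall>z\<in>ball z1 r. ?a u z = S11 u R z" using G11 conjunct2[OF W(1)[unfolded sol_pair_def]]
  proof eventually_elim
   case (elim u)
   show ?case
   proof
    fix z assume "z \<in> ball z1 r"
    then show "?a u z = S11 u R z" using r bspec[OF elim(1), of z] bspec[OF elim(2), of z] by (auto simp: algebra_simps)
   qed
  qed
  have "locO z1 (%u. S11 u R) 0" by (rule locO_cong[OF L r(1) ev])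
  then have "?b"
  by (rule locO_reflect[of _ _ _ "%z. - cnj z"]) ((simp_all add: z1_def dist_cnj_cnj dist_minus), (unfold S11_parity S11_cnj, simp add: norm_mult norm_power))
  then show ?thesis using h(3) zx by (intro direct) auto
 qed
qed

end

section \<open>Contour integrals\<close>

text \<open>Subtracting the principal part P leaves a Laurent series without negative powers, so the
  singularity of h at a is removable and \<open>remove_sings\<close> is analytic there.\<close>

lemma analytic_part_holomorphic:
 assumes S: "open S" "a \<in> S" and f: "f holomorphic_on S - {a}" "not_essential f a"
 shows "analytic_part f a holomorphic_on S"
  and "\<And>t. t \<in> S ==> t \<noteq> a ==> analytic_part f a t = f t - poly (fls_prpart (laurent_expansion f a)) (1 / (t - a))"
proof -
 define L p where "L = laurent_expansion f a" and "p = fls_prpart L"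
 define h where "h = (%z. f z - poly p (1 / (z - a)))"
 have L: "(%x. f (a + x)) has_laurent_expansion L"
  unfolding L_def by (rule not_essential_has_laurent_expansion[OF isolated_singularity_at_holomorphic[OF f(1) S] f(2)])
 define P where "P = (\<Sum>i\<le>degree p. fls_const (coeff p i) * fls_X_inv ^ i)"
 have "(%x. \<Sum>i\<le>degree p. coeff p i * inverse x ^ i) has_laurent_expansion P" unfolding P_def by (intro laurent_expansion_intros)
 then have "(%x. f (a + x) - (\<Sum>i\<le>degree p. coeff p i * inverse x ^ i)) has_laurent_expansion L - P"
  by (rule has_laurent_expansion_diff[OF L])
 then have h: "(%x. h (a + x)) has_laurent_expansion L - P" unfolding h_def poly_altdef by (simp add: inverse_eq_divide)
 have Pk: "fls_nth P (- int k) = coeff p k" for k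
 proof -
  have "fls_nth P (- int k) = (\<Sum>i\<le>degree p. if k = i then coeff p i else 0)"
  proof -
   have "fls_nth (sum h I) j = (\<Sum>i\<in>I. fls_nth (h i) j)" if "finite I" for h :: "nat => complex fls" and I j
    using that by (induction) auto
   note n = this
   show ?thesis unfolding P_def n[OF finite_atMost] by (rule sum.cong) auto
  qed
  then show ?thesis by (auto simp: coeff_eq_0)
 qed
 have "fls_nth (L - P) k = 0" if "k < 0" for k
 using Pk[of "nat (- k)"] that by (simp add: p_def)
 then have sd: "fls_subdegree (L - P) \<ge> 0" by (rule fls_subdegree_ge0I)
 have hh: "h holomorphic_on S - {a}" unfolding h_def by (intro holomorphic_intros f(1)) auto
 have ap: "analytic_part f a = remove_sings h" by (simp add: analytic_part_def h_def p_def L_def)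
 have an: "h analytic_on {t}" if "t \<in> S" "t \<noteq> a" for t by (rule holomorphic_on_imp_analytic_at[OF hh]) (use S that in auto)
 have "remove_sings h analytic_on {t}" if "t \<in> S" for t
 proof (cases "t = a")
  case True
  then show ?thesis
   using remove_sings_analytic_at[OF isolated_singularity_at_holomorphic[OF hh S] has_laurent_expansion_imp_tendsto[OF h sd]] by simp
 next
  case False
  then show ?thesis by (intro remove_sings_analytic_on an that)
 qed
 then have "remove_sings h analytic_on S" using analytic_on_analytic_at by blast
 then show "analytic_part f a holomorphic_on S" unfolding ap by (rule analytic_imp_holomorphic)
 show "analytic_part f a t = f t - poly (fls_prpart (laurent_expansion f a)) (1 / (t - a))" if "t \<in> S" "t \<noteq> a" for t
  unfolding ap using an[OF that] by (simp add: h_def p_def L_def)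
qed

lemma G_coeff_meromorphic: "G_coeff R s meromorphic_on {1}"
proof (induction s)
 case 0
 show ?case unfolding G_coeff.simps by (intro meromorphic_intros)
next
 case (Suc s)
 show ?case unfolding G_coeff.simps by (intro meromorphic_intros Suc)
qed

text \<open>By the residue theorem the integrals differ by the residue F z at z, weighted with the
  difference of winding numbers; for z = a this difference is 0.\<close>

lemma two_loops:
 assumes S: "open S" "connected S" "z \<in> S" and F: "F holomorphic_on S - {a}"
  and 1: "valid_path g" "pathfinish g = pathstart g" "path_image g \<subseteq> S - {a, z}" "\<And>t. t \<notin> S ==> winding_number g t = 0"
  and 2: "valid_path g'" "pathfinish g' = pathstart g'" "path_image g' \<subseteq> S - {a, z}" "\<And>t. t \<notin> S ==> winding_number g' t = 0"
  and w: "winding_number g a = winding_number g' a"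
 shows "contour_integral g (%t. F t / (t - z)) =
   contour_integral g' (%t. F t / (t - z)) + 2 * pi * \<i> * (winding_number g z - winding_number g' z) * F z"
proof -
 let ?f = "%t. F t / (t - z)"
 have h: "?f holomorphic_on S - {a, z}" by (intro holomorphic_intros holomorphic_on_subset[OF F]) auto
 note R = Residue_theorem[where S = S and pts = "{a, z}" and f = ?f, OF S(1,2) _ h]
 have R: "contour_integral g ?f = 2 * pi * \<i> * (\<Sum>p\<in>{a, z}. winding_number g p * residue ?f p)"
  "contour_integral g' ?f = 2 * pi * \<i> * (\<Sum>p\<in>{a, z}. winding_number g' p * residue ?f p)"
  by (rule R; use 1 2 in auto)+
 have "residue ?f z = F z" if "z \<noteq> a" by (rule residue_simple[of "S - {a}"]) (use S F that in auto)
 then show ?thesis unfolding R using w by (cases "z = a") (simp_all add: algebra_simps)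
qed

text \<open>A principal part has no constant term, so on a circle of radius r the integrand is
  O(r^(-2)), and enlarging the circle gives 0.\<close>

lemma principal_part_integral:
 assumes p: "coeff p 0 = 0" and g: "valid_path g" "pathfinish g = pathstart g" "a \<notin> path_image g" "z \<notin> path_image g"
  and w: "winding_number g a = 1" "winding_number g z = 1"
 shows "contour_integral g (%t. poly p (1 / (t - a)) / (t - z)) = 0"
proof -
 let ?b = "%p t. poly p (1 / (t - a))"
 let ?a = "%t. ?b p t / (t - z)"
 define I where "I = contour_integral g ?a"
 obtain q where q: "p = pCons 0 q" using p by (cases p) auto
 have "compact (cball (0::complex) 1)" by simp
 then have "bounded (poly q ` cball (0::complex) 1)" by (intro compact_imp_bounded compact_continuous_image continuous_intros)
 then obtain M where M: "M > 0" "\<And>y. norm y \<le> 1 ==> norm (poly q y) \<le> M" unfolding bounded_pos by auto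
 have pM: "norm (poly p y) \<le> M * norm y" if "norm y \<le> 1" for y
  unfolding q using mult_right_mono[OF M(2)[OF that], of "norm y"] by (simp add: norm_mult mult.commute)
 have F: "(%t. ?b p t) holomorphic_on UNIV - {a}" by (intro holomorphic_intros) auto
 let ?c = "%r. r - norm (z - a)"
 let ?e = "%r. 2 * pi * M / ?c r"
 have I: "norm I \<le> ?e r" if r: "r > norm (z - a)" "r \<ge> 1" for r
 proof -
  have r0: "r > 0" "\<bar>r\<bar> = r" using r by auto
  let ?d = "circlepath a r"
  have im: "path_image ?d \<subseteq> UNIV - {a, z}" using r by (auto simp: dist_norm norm_minus_commute)
  have wc: "winding_number ?d t = 1" if "norm (t - a) < r" for t using winding_number_circlepath[OF that] .
  have "I = contour_integral ?d ?a + 2 * pi * \<i> * (winding_number g z - winding_number ?d z) * poly p (1 / (z - a))"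
   unfolding I_def by (rule two_loops[where S = UNIV and F = "%t. ?b p t", OF _ _ _ F]) (use g w wc[of a] r0 im in auto)
  then have "I = contour_integral ?d ?a" using w wc[of z] r by simp
  moreover have "?a contour_integrable_on circlepath a r" by (rule contour_integrable_holomorphic_simple[of _ "UNIV - {a, z}"])
    (use im in "auto intro!: holomorphic_intros")
  ultimately have H: "(?a has_contour_integral I) ?d" using has_contour_integral_integral by simp
  have "norm I \<le> M / r / ?c r * (2 * pi * r)"
  proof (rule has_contour_integral_bound_circlepath[OF H])
   fix t assume t: "norm (t - a) = r"
   have 1: "norm (?b p t) \<le> M / r" using pM[of "1 / (t - a)"] r t by (simp add: norm_divide)
   have 2: "r - norm (z - a) \<le> norm (t - z)" using norm_triangle_ineq2[of "t - a" "z - a"] t by simp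
   show "norm (?b p t / (t - z)) \<le> M / r / ?c r" unfolding norm_divide by (rule frac_le[OF _ 1 _ 2]) (use M r in auto)
  qed (use M r r0 in auto)
  also have "\<dots> = ?e r" using r0 by simp
  finally show ?thesis .
 qed
 have "(?e \<longlongrightarrow> 0) at_top" by real_asymp
 moreover have "\<forall>\<^sub>F r in at_top. norm I \<le> ?e r"
  using eventually_gt_at_top[of "norm (z - a)"] eventually_ge_at_top[of 1] by eventually_elim (rule I)
 ultimately have "norm I \<le> 0" by (rule tendsto_lowerbound) simp
 then show ?thesis by (simp add: I_def)
qed

lemma analytic_part_integral:
 assumes S: "open S" "a \<in> S" and f: "f holomorphic_on S - {a}" "not_essential f a"
  and g: "valid_path g" "pathfinish g = pathstart g" "path_image g \<subseteq> S - {a}" "\<And>t. t \<notin> S ==> winding_number g t = 0"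
  and z: "z \<in> S" "z \<notin> path_image g" "winding_number g z = 1" and w: "winding_number g a = 1"
 shows "((%t. f t / (t - z)) has_contour_integral 2 * pi * \<i> * analytic_part f a z) g"
proof -
 define p where "p = fls_prpart (laurent_expansion f a)"
 note ap = analytic_part_holomorphic[OF S f]
 let ?c = "analytic_part f a"
 have 1: "((%t. ?c t / (t - z)) has_contour_integral 2 * pi * \<i> * winding_number g z * ?c z) g"
  by (rule Cauchy_integral_formula_global[OF S(1) ap(1)]) (use g z in auto)
 let ?a = "%t. poly p (1 / (t - a)) / (t - z)"
 have "?a holomorphic_on UNIV - {a, z}" by (intro holomorphic_intros) auto
 then have "?a contour_integrable_on g" by (rule contour_integrable_holomorphic_simple) (use g z in auto)
 moreover have "contour_integral g ?a = 0" by (rule principal_part_integral) (use g z w in "auto simp: p_def")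
 ultimately have 2: "(?a has_contour_integral 0) g" using has_contour_integral_integral by metis
 let ?b = "%f a t. ?c t / (t - z) + poly p (1 / (t - a)) / (t - z)"
 have "((%t. ?b f a t) has_contour_integral 2 * pi * \<i> * ?c z) g" using has_contour_integral_add[OF 1 2] z(3) by simp
 then show ?thesis
 proof (rule has_contour_integral_eq)
  fix t assume "t \<in> path_image g"
  then have "t \<in> S" "t \<noteq> a" using g(3) by auto
  then show "?b f a t = f t / (t - z)" using ap(2)[of t] by (simp add: p_def add_divide_distrib[symmetric])
 qed
qed

text \<open>F is not controlled near a, and z may approach the loop as well as a. So the loop is
  deformed to the circle of radius 3 \<rho> if z is within 2 \<rho> of a, and otherwise to the
  circle of radius \<rho> at the price of the residue F z. Either circle keeps distance \<rho> from
  z; the first case gives the constant 6 pi.\<close>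

lemma loop_integral_bound:
 assumes S: "open S" "connected S" and F: "F holomorphic_on S - {a}"
  and g: "valid_path g" "pathfinish g = pathstart g" "path_image g \<subseteq> S - {a}" "\<And>t. t \<notin> S ==> winding_number g t = 0"
  and X: "X \<subseteq> S - path_image g" "\<And>t. t \<in> X ==> winding_number g t = 1"
  and \<rho>: "\<rho> > 0" "cball a (3 * \<rho>) \<subseteq> X"
  and M: "\<And>t. t \<in> X ==> norm (t - a) \<ge> \<rho> ==> norm (F t) \<le> M"
  and z: "z \<in> X"
 shows "norm (contour_integral g (%t. F t / (t - z))) \<le> 6 * pi * M"
proof -
 have a: "a \<in> X" using \<rho> by auto
 have M0: "M \<ge> 0"
 proof -
  have "a + of_real \<rho> \<in> X" using \<rho> by (intro subsetD[OF \<rho>(2)]) (simp add: dist_norm)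
  then show ?thesis using order_trans[OF norm_ge_zero M[of "a + of_real \<rho>"]] \<rho>(1) by simp
 qed
 have circ: "path_image (circlepath a r) \<subseteq> S - {a, z}" if "0 < r" "r \<le> 3 * \<rho>" "r \<noteq> norm (z - a)" for r
 using that \<rho>(2) X(1) by (auto simp: dist_norm norm_minus_commute subset_iff)
 let ?b = "%a r. winding_number (circlepath a r)"
 have wo: "?b a r t = 0" if "0 < r" "norm (t - a) > r" for r t
  by (rule winding_number_zero_outside[of _ "cball a r"]) (use that in "auto simp: dist_norm norm_minus_commute")
 have wi: "?b a r t = 1" if "norm (t - a) < r" for r t using winding_number_circlepath[OF that] .
 have wS: "?b a r t = 0" if "0 < r" "r \<le> 3 * \<rho>" "t \<notin> S" for r t
 proof (rule wo[OF that(1)])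
  have "t \<notin> cball a (3 * \<rho>)" using that X(1) \<rho>(2) by auto
  then show "norm (t - a) > r" using that(2) by (simp add: dist_norm norm_minus_commute)
 qed
 let ?e = "contour_integral"
 have bnd: "norm (?e (circlepath a r) (%t. F t / (t - z))) \<le> M / \<rho> * (2 * pi * r)"
  if r: "\<rho> \<le> r" "r \<le> 3 * \<rho>" and d: "\<And>t. norm (t - a) = r ==> norm (t - z) \<ge> \<rho>" "r \<noteq> norm (z - a)" for r
 proof -
  have r0: "0 < r" using r \<rho> by simp
  have "(%t. F t / (t - z)) holomorphic_on S - {a, z}" by (intro holomorphic_intros holomorphic_on_subset[OF F]) auto
  then have "(%t. F t / (t - z)) contour_integrable_on circlepath a r"
   by (rule contour_integrable_holomorphic_simple) (use S circ[OF r0 r(2) d(2)] in auto)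
  then show ?thesis
  proof (rule has_contour_integral_bound_circlepath[OF has_contour_integral_integral])
   fix t assume t: "norm (t - a) = r"
   have "t \<in> X" by (rule subsetD[OF \<rho>(2)]) (use t r in "simp add: dist_norm norm_minus_commute")
   then show "norm (F t / (t - z)) \<le> M / \<rho>" unfolding norm_divide by (intro frac_le M d(1)) (use t r \<rho> M0 in auto)
  qed (use r0 M0 \<rho> in auto)
 qed
 have zS: "z \<in> S" "z \<notin> path_image g" using z X(1) by auto
 have gi: "path_image g \<subseteq> S - {a, z}" using g(3) zS by auto
 have wg: "winding_number g a = 1" "winding_number g z = 1" using X(2) a z by auto
 have T: "?e g (%t. F t / (t - z)) = ?e (circlepath a r) (%t. F t / (t - z)) + 2 * pi * \<i> * (1 - ?b a r z) * F z"
  if "0 < r" "r \<le> 3 * \<rho>" "r \<noteq> norm (z - a)" for r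
  unfolding wg(2)[symmetric] by (rule two_loops[OF S zS(1) F g(1,2) gi g(4)]) (use circ[OF that] wS[OF that(1,2)] wi[of a r] wg that in auto)
 show ?thesis
 proof (cases "norm (z - a) < 2 * \<rho>")
  case True
  have ne: "3 * \<rho> \<noteq> norm (z - a)" "norm (z - a) < 3 * \<rho>" using True \<rho> by auto
  have eq: "?e g (%t. F t / (t - z)) = ?e (circlepath a (3 * \<rho>)) (%t. F t / (t - z))"
   using T[of "3 * \<rho>"] ne \<rho> wi[OF ne(2)] by simp
  have "norm (?e g (%t. F t / (t - z))) \<le> M / \<rho> * (2 * pi * (3 * \<rho>))" unfolding eq
  proof (rule bnd)
   show "\<rho> \<le> norm (t - z)" if "norm (t - a) = 3 * \<rho>" for t using norm_triangle_ineq2[of "t - a" "z - a"] that True by simp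
  qed (use \<rho> ne in auto)
  also have "\<dots> = 6 * pi * M" using \<rho> by simp
  finally show ?thesis .
 next
  case False
  have ne: "\<rho> \<noteq> norm (z - a)" "norm (z - a) > \<rho>" using False \<rho> by auto
  let ?I = "?e (circlepath a \<rho>) (%t. F t / (t - z))"
  have eq: "?e g (%t. F t / (t - z)) = ?I + 2 * pi * \<i> * F z" using T[of \<rho>] ne \<rho> wo[OF \<rho>(1) ne(2)] by simp
  have 1: "norm ?I \<le> M / \<rho> * (2 * pi * \<rho>)"
  proof (rule bnd)
   show "\<rho> \<le> norm (t - z)" if "norm (t - a) = \<rho>" for t
    using norm_triangle_ineq2[of "z - a" "t - a"] that False by (simp add: norm_minus_commute)
  qed (use \<rho> ne in auto)
  have "norm (?e g (%t. F t / (t - z))) \<le> M / \<rho> * (2 * pi * \<rho>) + 2 * pi * M"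
   unfolding eq by (rule norm_triangle_mono[OF 1]) (use M[OF z] ne in "simp add: norm_mult")
  also have "\<dots> = 4 * pi * M" using \<rho> by simp
  finally show ?thesis by (rule order_trans) (use M0 in "intro mult_right_mono, auto")
 qed
qed

lemma encircles_1_facts:
 assumes "encircles_1 \<Gamma>"
 shows "inside (path_image \<Gamma>) \<subseteq> Zdom - path_image \<Gamma>"
  and "t \<in> inside (path_image \<Gamma>) ==> winding_number \<Gamma> t = 1"
  and "t \<notin> Zdom ==> winding_number \<Gamma> t = 0"
  and "compact (closure (inside (path_image \<Gamma>)))"
  and "closure (inside (path_image \<Gamma>)) \<subseteq> Zdom"
  and "open (inside (path_image \<Gamma>))"
proof -
 note \<Gamma> = assms[unfolded encircles_1_def]
 let ?b = "path_image \<Gamma>"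
 have p: "path \<Gamma>" "?b \<subseteq> Zdom" using \<Gamma> by (auto simp: valid_path_imp_path)
 have cl: "closed ?b" using p(1) by (simp add: closed_path_image)
 let ?a = "inside ?b"
 have X: "?a \<subseteq> Zdom" by (rule inside_Zdom[OF p(2)])
 then show "?a \<subseteq> Zdom - ?b" using inside_no_overlap[of "?b"] by blast
 show "winding_number \<Gamma> t = 1" if "t \<in> ?a" for t
 by (rule simple_closed_path_winding_number_inside[of \<Gamma>]) (((use \<Gamma> in auto))[1], (use \<Gamma> that in auto))
 show "winding_number \<Gamma> t = 0" if "t \<notin> Zdom" for t
 by (rule winding_number_zero_in_outside) ((use \<Gamma> p in auto), ((use that X inside_Un_outside[of "?b"] in blast))[1])
 show "compact (closure ?a)" using bounded_inside[OF bounded_path_image[OF p(1)]] by simp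
 show "closure ?a \<subseteq> Zdom" using closure_inside_subset[OF cl] X p(2) by auto
 show "open ?a" by (rule open_inside[OF cl])
qed

lemma locO_compact:
 assumes "compact K" and F: "\<And>z. z \<in> K ==> locO z F k"
 shows "\<exists>C\<ge>0. \<forall>\<^sub>F u in at_top. \<forall>z\<in>K. norm (F u z) \<le> C * u powr k"
proof -
 obtain r where r: "\<And>z. z \<in> K ==> r z > 0"
  "\<And>z. z \<in> K ==> \<exists>C\<ge>0. \<forall>\<^sub>F u in at_top. \<forall>t\<in>ball z (r z). norm (F u t) \<le> C * u powr k" using F bchoice[of K "%z r. r > 0 \<and> (\<exists>C\<ge>0. \<forall>\<^sub>F u in at_top. \<forall>t\<in>ball z r. norm (F u t) \<le> C * u powr k)"] unfolding locO_def by blast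
 obtain D where D: "D \<subseteq> K" "finite D" "K \<subseteq> (\<Union>z\<in>D. ball z (r z))"
  by (rule compactE_image[OF assms(1), of K "%z. ball z (r z)"]) (use r in auto)
 obtain C where C: "\<And>z. z \<in> D ==> C z \<ge> 0" "\<And>z. z \<in> D ==> \<forall>\<^sub>F u in at_top. \<forall>t\<in>ball z (r z). norm (F u t) \<le> C z * u powr k"
  using bchoice[of D "%z C. C \<ge> 0 \<and> (\<forall>\<^sub>F u in at_top. \<forall>t\<in>ball z (r z). norm (F u t) \<le> C * u powr k)"] r(2) D(1) by blast
 have "\<forall>\<^sub>F u in at_top. \<forall>z\<in>D. \<forall>t\<in>ball z (r z). norm (F u t) \<le> C z * u powr k"
  using D(2) C(2) by (simp add: eventually_ball_finite)
 then have "\<forall>\<^sub>F u in at_top. \<forall>z\<in>K. norm (F u z) \<le> sum C D * u powr k"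
 proof eventually_elim
  case (elim u)
  show ?case
  proof
   fix z assume "z \<in> K"
   then obtain d where d: "d \<in> D" "z \<in> ball d (r d)" using D(3) by auto
   then have "norm (F u z) \<le> C d * u powr k" using elim by simp
   also have "\<dots> \<le> sum C D * u powr k" using C(1) D(2) d(1) by (intro mult_right_mono member_le_sum) auto
   finally show "norm (F u z) \<le> sum C D * u powr k" .
  qed
 qed
 then show ?thesis using C(1) by (intro exI[of _ "sum C D"]) (auto intro: sum_nonneg)
qed

lemma airy_arg_holo: "airy_arg u holomorphic_on Zdom"
 unfolding airy_arg_def[abs_def] using Zdom_cutp by (intro holomorphic_intros holomorphic_on_subset[OF zeta_holo])

lemma comp_airy_holo:
 assumes "f holomorphic_on UNIV" "A u holomorphic_on Zdom" "B u holomorphic_on Zdom"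
 shows "(%z. f (airy_arg u z) * A u z + deriv f (airy_arg u z) * B u z) holomorphic_on Zdom"
proof -
 have "(%z. f (airy_arg u z)) holomorphic_on Zdom" "(%z. deriv f (airy_arg u z)) holomorphic_on Zdom"
  using holomorphic_on_compose_gen[OF airy_arg_holo assms(1)]
   holomorphic_on_compose_gen[OF airy_arg_holo holomorphic_deriv[OF assms(1) open_UNIV]] by (simp_all add: o_def)
 then show ?thesis using assms by (intro holomorphic_intros)
qed

lemma Nn_nz: "u > 0 ==> Nn m \<epsilon> u \<noteq> 0" by (simp add: Nn_def)

text \<open>Y1 is eliminated between \<open>S_connection\<close> and \<open>airy_connection\<close>;
  the remaining product \<open>rho * Nn\<close> is \<open>gamma_mR\<close>.\<close>

lemma inhomogeneous_connection:
 assumes u: "u > 3"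
  and AB: "A u holomorphic_on Zdom" "B u holomorphic_on Zdom"
   "\<forall>l\<in>{-1, 0, 1}. (\<forall>z\<in>Zdom. (deriv ^^ 2) (w_airy A B l u) z - of_real (u^2) * (z^2 - 1) * w_airy A B l u z = 0) \<and>
      recessive_at (inf_dir l) (w_airy A B l u)"
  and U: "\<forall>z\<in>Zdom. w0Y u z = Nn m \<epsilon> u * w_airy A B 0 u z"
 shows "bddr 1 (w0Y u)"
  and "z \<in> Zdom ==> S11 u R z - S01 u R z = gamma_mR m R \<epsilon> u * (cW1 * w_airy A B 1 u z)"
  and "z \<in> Zdom ==> S11 u R z - cnj (S01 u R (cnj z)) = gamma_mR m R \<epsilon> u * (cW2 * w_airy A B (-1) u z)"
proof -
 let ?a = "w_airy A B"
 have h: "?a l u holomorphic_on Zdom" for l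
  unfolding w_airy_def[abs_def] by (rule comp_airy_holo[where A = A and B = B and u = u, OF Ai_rot_holo AB(1,2)])
 have wo: "weber u Zdom (%_. 0) (?a l u) \<and> recessive_at (inf_dir l) (?a l u)" if "l \<in> {-1, 0, 1}" for l
  using AB(3) h that unfolding ode2_def by blast
 have N: "Nn m \<epsilon> u \<noteq> 0" using u by (intro Nn_nz) simp
 show "bddr 1 (w0Y u)" by (rule airy_connection(1)[OF u N wo bspec[OF U]])
 show "S11 u R z - S01 u R z = gamma_mR m R \<epsilon> u * (cW1 * ?a 1 u z)" if z: "z \<in> Zdom"
 proof -
  have "Nn m \<epsilon> u * (cW1 * ?a 1 u z) = - (2 * pi * \<i>) * (al u * Y1 u z)" by (rule airy_connection(2)[OF u N wo bspec[OF U] z])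
  then show ?thesis unfolding S_connection(1)[OF u] gamma_rho mult.assoc by simp
 qed
 show "S11 u R z - cnj (S01 u R (cnj z)) = gamma_mR m R \<epsilon> u * (cW2 * ?a (-1) u z)" if z: "z \<in> Zdom"
 proof -
  have "Nn m \<epsilon> u * (cW2 * ?a (-1) u z) = 2 * pi * \<i> * (al' u * Y1 u (- z))" by (rule airy_connection(3)[OF u N wo bspec[OF U] z])
  then show ?thesis unfolding S_connection(2)[OF u] gamma_rho by simp
 qed
qed

context expn_G begin

lemma G_coeff_holo: "G_coeff R s holomorphic_on Zdom - {1}"
proof -
 have "z^2 - 1 \<noteq> 0" if "z \<in> Zdom - {1}" for z
 proof
  assume "z^2 - 1 = 0"
  then show False using that Zdom_cutp by (auto simp: power2_eq_1_iff cutp_def)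
 qed
 then show ?thesis unfolding G_coeff_bc using open_Zdom by (intro bc_holomorphic holomorphic_intros) auto
qed

lemma qJ_holo: "u \<noteq> 0 ==> qJ u holomorphic_on Zdom - {1}" unfolding qJ_def[abs_def] using Zdom_cutp zeta_nz
 by (intro holomorphic_intros holomorphic_on_subset[OF J_holo] holomorphic_on_subset[OF zeta_holo]
   holomorphic_on_subset[OF quot_root4_holo]) auto

text \<open>Of the three parts of \<open>err\<close>, G reproduces itself by Cauchy's formula, each
  G_s yields its analytic part, and the term with \<open>J\<close> stays as a contour
  integral.\<close>

lemma err_contour:
 assumes \<Gamma>: "encircles_1 \<Gamma>" and u: "u > 0" and G: "G u holomorphic_on Zdom" and z: "z \<in> inside (path_image \<Gamma>)"
 shows "contour_integral \<Gamma> (%t. err u t / (t - z)) = 2 * pi * \<i> *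
  (G u z - (1 / of_real u ^ 2 * (\<Sum>s=0..m. G_star R s z / of_real u ^ (2 * s))
   - g u / (2 * pi * \<i> * of_real (u powr (2/3))) * contour_integral \<Gamma> (%t. quot_root4 t * J m u t / (\<zeta> t * (t - z)))))"
proof -
 note f = encircles_1_facts[OF \<Gamma>] and \<Gamma>' = \<Gamma>[unfolded encircles_1_def]
 have zZ: "z \<in> Zdom" "z \<notin> path_image \<Gamma>" using z f(1) by auto
 have vp: "valid_path \<Gamma>" "pathfinish \<Gamma> = pathstart \<Gamma>" "path_image \<Gamma> \<subseteq> Zdom - {1}" "1 \<in> Zdom"
  using \<Gamma>' f(1) by auto
 let ?c = "2 * pi * \<i>"
 let ?g = "?c * winding_number \<Gamma> z * G u z"
 have 1: "((%t. G u t / (t - z)) has_contour_integral ?g) \<Gamma>"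
  by (rule Cauchy_integral_formula_global[OF open_Zdom G zZ(1)]) (use vp zZ f(3) in auto)
 have 2: "((%t. G_coeff R s t / (t - z)) has_contour_integral ?c * G_star R s z) \<Gamma>" for s unfolding G_star_def
  by (rule analytic_part_integral[OF open_Zdom vp(4) G_coeff_holo meromorphic_on_not_essential[OF G_coeff_meromorphic] vp(1-3)])
   (use f(3) f(2)[OF z] zZ \<Gamma>' in auto)
 have ring: "c * x - c * y + c * z = c * (x - (y - z))" for c x y z :: complex by (simp add: algebra_simps)
 define c where "c = g u * of_real (u powr (-2/3))"
 let ?f = "contour_integral \<Gamma>"
 define I where "I = ?f (%t. qJ u t / (t - z))"
 have "(%t. qJ u t / (t - z)) contour_integrable_on \<Gamma>" by (rule contour_integrable_holomorphic_simple[of _ "Zdom - {1, z}"])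
   (use u vp zZ open_Zdom in "auto intro!: holomorphic_intros holomorphic_on_subset[OF qJ_holo]")
 then have 3: "((%t. qJ u t / (t - z)) has_contour_integral I) \<Gamma>" unfolding I_def by (rule has_contour_integral_integral)
 let ?a = "\<Sum>s\<le>m. 1 / of_real u ^ (2 * s + 2) * (?c * G_star R s z)"
 let ?d = "%u s t. 1 / of_real u ^ (2 * s + 2) * (G_coeff R s t / (t - z))"
 have 4: "((%t. \<Sum>s\<le>m. ?d u s t) has_contour_integral
   ?a) \<Gamma>"
  by (intro has_contour_integral_sum has_contour_integral_lmul 2) auto
 let ?b = "%s u t. \<Sum>s\<le>m. ?d u s t"
 let ?e = "%G u t. G u t / (t - z) - (?b s u t) + c * (qJ u t / (t - z))"
 have "((%t. ?e G u t)
   has_contour_integral ?g - ?a + c * I) \<Gamma>"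
  by (intro has_contour_integral_add has_contour_integral_diff has_contour_integral_lmul 1 3 4)
 moreover have "?e G u t = err u t / (t - z)" for t by (simp add: err_def c_def add_divide_distrib diff_divide_distrib sum_divide_distrib)
 ultimately have "?f (%t. err u t / (t - z)) = ?c * G u z - ?a + c * I" using f(2)[OF z] by (simp add: contour_integral_unique)
 also have "?a = ?c * (1 / of_real u ^ 2 * (\<Sum>s=0..m. G_star R s z / of_real u ^ (2 * s)))"
  unfolding sum_distrib_left atLeast0AtMost by rule (simp_all add: power2_eq_square mult_ac)
 also have "c * I = ?c * (g u / (?c * of_real (u powr (2/3))) * I)" by (simp add: c_def powr_minus divide_inverse[of _ "of_real _"])
 also have "I = ?f (%t. quot_root4 t * J m u t / (\<zeta> t * (t - z)))" unfolding I_def qJ_def by simp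
 finally show ?thesis by (rule trans) (rule ring)
qed

lemma contour_error:
 assumes \<Gamma>: "encircles_1 \<Gamma>" and G: "\<forall>\<^sub>F u in at_top. G u holomorphic_on Zdom"
 shows "uniform_bigo (inside (path_image \<Gamma>))
     (%u z. G u z -
      (1 / of_real u ^ 2 * (\<Sum>s=0..m. G_star R s z / of_real u ^ (2 * s)) - g u / (2 * pi * \<i> * of_real (u powr (2/3)))
        * contour_integral \<Gamma> (%t. quot_root4 t * J m u t / (\<zeta> t * (t - z)))))
     (%u. 1 / u ^ (2*m+4))"
proof -
 define X where "X = inside (path_image \<Gamma>)"
 note f = encircles_1_facts[OF \<Gamma>, folded X_def] and \<Gamma>' = \<Gamma>[unfolded encircles_1_def, folded X_def]
 obtain r where r: "r > 0" "cball 1 r \<subseteq> X" using f(6) \<Gamma>' open_contains_cball[of X] by auto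
 define \<rho> where "\<rho> = r / 3"
 have \<rho>: "\<rho> > 0" "cball 1 (3 * \<rho>) \<subseteq> X" using r by (auto simp: \<rho>_def)
 \<comment> \<open>Compact in \<open>Zdom\<close> without 1, and containing the part of X outside
   the disc of radius \<rho>, where \<open>loop_integral_bound\<close> asks for the
   estimate.\<close>
 define K where "K = closure X - ball 1 \<rho>"
 have "compact K" unfolding K_def by (rule compact_diff[OF f(4) open_ball])
 moreover have "locO t err (- real (2 * m + 4))" if "t \<in> K" for t by (rule err_locO) (use that f(5) \<rho>(1) in "auto simp: K_def")
 ultimately obtain C where C: "C \<ge> 0" "\<forall>\<^sub>F u in at_top. \<forall>t\<in>K. norm (err u t) \<le> C * u powr (- real (2 * m + 4))"
  using locO_compact by blast
 let ?a = "%u z. norm (G u z -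
      (1 / of_real u ^ 2 * (\<Sum>s=0..m. G_star R s z / of_real u ^ (2 * s)) - g u / (2 * pi * \<i> * of_real (u powr (2/3)))
        * contour_integral \<Gamma> (%t. quot_root4 t * J m u t / (\<zeta> t * (t - z)))))"
 have "\<forall>\<^sub>F u in at_top. \<forall>z\<in>X. ?a u z \<le> 3 * C * (1 / u ^ (2*m+4))" using C(2) G eventually_gt_at_top[of 0]
 proof eventually_elim
  case (elim u)
  show ?case
  proof
   fix z assume z: "z \<in> X"
   have hol: "err u holomorphic_on Zdom - {1}" unfolding err_def[abs_def] using elim(3)
    by (intro holomorphic_intros G_coeff_holo qJ_holo holomorphic_on_subset[OF elim(2)]) auto
   let ?b = "1 / u ^ (2 * m + 4)"
   have p: "u powr (- real (2 * m + 4)) = ?b" using elim(3) by (simp only: powr_minus_divide powr_realpow)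
   have "norm (contour_integral \<Gamma> (%t. err u t / (t - z))) \<le> 6 * pi * (C * ?b)"
   proof (rule loop_integral_bound[OF open_Zdom connected_Zdom hol _ _ _ _ f(1) _ \<rho> _ z])
    show "norm (err u t) \<le> C * ?b" if "t \<in> X" "\<rho> \<le> norm (t - 1)" for t
     using elim(1) that closure_subset[of X] unfolding p by (auto simp: K_def dist_norm norm_minus_commute)
   qed (use \<Gamma>' f in auto)
   then have *: "2 * pi * ?a u z \<le> 6 * pi * (C * (1 / u ^ (2*m+4)))"
    unfolding err_contour[OF \<Gamma> elim(3,2) z[unfolded X_def]] by (simp add: norm_mult)
   have "x \<le> 3 * y" if "2 * pi * x \<le> 6 * pi * y" for x y :: real using that by simp
   from this[OF *] show "?a u z \<le> 3 * C * (1 / u ^ (2*m+4))" by simp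
  qed
 qed
 then show ?thesis unfolding uniform_bigo_def X_def by blast
qed

end

theorem mainTheorem7:
  fixes m R :: nat
    and U :: "real \<Rightarrow> complex \<Rightarrow> complex"
    and A B :: "real \<Rightarrow> complex \<Rightarrow> complex"
    and \<epsilon> :: "real \<Rightarrow> complex"
    and w :: "int \<Rightarrow> int \<Rightarrow> real \<Rightarrow> complex \<Rightarrow> complex"
  assumes U: "parabolic_cylinder_U U"
    and AB: "airy_type_coefficients m A B"
    and \<epsilon>_def: "\<forall>\<^sub>F u in at_top. \<forall>z\<in>Zdom.
          U (- u / 2) (of_real (sqrt (2 * u)) * z) =
            of_real (sqrt pi * 2 powr (3/4 - u/4) * u powr (u/4 - 1/12))
            * exp (- of_real u / 4 + (\<Sum>s=0..m. E (2 * s+1) 1 / of_real u ^ (2 * s+1)) + \<epsilon> u)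
            * w_airy A B 0 u z"
    and \<epsilon>_bigo: "\<epsilon> \<in> O(\<lambda>u. of_real (1 / u ^ (2*m+2)))"
    and w: "\<And>j k u. \<lbrakk>j \<in> {-1, 0, 1}; k \<in> {-1, 0, 1}; j < k; u > 0\<rbrakk> \<Longrightarrow> wR_solution R j k u (w j k u)"
  shows "\<exists>G :: real \<Rightarrow> complex \<Rightarrow> complex.
    (\<forall>\<^sub>F u in at_top.
       G u holomorphic_on Zdom \<and>
       (\<forall>j\<in>{-1, 0, 1}. \<forall>k\<in>{-1, 0, 1}. j < k \<longrightarrow>
          (\<forall>z\<in>Zdom. w j k u z =
             gamma_mR m R \<epsilon> u
               * (Wi j k (airy_arg u z) * A u z + deriv (Wi j k) (airy_arg u z) * B u z)
             + G u z))) \<and>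
    (\<forall>\<Gamma>. encircles_1 \<Gamma> \<longrightarrow>
       uniform_bigo (inside (path_image \<Gamma>))
         (\<lambda>u z. G u z -
            (1 / of_real u ^ 2 * (\<Sum>s=0..m. G_star R s z / of_real u ^ (2 * s))
             - gamma_mR m R \<epsilon> u / (2 * pi * \<i> * of_real (u powr (2/3)))
               * contour_integral \<Gamma> (\<lambda>t. quot_root4 t * J m u t / (\<zeta> t * (t - z)))))
         (\<lambda>u. 1 / u ^ (2*m+4)))"
proof -
 define g where "g = gamma_mR m R \<epsilon>"
 define V where "V = (%j k u z. Wi j k (airy_arg u z) * A u z + deriv (Wi j k) (airy_arg u z) * B u z)"
 \<comment> \<open>G is read off from the pair (-1,1). The differences of the functions V are
   multiples of the solutions of Airy type, which is why the same G serves the other pairs.\<close>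
 define G where "G = (%u z. w (-1) 1 u z - g u * V (-1) 1 u z)"
 have V: "V (-1) 1 u z - V 0 1 u z = cW1 * w_airy A B 1 u z" "V (-1) 1 u z - V (-1) 0 u z = cW2 * w_airy A B (-1) u z" for u z
 proof -
  have "V (-1) 1 u z - V j k u z = (Wi (-1) 1 (airy_arg u z) - Wi j k (airy_arg u z)) * A u z
    + (deriv (Wi (-1) 1) (airy_arg u z) - deriv (Wi j k) (airy_arg u z)) * B u z" for j k
   by (simp add: V_def algebra_simps)
  then show "V (-1) 1 u z - V 0 1 u z = cW1 * w_airy A B 1 u z" "V (-1) 1 u z - V (-1) 0 u z = cW2 * w_airy A B (-1) u z"
   by (simp_all only: Wi_diff Wi_diff_deriv w_airy_def) (simp_all add: algebra_simps)
 qed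
 have ev: "\<forall>\<^sub>F u in at_top. u > 3 \<and> A u holomorphic_on Zdom \<and> B u holomorphic_on Zdom \<and>
   (\<forall>l\<in>{-1, 0, 1}. (\<forall>z\<in>Zdom. (deriv ^^ 2) (w_airy A B l u) z - of_real (u^2) * (z^2 - 1) * w_airy A B l u z = 0) \<and>
      recessive_at (inf_dir l) (w_airy A B l u)) \<and> (\<forall>z\<in>Zdom. w0Y u z = Nn m \<epsilon> u * w_airy A B 0 u z)"
  using eventually_gt_at_top[of 3] conjunct1[OF AB[unfolded airy_type_coefficients_def]] \<epsilon>_def
 proof eventually_elim
  case (elim u)
  have "\<forall>z\<in>Zdom. w0Y u z = Nn m \<epsilon> u * w_airy A B 0 u z" using elim(3) unfolding U_Y1[OF U elim(1)] Nn_def w0Y_def .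
  then show ?case using elim(1,2) by blast
 qed
 have sols: "\<forall>\<^sub>F u in at_top. G u holomorphic_on Zdom \<and>
   w (-1) 1 u = S11 u R \<and> w 0 1 u = S01 u R \<and> w (-1) 0 u = (%z. cnj (S01 u R (cnj z))) \<and>
   (\<forall>z\<in>Zdom. w (-1) 1 u z = g u * V (-1) 1 u z + G u z \<and> w 0 1 u z = g u * V 0 1 u z + G u z \<and>
    w (-1) 0 u z = g u * V (-1) 0 u z + G u z)"
  using ev
 proof eventually_elim
  case (elim u)
  have u: "u > 3" "u > 0" using elim by auto
  note C = inhomogeneous_connection[where A = A and B = B and u = u and m = m and \<epsilon> = \<epsilon>, OF u(1)]
  have b: "bddr 1 (w0Y u)" by (rule C(1)) (use elim in blast)+
  have S: "w (-1) 1 u = S11 u R" "w 0 1 u = S01 u R" "w (-1) 0 u = (%z. cnj (S01 u R (cnj z)))"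
   using w11_unique[OF u(1) w] w01_unique[OF u(1) b w] w10_unique[OF u(1) b w] u(2) by auto
  have "w (-1) 1 u holomorphic_on Zdom" using w[of "-1" 1 u] u(2) holomorphic_on_subset[of _ UNIV Zdom] by (simp add: wR_solution_def)
  moreover have "V (-1) 1 u holomorphic_on Zdom" unfolding V_def by (rule comp_airy_holo[OF Wi_holo]) (use elim in blast)+
  ultimately have "G u holomorphic_on Zdom" unfolding G_def by (intro holomorphic_intros)
  moreover have "w (-1) 1 u z - w 0 1 u z = g u * (V (-1) 1 u z - V 0 1 u z)"
   "w (-1) 1 u z - w (-1) 0 u z = g u * (V (-1) 1 u z - V (-1) 0 u z)" if "z \<in> Zdom" for z
   unfolding S V g_def by (rule C(2,3); use elim that in blast)+
  ultimately show ?case using S by (simp add: G_def algebra_simps)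
 qed
 interpret expn m R A B g G by unfold_locales (use AB gamma_bound[OF \<epsilon>_bigo] in \<open>simp_all add: g_def\<close>)
 interpret expn_G m R A B g G by unfold_locales (rule eventually_mono[OF sols], elim conjE, simp add: WAB_def V_def)+
 have GH: "\<forall>\<^sub>F u in at_top. G u holomorphic_on Zdom" using sols by eventually_elim blast
 have pairs: "\<forall>j\<in>{-1, 0, 1}. \<forall>k\<in>{-1, 0, 1}. j < k \<longrightarrow> P j k" if "P (-1) 1" "P 0 1" "P (-1) 0" for P :: "int => int => bool"
  using that by simp
 show ?thesis by (rule exI[of _ G], rule conjI, rule eventually_mono[OF sols], rule conjI, blast, rule pairs)
   (use contour_error GH in \<open>auto simp: V_def g_def\<close>)
qed

end
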